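(* Let $n>k\ge0$ and let $\mathfrak{I}:\mathbb{X}_n\times\mathbb{X}_n\to\mathbb{R}$ be a continuous complete $n$-symmetric $\mathrm{PDI}_k$ kernel that is zero on the extended diagonal $\Delta^n_{k-1}$. Then for every $\lambda\in\mathfrak{M}_k[\mathfrak{I}]$ and for whichever $x_{\vec 0}\in\mathbb{X}_n$ is used to define $K^{\mathfrak{I}}$, $$\int_{\mathbb{X}_n}\int_{\mathbb{X}_n}(-1)^k\mathfrak{I}(u,v)\,d\lambda(u)d\lambda(v)=\int_{\mathbb{X}_n}\int_{\mathbb{X}_n}K^{\mathfrak{I}}(u,v)\,d\lambda(u)d\lambda(v)=\langle K^{\mathfrak{I}}_\lambda,K^{\mathfrak{I}}_\lambda\rangle_{\mathcal{H}_{\mathfrak{I}}}\ge0.$$ In particular, for any fixed $P\in\mathcal{P}[\mathfrak{I}]$, the bilinear function $$(\lambda,\eta)\in\mathfrak{M}_k[\mathfrak{I},P]\times\mathfrak{M}_k[\mathfrak{I},P]\mapsto\int_{\mathbb{X}_n}\int_{\mathbb{X}_n}(-1)^k\mathfrak{I}(u,v)\,d\lambda(u)d\eta(v)$$ is well defined and is a semi-inner product, because $$\int_{\mathbb{X}_n}\int_{\mathbb{X}_n}(-1)^k\mathfrak{I}(u,v)\,d\lambda(u)d\eta(v)=\int_{\mathbb{X}_n}\int_{\mathbb{X}_n}K^{\mathfrak{I}}(u,v)\,d\lambda(u)d\eta(v)=\langle K^{\mathfrak{I}}_\lambda,K^{\mathfrak{I}}_\eta\rangle_{\mathcal{H}_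{\mathfrak{I}}}.$$
   Context: $X_1,\dots,X_n$ are nonempty Hausdorff spaces, $\mathbb{X}_n=\prod_{i=1}^nX_i$, $\mathbb{X}_F=\prod_{i\in F}X_i$. For points $x_{\vec a}=(x_1^a,\dots,x_n^a)$ and a multi-index $\alpha$, $x_\alpha=(x_1^{\alpha_1},\dots,x_n^{\alpha_n})$; $x_{\vec a_F+\vec b_{F^c}}$ is the point with coordinates $x_i^a$ for $i\in F$ and $x_i^b$ for $i\notin F$. $\mathfrak{M}(\mathbb{X}_n)$: real signed regular Radon measures of finite variation. $\mathcal{M}(\mathbb{X}_n)$: finitely supported real signed measures. $\mathcal{M}_k(\mathbb{X}_n)$, $\mathfrak{M}_k(\mathbb{X}_n)$: the subspaces of those $\mu$ with $\mu(\prod_iA_i)=0$ for all (measurable) $A_i\subset X_i$ with $|\{i:A_i=X_i\}|\ge n-k+1$. A kernel is $n$-symmetric if $\mathfrak{I}(x_{\vec 1},x_{\vec 2})=\mathfrak{I}(x_\alpha,x_{\vec 3-\alpha})$ for all $\alpha\in\{1,2\}^n$ and all points ($\vec 3-\alpha=(3-\alpha_i)_i$). It is complete $n$-symmetric if, moreover, $\mathfrak{I}(x_{\vec 1_F+\vec 3_{F^c}},x_{\vec 2_F+\vec 3_{F^c}})=\mathfrak{I}(x_{\vec 1_F+\vec 4_{F^c}},x_{\vec 2_F+\vec 4_{F^c}})$ for all $F\subset\{1,\dots,n\}$ and all points. It is $\mathrm{PDI}_k$ if it is $n$-symmetric and $\iint(-1)^k\mathfrak{I}\,d\mu\,d\mu\ge0$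 for all $\mu\in\mathcal{M}_k(\mathbb{X}_n)$. $\Delta^n_{k-1}$ is the set of pairs of points of $\mathbb{X}_n$ agreeing in at least $n-k+1$ coordinates. Put $\mu_k^n[x_{\vec 1},x_{\vec 0}]=\delta_{x_{\vec 1}}+\sum_{j=0}^{k-1}(-1)^{k-j}\binom{n-j-1}{n-k}\sum_{|F|=j}\delta_{x_{\vec 1_F+\vec 0_{F^c}}}$ and, for fixed $x_{\vec 0}$, $K^{\mathfrak{I}}(x,y)=\iint(-1)^k\mathfrak{I}(u,v)\,d\mu_k^n[x,x_{\vec 0}](u)\,d\mu_k^n[y,x_{\vec 0}](v)$; this is a positive definite kernel with reproducing kernel Hilbert space $\mathcal{H}_{\mathfrak{I}}$. Put $K^{\mathfrak{I}}_\lambda(z)=\int K^{\mathfrak{I}}(x,z)\,d\lambda(x)$, an element of $\mathcal{H}_{\mathfrak{I}}$ when $\sqrt{K^{\mathfrak{I}}(x,x)}\in L^1(|\lambda|)$. For a partition $\pi=\{F_1,\dots,F_\ell\}$ of $G\subset\{1,\dots,n\}$ and a nonnegative measure $\nu$, $\nu_F$ is the marginal of $\nu$ on $\mathbb{X}_F$ and $\nu_\pi=\bigotimes_j\nu_{F_j}$. A function $T:\mathbb{X}_n\times\mathbb{X}_n\to\mathbb{R}$ is FIP (fully integrable by partitions) with respect to $\mu\times\mu$ if $\int|T(x_{\vec 1_F+\vec 2_{F^c}},y_{\vec 1_G+\vec 2_{G^c}})|\,d|\mu|_\pi(x_{\vec 1})\,d|\mu|_\sigma(y_{\vec 1})<\infty$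 for all $x_{\vec 2},y_{\vec 2}\in\mathbb{X}_n$, all subsets $F,G$ and all partitions $\pi,\sigma$ of $\{1,\dots,n\}$. $\mathfrak{M}[\mathfrak{I}]$ is the set of $\mu\in\mathfrak{M}(\mathbb{X}_n)$ such that $\mathfrak{I}$ is FIP with respect to $\mu\times\mu$; $\mathcal{P}[\mathfrak{I}]$ is the set of probabilities in $\mathfrak{M}[\mathfrak{I}]$; $\mathfrak{M}_k[\mathfrak{I}]=\mathfrak{M}[\mathfrak{I}]\cap\mathfrak{M}_k(\mathbb{X}_n)$. A measure $\mu$ is marginally delimited by a probability $P$ if there is $M\ge1$ such that for every $F\subset\{1,\dots,n\}$ with $|F|\le n-1$ the measure $M\sum_\pi(P_F)_\pi-|\mu|_F$ (sum over all partitions $\pi$ of $F$) is nonnegative. For $P\in\mathcal{P}[\mathfrak{I}]$, $\mathfrak{M}_k[\mathfrak{I},P]$ is the set of $\mu\in\mathfrak{M}_k[\mathfrak{I}]$ that are marginally delimited by $P$ (it is a vector space). A semi-inner product is a symmetric positive semidefinite bilinear form. *)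

theory Defs
  imports "HOL-Analysis.Analysis"
begin

definition borel_top :: "'p topology \<Rightarrow> 'p measure" where
  "borel_top T = sigma (topspace T) {U. openin T U}"

definition radon_measure :: "'p topology \<Rightarrow> 'p measure \<Rightarrow> bool" where
  "radon_measure T m \<longleftrightarrow>
     space m = topspace T \<and> sets m = sets (borel_top T) \<and>
     (\<forall>C. compactin T C \<longrightarrow> emeasure m C < \<infinity>) \<and>
     (\<forall>E\<in>sets m. emeasure m E = (SUP C\<in>{C. compactin T C \<and> C \<subseteq> E}. emeasure m C)) \<and>
     (\<forall>E\<in>sets m. emeasure m E = (INF U\<in>{U. openin T U \<and> E \<subseteq> U}. emeasure m U))"

text \<open>
  A real signed measure on the sigma-algebra of \<open>M\<close> is a set function, normalised to be
  \<open>0\<close> off the sigma-algebra, so that pointwise operations make the signed measures a vector space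
  and equality of set functions is equality of measures.
\<close>

definition signed_measure :: "'p measure \<Rightarrow> ('p set \<Rightarrow> real) \<Rightarrow> bool" where
  "signed_measure M \<mu> \<longleftrightarrow>
     (\<forall>A. A \<notin> sets M \<longrightarrow> \<mu> A = 0) \<and> \<mu> {} = 0 \<and>
     (\<forall>A::nat \<Rightarrow> 'p set. range A \<subseteq> sets M \<and> disjoint_family A \<longrightarrow>
        (\<lambda>i. \<mu> (A i)) sums \<mu> (\<Union>i. A i))"

definition variation :: "'p measure \<Rightarrow> ('p set \<Rightarrow> real) \<Rightarrow> 'p measure" where
  "variation M \<mu> = measure_of (space M) (sets M)
     (\<lambda>A. SUP \<C>\<in>{\<C>. finite \<C> \<and> \<C> \<subseteq> sets M \<and> disjoint \<C> \<and> \<Union>\<C> = A}. ennreal (\<Sum>B\<in>\<C>. \<bar>\<mu> B\<bar>))"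

definition to_measure :: "'p measure \<Rightarrow> ('p set \<Rightarrow> real) \<Rightarrow> 'p measure" where
  "to_measure M \<mu> = measure_of (space M) (sets M) (\<lambda>A. ennreal (\<mu> A))"

text \<open>Jordan decomposition: the positive and negative parts are \<open>(\<bar>\<mu>\<bar> + \<mu>)/2\<close> and \<open>(\<bar>\<mu>\<bar> - \<mu>)/2\<close>.\<close>

definition pos_var :: "'p measure \<Rightarrow> ('p set \<Rightarrow> real) \<Rightarrow> 'p measure" where
  "pos_var M \<mu> = to_measure M (\<lambda>A. (measure (variation M \<mu>) A + \<mu> A) / 2)"

definition neg_var :: "'p measure \<Rightarrow> ('p set \<Rightarrow> real) \<Rightarrow> 'p measure" where
  "neg_var M \<mu> = to_measure M (\<lambda>A. (measure (variation M \<mu>) A - \<mu> A) / 2)"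

definition sint :: "'p measure \<Rightarrow> ('p set \<Rightarrow> real) \<Rightarrow> ('p \<Rightarrow> real) \<Rightarrow> real" where
  "sint M \<mu> f = (\<integral>x. f x \<partial>pos_var M \<mu>) - (\<integral>x. f x \<partial>neg_var M \<mu>)"

definition dsint ::
  "'p measure \<Rightarrow> ('p set \<Rightarrow> real) \<Rightarrow> ('p set \<Rightarrow> real) \<Rightarrow> ('p \<Rightarrow> 'p \<Rightarrow> real) \<Rightarrow> real" where
  "dsint M \<mu> \<nu> f = sint M \<nu> (\<lambda>v. sint M \<mu> (\<lambda>u. f u v))"

definition dsintegrable ::
  "'p measure \<Rightarrow> ('p set \<Rightarrow> real) \<Rightarrow> ('p set \<Rightarrow> real) \<Rightarrow> ('p \<Rightarrow> 'p \<Rightarrow> real) \<Rightarrow> bool" where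
  "dsintegrable M \<mu> \<nu> f \<longleftrightarrow>
     (AE v in variation M \<nu>. integrable (variation M \<mu>) (\<lambda>u. f u v)) \<and>
     integrable (variation M \<nu>) (\<lambda>v. sint M \<mu> (\<lambda>u. f u v)) \<and>
     integrable (variation M \<nu>) (\<lambda>v. \<integral>u. \<bar>f u v\<bar> \<partial>variation M \<mu>)"

definition radon_signed :: "'p topology \<Rightarrow> ('p set \<Rightarrow> real) set" where
  "radon_signed T = {\<mu>. signed_measure (borel_top T) \<mu> \<and>
     finite_measure (variation (borel_top T) \<mu>) \<and> radon_measure T (variation (borel_top T) \<mu>)}"

text \<open>
  The spaces are \<open>X 1, \<dots>, X n\<close>, topologies on subsets of a common carrier type; the points of the
  product over \<open>F\<close> are the extensional functions on \<open>F\<close>.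
\<close>

abbreviation prod_sp :: "(nat \<Rightarrow> 'a topology) \<Rightarrow> nat set \<Rightarrow> (nat \<Rightarrow> 'a) topology" where
  "prod_sp X F \<equiv> product_topology X F"

abbreviation points :: "(nat \<Rightarrow> 'a topology) \<Rightarrow> nat \<Rightarrow> (nat \<Rightarrow> 'a) set" where
  "points X n \<equiv> topspace (prod_sp X {1..n})"

abbreviation prod_borel :: "(nat \<Rightarrow> 'a topology) \<Rightarrow> nat set \<Rightarrow> (nat \<Rightarrow> 'a) measure" where
  "prod_borel X F \<equiv> borel_top (prod_sp X F)"

text \<open>The point with the coordinates of \<open>x\<close> in \<open>F\<close> and those of \<open>y\<close> outside \<open>F\<close>.\<close>

definition mix :: "nat \<Rightarrow> nat set \<Rightarrow> (nat \<Rightarrow> 'a) \<Rightarrow> (nat \<Rightarrow> 'a) \<Rightarrow> (nat \<Rightarrow> 'a)" where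
  "mix n F x y = (\<lambda>i\<in>{1..n}. if i \<in> F then x i else y i)"

definition marg ::
  "(nat \<Rightarrow> 'a topology) \<Rightarrow> nat set \<Rightarrow> (nat \<Rightarrow> 'a) measure \<Rightarrow> (nat \<Rightarrow> 'a) measure" where
  "marg X F \<nu> = distr \<nu> (prod_borel X F) (\<lambda>x. restrict x F)"

text \<open>
  The tensor product of Radon measures \<open>\<kappa> B\<close> on the blocks \<open>B \<in> \<pi>\<close> lives on all Borel sets of the
  product topology, which in general are more than the product sigma-algebra: it is the unique
  Radon measure with the prescribed values on measurable rectangles.
\<close>

definition radon_product ::
  "(nat \<Rightarrow> 'a topology) \<Rightarrow> nat set set \<Rightarrow> (nat set \<Rightarrow> (nat \<Rightarrow> 'a) measure) \<Rightarrow> (nat \<Rightarrow> 'a) measure" where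
  "radon_product X \<pi> \<kappa> = (THE \<rho>. radon_measure (prod_sp X (\<Union>\<pi>)) \<rho> \<and>
     (\<forall>A. (\<forall>B\<in>\<pi>. A B \<in> sets (prod_borel X B)) \<longrightarrow>
        emeasure \<rho> {x \<in> topspace (prod_sp X (\<Union>\<pi>)). \<forall>B\<in>\<pi>. restrict x B \<in> A B}
          = (\<Prod>B\<in>\<pi>. emeasure (\<kappa> B) (A B))))"

definition part_prod ::
  "(nat \<Rightarrow> 'a topology) \<Rightarrow> (nat \<Rightarrow> 'a) measure \<Rightarrow> nat set set \<Rightarrow> (nat \<Rightarrow> 'a) measure" where
  "part_prod X \<nu> \<pi> = radon_product X \<pi> (\<lambda>B. marg X B \<nu>)"

text \<open>A finitely supported signed measure is given by its weight function.\<close>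

definition discrete_measures :: "'p set \<Rightarrow> ('p \<Rightarrow> real) set" where
  "discrete_measures S = {w. finite {p. w p \<noteq> 0} \<and> {p. w p \<noteq> 0} \<subseteq> S}"

definition dmeas :: "('p \<Rightarrow> real) \<Rightarrow> 'p set \<Rightarrow> real" where
  "dmeas w A = (\<Sum>p\<in>{p\<in>A. w p \<noteq> 0}. w p)"

definition dint :: "('p \<Rightarrow> real) \<Rightarrow> ('p \<Rightarrow> real) \<Rightarrow> real" where
  "dint w f = (\<Sum>p\<in>{p. w p \<noteq> 0}. w p * f p)"

definition dirac :: "'p \<Rightarrow> 'p \<Rightarrow> real" where
  "dirac x = (\<lambda>p. if p = x then 1 else 0)"

definition discrete_k ::
  "(nat \<Rightarrow> 'a topology) \<Rightarrow> nat \<Rightarrow> nat \<Rightarrow> ((nat \<Rightarrow> 'a) \<Rightarrow> real) set" where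
  "discrete_k X n k = {w \<in> discrete_measures (points X n).
     \<forall>A. (\<forall>i\<in>{1..n}. A i \<subseteq> topspace (X i)) \<and>
         card {i\<in>{1..n}. A i = topspace (X i)} \<ge> n - k + 1 \<longrightarrow> dmeas w (PiE {1..n} A) = 0}"

definition radon_k ::
  "(nat \<Rightarrow> 'a topology) \<Rightarrow> nat \<Rightarrow> nat \<Rightarrow> ((nat \<Rightarrow> 'a) set \<Rightarrow> real) set" where
  "radon_k X n k = {\<mu> \<in> radon_signed (prod_sp X {1..n}).
     \<forall>A. (\<forall>i\<in>{1..n}. A i \<in> sets (borel_top (X i))) \<and>
         card {i\<in>{1..n}. A i = topspace (X i)} \<ge> n - k + 1 \<longrightarrow> \<mu> (PiE {1..n} A) = 0}"

text \<open>A multi-index \<open>\<alpha> \<in> {1,2}\<^sup>n\<close> is encoded by the set \<open>F\<close> of those \<open>i\<close> with \<open>\<alpha>\<^sub>i = 1\<close>.\<close>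

definition n_symmetric ::
  "(nat \<Rightarrow> 'a topology) \<Rightarrow> nat \<Rightarrow> ((nat \<Rightarrow> 'a) \<Rightarrow> (nat \<Rightarrow> 'a) \<Rightarrow> real) \<Rightarrow> bool" where
  "n_symmetric X n J \<longleftrightarrow>
     (\<forall>x1\<in>points X n. \<forall>x2\<in>points X n. \<forall>F\<subseteq>{1..n}. J x1 x2 = J (mix n F x1 x2) (mix n F x2 x1))"

definition complete_n_symmetric ::
  "(nat \<Rightarrow> 'a topology) \<Rightarrow> nat \<Rightarrow> ((nat \<Rightarrow> 'a) \<Rightarrow> (nat \<Rightarrow> 'a) \<Rightarrow> real) \<Rightarrow> bool" where
  "complete_n_symmetric X n J \<longleftrightarrow> n_symmetric X n J \<and>
     (\<forall>x1\<in>points X n. \<forall>x2\<in>points X n. \<forall>x3\<in>points X n. \<forall>x4\<in>points X n. \<forall>F\<subseteq>{1..n}.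
        J (mix n F x1 x3) (mix n F x2 x3) = J (mix n F x1 x4) (mix n F x2 x4))"

definition PDI ::
  "(nat \<Rightarrow> 'a topology) \<Rightarrow> nat \<Rightarrow> nat \<Rightarrow> ((nat \<Rightarrow> 'a) \<Rightarrow> (nat \<Rightarrow> 'a) \<Rightarrow> real) \<Rightarrow> bool" where
  "PDI X n k J \<longleftrightarrow> n_symmetric X n J \<and>
     (\<forall>w\<in>discrete_k X n k. dint w (\<lambda>v. dint w (\<lambda>u. (-1) ^ k * J u v)) \<ge> 0)"

text \<open>
  The extended diagonal with index \<open>k - 1\<close>; it is indexed by \<open>k\<close> here because \<open>k = 0\<close>
  (the empty set of pairs) is allowed.
\<close>

definition ext_diag :: "(nat \<Rightarrow> 'a topology) \<Rightarrow> nat \<Rightarrow> nat \<Rightarrow> ((nat \<Rightarrow> 'a) \<times> (nat \<Rightarrow> 'a)) set" where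
  "ext_diag X n k =
     {(x, y). x \<in> points X n \<and> y \<in> points X n \<and> card {i\<in>{1..n}. x i = y i} \<ge> n - k + 1}"

definition mu_kn :: "nat \<Rightarrow> nat \<Rightarrow> (nat \<Rightarrow> 'a) \<Rightarrow> (nat \<Rightarrow> 'a) \<Rightarrow> (nat \<Rightarrow> 'a) \<Rightarrow> real" where
  "mu_kn n k x1 x0 = (\<lambda>p. dirac x1 p +
     (\<Sum>j<k. (-1) ^ (k - j) * real ((n - j - 1) choose (n - k)) *
        (\<Sum>F\<in>{F. F \<subseteq> {1..n} \<and> card F = j}. dirac (mix n F x1 x0) p)))"

definition KJ ::
  "nat \<Rightarrow> nat \<Rightarrow> ((nat \<Rightarrow> 'a) \<Rightarrow> (nat \<Rightarrow> 'a) \<Rightarrow> real) \<Rightarrow> (nat \<Rightarrow> 'a) \<Rightarrow>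
   (nat \<Rightarrow> 'a) \<Rightarrow> (nat \<Rightarrow> 'a) \<Rightarrow> real" where
  "KJ n k J x0 x y =
     dint (mu_kn n k y x0) (\<lambda>v. dint (mu_kn n k x x0) (\<lambda>u. (-1) ^ k * J u v))"

definition fun_subspace :: "('b \<Rightarrow> real) set \<Rightarrow> bool" where
  "fun_subspace V \<longleftrightarrow> (\<lambda>_. 0) \<in> V \<and>
     (\<forall>f\<in>V. \<forall>g\<in>V. (\<lambda>z. f z + g z) \<in> V) \<and> (\<forall>c. \<forall>f\<in>V. (\<lambda>z. c * f z) \<in> V)"

definition semi_inner_product_on ::
  "('b \<Rightarrow> real) set \<Rightarrow> (('b \<Rightarrow> real) \<Rightarrow> ('b \<Rightarrow> real) \<Rightarrow> real) \<Rightarrow> bool" where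
  "semi_inner_product_on V B \<longleftrightarrow> fun_subspace V \<and>
     (\<forall>f\<in>V. \<forall>g\<in>V. B f g = B g f) \<and>
     (\<forall>f\<in>V. \<forall>g\<in>V. \<forall>h\<in>V. B (\<lambda>z. f z + g z) h = B f h + B g h) \<and>
     (\<forall>c. \<forall>f\<in>V. \<forall>h\<in>V. B (\<lambda>z. c * f z) h = c * B f h) \<and>
     (\<forall>f\<in>V. B f f \<ge> 0)"

text \<open>
  Real Hilbert spaces of functions on \<open>S\<close> (normalised to vanish off \<open>S\<close>) with reproducing
  kernel \<open>K\<close>. The inner product is normalised to vanish off \<open>H\<close>, so that the space and the
  inner product are uniquely determined by \<open>S\<close> and \<open>K\<close>.
\<close>

definition is_rkhs ::
  "'p set \<Rightarrow> ('p \<Rightarrow> 'p \<Rightarrow> real) \<Rightarrow> ('p \<Rightarrow> real) set \<Rightarrow>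
   (('p \<Rightarrow> real) \<Rightarrow> ('p \<Rightarrow> real) \<Rightarrow> real) \<Rightarrow> bool" where
  "is_rkhs S K H ip \<longleftrightarrow>
     (\<forall>f\<in>H. \<forall>z. z \<notin> S \<longrightarrow> f z = 0) \<and>
     semi_inner_product_on H ip \<and>
     (\<forall>f\<in>H. ip f f = 0 \<longrightarrow> f = (\<lambda>_. 0)) \<and>
     (\<forall>f g. f \<notin> H \<or> g \<notin> H \<longrightarrow> ip f g = 0) \<and>
     Metric_space.mcomplete H (\<lambda>f g. sqrt (ip (\<lambda>z. f z - g z) (\<lambda>z. f z - g z))) \<and>
     (\<forall>y\<in>S. (\<lambda>z. if z \<in> S then K z y else 0) \<in> H \<and>
        (\<forall>f\<in>H. ip f (\<lambda>z. if z \<in> S then K z y else 0) = f y))"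

definition rkhs ::
  "'p set \<Rightarrow> ('p \<Rightarrow> 'p \<Rightarrow> real) \<Rightarrow>
   ('p \<Rightarrow> real) set \<times> (('p \<Rightarrow> real) \<Rightarrow> ('p \<Rightarrow> real) \<Rightarrow> real)" where
  "rkhs S K = (THE R. is_rkhs S K (fst R) (snd R))"

definition HJ ::
  "(nat \<Rightarrow> 'a topology) \<Rightarrow> nat \<Rightarrow> nat \<Rightarrow> ((nat \<Rightarrow> 'a) \<Rightarrow> (nat \<Rightarrow> 'a) \<Rightarrow> real) \<Rightarrow> (nat \<Rightarrow> 'a) \<Rightarrow>
   ((nat \<Rightarrow> 'a) \<Rightarrow> real) set" where
  "HJ X n k J x0 = fst (rkhs (points X n) (KJ n k J x0))"

definition ipJ ::
  "(nat \<Rightarrow> 'a topology) \<Rightarrow> nat \<Rightarrow> nat \<Rightarrow> ((nat \<Rightarrow> 'a) \<Rightarrow> (nat \<Rightarrow> 'a) \<Rightarrow> real) \<Rightarrow> (nat \<Rightarrow> 'a) \<Rightarrow>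
   ((nat \<Rightarrow> 'a) \<Rightarrow> real) \<Rightarrow> ((nat \<Rightarrow> 'a) \<Rightarrow> real) \<Rightarrow> real" where
  "ipJ X n k J x0 = snd (rkhs (points X n) (KJ n k J x0))"

definition KJ_embed ::
  "(nat \<Rightarrow> 'a topology) \<Rightarrow> nat \<Rightarrow> nat \<Rightarrow> ((nat \<Rightarrow> 'a) \<Rightarrow> (nat \<Rightarrow> 'a) \<Rightarrow> real) \<Rightarrow> (nat \<Rightarrow> 'a) \<Rightarrow>
   ((nat \<Rightarrow> 'a) set \<Rightarrow> real) \<Rightarrow> (nat \<Rightarrow> 'a) \<Rightarrow> real" where
  "KJ_embed X n k J x0 \<mu> =
     (\<lambda>z. if z \<in> points X n then sint (prod_borel X {1..n}) \<mu> (\<lambda>x. KJ n k J x0 x z) else 0)"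

text \<open>
  Integrals over pairs of points are iterated: a continuous \<open>T\<close> need not be measurable for the
  product of the two Borel sigma-algebras, while for Radon measures its inner integral is Borel.
\<close>

definition FIP ::
  "(nat \<Rightarrow> 'a topology) \<Rightarrow> nat \<Rightarrow> ((nat \<Rightarrow> 'a) \<Rightarrow> (nat \<Rightarrow> 'a) \<Rightarrow> real) \<Rightarrow>
   ((nat \<Rightarrow> 'a) set \<Rightarrow> real) \<Rightarrow> bool" where
  "FIP X n T \<mu> \<longleftrightarrow> (let V = variation (prod_borel X {1..n}) \<mu> in
     \<forall>x2\<in>points X n. \<forall>y2\<in>points X n. \<forall>F\<subseteq>{1..n}. \<forall>G\<subseteq>{1..n}. \<forall>\<pi> \<sigma>.
       partition_on {1..n} \<pi> \<and> partition_on {1..n} \<sigma> \<longrightarrow>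
       (\<integral>\<^sup>+y1. (\<integral>\<^sup>+x1. ennreal \<bar>T (mix n F x1 x2) (mix n G y1 y2)\<bar> \<partial>part_prod X V \<pi>)
          \<partial>part_prod X V \<sigma>) < \<infinity>)"

definition measJ ::
  "(nat \<Rightarrow> 'a topology) \<Rightarrow> nat \<Rightarrow> ((nat \<Rightarrow> 'a) \<Rightarrow> (nat \<Rightarrow> 'a) \<Rightarrow> real) \<Rightarrow>
   ((nat \<Rightarrow> 'a) set \<Rightarrow> real) set" where
  "measJ X n J = {\<mu> \<in> radon_signed (prod_sp X {1..n}). FIP X n J \<mu>}"

definition probJ ::
  "(nat \<Rightarrow> 'a topology) \<Rightarrow> nat \<Rightarrow> ((nat \<Rightarrow> 'a) \<Rightarrow> (nat \<Rightarrow> 'a) \<Rightarrow> real) \<Rightarrow>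
   ((nat \<Rightarrow> 'a) set \<Rightarrow> real) set" where
  "probJ X n J = {P \<in> measJ X n J. (\<forall>A. P A \<ge> 0) \<and> P (points X n) = 1}"

definition measJ_k ::
  "(nat \<Rightarrow> 'a topology) \<Rightarrow> nat \<Rightarrow> nat \<Rightarrow> ((nat \<Rightarrow> 'a) \<Rightarrow> (nat \<Rightarrow> 'a) \<Rightarrow> real) \<Rightarrow>
   ((nat \<Rightarrow> 'a) set \<Rightarrow> real) set" where
  "measJ_k X n k J = measJ X n J \<inter> radon_k X n k"

definition marginally_delimited ::
  "(nat \<Rightarrow> 'a topology) \<Rightarrow> nat \<Rightarrow> ((nat \<Rightarrow> 'a) set \<Rightarrow> real) \<Rightarrow> ((nat \<Rightarrow> 'a) set \<Rightarrow> real) \<Rightarrow> bool" where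
  "marginally_delimited X n P \<mu> \<longleftrightarrow>
     (\<exists>M\<ge>1. \<forall>F\<subseteq>{1..n}. card F \<le> n - 1 \<longrightarrow>
        (\<forall>A\<in>sets (prod_borel X F).
           emeasure (marg X F (variation (prod_borel X {1..n}) \<mu>)) A
             \<le> ennreal M * (\<Sum>\<pi>\<in>{\<pi>. partition_on F \<pi>}.
                  emeasure (part_prod X (marg X F (to_measure (prod_borel X {1..n}) P)) \<pi>) A)))"

definition measJ_kP ::
  "(nat \<Rightarrow> 'a topology) \<Rightarrow> nat \<Rightarrow> nat \<Rightarrow> ((nat \<Rightarrow> 'a) \<Rightarrow> (nat \<Rightarrow> 'a) \<Rightarrow> real) \<Rightarrow>
   ((nat \<Rightarrow> 'a) set \<Rightarrow> real) \<Rightarrow> ((nat \<Rightarrow> 'a) set \<Rightarrow> real) set" where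
  "measJ_kP X n k J P = {\<mu> \<in> measJ_k X n k J. marginally_delimited X n P \<mu>}"

end

theory Submission
  imports Defs
begin

text \<open>
  Complete symmetry makes \<open>J u v\<close> depend, coordinate by coordinate, only on the unordered pair
  \<open>{u i, v i}\<close>, and all coordinates with \<open>u i = v i\<close> may be moved to a common base point. So
  \<open>K x x\<close> is a linear combination of the functions \<open>J (mix F x x0) x0\<close>, which gives the integrability
  of \<open>sqrt (K x x)\<close>. When \<open>K\<close> is expanded and integrated against \<open>L \<in> radon_k X n k\<close>, the terms in
  which the integration variable enters through fewer than \<open>k\<close> coordinates vanish, because the
  marginals of \<open>L\<close> on fewer than \<open>k\<close> factors are zero; only \<open>(-1) ^ k * J\<close> survives. The identity
  with the inner product follows from \<open>\<langle>f, K\<^sub>L\<rangle> = \<integral> f dL\<close> for every \<open>f\<close> in the Hilbert space, by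
  approximating \<open>f\<close> with finite combinations of kernel sections; the space itself is the set of \<open>f\<close> with
  \<open>sup\<^sub>w (2 \<integral> f dw - \<integral>\<integral> K dw dw) < \<infinity>\<close> over the finitely supported \<open>w\<close>.

  For two different measures the point is the finiteness of the double integrals of \<open>\<bar>J\<bar>\<close>. For
  \<open>k \<ge> 2\<close>, testing the \<open>PDI\<close> condition on suitable product measures gives, in each coordinate \<open>i\<close>,
  \<open>J x y \<le> 2 J x (y(i := c)) + 2 J (x(i := c)) y - 3 J (x(i := c)) (y(i := c))\<close>. Iterated over all
  coordinates, this bounds \<open>\<bar>J u v\<bar>\<close> by terms in which \<open>u\<close> and \<open>v\<close> enter through disjoint sets of
  coordinates. In such a term either one of the two variables is absent, or both enter only
  through proper marginals, which are dominated by products of marginals of \<open>P\<close>.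
\<close>

section \<open>Radon measures\<close>

text \<open>Two obstacles shape the development. Symmetry and bilinearity of the form on two
  measures are read off from the inner product of the embedded functions. For the same reason
  \<open>part_prod\<close> is a Radon measure singled out by \<open>THE\<close>; its existence and
  uniqueness come from extending an ordinary product measure from the open rectangles. Secondly,
  \<open>FIP\<close> is quadratic in the measure, hence not visibly stable under sums. For measures
  delimited by \<open>P\<close> it is equivalent to finiteness of the integrals of
  \<open>J x c\<close> in absolute value for fixed \<open>c\<close>, which passes to sums. The
  constants 2, 2, 3 come from the weights 1, 1, -2 at \<open>x i\<close>, \<open>y i\<close>,
  \<open>c\<close>: their sum is 0, their squares add up to 6, and the doubled mixed products are 2,
  -4, -4. The tests in the other coordinates are Walsh functions; an induction over the cube merges
  their sign conditions into one inequality at its top.\<close>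

lemma space_borel_top [simp]: "space (borel_top T) = topspace T"
  unfolding borel_top_def by (rule space_measure_of) (auto dest: openin_subset)

lemma sets_borel_top: "sets (borel_top T) = sigma_sets (topspace T) {U. openin T U}"
  unfolding borel_top_def by (rule sets_measure_of) (auto dest: openin_subset)

lemma openin_sets_borel_top: "openin T U \<Longrightarrow> U \<in> sets (borel_top T)"
  unfolding sets_borel_top by (rule sigma_sets.Basic) simp

lemma closedin_sets_borel_top: "closedin T C \<Longrightarrow> C \<in> sets (borel_top T)"
  by (metis Diff_Diff_Int closedin_def inf.absorb_iff2 openin_sets_borel_top sets.compl_sets space_borel_top)

lemma compactin_sets_borel_top: "Hausdorff_space T \<Longrightarrow> compactin T C \<Longrightarrow> C \<in> sets (borel_top T)"
  by (simp add: closedin_sets_borel_top compactin_imp_closedin)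

lemma continuous_map_measurable_borel_top:
  assumes "continuous_map T T' f"
  shows "f \<in> measurable (borel_top T) (borel_top T')"
  unfolding borel_top_def[of T']
proof (rule measurable_measure_of)
  fix U assume "U \<in> {U. openin T' U}"
  then have "openin T {x \<in> topspace T. f x \<in> U}" using assms by (auto simp: continuous_map)
  moreover have "f -` U \<inter> space (borel_top T) = {x \<in> topspace T. f x \<in> U}" by auto
  ultimately show "f -` U \<inter> space (borel_top T) \<in> sets (borel_top T)"
    by (simp add: openin_sets_borel_top)
qed (use assms in \<open>auto dest: openin_subset simp: continuous_map_def\<close>)

lemma continuous_map_borel_measurable:
  assumes "continuous_map T euclideanreal f"
  shows "f \<in> borel_measurable (borel_top T)"
proof (rule borel_measurableI)
  fix U :: "real set" assume "open U"
  then have "openin T {x \<in> topspace T. f x \<in> U}" using assms by (auto simp: continuous_map)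
  moreover have "f -` U \<inter> space (borel_top T) = {x \<in> topspace T. f x \<in> U}" by auto
  ultimately show "f -` U \<inter> space (borel_top T) \<in> sets (borel_top T)"
    by (simp add: openin_sets_borel_top)
qed

text \<open>For a finite measure on a Hausdorff space, inner regularity by compact sets gives outer
  regularity through complements. So this is \<open>radon_measure\<close> for finite measures, in a
  form suited to real-valued epsilon estimates.\<close>

definition finite_radon :: "'p topology \<Rightarrow> 'p measure \<Rightarrow> bool" where
  "finite_radon T m \<longleftrightarrow> finite_measure m \<and> sets m = sets (borel_top T) \<and>
     (\<forall>E\<in>sets m. \<forall>e>0. \<exists>C. compactin T C \<and> C \<subseteq> E \<and> measure m E \<le> measure m C + e)"

lemma finite_radonD:
  assumes "finite_radon T m"
  shows "finite_measure m" "sets m = sets (borel_top T)" "space m = topspace T"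
  using assms sets_eq_imp_space_eq[of m "borel_top T"] unfolding finite_radon_def by auto

lemma finite_radon_compact:
  assumes "finite_radon T m" "E \<in> sets m" "e > 0"
  obtains C where "compactin T C" "C \<subseteq> E" "measure m E \<le> measure m C + e"
  using assms unfolding finite_radon_def by blast

text \<open>A compact set that nearly exhausts the complement of \<open>E\<close> is closed because
  the space is Hausdorff; its complement is the open set wanted.\<close>

lemma finite_radon_open:
  assumes T: "Hausdorff_space T" and m: "finite_radon T m" and E: "E \<in> sets m" and e: "e > 0"
  obtains U where "openin T U" "E \<subseteq> U" "measure m U \<le> measure m E + e"
proof -
  interpret finite_measure m by (rule finite_radonD[OF m])
  have sp: "space m = topspace T" by (rule finite_radonD[OF m])
  have "space m - E \<in> sets m" using E by auto
  then obtain C where C: "compactin T C" "C \<subseteq> space m - E" "measure m (space m - E) \<le> measure m C + e"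
    using finite_radon_compact[OF m _ e] by blast
  have Cs: "C \<in> sets m" using compactin_sets_borel_top[OF T C(1)] finite_radonD(2)[OF m] by simp
  have "openin T (topspace T - C)" using compactin_imp_closedin[OF T C(1)] by (simp add: closedin_def)
  moreover have "E \<subseteq> topspace T - C" using C(2) sets.sets_into_space[OF E] sp by auto
  moreover have "measure m (topspace T - C) \<le> measure m E + e"
    using finite_measure_compl[OF E] finite_measure_compl[OF Cs] C(3) sp by simp
  ultimately show thesis by (rule that)
qed

lemma radon_measure_imp_finite_radon:
  assumes "finite_measure m" "radon_measure T m"
  shows "finite_radon T m"
  unfolding finite_radon_def
proof (intro conjI ballI allI impI)
  interpret finite_measure m by fact
  show "sets m = sets (borel_top T)" using assms unfolding radon_measure_def by simp
  fix E and e :: real assume E: "E \<in> sets m" and e: "e > 0"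
  have "emeasure m E = (SUP C\<in>{C. compactin T C \<and> C \<subseteq> E}. emeasure m C)"
    using assms E unfolding radon_measure_def by blast
  then have "\<exists>C\<in>{C. compactin T C \<and> C \<subseteq> E}. emeasure m E < emeasure m C + e"
    by (rule SUP_approx_ennreal[OF e, rotated]) (auto simp: emeasure_eq_measure intro: exI[of _ "{}"])
  then obtain C where C: "compactin T C" "C \<subseteq> E" "emeasure m E < emeasure m C + e" by auto
  then have "ennreal (measure m E) \<le> ennreal (measure m C + e)"
    using e by (simp add: emeasure_eq_measure)
  then have "measure m E \<le> measure m C + e" using e by (subst (asm) ennreal_le_iff) auto
  then show "\<exists>C. compactin T C \<and> C \<subseteq> E \<and> measure m E \<le> measure m C + e" using C by blast
qed fact

lemma finite_radon_imp_radon_measure: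
  assumes T: "Hausdorff_space T" and m: "finite_radon T m"
  shows "radon_measure T m"
proof -
  interpret finite_measure m by (rule finite_radonD[OF m])
  note s = finite_radonD[OF m]
  have "emeasure m E = (SUP C\<in>{C. compactin T C \<and> C \<subseteq> E}. emeasure m C)" if E: "E \<in> sets m" for E
  proof (rule antisym)
    show "(SUP C\<in>{C. compactin T C \<and> C \<subseteq> E}. emeasure m C) \<le> emeasure m E"
      using E by (intro SUP_least emeasure_mono) auto
    show "emeasure m E \<le> (SUP C\<in>{C. compactin T C \<and> C \<subseteq> E}. emeasure m C)"
    proof (rule ennreal_le_epsilon)
      fix e :: real assume e: "0 < e"
      obtain C where C: "compactin T C" "C \<subseteq> E" "measure m E \<le> measure m C + e"
        using finite_radon_compact[OF m E e] .
      have "emeasure m E \<le> emeasure m C + e"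
        using C(3) e by (simp add: emeasure_eq_measure flip: ennreal_plus)
      also have "\<dots> \<le> (SUP C\<in>{C. compactin T C \<and> C \<subseteq> E}. emeasure m C) + e"
        using C by (intro add_right_mono SUP_upper) auto
      finally show "emeasure m E \<le> (SUP C\<in>{C. compactin T C \<and> C \<subseteq> E}. emeasure m C) + e" .
    qed
  qed
  moreover have "emeasure m E = (INF U\<in>{U. openin T U \<and> E \<subseteq> U}. emeasure m U)" if E: "E \<in> sets m" for E
  proof (rule antisym)
    show "emeasure m E \<le> (INF U\<in>{U. openin T U \<and> E \<subseteq> U}. emeasure m U)"
      using s by (intro INF_greatest emeasure_mono) (auto simp: openin_sets_borel_top)
    show "(INF U\<in>{U. openin T U \<and> E \<subseteq> U}. emeasure m U) \<le> emeasure m E"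
    proof (rule ennreal_le_epsilon)
      fix e :: real assume e: "0 < e"
      obtain U where U: "openin T U" "E \<subseteq> U" "measure m U \<le> measure m E + e"
        using finite_radon_open[OF T m E e] .
      have "(INF U\<in>{U. openin T U \<and> E \<subseteq> U}. emeasure m U) \<le> emeasure m U"
        using U by (intro INF_lower) auto
      also have "\<dots> \<le> emeasure m E + e"
        using U(3) e by (simp add: emeasure_eq_measure flip: ennreal_plus)
      finally show "(INF U\<in>{U. openin T U \<and> E \<subseteq> U}. emeasure m U) \<le> emeasure m E + e" .
    qed
  qed
  moreover have "emeasure m C < \<infinity>" for C by (simp add: emeasure_eq_measure)
  ultimately show ?thesis unfolding radon_measure_def using s by auto
qed

text \<open>For each \<open>m i\<close> a compact subset of \<open>E\<close> misses mass at most
  \<open>d\<close>; the finite union of these sets misses at most \<open>c * card I * d\<close> of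
  \<open>m'\<close>. Jordan parts and linear combinations of Radon measures are seen to be Radon in
  this way.\<close>

lemma finite_radon_dominated:
  assumes T: "Hausdorff_space T" and I: "finite I" "\<And>i. i \<in> I \<Longrightarrow> finite_radon T (m i)"
    and s: "sets m' = sets (borel_top T)" and c: "c \<ge> 0"
    and dom: "\<And>A. A \<in> sets m' \<Longrightarrow> emeasure m' A \<le> ennreal c * (\<Sum>i\<in>I. emeasure (m i) A)"
  shows "finite_radon T m'"
proof -
  have sp: "space m' = topspace T" using sets_eq_imp_space_eq[OF s] by simp
  have fin: "finite_measure (m i)" and si: "sets (m i) = sets m'" if "i \<in> I" for i
    using finite_radonD[OF I(2)[OF that]] s by auto
  have em: "emeasure (m i) A = ennreal (measure (m i) A)" if "i \<in> I" for i A
    by (rule finite_measure.emeasure_eq_measure[OF fin[OF that]])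
  have dom': "emeasure m' A \<le> ennreal (c * (\<Sum>i\<in>I. measure (m i) A))" if "A \<in> sets m'" for A
    using dom[OF that] c by (simp add: em sum_nonneg ennreal_mult)
  interpret finite_measure m'
    by standard (use dom'[OF sets.top] in \<open>auto simp: top_unique\<close>)
  have domr: "measure m' A \<le> c * (\<Sum>i\<in>I. measure (m i) A)" if "A \<in> sets m'" for A
    using dom'[OF that] c by (simp add: emeasure_eq_measure sum_nonneg)
  show ?thesis unfolding finite_radon_def
  proof (intro conjI ballI allI impI s)
    fix E and e :: real assume E: "E \<in> sets m'" and e: "e > 0"
    \<comment> \<open>The added 1 keeps the denominator positive when \<open>c\<close> is 0 or
      \<open>I\<close> is empty.\<close>
    define d where "d = e / (c * card I + 1)"
    have cp: "c * card I + 1 > 0" using c by (simp add: add_nonneg_pos)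
    have d: "d > 0" unfolding d_def using e cp by simp
    have "\<exists>C. compactin T C \<and> C \<subseteq> E \<and> measure (m i) E \<le> measure (m i) C + d" if "i \<in> I" for i
      using finite_radon_compact[OF I(2)[OF that] _ d] E si[OF that] by metis
    then obtain C where C: "\<And>i. i \<in> I \<Longrightarrow> compactin T (C i)" "\<And>i. i \<in> I \<Longrightarrow> C i \<subseteq> E"
      "\<And>i. i \<in> I \<Longrightarrow> measure (m i) E \<le> measure (m i) (C i) + d" by metis
    let ?C = "\<Union>i\<in>I. C i"
    have comp: "compactin T ?C" using I(1) C(1) by (intro compactin_Union) auto
    have sub: "?C \<subseteq> E" using C(2) by auto
    have Cs: "?C \<in> sets m'" "\<And>i. i \<in> I \<Longrightarrow> C i \<in> sets m'"
      using compactin_sets_borel_top[OF T] comp C(1) s by auto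
    have "measure (m i) (E - ?C) \<le> d" if "i \<in> I" for i
    proof -
      interpret mi: finite_measure "m i" by (rule fin[OF that])
      have "measure (m i) (E - ?C) \<le> measure (m i) (E - C i)"
        using that E Cs si[OF that] by (intro mi.finite_measure_mono) auto
      also have "\<dots> = measure (m i) E - measure (m i) (C i)"
        using that E Cs C(2) si[OF that] by (intro mi.finite_measure_Diff) auto
      finally show ?thesis using C(3)[OF that] by simp
    qed
    then have "(\<Sum>i\<in>I. measure (m i) (E - ?C)) \<le> card I * d"
      using sum_bounded_above[of I "\<lambda>i. measure (m i) (E - ?C)" d] by simp
    then have "c * (\<Sum>i\<in>I. measure (m i) (E - ?C)) \<le> c * (card I * d)"
      using c by (intro mult_left_mono)
    also have "\<dots> \<le> (c * card I + 1) * d" using d by (simp add: algebra_simps)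
    also have "\<dots> = e" unfolding d_def using cp by simp
    finally have "measure m' (E - ?C) \<le> e" using domr[of "E - ?C"] E Cs by auto
    then have "measure m' E \<le> measure m' ?C + e"
      using finite_measure_Diff[OF E Cs(1) sub] by simp
    then show "\<exists>C. compactin T C \<and> C \<subseteq> E \<and> measure m' E \<le> measure m' C + e" using comp sub by blast
  qed unfold_locales
qed

lemma finite_radon_distr:
  assumes T: "Hausdorff_space T'" and m: "finite_radon T m" and f: "continuous_map T T' f"
  shows "finite_radon T' (distr m (borel_top T') f)"
proof -
  interpret finite_measure m by (rule finite_radonD[OF m])
  have meas: "f \<in> measurable m (borel_top T')"
    using continuous_map_measurable_borel_top[OF f] measurable_cong_sets[OF finite_radonD(2)[OF m] refl] by blast
  have sp: "space m = topspace T" by (rule finite_radonD[OF m])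
  show ?thesis unfolding finite_radon_def
  proof (intro conjI ballI allI impI)
    fix E and e :: real assume E: "E \<in> sets (distr m (borel_top T') f)" and e: "e > 0"
    have fE: "f -` E \<inter> space m \<in> sets m" using measurable_sets[OF meas] E by simp
    obtain C where C: "compactin T C" "C \<subseteq> f -` E \<inter> space m" "measure m (f -` E \<inter> space m) \<le> measure m C + e"
      using finite_radon_compact[OF m fE e] .
    have comp: "compactin T' (f ` C)" by (rule image_compactin[OF C(1) f])
    have Cs: "f ` C \<in> sets (borel_top T')" by (rule compactin_sets_borel_top[OF T comp])
    have "measure m C \<le> measure m (f -` (f ` C) \<inter> space m)"
      using C(2) measurable_sets[OF meas Cs] by (intro finite_measure_mono) auto
    then have "measure (distr m (borel_top T') f) E \<le> measure (distr m (borel_top T') f) (f ` C) + e"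
      using C(3) E Cs by (simp add: measure_distr[OF meas])
    then show "\<exists>C. compactin T' C \<and> C \<subseteq> E \<and>
        measure (distr m (borel_top T') f) E \<le> measure (distr m (borel_top T') f) C + e"
      using comp C(2) by (intro exI[of _ "f ` C"]) auto
  qed (use finite_measure_distr[OF meas] in auto)
qed

section \<open>Comparison of Radon measures on finite unions of base sets\<close>

definition base_of :: "'p topology \<Rightarrow> 'p set set \<Rightarrow> bool" where
  "base_of T \<B> \<longleftrightarrow> (\<forall>W\<in>\<B>. openin T W) \<and> (\<forall>U. openin T U \<longrightarrow> (\<forall>x\<in>U. \<exists>W\<in>\<B>. x \<in> W \<and> W \<subseteq> U))"

text \<open>Compactness is applied to the base sets contained in some \<open>U i\<close>, so that
  each selected set can be assigned to a member of the original cover.\<close>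

lemma compactin_base_cover:
  assumes B: "base_of T \<B>" and C: "compactin T C"
    and U: "\<And>i. i \<in> I \<Longrightarrow> openin T (U i)" "C \<subseteq> (\<Union>i\<in>I. U i)"
  obtains \<F> where "finite \<F>" "\<F> \<subseteq> \<B>" "C \<subseteq> \<Union>\<F>" "\<forall>W\<in>\<F>. \<exists>i\<in>I. W \<subseteq> U i"
proof -
  let ?\<W> = "{W\<in>\<B>. \<exists>i\<in>I. W \<subseteq> U i}"
  have op: "\<forall>W\<in>?\<W>. openin T W" using B unfolding base_of_def by auto
  have "C \<subseteq> \<Union>?\<W>"
  proof
    fix x assume "x \<in> C"
    then obtain i where "i \<in> I" "x \<in> U i" using U(2) by blast
    moreover then obtain W where "W \<in> \<B>" "x \<in> W" "W \<subseteq> U i" using B U(1) unfolding base_of_def by meson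
    ultimately show "x \<in> \<Union>?\<W>" by auto
  qed
  with op obtain \<F> where "finite \<F>" "\<F> \<subseteq> ?\<W>" "C \<subseteq> \<Union>\<F>"
    using C unfolding compactin_def by meson
  then show thesis by (intro that[of \<F>]) auto
qed

lemma compactin_base_between:
  assumes B: "base_of T \<B>" and C: "compactin T C" and U: "openin T U" "C \<subseteq> U"
  obtains \<F> where "finite \<F>" "\<F> \<subseteq> \<B>" "C \<subseteq> \<Union>\<F>" "\<Union>\<F> \<subseteq> U"
proof -
  have "C \<subseteq> (\<Union>i\<in>{()}. U)" using U(2) by simp
  from compactin_base_cover[OF B C U(1) this] obtain \<F> where F: "finite \<F>" "\<F> \<subseteq> \<B>" "C \<subseteq> \<Union>\<F>"
    "\<forall>W\<in>\<F>. \<exists>i\<in>{()}. W \<subseteq> U" .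
  then have "\<Union>\<F> \<subseteq> U" by auto
  then show thesis by (rule that[OF F(1-3)])
qed

text \<open>A compact \<open>C\<close> inside \<open>E\<close> carries almost all of
  \<open>\<rho> E\<close>, and open sets around \<open>C\<close> carry hardly more than
  \<open>\<rho>' i C\<close>. A finite union of base sets fits between \<open>C\<close> and the
  intersection of these open sets, and there the inequality is given. Thus an inequality known only
  on a small sigma-algebra containing the base reaches all Borel sets.\<close>

lemma finite_radon_le_from_base:
  assumes T: "Hausdorff_space T" and B: "base_of T \<B>" and \<rho>: "finite_radon T \<rho>"
    and I: "finite I" "\<And>i. i \<in> I \<Longrightarrow> finite_radon T (\<rho>' i)" and c: "c \<ge> 0"
    and le: "\<And>\<F>. finite \<F> \<Longrightarrow> \<F> \<subseteq> \<B> \<Longrightarrow> measure \<rho> (\<Union>\<F>) \<le> c * (\<Sum>i\<in>I. measure (\<rho>' i) (\<Union>\<F>))"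
    and E: "E \<in> sets (borel_top T)"
  shows "measure \<rho> E \<le> c * (\<Sum>i\<in>I. measure (\<rho>' i) E)"
proof (rule field_le_epsilon)
  fix e :: real assume e: "e > 0"
  define d where "d = e / (c * card I + 1)"
  have cp: "c * card I + 1 > 0" using c by (simp add: add_nonneg_pos)
  have d: "d > 0" unfolding d_def using e cp by simp
  interpret finite_measure \<rho> by (rule finite_radonD[OF \<rho>])
  have s\<rho>: "sets \<rho> = sets (borel_top T)" by (rule finite_radonD[OF \<rho>])
  have si: "sets (\<rho>' i) = sets (borel_top T)" "finite_measure (\<rho>' i)" if "i \<in> I" for i
    using finite_radonD[OF I(2)[OF that]] by auto
  obtain C where C: "compactin T C" "C \<subseteq> E" "measure \<rho> E \<le> measure \<rho> C + d"
    using finite_radon_compact[OF \<rho> _ d] E s\<rho> by metis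
  have Cs: "C \<in> sets (borel_top T)" by (rule compactin_sets_borel_top[OF T C(1)])
  have "\<exists>U. openin T U \<and> C \<subseteq> U \<and> measure (\<rho>' i) U \<le> measure (\<rho>' i) C + d" if "i \<in> I" for i
    using finite_radon_open[OF T I(2)[OF that] _ d, of C] Cs si[OF that] by metis
  then obtain U where U: "\<And>i. i \<in> I \<Longrightarrow> openin T (U i)" "\<And>i. i \<in> I \<Longrightarrow> C \<subseteq> U i"
      "\<And>i. i \<in> I \<Longrightarrow> measure (\<rho>' i) (U i) \<le> measure (\<rho>' i) C + d" by metis
  \<comment> \<open>The factor \<open>topspace T\<close> makes the set open also for empty
    \<open>I\<close>, where the intersection is the whole type.\<close>
  let ?U = "topspace T \<inter> (\<Inter>i\<in>I. U i)"
  have opU: "openin T ?U"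
  proof (cases "I = {}")
    case False
    then show ?thesis using I(1) U(1) by (intro openin_Int openin_INT2) auto
  qed simp
  have CU: "C \<subseteq> ?U" using U(2) compactin_subset_topspace[OF C(1)] by auto
  obtain \<F> where F: "finite \<F>" "\<F> \<subseteq> \<B>" "C \<subseteq> \<Union>\<F>" "\<Union>\<F> \<subseteq> ?U"
    using compactin_base_between[OF B C(1) opU CU] .
  have Fs: "\<Union>\<F> \<in> sets (borel_top T)"
    using F(2) B unfolding base_of_def by (intro openin_sets_borel_top openin_Union) auto
  have "measure \<rho> E \<le> measure \<rho> (\<Union>\<F>) + d"
    using C(3) finite_measure_mono[OF F(3)] Fs s\<rho> by auto
  also have "\<dots> \<le> c * (\<Sum>i\<in>I. measure (\<rho>' i) E + d) + d"
  proof (intro add_right_mono order_trans[OF le[OF F(1,2)]] mult_left_mono sum_mono c)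
    fix i assume i: "i \<in> I"
    interpret i: finite_measure "\<rho>' i" by (rule si[OF i])
    have "measure (\<rho>' i) (\<Union>\<F>) \<le> measure (\<rho>' i) (U i)"
      using F(4) i si[OF i] U(1)[OF i] by (intro i.finite_measure_mono) (auto simp: openin_sets_borel_top)
    moreover have "measure (\<rho>' i) C \<le> measure (\<rho>' i) E"
      using C(2) E si[OF i] by (intro i.finite_measure_mono) auto
    ultimately show "measure (\<rho>' i) (\<Union>\<F>) \<le> measure (\<rho>' i) E + d" using U(3)[OF i] by simp
  qed
  also have "\<dots> = c * (\<Sum>i\<in>I. measure (\<rho>' i) E) + (c * card I + 1) * d"
    by (simp add: sum.distrib algebra_simps)
  also have "(c * card I + 1) * d = e" unfolding d_def using cp by simp
  finally show "measure \<rho> E \<le> c * (\<Sum>i\<in>I. measure (\<rho>' i) E) + e" .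
qed

lemma finite_radon_eq_from_base:
  assumes T: "Hausdorff_space T" and B: "base_of T \<B>" and \<rho>: "finite_radon T \<rho>" "finite_radon T \<rho>'"
    and eq: "\<And>\<F>. finite \<F> \<Longrightarrow> \<F> \<subseteq> \<B> \<Longrightarrow> measure \<rho> (\<Union>\<F>) = measure \<rho>' (\<Union>\<F>)"
  shows "\<rho> = \<rho>'"
proof (rule measure_eqI)
  show s: "sets \<rho> = sets \<rho>'" using finite_radonD[OF \<rho>(1)] finite_radonD[OF \<rho>(2)] by simp
  fix E assume E: "E \<in> sets \<rho>"
  then have E': "E \<in> sets (borel_top T)" using finite_radonD[OF \<rho>(1)] by simp
  have "measure \<rho> E \<le> measure \<rho>' E"
    using finite_radon_le_from_base[OF T B \<rho>(1), of "{()}" "\<lambda>_. \<rho>'" 1 E] \<rho>(2) eq E' by simp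
  moreover have "measure \<rho>' E \<le> measure \<rho> E"
    using finite_radon_le_from_base[OF T B \<rho>(2), of "{()}" "\<lambda>_. \<rho>" 1 E] \<rho>(1) eq E' by simp
  ultimately show "emeasure \<rho> E = emeasure \<rho>' E"
    using finite_radonD(1)[OF \<rho>(1)] finite_radonD(1)[OF \<rho>(2)] by (simp add: finite_measure.emeasure_eq_measure)
qed

section \<open>Extension of a finite measure from a base of the topology to a Radon measure\<close>

locale radon_extension =
  fixes T :: "'p topology" and \<nu> :: "'p measure" and \<B> :: "'p set set"
  assumes T: "Hausdorff_space T" and fin: "finite_measure \<nu>" and space_nu: "space \<nu> = topspace T"
    and base: "base_of T \<B>" and \<B>_sets: "\<B> \<subseteq> sets \<nu>"
    and inner: "\<And>W e. W \<in> \<B> \<Longrightarrow> e > 0 \<Longrightarrow>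
       \<exists>C. compactin T C \<and> C \<in> sets \<nu> \<and> C \<subseteq> W \<and> measure \<nu> (W - C) \<le> e"
begin

sublocale finite_measure \<nu> by (rule fin)

text \<open>The prospective value on open sets. An open set may be an uncountable union of base sets
  and so lie outside \<open>sets \<nu>\<close>; finite unions of base sets always lie
  inside.\<close>

definition tau where "tau U = (SUP \<F>\<in>{\<F>. finite \<F> \<and> \<F> \<subseteq> \<B> \<and> \<Union>\<F> \<subseteq> U}. emeasure \<nu> (\<Union>\<F>))"
definition outer where "outer E = (INF U\<in>{U. openin T U \<and> E \<subseteq> U}. tau U)"

lemma Union_sets: "finite \<F> \<Longrightarrow> \<F> \<subseteq> \<B> \<Longrightarrow> \<Union>\<F> \<in> sets \<nu>"
  using \<B>_sets by (intro sets.finite_Union) auto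

lemma Union_open: "\<F> \<subseteq> \<B> \<Longrightarrow> openin T (\<Union>\<F>)"
  using base unfolding base_of_def by (intro openin_Union) auto

lemma inner_Union:
  assumes F: "finite \<F>" "\<F> \<subseteq> \<B>" and e: "e > 0"
  obtains C where "compactin T C" "C \<in> sets \<nu>" "C \<subseteq> \<Union>\<F>" "emeasure \<nu> (\<Union>\<F>) \<le> emeasure \<nu> C + ennreal e"
proof -
  define d where "d = e / (card \<F> + 1)"
  have d: "d > 0" "card \<F> * d \<le> e" unfolding d_def using e by (auto simp: field_simps)
  obtain C where C: "\<And>W. W \<in> \<F> \<Longrightarrow> compactin T (C W)" "\<And>W. W \<in> \<F> \<Longrightarrow> C W \<in> sets \<nu>"
     "\<And>W. W \<in> \<F> \<Longrightarrow> C W \<subseteq> W" "\<And>W. W \<in> \<F> \<Longrightarrow> measure \<nu> (W - C W) \<le> d"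
    using inner[OF _ d(1)] F(2) by (metis subsetD)
  let ?C = "\<Union>(C ` \<F>)"
  have Cs: "?C \<in> sets \<nu>" using C(2) F(1) by auto
  have Fs: "\<Union>\<F> \<in> sets \<nu>" by (rule Union_sets[OF F])
  have sub: "?C \<subseteq> \<Union>\<F>" using C(3) by blast
  have "measure \<nu> (\<Union>\<F> - ?C) \<le> measure \<nu> (\<Union>W\<in>\<F>. W - C W)"
    using F \<B>_sets C(2) by (intro finite_measure_mono sets.finite_UN) auto
  also have "\<dots> \<le> (\<Sum>W\<in>\<F>. measure \<nu> (W - C W))"
    using F \<B>_sets C(2) by (intro measure_UNION_le) auto
  also have "\<dots> \<le> (\<Sum>W\<in>\<F>. d)" by (intro sum_mono C(4))
  finally have "measure \<nu> (\<Union>\<F> - ?C) \<le> e" using d(2) by simp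
  then have "measure \<nu> (\<Union>\<F>) \<le> measure \<nu> ?C + e"
    using finite_measure_Diff[OF Fs Cs sub] by simp
  then have "emeasure \<nu> (\<Union>\<F>) \<le> emeasure \<nu> ?C + ennreal e"
    using e by (simp add: emeasure_eq_measure flip: ennreal_plus)
  moreover have "compactin T ?C" using C(1) F(1) by (intro compactin_Union) auto
  ultimately show thesis by (intro that[OF _ Cs sub])
qed

lemma tau_mono: "U \<subseteq> V \<Longrightarrow> tau U \<le> tau V"
  unfolding tau_def by (rule SUP_subset_mono) auto

lemma tau_upper: "finite \<F> \<Longrightarrow> \<F> \<subseteq> \<B> \<Longrightarrow> \<Union>\<F> \<subseteq> U \<Longrightarrow> emeasure \<nu> (\<Union>\<F>) \<le> tau U"
  unfolding tau_def by (intro SUP_upper) auto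

lemma tau_Union: "finite \<F> \<Longrightarrow> \<F> \<subseteq> \<B> \<Longrightarrow> tau (\<Union>\<F>) = emeasure \<nu> (\<Union>\<F>)"
  by (rule antisym[OF _ tau_upper])
    (auto simp: tau_def intro!: SUP_least emeasure_mono Union_sets)

lemma tau_le_space: "tau U \<le> emeasure \<nu> (space \<nu>)"
  unfolding tau_def by (intro SUP_least emeasure_space)

lemma tau_finite: "tau U \<noteq> \<infinity>"
  using tau_le_space[of U] emeasure_finite by (metis infinity_ennreal_def top_unique)

lemma tau_approx:
  assumes "e > 0"
  obtains \<F> where "finite \<F>" "\<F> \<subseteq> \<B>" "\<Union>\<F> \<subseteq> U" "tau U \<le> emeasure \<nu> (\<Union>\<F>) + ennreal e"
proof -
  have "\<exists>\<F>\<in>{\<F>. finite \<F> \<and> \<F> \<subseteq> \<B> \<and> \<Union>\<F> \<subseteq> U}. tau U < emeasure \<nu> (\<Union>\<F>) + ennreal e"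
    by (rule SUP_approx_ennreal[OF assms _ tau_def tau_finite]) (auto intro: exI[of _ "{}"])
  then obtain \<F> where "finite \<F>" "\<F> \<subseteq> \<B>" "\<Union>\<F> \<subseteq> U" "tau U < emeasure \<nu> (\<Union>\<F>) + ennreal e" by auto
  then show thesis by (intro that[of \<F>]) auto
qed

lemma tau_compact:
  assumes C: "compactin T C" "C \<in> sets \<nu>" and U: "openin T U" "C \<subseteq> U"
  shows "emeasure \<nu> C \<le> tau U"
proof -
  obtain \<F> where F: "finite \<F>" "\<F> \<subseteq> \<B>" "C \<subseteq> \<Union>\<F>" "\<Union>\<F> \<subseteq> U"
    using compactin_base_between[OF base C(1) U] .
  have "emeasure \<nu> C \<le> emeasure \<nu> (\<Union>\<F>)" by (intro emeasure_mono F Union_sets)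
  also have "\<dots> \<le> tau U" using F by (intro tau_upper) auto
  finally show ?thesis .
qed

text \<open>A finite union of base sets inside the union of all \<open>U i\<close> is replaced, at
  small cost, by a compact set \<open>C\<close> (this is where \<open>inner\<close> enters).
  \<open>C\<close> is covered by finitely many base sets, each inside one \<open>U i\<close>;
  grouping them by \<open>i\<close> leaves only countable subadditivity of
  \<open>\<nu>\<close>.\<close>

lemma tau_subadditive:
  fixes U :: "nat \<Rightarrow> 'p set"
  assumes U: "\<And>i. openin T (U i)"
  shows "tau (\<Union>i. U i) \<le> (\<Sum>i. tau (U i))"
proof (rule ennreal_le_epsilon)
  fix e :: real assume e: "e > 0"
  obtain \<F> where F: "finite \<F>" "\<F> \<subseteq> \<B>" "\<Union>\<F> \<subseteq> (\<Union>i. U i)" "tau (\<Union>i. U i) \<le> emeasure \<nu> (\<Union>\<F>) + ennreal (e/2)"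
    using tau_approx[of "e/2"] e by (metis half_gt_zero)
  obtain C where C: "compactin T C" "C \<in> sets \<nu>" "C \<subseteq> \<Union>\<F>" "emeasure \<nu> (\<Union>\<F>) \<le> emeasure \<nu> C + ennreal (e/2)"
    using inner_Union[OF F(1,2), of "e/2"] e by (metis half_gt_zero)
  obtain \<G> where G: "finite \<G>" "\<G> \<subseteq> \<B>" "C \<subseteq> \<Union>\<G>" "\<forall>W\<in>\<G>. \<exists>i\<in>UNIV. W \<subseteq> U i"
    using compactin_base_cover[OF base C(1) U subset_trans[OF C(3) F(3)]] .
  have Gi: "finite {W\<in>\<G>. W \<subseteq> U i}" "{W\<in>\<G>. W \<subseteq> U i} \<subseteq> \<B>" for i using G(1,2) by auto
  have "emeasure \<nu> C \<le> emeasure \<nu> (\<Union>i. \<Union>{W\<in>\<G>. W \<subseteq> U i})"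
  proof (rule emeasure_mono)
    show "C \<subseteq> (\<Union>i. \<Union>{W\<in>\<G>. W \<subseteq> U i})"
    proof
      fix x assume "x \<in> C"
      then obtain W where W: "W \<in> \<G>" "x \<in> W" using G(3) by auto
      with G(4) obtain i where "W \<subseteq> U i" by auto
      with W show "x \<in> (\<Union>i. \<Union>{W\<in>\<G>. W \<subseteq> U i})" by auto
    qed
    show "(\<Union>i. \<Union>{W\<in>\<G>. W \<subseteq> U i}) \<in> sets \<nu>" by (intro sets.countable_UN') (auto intro: Union_sets[OF Gi])
  qed
  also have "\<dots> \<le> (\<Sum>i. emeasure \<nu> (\<Union>{W\<in>\<G>. W \<subseteq> U i}))"
    using Union_sets[OF Gi] by (intro emeasure_subadditive_countably) auto
  also have "\<dots> \<le> (\<Sum>i. tau (U i))"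
    using Gi by (intro suminf_le tau_upper) auto
  finally have Cle: "emeasure \<nu> C \<le> (\<Sum>i. tau (U i))" .
  have "tau (\<Union>i. U i) \<le> (emeasure \<nu> C + ennreal (e/2)) + ennreal (e/2)"
    by (rule order_trans[OF F(4) add_right_mono[OF C(4)]])
  also have "\<dots> \<le> (\<Sum>i. tau (U i)) + ennreal (e/2) + ennreal (e/2)" by (intro add_right_mono Cle)
  also have "\<dots> = (\<Sum>i. tau (U i)) + ennreal e"
    using e by (simp add: add.assoc flip: ennreal_plus)
  finally show "tau (\<Union>i. U i) \<le> (\<Sum>i. tau (U i)) + ennreal e" .
qed

lemma outer_open: "openin T U \<Longrightarrow> outer U = tau U"
  unfolding outer_def by (intro antisym INF_lower INF_greatest tau_mono) auto

lemma outer_le: "openin T U \<Longrightarrow> E \<subseteq> U \<Longrightarrow> outer E \<le> tau U"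
  unfolding outer_def by (intro INF_lower) auto

lemma outer_mono: "E \<subseteq> F \<Longrightarrow> outer E \<le> outer F"
  unfolding outer_def by (rule INF_superset_mono) auto

lemma outer_approx:
  assumes "E \<subseteq> topspace T" "e > 0"
  obtains U where "openin T U" "E \<subseteq> U" "tau U \<le> outer E + ennreal e"
proof -
  have "outer E \<noteq> \<infinity>"
    using outer_le[OF openin_topspace assms(1)] tau_finite[of "topspace T"] by (metis infinity_ennreal_def top_unique)
  then have "\<exists>U\<in>{U. openin T U \<and> E \<subseteq> U}. tau U < outer E + ennreal e"
    using assms by (intro INF_approx_ennreal) (auto simp: outer_def)
  then obtain U where "openin T U" "E \<subseteq> U" "tau U < outer E + ennreal e" by auto
  then show thesis by (intro that[of U]) auto
qed

lemma outer_empty: "outer {} = 0"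
proof -
  have "outer {} = tau (\<Union>{})" by (simp add: outer_open)
  also have "\<dots> = 0" by (subst tau_Union) auto
  finally show ?thesis .
qed

lemma outer_subadditive:
  fixes A :: "nat \<Rightarrow> 'p set"
  assumes "\<And>i. A i \<subseteq> topspace T"
  shows "outer (\<Union>i. A i) \<le> (\<Sum>i. outer (A i))"
proof (rule ennreal_le_epsilon)
  fix e :: real assume e: "e > 0"
  have "\<exists>U. openin T U \<and> A n \<subseteq> U \<and> tau U \<le> outer (A n) + ennreal (e * (1/2) ^ Suc n)" for n
    using outer_approx[OF assms[of n], of "e * (1/2) ^ Suc n"] e by (metis half_gt_zero_iff mult_pos_pos zero_less_one zero_less_power)
  then obtain U where U: "\<And>n. openin T (U n)" "\<And>n. A n \<subseteq> U n"
      "\<And>n. tau (U n) \<le> outer (A n) + ennreal (e * (1/2) ^ Suc n)" by metis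
  have "outer (\<Union>i. A i) \<le> tau (\<Union>i. U i)" using U by (intro outer_le) auto
  also have "\<dots> \<le> (\<Sum>i. tau (U i))" by (rule tau_subadditive[OF U(1)])
  also have "\<dots> \<le> (\<Sum>n. outer (A n) + ennreal (e * (1/2) ^ Suc n))" by (intro suminf_le U(3)) auto
  also have "\<dots> = (\<Sum>n. outer (A n)) + (\<Sum>n. ennreal e * ennreal ((1/2) ^ Suc n))"
    using e by (subst suminf_add[symmetric]) (auto simp del: ennreal_suminf_cmult simp add: ennreal_mult[symmetric])
  also have "\<dots> = (\<Sum>n. outer (A n)) + ennreal e"
    unfolding ennreal_suminf_cmult by (subst suminf_ennreal_eq[OF zero_le_power power_half_series]) auto
  finally show "outer (\<Union>i. A i) \<le> (\<Sum>n. outer (A n)) + ennreal e" .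
qed

lemma outer_measure_space_outer: "outer_measure_space (Pow (topspace T)) outer"
  unfolding outer_measure_space_def positive_def increasing_def countably_subadditive_def
proof (intro conjI ballI allI impI)
  fix A :: "nat \<Rightarrow> 'p set" assume "range A \<subseteq> Pow (topspace T)"
  then show "outer (\<Union>i. A i) \<le> (\<Sum>i. outer (A i))" by (intro outer_subadditive) auto
qed (auto simp: outer_empty intro: outer_mono)

text \<open>This is the Caratheodory condition for open \<open>U\<close>. Around \<open>x\<close>
  take an open \<open>G\<close>, and inside \<open>G \<inter> U\<close> a compact \<open>C\<close>
  of almost full mass. Then \<open>G - C\<close> is open and contains the part of \<open>x\<close>
  outside \<open>U\<close>; \<open>C\<close> and any finite union of base sets in
  \<open>G - C\<close> are disjoint and fit together into \<open>G\<close>.\<close>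

lemma outer_split:
  assumes U: "openin T U" and x: "x \<subseteq> topspace T"
  shows "outer (U \<inter> x) + outer ((topspace T - U) \<inter> x) \<le> outer x"
proof (rule ennreal_le_epsilon)
  fix e :: real assume e: "e > 0"
  \<comment> \<open>Four approximations are made, by \<open>G\<close>, \<open>\<F>\<close>,
    \<open>C\<close> and \<open>\<F>'\<close>, and each costs \<open>d\<close>.\<close>
  define d where "d = e / 4"
  have d: "d > 0" using e d_def by simp
  obtain G where G: "openin T G" "x \<subseteq> G" "tau G \<le> outer x + ennreal d"
    using outer_approx[OF x d] .
  obtain \<F> where F: "finite \<F>" "\<F> \<subseteq> \<B>" "\<Union>\<F> \<subseteq> G \<inter> U" "tau (G \<inter> U) \<le> emeasure \<nu> (\<Union>\<F>) + ennreal d"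
    using tau_approx[OF d] .
  obtain C where C: "compactin T C" "C \<in> sets \<nu>" "C \<subseteq> \<Union>\<F>" "emeasure \<nu> (\<Union>\<F>) \<le> emeasure \<nu> C + ennreal d"
    using inner_Union[OF F(1,2) d] .
  have GC: "openin T (G - C)" using G(1) compactin_imp_closedin[OF T C(1)] by (rule openin_diff)
  obtain \<F>' where F': "finite \<F>'" "\<F>' \<subseteq> \<B>" "\<Union>\<F>' \<subseteq> G - C" "tau (G - C) \<le> emeasure \<nu> (\<Union>\<F>') + ennreal d"
    using tau_approx[OF d] .
  have "outer (U \<inter> x) \<le> tau (G \<inter> U)" using G U by (intro outer_le) auto
  also have "\<dots> \<le> (emeasure \<nu> C + ennreal d) + ennreal d" by (rule order_trans[OF F(4) add_right_mono[OF C(4)]])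
  finally have 1: "outer (U \<inter> x) \<le> emeasure \<nu> C + ennreal d + ennreal d" .
  have "outer ((topspace T - U) \<inter> x) \<le> tau (G - C)" using G(2) C(3) F(3) by (intro outer_le GC) blast
  then have 2: "outer ((topspace T - U) \<inter> x) \<le> emeasure \<nu> (\<Union>\<F>') + ennreal d" using F'(4) by (rule order_trans)
  have "emeasure \<nu> C + emeasure \<nu> (\<Union>\<F>') = emeasure \<nu> (C \<union> \<Union>\<F>')"
    using F'(3) by (intro plus_emeasure C Union_sets F') auto
  also have "\<dots> \<le> emeasure \<nu> (\<Union>(\<F> \<union> \<F>'))" using C(3) F F' by (intro emeasure_mono Union_sets) auto
  also have "\<dots> \<le> tau G" using F F' by (intro tau_upper) auto
  finally have 3: "emeasure \<nu> C + emeasure \<nu> (\<Union>\<F>') \<le> outer x + ennreal d" using G(3) by (rule order_trans)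
  have "outer (U \<inter> x) + outer ((topspace T - U) \<inter> x)
      \<le> (emeasure \<nu> C + ennreal d + ennreal d) + (emeasure \<nu> (\<Union>\<F>') + ennreal d)" by (rule add_mono[OF 1 2])
  also have "\<dots> = (emeasure \<nu> C + emeasure \<nu> (\<Union>\<F>')) + (ennreal d + ennreal d + ennreal d)" by (simp add: ac_simps)
  also have "\<dots> \<le> (outer x + ennreal d) + (ennreal d + ennreal d + ennreal d)" by (rule add_right_mono[OF 3])
  also have "\<dots> = outer x + ennreal e" using d by (simp add: d_def add.assoc flip: ennreal_plus)
  finally show "outer (U \<inter> x) + outer ((topspace T - U) \<inter> x) \<le> outer x + ennreal e" .
qed

text \<open>With \<open>outer_split\<close> all open sets belong to the Caratheodory lambda system,
  hence so do the Borel sets.\<close>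

lemma measure_space_outer: "measure_space (topspace T) (sigma_sets (topspace T) {U. openin T U}) outer"
proof -
  let ?L = "lambda_system (topspace T) (Pow (topspace T)) outer"
  interpret P: sigma_algebra "topspace T" "Pow (topspace T)" by (rule sigma_algebra_Pow)
  have mL: "measure_space (topspace T) ?L outer" by (rule P.caratheodory_lemma[OF outer_measure_space_outer])
  then have sL: "sigma_algebra (topspace T) ?L" by (simp add: measure_space_def)
  have sub: "subadditive (Pow (topspace T)) outer"
    using outer_measure_space_outer P.countably_subadditive_subadditive unfolding outer_measure_space_def by blast
  have "U \<in> ?L" if U: "openin T U" for U
    unfolding lambda_system_def
  proof (intro CollectI conjI ballI)
    show "U \<in> Pow (topspace T)" using openin_subset[OF U] by auto
    fix x assume x: "x \<in> Pow (topspace T)"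
    have "outer ((U \<inter> x) \<union> ((topspace T - U) \<inter> x)) \<le> outer (U \<inter> x) + outer ((topspace T - U) \<inter> x)"
      by (rule subadditiveD[OF sub]) (use x in auto)
    moreover have "(U \<inter> x) \<union> ((topspace T - U) \<inter> x) = x" using x by auto
    ultimately show "outer (U \<inter> x) + outer ((topspace T - U) \<inter> x) = outer x"
      using outer_split[OF U, of x] x by (auto intro: antisym)
  qed
  then have "sigma_sets (topspace T) {U. openin T U} \<subseteq> ?L"
    by (intro sigma_algebra.sigma_sets_subset[OF sL]) auto
  then show ?thesis
    by (intro measure_down[OF mL] sigma_algebra_sigma_sets) (auto dest: openin_subset)
qed

definition ext where "ext = measure_of (topspace T) {U. openin T U} outer"

lemma sets_ext: "sets ext = sets (borel_top T)" and space_ext: "space ext = topspace T"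
  unfolding ext_def sets_borel_top by (auto intro!: sets_measure_of space_measure_of dest: openin_subset)

lemma emeasure_ext: "A \<in> sets ext \<Longrightarrow> emeasure ext A = outer A"
  using measure_space_outer
  by (intro emeasure_measure_of[OF ext_def]) (auto simp: measure_space_def sets_ext sets_borel_top dest: openin_subset)

lemma emeasure_ext_open: "openin T U \<Longrightarrow> emeasure ext U = tau U"
  by (simp add: emeasure_ext sets_ext openin_sets_borel_top outer_open)

lemma emeasure_ext_Union: "finite \<F> \<Longrightarrow> \<F> \<subseteq> \<B> \<Longrightarrow> emeasure ext (\<Union>\<F>) = emeasure \<nu> (\<Union>\<F>)"
  by (simp add: emeasure_ext_open Union_open tau_Union)

lemma finite_measure_ext: "finite_measure ext"
  by standard (use tau_finite in \<open>simp add: space_ext emeasure_ext_open\<close>)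

lemma emeasure_ext_compact:
  assumes "compactin T C" "C \<in> sets \<nu>"
  shows "emeasure \<nu> C \<le> emeasure ext C"
  using assms compactin_sets_borel_top[OF T assms(1)]
  by (auto simp: emeasure_ext sets_ext outer_def intro!: INF_greatest tau_compact)

text \<open>Choose a compact \<open>D\<close> of almost full mass and an open \<open>U\<close>
  around the complement of \<open>E\<close> with little excess. Then \<open>D - U\<close> is
  compact, lies in \<open>E\<close>, and loses only the mass outside \<open>D\<close> and the excess
  of \<open>U\<close>.\<close>

lemma finite_radon_ext: "finite_radon T ext"
  unfolding finite_radon_def
proof (intro conjI ballI allI impI finite_measure_ext sets_ext)
  interpret E: finite_measure ext by (rule finite_measure_ext)
  fix E and e :: real assume E: "E \<in> sets ext" and e: "e > 0"
  have e4: "e/4 > 0" using e by simp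
  have sub: "E \<subseteq> topspace T" using sets.sets_into_space[OF E] space_ext by simp
  obtain \<F> where F: "finite \<F>" "\<F> \<subseteq> \<B>" "\<Union>\<F> \<subseteq> topspace T" "tau (topspace T) \<le> emeasure \<nu> (\<Union>\<F>) + ennreal (e/4)"
    using tau_approx[OF e4] .
  obtain D where D: "compactin T D" "D \<in> sets \<nu>" "D \<subseteq> \<Union>\<F>" "emeasure \<nu> (\<Union>\<F>) \<le> emeasure \<nu> D + ennreal (e/4)"
    using inner_Union[OF F(1,2) e4] .
  have Ds: "D \<in> sets ext" using compactin_sets_borel_top[OF T D(1)] by (simp add: sets_ext)
  have "emeasure ext (space ext) \<le> emeasure \<nu> D + ennreal (e/4) + ennreal (e/4)"
    using order_trans[OF F(4) add_right_mono[OF D(4)]] by (simp add: space_ext emeasure_ext_open)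
  also have "\<dots> \<le> emeasure ext D + ennreal (e/2)"
    using e emeasure_ext_compact[OF D(1,2)] by (simp add: add.assoc add_right_mono flip: ennreal_plus)
  finally have 1: "measure ext (space ext) \<le> measure ext D + e/2"
    using e by (simp add: E.emeasure_eq_measure flip: ennreal_plus)
  obtain U where U: "openin T U" "topspace T - E \<subseteq> U" "tau U \<le> outer (topspace T - E) + ennreal (e/4)"
    using outer_approx[OF _ e4, of "topspace T - E"] by auto
  have Us: "U \<in> sets ext" by (simp add: sets_ext openin_sets_borel_top U)
  have cE: "topspace T - E \<in> sets ext" using E space_ext by (metis sets.compl_sets)
  have 2: "measure ext U \<le> measure ext (space ext) - measure ext E + e/4"
    using U(3) e E.finite_measure_compl[OF E]
    by (simp add: space_ext emeasure_ext_open[OF U(1), symmetric] emeasure_ext[OF cE, symmetric] E.emeasure_eq_measure flip: ennreal_plus)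
  have "measure ext (space ext - (D - U)) \<le> measure ext ((space ext - D) \<union> U)"
    using Ds Us by (intro E.finite_measure_mono) auto
  also have "\<dots> \<le> measure ext (space ext - D) + measure ext U"
    using Ds Us by (intro measure_Un_le) auto
  also have "\<dots> = measure ext (space ext) - measure ext D + measure ext U"
    using E.finite_measure_compl[OF Ds] by simp
  also have "measure ext (space ext - (D - U)) = measure ext (space ext) - measure ext (D - U)"
    using Ds Us by (intro E.finite_measure_compl) auto
  finally have "measure ext E \<le> measure ext (D - U) + e" using 1 2 e by simp
  moreover have "D - U \<subseteq> E" using U(2) compactin_subset_topspace[OF D(1)] by auto
  moreover have "compactin T (D - U)"
  proof -
    have "D - U = D \<inter> (topspace T - U)" using compactin_subset_topspace[OF D(1)] by auto
    then show ?thesis using compact_Int_closedin[OF D(1), of "topspace T - U"] U(1) by auto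
  qed
  ultimately show "\<exists>C. compactin T C \<and> C \<subseteq> E \<and> measure ext E \<le> measure ext C + e" by blast
qed

end

section \<open>Signed measures\<close>

text \<open>\<open>nn_integral\<close> is a supremum over simple functions below \<open>f\<close>,
  and for simple functions the bound is the one on sets. Hence it holds for an arbitrary
  \<open>f\<close>.\<close>

lemma nn_integral_le_sum:
  fixes f :: "'p \<Rightarrow> ennreal"
  assumes s: "\<And>i. i \<in> I \<Longrightarrow> sets (m' i) = sets m"
    and le: "\<And>A. A \<in> sets m \<Longrightarrow> emeasure m A \<le> c * (\<Sum>i\<in>I. emeasure (m' i) A)"
  shows "(\<integral>\<^sup>+x. f x \<partial>m) \<le> c * (\<Sum>i\<in>I. \<integral>\<^sup>+x. f x \<partial>m' i)"
  unfolding nn_integral_def[of m]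
proof (rule SUP_least)
  fix g assume g: "g \<in> {g. simple_function m g \<and> g \<le> f}"
  have sp: "space (m' i) = space m" if "i \<in> I" for i by (rule sets_eq_imp_space_eq[OF s[OF that]])
  have gi: "simple_function (m' i) g" if "i \<in> I" for i
    using g sp[OF that] s[OF that] by (simp add: simple_function_def)
  have "integral\<^sup>S m g \<le> (\<Sum>x\<in>g ` space m. x * (c * (\<Sum>i\<in>I. emeasure (m' i) (g -` {x} \<inter> space m))))"
    unfolding simple_integral_def using g
    by (intro sum_mono mult_left_mono le) (auto simp: simple_function_def)
  also have "\<dots> = c * (\<Sum>i\<in>I. \<Sum>x\<in>g ` space m. x * emeasure (m' i) (g -` {x} \<inter> space m))"
    by (subst sum.swap) (simp add: sum_distrib_left mult.left_commute)
  also have "\<dots> = c * (\<Sum>i\<in>I. integral\<^sup>S (m' i) g)"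
    by (simp add: simple_integral_def sp)
  also have "\<dots> \<le> c * (\<Sum>i\<in>I. \<integral>\<^sup>+x. f x \<partial>m' i)"
    using g gi by (intro mult_left_mono sum_mono) (auto simp: nn_integral_def intro!: SUP_upper)
  finally show "integral\<^sup>S m g \<le> c * (\<Sum>i\<in>I. \<integral>\<^sup>+x. f x \<partial>m' i)" .
qed

text \<open>A linear relation with coefficients of both signs passes from sets to integrals by the
  usual approximation. It replaces any calculus of signed integrals: \<open>sint\<close> is linear
  in the measure because the Jordan parts satisfy such a relation on sets.\<close>

lemma integral_combination_zero:
  fixes f :: "'p \<Rightarrow> real"
  assumes I: "finite I" and s: "\<And>i. i \<in> I \<Longrightarrow> sets (m i) = sets M"
    and fin: "\<And>i. i \<in> I \<Longrightarrow> finite_measure (m i)"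
    and zero: "\<And>A. A \<in> sets M \<Longrightarrow> (\<Sum>i\<in>I. c i * measure (m i) A) = 0"
    and int: "\<And>i. i \<in> I \<Longrightarrow> integrable (m i) f"
  shows "(\<Sum>i\<in>I. c i * (\<integral>x. f x \<partial>m i)) = 0"
proof (cases "I = {}")
  case False
  then obtain i0 where i0: "i0 \<in> I" by auto
  have sp: "space (m i) = space M" if "i \<in> I" for i by (rule sets_eq_imp_space_eq[OF s[OF that]])
  have meas: "u \<in> borel_measurable (m i) \<longleftrightarrow> u \<in> borel_measurable M" if "i \<in> I" for i and u :: "'p \<Rightarrow> real"
    by (rule arg_cong[OF measurable_cong_sets[OF s[OF that] refl]])
  \<comment> \<open>Integrability stands inside the induction formula because it must be handed down
    from a sum or a limit to its smaller nonnegative pieces.\<close>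
  have pos: "(\<forall>i\<in>I. integrable (m i) u) \<longrightarrow> (\<Sum>i\<in>I. c i * (\<integral>x. u x \<partial>m i)) = 0"
    if u: "u \<in> borel_measurable M" "\<And>x. 0 \<le> u x" for u :: "'p \<Rightarrow> real"
    using u
  proof (induction u rule: borel_measurable_induct_real)
    case (set A)
    have "(\<integral>x. indicator A x \<partial>m i) = measure (m i) A" if "i \<in> I" for i
      using set s[OF that] sets.sets_into_space[OF set] sp[OF that] by (simp add: Int_absorb2)
    then show ?case using zero[OF set] by simp
  next
    case (mult u a)
    show ?case
    proof (cases "a = 0")
      case False
      then have "(\<forall>i\<in>I. integrable (m i) (\<lambda>x. a * u x)) \<longrightarrow> (\<forall>i\<in>I. integrable (m i) u)" by simp
      moreover have "(\<Sum>i\<in>I. c i * (\<integral>x. a * u x \<partial>m i)) = a * (\<Sum>i\<in>I. c i * (\<integral>x. u x \<partial>m i))"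
        by (simp add: sum_distrib_left mult.left_commute)
      ultimately show ?thesis using mult.IH by simp
    qed simp
  next
    case (add u v)
    show ?case
    proof
      assume int: "\<forall>i\<in>I. integrable (m i) (\<lambda>x. v x + u x)"
      have iu: "integrable (m i) u" and iv: "integrable (m i) v" if "i \<in> I" for i
        using add meas[OF that]
        by (auto intro!: Bochner_Integration.integrable_bound[OF bspec[OF int that]])
      then have "(\<Sum>i\<in>I. c i * (\<integral>x. v x + u x \<partial>m i)) = (\<Sum>i\<in>I. c i * (\<integral>x. v x \<partial>m i)) + (\<Sum>i\<in>I. c i * (\<integral>x. u x \<partial>m i))"
        by (simp add: sum.distrib[symmetric] algebra_simps)
      then show "(\<Sum>i\<in>I. c i * (\<integral>x. v x + u x \<partial>m i)) = 0" using add.IH iu iv by simp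
    qed
  next
    case (seq U)
    show ?case
    proof
      assume int: "\<forall>i\<in>I. integrable (m i) u"
      have um: "u \<in> borel_measurable M" using int i0 meas[OF i0] by auto
      have le: "U j x \<le> u x" if "x \<in> space M" for j x
        using seq.hyps(3) seq.hyps(4)[OF that] by (intro incseq_le) (auto simp: incseq_def le_fun_def)
      have iU: "integrable (m i) (U j)" if "i \<in> I" for i j
        by (rule Bochner_Integration.integrable_bound[OF bspec[OF int that]])
          (use seq.hyps(1,2) meas[OF that] le sp[OF that] in \<open>auto intro!: AE_I2 order_trans[OF le]\<close>)
      have lim: "(\<lambda>j. \<integral>x. U j x \<partial>m i) \<longlonglongrightarrow> (\<integral>x. u x \<partial>m i)" if "i \<in> I" for i
        by (rule integral_dominated_convergence[where w = u])
          (use seq.hyps(1,2,4) meas[OF that] um le sp[OF that] bspec[OF int that] in \<open>auto intro!: AE_I2\<close>)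
      have "(\<lambda>j. \<Sum>i\<in>I. c i * (\<integral>x. U j x \<partial>m i)) \<longlonglongrightarrow> (\<Sum>i\<in>I. c i * (\<integral>x. u x \<partial>m i))"
        by (intro tendsto_intros lim)
      moreover have "(\<Sum>i\<in>I. c i * (\<integral>x. U j x \<partial>m i)) = 0" for j using seq.IH[of j] iU by simp
      ultimately show "(\<Sum>i\<in>I. c i * (\<integral>x. u x \<partial>m i)) = 0"
        by (simp add: LIMSEQ_const_iff)
    qed
  qed
  have fm: "f \<in> borel_measurable M" using int[OF i0] meas[OF i0] by auto
  have ip: "integrable (m i) (\<lambda>x. max 0 (f x))" and im: "integrable (m i) (\<lambda>x. max 0 (- f x))" if "i \<in> I" for i
    using int[OF that] by auto
  have "(\<integral>x. f x \<partial>m i) = (\<integral>x. max 0 (f x) \<partial>m i) - (\<integral>x. max 0 (- f x) \<partial>m i)" if "i \<in> I" for i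
  proof -
    have "(\<integral>x. f x \<partial>m i) = (\<integral>x. max 0 (f x) - max 0 (- f x) \<partial>m i)"
      by (rule Bochner_Integration.integral_cong) auto
    also have "\<dots> = (\<integral>x. max 0 (f x) \<partial>m i) - (\<integral>x. max 0 (- f x) \<partial>m i)"
      by (rule Bochner_Integration.integral_diff[OF ip[OF that] im[OF that]])
    finally show ?thesis .
  qed
  then have "(\<Sum>i\<in>I. c i * (\<integral>x. f x \<partial>m i)) = (\<Sum>i\<in>I. c i * (\<integral>x. max 0 (f x) \<partial>m i)) - (\<Sum>i\<in>I. c i * (\<integral>x. max 0 (- f x) \<partial>m i))"
    by (simp add: right_diff_distrib sum_subtractf)
  also have "\<dots> = 0"
    using pos[of "\<lambda>x. max 0 (f x)"] pos[of "\<lambda>x. max 0 (- f x)"] fm ip im by auto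
  finally show ?thesis .
qed simp

section \<open>The variation of a signed measure\<close>

lemma signed_measure_sums:
  "signed_measure M \<mu> \<Longrightarrow> range A \<subseteq> sets M \<Longrightarrow> disjoint_family A \<Longrightarrow> (\<lambda>i. \<mu> (A i)) sums \<mu> (\<Union>i. A i)"
  unfolding signed_measure_def by blast

lemma signed_measure_off: "signed_measure M \<mu> \<Longrightarrow> A \<notin> sets M \<Longrightarrow> \<mu> A = 0"
  unfolding signed_measure_def by blast

lemma signed_measure_empty: "signed_measure M \<mu> \<Longrightarrow> \<mu> {} = 0"
  unfolding signed_measure_def by blast

lemma signed_measure_lin:
  assumes "signed_measure M \<mu>" "signed_measure M \<eta>"
  shows "signed_measure M (\<lambda>A. a * \<mu> A + b * \<eta> A)"
  unfolding signed_measure_def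
proof (intro conjI allI impI)
  fix A :: "nat \<Rightarrow> 'a set" assume "range A \<subseteq> sets M \<and> disjoint_family A"
  then show "(\<lambda>i. a * \<mu> (A i) + b * \<eta> (A i)) sums (a * \<mu> (\<Union>i. A i) + b * \<eta> (\<Union>i. A i))"
    using assms by (intro sums_add sums_mult signed_measure_sums) auto
qed (use assms in \<open>auto simp: signed_measure_off signed_measure_empty\<close>)

definition vparts :: "'p measure \<Rightarrow> 'p set \<Rightarrow> 'p set set set" where
  "vparts M A = {\<C>. finite \<C> \<and> \<C> \<subseteq> sets M \<and> disjoint \<C> \<and> \<Union>\<C> = A}"

text \<open>The set function behind \<open>variation\<close>. Since \<open>measure_of\<close>
  returns its values only for a measure, countable additivity is proved for it first.\<close>

definition vsup :: "'p measure \<Rightarrow> ('p set \<Rightarrow> real) \<Rightarrow> 'p set \<Rightarrow> ennreal" where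
  "vsup M \<mu> A = (SUP \<C>\<in>vparts M A. ennreal (\<Sum>B\<in>\<C>. \<bar>\<mu> B\<bar>))"

lemma variation_vsup: "variation M \<mu> = measure_of (space M) (sets M) (vsup M \<mu>)"
  unfolding variation_def vsup_def vparts_def ..

lemma sets_variation [simp]: "sets (variation M \<mu>) = sets M"
  and space_variation [simp]: "space (variation M \<mu>) = space M"
  by (simp_all add: variation_def)

lemma vparts_single: "A \<in> sets M \<Longrightarrow> {A} \<in> vparts M A"
  by (auto simp: vparts_def)

lemma abs_le_vsup: "A \<in> sets M \<Longrightarrow> ennreal \<bar>\<mu> A\<bar> \<le> vsup M \<mu> A"
  unfolding vsup_def by (rule SUP_upper2[OF vparts_single]) auto

lemma vsup_upper: "\<C> \<in> vparts M A \<Longrightarrow> ennreal (\<Sum>B\<in>\<C>. \<bar>\<mu> B\<bar>) \<le> vsup M \<mu> A"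
  unfolding vsup_def by (rule SUP_upper)

lemma vsup_empty: "signed_measure M \<mu> \<Longrightarrow> vsup M \<mu> {} = 0"
proof -
  assume s: "signed_measure M \<mu>"
  have "vsup M \<mu> {} \<le> 0" unfolding vsup_def
  proof (rule SUP_least)
    fix \<C> assume "\<C> \<in> vparts M {}"
    then have "\<And>B. B \<in> \<C> \<Longrightarrow> B = {}" by (auto simp: vparts_def)
    then have "(\<Sum>B\<in>\<C>. \<bar>\<mu> B\<bar>) = 0" using signed_measure_empty[OF s] by (intro sum.neutral) auto
    then show "ennreal (\<Sum>B\<in>\<C>. \<bar>\<mu> B\<bar>) \<le> 0" by simp
  qed
  then show ?thesis by simp
qed

lemma vsup_superadditive:
  assumes s: "signed_measure M \<mu>" and AB: "A \<in> sets M" "B \<in> sets M" "A \<inter> B = {}"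
  shows "vsup M \<mu> A + vsup M \<mu> B \<le> vsup M \<mu> (A \<union> B)"
proof -
  have ne: "vparts M A \<noteq> {}" "vparts M B \<noteq> {}" using vparts_single AB by auto
  have key: "ennreal (\<Sum>E\<in>\<C>. \<bar>\<mu> E\<bar>) + ennreal (\<Sum>E\<in>\<D>. \<bar>\<mu> E\<bar>) \<le> vsup M \<mu> (A \<union> B)"
    if C: "\<C> \<in> vparts M A" and D: "\<D> \<in> vparts M B" for \<C> \<D>
  proof -
    have fin: "finite \<C>" "finite \<D>" using C D by (auto simp: vparts_def)
    \<comment> \<open>Members of partitions of disjoint sets coincide only if they are empty, and
      the empty set contributes nothing, so the two sums add up over the union.\<close>
    have inter: "\<And>E. E \<in> \<C> \<inter> \<D> \<Longrightarrow> E = {}" using C D AB(3) by (fastforce simp: vparts_def)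
    have "disjoint (\<C> \<union> \<D>)"
    proof (rule disjointI)
      fix E F assume EF: "E \<in> \<C> \<union> \<D>" "F \<in> \<C> \<union> \<D>" "E \<noteq> F"
      have sub: "G \<in> \<C> \<Longrightarrow> G \<subseteq> A" "G \<in> \<D> \<Longrightarrow> G \<subseteq> B" for G using C D by (auto simp: vparts_def)
      have dis: "disjoint \<C>" "disjoint \<D>" using C D by (auto simp: vparts_def)
      consider "E \<in> \<C>" "F \<in> \<C>" | "E \<in> \<D>" "F \<in> \<D>" | "E \<subseteq> A" "F \<subseteq> B" | "E \<subseteq> B" "F \<subseteq> A"
        using EF(1,2) sub by (elim UnE) auto
      then show "E \<inter> F = {}"
      proof cases
        case 1 then show ?thesis using disjointD[OF dis(1) _ _ EF(3)] by simp
      next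
        case 2 then show ?thesis using disjointD[OF dis(2) _ _ EF(3)] by simp
      qed (use AB(3) in blast)+
    qed
    then have CD: "\<C> \<union> \<D> \<in> vparts M (A \<union> B)" using C D by (auto simp: vparts_def)
    have "(\<Sum>E\<in>\<C>. \<bar>\<mu> E\<bar>) + (\<Sum>E\<in>\<D>. \<bar>\<mu> E\<bar>) = (\<Sum>E\<in>\<C> \<union> \<D>. \<bar>\<mu> E\<bar>)"
      using inter signed_measure_empty[OF s] fin by (subst sum.union_inter_neutral) auto
    then show ?thesis using vsup_upper[OF CD, of \<mu>] by (simp add: sum_nonneg flip: ennreal_plus)
  qed
  have "vsup M \<mu> A + vsup M \<mu> B = (SUP \<C>\<in>vparts M A. ennreal (\<Sum>E\<in>\<C>. \<bar>\<mu> E\<bar>) + vsup M \<mu> B)"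
    unfolding vsup_def[of M \<mu> A] by (rule ennreal_SUP_add_left[OF ne(1), symmetric])
  also have "\<dots> \<le> vsup M \<mu> (A \<union> B)"
  proof (rule SUP_least)
    fix \<C> assume C: "\<C> \<in> vparts M A"
    have "ennreal (\<Sum>E\<in>\<C>. \<bar>\<mu> E\<bar>) + vsup M \<mu> B
        = (SUP \<D>\<in>vparts M B. ennreal (\<Sum>E\<in>\<C>. \<bar>\<mu> E\<bar>) + ennreal (\<Sum>E\<in>\<D>. \<bar>\<mu> E\<bar>))"
      unfolding vsup_def[of M \<mu> B] by (rule ennreal_SUP_add_right[OF ne(2)])
    also have "\<dots> \<le> vsup M \<mu> (A \<union> B)" by (rule SUP_least) (rule key[OF C])
    finally show "ennreal (\<Sum>E\<in>\<C>. \<bar>\<mu> E\<bar>) + vsup M \<mu> B \<le> vsup M \<mu> (A \<union> B)" .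
  qed
  finally show ?thesis .
qed

lemma abs_sums_le:
  fixes f :: "nat \<Rightarrow> real"
  assumes "f sums s"
  shows "ennreal \<bar>s\<bar> \<le> (\<Sum>i. ennreal \<bar>f i\<bar>)"
proof (cases "(\<Sum>i. ennreal \<bar>f i\<bar>) = top")
  case False
  then have sm: "summable (\<lambda>i. \<bar>f i\<bar>)" by (intro summable_suminf_not_top) auto
  have "\<bar>s\<bar> \<le> (\<Sum>i. \<bar>f i\<bar>)" using summable_rabs[OF sm] sums_unique[OF assms] by simp
  then show ?thesis using sm by (simp add: suminf_ennreal2 ennreal_leI)
qed simp

text \<open>Each block \<open>B\<close> of a partition of the union is cut by the sets
  \<open>A i\<close>; its mass is at most the sum of the masses of the pieces, and the pieces with
  fixed \<open>i\<close> partition \<open>A i\<close>.\<close>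

lemma vsup_subadditive:
  fixes A :: "nat \<Rightarrow> 'p set"
  assumes s: "signed_measure M \<mu>" and A: "range A \<subseteq> sets M" "disjoint_family A"
  shows "vsup M \<mu> (\<Union>i. A i) \<le> (\<Sum>i. vsup M \<mu> (A i))"
  unfolding vsup_def[of M \<mu> "\<Union>i. A i"]
proof (rule SUP_least)
  fix \<C> assume C: "\<C> \<in> vparts M (\<Union>i. A i)"
  have Cs: "finite \<C>" "\<And>B. B \<in> \<C> \<Longrightarrow> B \<in> sets M" "disjoint \<C>" "\<Union>\<C> = (\<Union>i. A i)"
    using C by (auto simp: vparts_def)
  have "ennreal \<bar>\<mu> B\<bar> \<le> (\<Sum>i. ennreal \<bar>\<mu> (B \<inter> A i)\<bar>)" if B: "B \<in> \<C>" for B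
  proof (rule abs_sums_le)
    have "(\<lambda>i. \<mu> (B \<inter> A i)) sums \<mu> (\<Union>i. B \<inter> A i)"
      using A Cs(2)[OF B] by (intro signed_measure_sums[OF s]) (auto simp: disjoint_family_on_def)
    moreover have "(\<Union>i. B \<inter> A i) = B" using B Cs(4) by auto
    ultimately show "(\<lambda>i. \<mu> (B \<inter> A i)) sums \<mu> B" by simp
  qed
  then have "(\<Sum>B\<in>\<C>. ennreal \<bar>\<mu> B\<bar>) \<le> (\<Sum>B\<in>\<C>. \<Sum>i. ennreal \<bar>\<mu> (B \<inter> A i)\<bar>)"
    by (rule sum_mono)
  then have "ennreal (\<Sum>B\<in>\<C>. \<bar>\<mu> B\<bar>) \<le> (\<Sum>B\<in>\<C>. \<Sum>i. ennreal \<bar>\<mu> (B \<inter> A i)\<bar>)"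
    by simp
  also have "\<dots> = (\<Sum>i. \<Sum>B\<in>\<C>. ennreal \<bar>\<mu> (B \<inter> A i)\<bar>)"
    by (rule suminf_sum[symmetric]) simp
  also have "\<dots> \<le> (\<Sum>i. vsup M \<mu> (A i))"
  proof (intro suminf_le)
    fix i
    let ?D = "(\<lambda>B. B \<inter> A i) ` \<C>"
    have Ai: "A i \<in> sets M" using A by auto
    have D: "?D \<in> vparts M (A i)"
      unfolding vparts_def using Cs Ai by (auto simp: disjoint_def)
    have "(\<Sum>B\<in>\<C>. \<bar>\<mu> (B \<inter> A i)\<bar>) = (\<Sum>E\<in>?D. \<bar>\<mu> E\<bar>)"
    \<comment> \<open>Different blocks have the same trace on \<open>A i\<close> only if that trace
      is empty, and then its mass is 0.\<close>
    proof (subst sum.reindex_nontrivial[OF Cs(1)])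
      fix B B' assume "B \<in> \<C>" "B' \<in> \<C>" "B \<noteq> B'" "B \<inter> A i = B' \<inter> A i"
      then have "B \<inter> A i = {}" using Cs(3) unfolding disjoint_def by blast
      then show "\<bar>\<mu> (B \<inter> A i)\<bar> = 0" using signed_measure_empty[OF s] by simp
    qed simp
    then show "(\<Sum>B\<in>\<C>. ennreal \<bar>\<mu> (B \<inter> A i)\<bar>) \<le> vsup M \<mu> (A i)"
      using vsup_upper[OF D, of \<mu>] by (simp add: sum_ennreal)
  qed auto
  finally show "ennreal (\<Sum>B\<in>\<C>. \<bar>\<mu> B\<bar>) \<le> (\<Sum>i. vsup M \<mu> (A i))" .
qed

lemma vsup_mono:
  assumes s: "signed_measure M \<mu>" and AB: "A \<in> sets M" "B \<in> sets M" "A \<subseteq> B"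
  shows "vsup M \<mu> A \<le> vsup M \<mu> B"
proof -
  have "vsup M \<mu> A \<le> vsup M \<mu> A + vsup M \<mu> (B - A)" by simp
  also have "\<dots> \<le> vsup M \<mu> (A \<union> (B - A))" using AB by (intro vsup_superadditive[OF s]) auto
  also have "A \<union> (B - A) = B" using AB by auto
  finally show ?thesis .
qed

lemma countably_additive_vsup:
  assumes s: "signed_measure M \<mu>"
  shows "countably_additive (sets M) (vsup M \<mu>)"
  unfolding countably_additive_def
proof (intro allI impI antisym)
  fix A :: "nat \<Rightarrow> 'a set"
  assume A: "range A \<subseteq> sets M" "disjoint_family A" and U: "(\<Union>i. A i) \<in> sets M"
  show "vsup M \<mu> (\<Union>i. A i) \<le> (\<Sum>i. vsup M \<mu> (A i))" by (rule vsup_subadditive[OF s A])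
  have fin: "(\<Sum>i<n. vsup M \<mu> (A i)) \<le> vsup M \<mu> (\<Union>i<n. A i)" for n
  proof (induction n)
    case (Suc n)
    have "(\<Sum>i<Suc n. vsup M \<mu> (A i)) \<le> vsup M \<mu> (\<Union>i<n. A i) + vsup M \<mu> (A n)"
      using Suc by (simp add: add_right_mono)
    also have "\<dots> \<le> vsup M \<mu> ((\<Union>i<n. A i) \<union> A n)"
    proof (rule vsup_superadditive[OF s])
      have "A i \<inter> A n = {}" if "i < n" for i using disjoint_family_onD[OF A(2), of i n] that by simp
      then show "(\<Union>i<n. A i) \<inter> A n = {}" by (auto simp: Int_UN_distrib2)
    qed (use A in auto)
    also have "(\<Union>i<n. A i) \<union> A n = (\<Union>i<Suc n. A i)" by (auto simp: less_Suc_eq)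
    finally show ?case .
  qed simp
  show "(\<Sum>i. vsup M \<mu> (A i)) \<le> vsup M \<mu> (\<Union>i. A i)"
    unfolding suminf_eq_SUP
  proof (rule SUP_least)
    fix n
    have "vsup M \<mu> (\<Union>i<n. A i) \<le> vsup M \<mu> (\<Union>i. A i)"
      using A U by (intro vsup_mono[OF s]) auto
    with fin[of n] show "(\<Sum>i<n. vsup M \<mu> (A i)) \<le> vsup M \<mu> (\<Union>i. A i)" by (rule order_trans)
  qed
qed

lemma emeasure_variation:
  assumes "signed_measure M \<mu>" "A \<in> sets M"
  shows "emeasure (variation M \<mu>) A = vsup M \<mu> A"
  by (rule emeasure_measure_of[OF variation_vsup])
    (use assms countably_additive_vsup[OF assms(1)] vsup_empty[OF assms(1)] sets.space_closed in \<open>auto simp: positive_def\<close>)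

lemma vsup_lin:
  "vsup M (\<lambda>A. a * \<mu> A + b * \<eta> A) A \<le> ennreal \<bar>a\<bar> * vsup M \<mu> A + ennreal \<bar>b\<bar> * vsup M \<eta> A"
  unfolding vsup_def[of M "\<lambda>A. a * \<mu> A + b * \<eta> A"]
proof (rule SUP_least)
  fix \<C> assume C: "\<C> \<in> vparts M A"
  have "(\<Sum>B\<in>\<C>. \<bar>a * \<mu> B + b * \<eta> B\<bar>) \<le> (\<Sum>B\<in>\<C>. \<bar>a\<bar> * \<bar>\<mu> B\<bar> + \<bar>b\<bar> * \<bar>\<eta> B\<bar>)"
    by (intro sum_mono) (metis abs_mult abs_triangle_ineq)
  also have "\<dots> = \<bar>a\<bar> * (\<Sum>B\<in>\<C>. \<bar>\<mu> B\<bar>) + \<bar>b\<bar> * (\<Sum>B\<in>\<C>. \<bar>\<eta> B\<bar>)"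
    by (simp add: sum.distrib sum_distrib_left)
  finally have "ennreal (\<Sum>B\<in>\<C>. \<bar>a * \<mu> B + b * \<eta> B\<bar>)
      \<le> ennreal (\<bar>a\<bar> * (\<Sum>B\<in>\<C>. \<bar>\<mu> B\<bar>) + \<bar>b\<bar> * (\<Sum>B\<in>\<C>. \<bar>\<eta> B\<bar>))" by (rule ennreal_leI)
  also have "\<dots> = ennreal \<bar>a\<bar> * ennreal (\<Sum>B\<in>\<C>. \<bar>\<mu> B\<bar>) + ennreal \<bar>b\<bar> * ennreal (\<Sum>B\<in>\<C>. \<bar>\<eta> B\<bar>)"
    by (simp add: ennreal_plus ennreal_mult sum_nonneg)
  also have "\<dots> \<le> ennreal \<bar>a\<bar> * vsup M \<mu> A + ennreal \<bar>b\<bar> * vsup M \<eta> A"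
    by (intro add_mono mult_left_mono vsup_upper C) auto
  finally show "ennreal (\<Sum>B\<in>\<C>. \<bar>a * \<mu> B + b * \<eta> B\<bar>) \<le> ennreal \<bar>a\<bar> * vsup M \<mu> A + ennreal \<bar>b\<bar> * vsup M \<eta> A" .
qed

lemma sets_to_measure [simp]: "sets (to_measure M \<mu>) = sets M"
  and space_to_measure [simp]: "space (to_measure M \<mu>) = space M"
  by (simp_all add: to_measure_def)

lemma emeasure_to_measure:
  assumes nn: "\<And>A. A \<in> sets M \<Longrightarrow> 0 \<le> \<mu> A" and e: "\<mu> {} = 0"
    and sums: "\<And>A::nat \<Rightarrow> 'p set. range A \<subseteq> sets M \<Longrightarrow> disjoint_family A \<Longrightarrow> (\<lambda>i. \<mu> (A i)) sums \<mu> (\<Union>i. A i)"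
    and A: "A \<in> sets M"
  shows "emeasure (to_measure M \<mu>) A = ennreal (\<mu> A)"
proof (rule emeasure_measure_of[OF to_measure_def])
  show "countably_additive (sets (to_measure M \<mu>)) (\<lambda>A. ennreal (\<mu> A))"
    unfolding countably_additive_def
  proof (intro allI impI)
    fix A :: "nat \<Rightarrow> 'p set" assume *: "range A \<subseteq> sets (to_measure M \<mu>)" "disjoint_family A"
    then have "0 \<le> \<mu> (A i)" for i by (intro nn) auto
    with sums[of A] * show "(\<Sum>i. ennreal (\<mu> (A i))) = ennreal (\<mu> (\<Union>i. A i))"
      by (intro suminf_ennreal_eq) auto
  qed
qed (use e A sets.space_closed in \<open>auto simp: positive_def\<close>)

section \<open>Jordan parts and integrals against a signed measure\<close>

locale finite_signed =
  fixes M :: "'p measure" and \<mu> :: "'p set \<Rightarrow> real"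
  assumes signed: "signed_measure M \<mu>" and finite_var: "finite_measure (variation M \<mu>)"
begin

abbreviation "V \<equiv> variation M \<mu>"
abbreviation "P \<equiv> pos_var M \<mu>"
abbreviation "N \<equiv> neg_var M \<mu>"

sublocale V: finite_measure V by (rule finite_var)

lemma abs_le: "A \<in> sets M \<Longrightarrow> \<bar>\<mu> A\<bar> \<le> measure V A"
  using abs_le_vsup[of A M \<mu>] emeasure_variation[OF signed, of A]
  by (simp add: V.emeasure_eq_measure[symmetric] flip: ennreal_le_iff[OF measure_nonneg])

lemma sets_pn [simp]: "sets P = sets M" "sets N = sets M" "space P = space M" "space N = space M"
  by (simp_all add: pos_var_def neg_var_def)

text \<open>The values \<open>c = 1\<close> and \<open>c = -1\<close> give sigma-additivity of the
  set functions behind the positive and the negative part.\<close>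

lemma V_sums:
  assumes "range A \<subseteq> sets M" "disjoint_family A"
  shows "(\<lambda>i. (measure V (A i) + c * \<mu> (A i)) / 2) sums ((measure V (\<Union>i. A i) + c * \<mu> (\<Union>i. A i)) / 2)"
  using assms by (intro sums_divide sums_add sums_mult V.finite_measure_UNION signed_measure_sums[OF signed]) auto

lemma emeasure_pn:
  assumes "A \<in> sets M"
  shows "emeasure P A = ennreal ((measure V A + \<mu> A) / 2)" "emeasure N A = ennreal ((measure V A - \<mu> A) / 2)"
proof -
  show "emeasure P A = ennreal ((measure V A + \<mu> A) / 2)"
    unfolding pos_var_def
    by (rule emeasure_to_measure[OF _ _ _ assms])
      (use abs_le V_sums[of _ 1] signed_measure_empty[OF signed] in \<open>force+\<close>)
  show "emeasure N A = ennreal ((measure V A - \<mu> A) / 2)"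
    unfolding neg_var_def
    by (rule emeasure_to_measure[OF _ _ _ assms])
      (use abs_le V_sums[of _ "-1"] signed_measure_empty[OF signed] in \<open>force+\<close>)
qed

lemma measure_pn:
  assumes "A \<in> sets M"
  shows "measure P A = (measure V A + \<mu> A) / 2" "measure N A = (measure V A - \<mu> A) / 2"
  using abs_le[OF assms] emeasure_pn[OF assms] by (auto simp: measure_def)

lemma finite_pn: "finite_measure P" "finite_measure N"
  by (auto intro!: finite_measureI simp: emeasure_pn)

lemma pn_le:
  assumes "A \<in> sets M"
  shows "emeasure P A \<le> emeasure V A" "emeasure N A \<le> emeasure V A"
  using abs_le[OF assms] emeasure_pn[OF assms] by (auto simp: V.emeasure_eq_measure intro!: ennreal_leI)

lemma integrable_pn:
  assumes "integrable V f"
  shows "integrable P f" "integrable N (f::'p \<Rightarrow> real)"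
proof -
  have meas: "f \<in> borel_measurable M" using assms measurable_cong_sets[OF sets_variation refl] by blast
  have "(\<integral>\<^sup>+x. ennreal (norm (f x)) \<partial>P) \<le> 1 * (\<Sum>i\<in>{()}. \<integral>\<^sup>+x. ennreal (norm (f x)) \<partial>V)"
    by (rule nn_integral_le_sum) (auto simp: pn_le)
  moreover have "(\<integral>\<^sup>+x. ennreal (norm (f x)) \<partial>N) \<le> 1 * (\<Sum>i\<in>{()}. \<integral>\<^sup>+x. ennreal (norm (f x)) \<partial>V)"
    by (rule nn_integral_le_sum) (auto simp: pn_le)
  moreover have "f \<in> borel_measurable P" "f \<in> borel_measurable N"
    using meas by (auto simp: measurable_cong_sets[OF sets_pn(1) refl] measurable_cong_sets[OF sets_pn(2) refl])
  ultimately show "integrable P f" "integrable N f"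
    using assms by (auto simp: integrable_iff_bounded)
qed

lemma sint_add:
  "integrable V f \<Longrightarrow> integrable V g \<Longrightarrow> sint M \<mu> (\<lambda>x. f x + g x) = sint M \<mu> f + sint M \<mu> g"
  by (simp add: sint_def integrable_pn)

lemma sint_scale: "sint M \<mu> (\<lambda>x. c * f x) = c * sint M \<mu> f"
  by (simp add: sint_def algebra_simps)

lemma sint_sum:
  "finite I \<Longrightarrow> (\<And>i. i \<in> I \<Longrightarrow> integrable V (f i)) \<Longrightarrow> sint M \<mu> (\<lambda>x. \<Sum>i\<in>I. f i x) = (\<Sum>i\<in>I. sint M \<mu> (f i))"
  by (induction I rule: finite_induct) (auto simp: sint_add, simp add: sint_def)

lemma abs_sint_le:
  assumes "integrable V f"
  shows "\<bar>sint M \<mu> f\<bar> \<le> (\<integral>x. \<bar>f x\<bar> \<partial>V)"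
proof -
  have num: "{0..2::nat} = {0,1,2}" by auto
  \<comment> \<open>The coefficients 1, 1, -1 on the list \<open>P\<close>, \<open>N\<close>,
    \<open>V\<close> say that the two Jordan parts add up to the variation.\<close>
  have "(\<Sum>i\<in>{0..2::nat}. [1, 1, -1::real] ! i * (\<integral>x. \<bar>f x\<bar> \<partial>([P, N, V] ! i))) = 0"
  proof (rule integral_combination_zero[where M = M])
    fix i :: nat assume "i \<in> {0..2}"
    then have "i = 0 \<or> i = 1 \<or> i = 2" by auto
    then show "sets ([P, N, V] ! i) = sets M" "finite_measure ([P, N, V] ! i)"
      "integrable ([P, N, V] ! i) (\<lambda>x. \<bar>f x\<bar>)"
      using finite_pn finite_var integrable_pn[OF assms] assms by auto
  next
    fix A assume "A \<in> sets M"
    then show "(\<Sum>i\<in>{0..2::nat}. [1, 1, -1::real] ! i * measure ([P, N, V] ! i) A) = 0"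
      unfolding num by (simp add: measure_pn field_simps)
  qed simp
  then have "(\<integral>x. \<bar>f x\<bar> \<partial>P) + (\<integral>x. \<bar>f x\<bar> \<partial>N) = (\<integral>x. \<bar>f x\<bar> \<partial>V)" unfolding num by simp
  moreover have "\<bar>\<integral>x. f x \<partial>P\<bar> \<le> (\<integral>x. \<bar>f x\<bar> \<partial>P)" "\<bar>\<integral>x. f x \<partial>N\<bar> \<le> (\<integral>x. \<bar>f x\<bar> \<partial>N)" by (rule integral_abs_bound)+
  ultimately show ?thesis unfolding sint_def by linarith
qed

lemma sint_cong: "(\<And>x. x \<in> space M \<Longrightarrow> f x = g x) \<Longrightarrow> sint M \<mu> f = sint M \<mu> g"
  unfolding sint_def
  by (rule arg_cong2[of _ _ _ _ "(-)"]; rule Bochner_Integration.integral_cong) auto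

end

text \<open>The Jordan parts of a combination are in general not combinations of Jordan parts,
  because of cancellation. The relation among all six parts with coefficients 1, -1, -a, a, -b, b
  nevertheless holds on every measurable set.\<close>

lemma sint_lin_measure:
  assumes "finite_signed M \<mu>" "finite_signed M \<eta>" "finite_signed M (\<lambda>A. a * \<mu> A + b * \<eta> A)"
    and f: "integrable (variation M \<mu>) f" "integrable (variation M \<eta>) f" "integrable (variation M (\<lambda>A. a * \<mu> A + b * \<eta> A)) f"
  shows "sint M (\<lambda>A. a * \<mu> A + b * \<eta> A) f = a * sint M \<mu> f + b * sint M \<eta> f"
proof -
  interpret u: finite_signed M \<mu> by fact
  interpret e: finite_signed M \<eta> by fact
  interpret s: finite_signed M "\<lambda>A. a * \<mu> A + b * \<eta> A" by fact
  have less6: "i \<in> {0..5::nat} \<Longrightarrow> i = 0 \<or> i = 1 \<or> i = 2 \<or> i = 3 \<or> i = 4 \<or> i = 5" for i by auto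
  have num: "{0..5::nat} = {0,1,2,3,4,5}" by auto
  have "(\<Sum>i\<in>{0..5::nat}. [1, -1, -a, a, -b, b] ! i * (\<integral>x. f x \<partial>([s.P, s.N, u.P, u.N, e.P, e.N] ! i))) = 0"
  proof (rule integral_combination_zero[where M = M])
    fix i :: nat assume "i \<in> {0..5}"
    from less6[OF this] show "sets ([s.P, s.N, u.P, u.N, e.P, e.N] ! i) = sets M"
      "finite_measure ([s.P, s.N, u.P, u.N, e.P, e.N] ! i)"
      "integrable ([s.P, s.N, u.P, u.N, e.P, e.N] ! i) f"
      using u.finite_pn e.finite_pn s.finite_pn u.integrable_pn[OF f(1)] e.integrable_pn[OF f(2)] s.integrable_pn[OF f(3)]
      by auto
  next
    fix A assume "A \<in> sets M"
    then show "(\<Sum>i\<in>{0..5::nat}. [1, -1, -a, a, -b, b] ! i * measure ([s.P, s.N, u.P, u.N, e.P, e.N] ! i) A) = 0"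
      unfolding num by (simp add: u.measure_pn e.measure_pn s.measure_pn field_simps)
  qed simp
  then show ?thesis unfolding num by (simp add: sint_def algebra_simps)
qed

lemma radon_signedD:
  assumes "\<mu> \<in> radon_signed T"
  shows "finite_signed (borel_top T) \<mu>" "finite_radon T (variation (borel_top T) \<mu>)"
  using assms unfolding radon_signed_def finite_signed_def
  by (auto intro: radon_measure_imp_finite_radon)

lemma finite_radon_pn:
  assumes T: "Hausdorff_space T" and \<mu>: "\<mu> \<in> radon_signed T"
  shows "finite_radon T (pos_var (borel_top T) \<mu>)" "finite_radon T (neg_var (borel_top T) \<mu>)"
proof -
  interpret finite_signed "borel_top T" \<mu> by (rule radon_signedD[OF \<mu>])
  show "finite_radon T P"
    by (rule finite_radon_dominated[OF T, of "{()}" "\<lambda>_. V" _ 1]) (auto simp: radon_signedD[OF \<mu>] pn_le)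
  show "finite_radon T N"
    by (rule finite_radon_dominated[OF T, of "{()}" "\<lambda>_. V" _ 1]) (auto simp: radon_signedD[OF \<mu>] pn_le)
qed

lemma radon_signed_lin:
  assumes T: "Hausdorff_space T" and \<mu>: "\<mu> \<in> radon_signed T" "\<eta> \<in> radon_signed T"
  shows "(\<lambda>A. a * \<mu> A + b * \<eta> A) \<in> radon_signed T"
    and "A \<in> sets (borel_top T) \<Longrightarrow> emeasure (variation (borel_top T) (\<lambda>A. a * \<mu> A + b * \<eta> A)) A
      \<le> ennreal \<bar>a\<bar> * emeasure (variation (borel_top T) \<mu>) A + ennreal \<bar>b\<bar> * emeasure (variation (borel_top T) \<eta>) A"
proof -
  let ?M = "borel_top T" let ?s = "\<lambda>A. a * \<mu> A + b * \<eta> A"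
  have sg: "signed_measure ?M \<mu>" "signed_measure ?M \<eta>"
    using \<mu> by (auto simp: radon_signed_def)
  have ss: "signed_measure ?M ?s" by (rule signed_measure_lin[OF sg])
  have le: "emeasure (variation ?M ?s) A \<le> ennreal \<bar>a\<bar> * emeasure (variation ?M \<mu>) A + ennreal \<bar>b\<bar> * emeasure (variation ?M \<eta>) A"
    if "A \<in> sets ?M" for A
    using vsup_lin[of ?M a \<mu> b \<eta> A] that by (simp add: emeasure_variation sg ss)
  then show "A \<in> sets ?M \<Longrightarrow> emeasure (variation ?M ?s) A
      \<le> ennreal \<bar>a\<bar> * emeasure (variation ?M \<mu>) A + ennreal \<bar>b\<bar> * emeasure (variation ?M \<eta>) A" .
  have "finite_radon T (variation ?M ?s)"
  proof (rule finite_radon_dominated[OF T, of "UNIV::bool set" "\<lambda>i. variation ?M (if i then \<mu> else \<eta>)" _ "\<bar>a\<bar> + \<bar>b\<bar>"])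
    fix A assume A: "A \<in> sets (variation ?M ?s)"
    have "emeasure (variation ?M ?s) A \<le> ennreal \<bar>a\<bar> * emeasure (variation ?M \<mu>) A + ennreal \<bar>b\<bar> * emeasure (variation ?M \<eta>) A"
      using le A by simp
    also have "\<dots> \<le> ennreal (\<bar>a\<bar> + \<bar>b\<bar>) * emeasure (variation ?M \<mu>) A + ennreal (\<bar>a\<bar> + \<bar>b\<bar>) * emeasure (variation ?M \<eta>) A"
      by (intro add_mono mult_right_mono ennreal_leI) auto
    also have "\<dots> = ennreal (\<bar>a\<bar> + \<bar>b\<bar>) * (\<Sum>i\<in>UNIV. emeasure (variation ?M (if i then \<mu> else \<eta>)) A)"
      by (simp add: UNIV_bool distrib_left add.commute)
    finally show "emeasure (variation ?M ?s) A \<le> ennreal (\<bar>a\<bar> + \<bar>b\<bar>) * (\<Sum>i\<in>UNIV. emeasure (variation ?M (if i then \<mu> else \<eta>)) A)" .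
  qed (use radon_signedD(2)[OF \<mu>(1)] radon_signedD(2)[OF \<mu>(2)] in auto)
  then show "?s \<in> radon_signed T"
    using ss finite_radonD(1) finite_radon_imp_radon_measure[OF T] by (auto simp: radon_signed_def)
qed

text \<open>For nonnegative set functions every partition sum collapses to the value on the union.
  This identifies the two ways in which a probability enters: through its variation in
  \<open>FIP\<close> and through \<open>to_measure\<close> in
  \<open>marginally_delimited\<close>.\<close>

lemma variation_nonneg:
  assumes s: "signed_measure M P" and nn: "\<And>A. 0 \<le> P A"
  shows "variation M P = to_measure M P"
proof (rule measure_eqI)
  fix A assume "A \<in> sets (variation M P)"
  then have A: "A \<in> sets M" by simp
  have add: "P (B \<union> C) = P B + P C" if BC: "B \<in> sets M" "C \<in> sets M" "B \<inter> C = {}" for B C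
  proof -
    \<comment> \<open>Finite additivity is countable additivity for the sequence \<open>B\<close>,
      \<open>C\<close>, \<open>{}\<close>, \<open>{}\<close>, and so on.\<close>
    have "(\<lambda>i. P (binaryset B C i)) sums P (\<Union>i. binaryset B C i)"
      using BC by (intro signed_measure_sums[OF s]) (auto simp: range_binaryset_eq disjoint_family_on_def binaryset_def)
    moreover have "(\<lambda>i. P (binaryset B C i)) sums (\<Sum>i<2. P (binaryset B C i))"
      by (rule sums_finite) (auto simp: binaryset_def signed_measure_empty[OF s])
    ultimately show ?thesis using sums_unique2 by (fastforce simp: UN_binaryset_eq binaryset_def numeral_2_eq_2)
  qed
  have part: "finite \<C> \<Longrightarrow> \<C> \<subseteq> sets M \<Longrightarrow> disjoint \<C> \<Longrightarrow> (\<Sum>B\<in>\<C>. P B) = P (\<Union>\<C>)" for \<C>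
  proof (induction \<C> rule: finite_induct)
    case (insert B \<C>)
    have "B \<inter> \<Union>\<C> = {}" using insert.prems insert.hyps by (auto simp: disjoint_def)
    then have "P (B \<union> \<Union>\<C>) = P B + P (\<Union>\<C>)" using insert by (intro add) auto
    then show ?case using insert by (simp add: disjoint_def)
  qed (simp add: signed_measure_empty[OF s])
  have "vsup M P A = ennreal (P A)"
  proof (rule antisym)
    show "vsup M P A \<le> ennreal (P A)"
      unfolding vsup_def by (rule SUP_least) (auto simp: vparts_def nn part)
    show "ennreal (P A) \<le> vsup M P A" using abs_le_vsup[OF A, of P] nn by simp
  qed
  moreover have "emeasure (to_measure M P) A = ennreal (P A)"
    using emeasure_to_measure[of M P A] nn signed_measure_empty[OF s] signed_measure_sums[OF s] A by blast
  ultimately show "emeasure (variation M P) A = emeasure (to_measure M P) A"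
    by (simp add: emeasure_variation[OF s A])
qed simp

section \<open>Reproducing kernel Hilbert spaces\<close>

lemma dint_superset:
  assumes "finite A" "{p. w p \<noteq> 0} \<subseteq> A"
  shows "dint w f = (\<Sum>p\<in>A. w p * f p)"
  unfolding dint_def by (rule sum.mono_neutral_left) (use assms in auto)

lemma dint_lin:
  assumes "w \<in> discrete_measures S" "v \<in> discrete_measures S"
  shows "dint (\<lambda>p. a * w p + b * v p) f = a * dint w f + b * dint v f"
proof -
  let ?A = "{p. w p \<noteq> 0} \<union> {p. v p \<noteq> 0}"
  have fin: "finite ?A" using assms by (auto simp: discrete_measures_def)
  have "dint (\<lambda>p. a * w p + b * v p) f = (\<Sum>p\<in>?A. (a * w p + b * v p) * f p)"
    by (rule dint_superset[OF fin]) auto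
  also have "\<dots> = a * (\<Sum>p\<in>?A. w p * f p) + b * (\<Sum>p\<in>?A. v p * f p)"
    by (simp add: sum_distrib_left sum.distrib[symmetric] algebra_simps)
  also have "\<dots> = a * dint w f + b * dint v f"
    by (subst (1 2) dint_superset[OF fin]) auto
  finally show ?thesis .
qed

lemma dint_lin_fun: "dint w (\<lambda>p. a * f p + b * g p) = a * dint w f + b * dint w g"
  unfolding dint_def by (simp add: sum_distrib_left sum.distrib[symmetric] algebra_simps)

lemma dint_cong:
  "w \<in> discrete_measures S \<Longrightarrow> (\<And>p. p \<in> S \<Longrightarrow> f p = g p) \<Longrightarrow> dint w f = dint w g"
  unfolding dint_def discrete_measures_def by (intro sum.cong) auto

lemma dint_swap: "dint v (\<lambda>q. dint w (\<lambda>p. F p q)) = dint w (\<lambda>p. dint v (\<lambda>q. F p q))"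
  unfolding dint_def by (simp add: sum_distrib_left mult.left_commute) (rule sum.swap)

lemma dint_dirac: "dint (dirac x) f = f x"
proof -
  have "{p. dirac x p \<noteq> 0} = {x}" by (auto simp: dirac_def)
  then show ?thesis by (simp add: dint_def dirac_def)
qed

lemma discrete_measures_lin:
  assumes "w \<in> discrete_measures S" "v \<in> discrete_measures S"
  shows "(\<lambda>p. a * w p + b * v p) \<in> discrete_measures S"
proof -
  have "{p. a * w p + b * v p \<noteq> 0} \<subseteq> {p. w p \<noteq> 0} \<union> {p. v p \<noteq> 0}" by auto
  then show ?thesis using assms unfolding discrete_measures_def
    by (auto intro: finite_subset)
qed

lemma discrete_measures_dirac: "x \<in> S \<Longrightarrow> dirac x \<in> discrete_measures S"
  by (auto simp: discrete_measures_def dirac_def)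

lemma discrete_measures_zero: "(\<lambda>_. 0) \<in> discrete_measures S"
  by (auto simp: discrete_measures_def)

lemma dint_zero: "dint (\<lambda>_. 0) f = 0"
  by (simp add: dint_def)

lemma cSUP_add_le:
  fixes f g :: "'b \<Rightarrow> real"
  assumes "A \<noteq> {}" and le: "\<And>a b. a \<in> A \<Longrightarrow> b \<in> A \<Longrightarrow> f a + g b \<le> c"
  shows "(SUP a\<in>A. f a) + (SUP b\<in>A. g b) \<le> c"
proof -
  have "(SUP a\<in>A. f a) \<le> c - g b" if "b \<in> A" for b
    using assms(1) le[OF _ that] by (intro cSUP_least) (auto simp: algebra_simps)
  then have "(SUP b\<in>A. g b) \<le> c - (SUP a\<in>A. f a)"
    using assms(1) by (intro cSUP_least) (auto simp: algebra_simps)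
  then show ?thesis by simp
qed

text \<open>The deviation \<open>e\<close> from linearity is additive and vanishes at the integers,
  so reduction to the fractional part bounds it everywhere. A nonzero value \<open>e t\<close> would
  give the unbounded values \<open>m * e t\<close>. This supplies real homogeneity for a form
  constructed only from a parallelogram law.\<close>

lemma additive_bounded_imp_linear:
  fixes d :: "real \<Rightarrow> real"
  assumes add: "\<And>s t. d (s + t) = d s + d t" and bd: "\<And>t. 0 \<le> t \<Longrightarrow> t \<le> 1 \<Longrightarrow> \<bar>d t\<bar> \<le> B"
  shows "d t = t * d 1"
proof -
  define e where "e t = d t - t * d 1" for t
  have eadd: "e (s + t) = e s + e t" for s t by (simp add: e_def add algebra_simps)
  have e0: "e 0 = 0" using eadd[of 0 0] by simp
  have enat: "e (real m * t) = real m * e t" for m t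
  proof (induction m)
    case (Suc m)
    have "e (real (Suc m) * t) = e (real m * t + t)" by (simp add: algebra_simps)
    then show ?case using Suc by (simp add: eadd algebra_simps)
  qed (simp add: e0)
  have e1: "e 1 = 0" by (simp add: e_def)
  have eneg: "e (- t) = - e t" for t using eadd[of t "-t"] e0 by simp
  have eint: "e (of_int z) = 0" for z
  proof (cases "z \<ge> 0")
    case True
    then show ?thesis using enat[of "nat z" 1] e1 by simp
  next
    case False
    then show ?thesis using enat[of "nat (-z)" 1] e1 eneg[of "of_int (-z)"] by simp
  qed
  have ebd: "\<bar>e t\<bar> \<le> B + \<bar>d 1\<bar>" for t
  proof -
    have fr: "0 \<le> frac t" "frac t \<le> 1" by (simp_all add: frac_lt_1 less_imp_le)
    have "e t = e (of_int \<lfloor>t\<rfloor> + frac t)" by (simp add: frac_def)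
    also have "\<dots> = e (frac t)" by (simp add: eadd eint)
    finally have "\<bar>e t\<bar> \<le> \<bar>d (frac t)\<bar> + \<bar>frac t * d 1\<bar>" by (simp add: e_def)
    also have "\<dots> \<le> B + 1 * \<bar>d 1\<bar>"
      unfolding abs_mult using bd[OF fr] fr by (intro add_mono mult_right_mono) auto
    finally show ?thesis by simp
  qed
  have "e t = 0"
  proof (rule ccontr)
    assume "e t \<noteq> 0"
    then obtain m :: nat where m: "B + \<bar>d 1\<bar> < real m * \<bar>e t\<bar>"
      using reals_Archimedean3[of "\<bar>e t\<bar>"] by auto
    then show False using ebd[of "real m * t"] by (simp add: enat abs_mult)
  qed
  then show ?thesis by (simp add: e_def)
qed

section \<open>Cauchy-Schwarz and the metric of a semi-inner product\<close>

lemma semi_inner_right: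
  assumes "semi_inner_product_on V B" "f \<in> V" "g \<in> V" "h \<in> V"
  shows "B h (\<lambda>z. f z + g z) = B h f + B h g" "B h (\<lambda>z. c * f z) = c * B h f"
proof -
  have sub: "(\<lambda>z. f z + g z) \<in> V" "(\<lambda>z. c * f z) \<in> V"
    using assms unfolding semi_inner_product_on_def fun_subspace_def by auto
  have sym: "B u v = B v u" if "u \<in> V" "v \<in> V" for u v
    using assms(1) that unfolding semi_inner_product_on_def by auto
  show "B h (\<lambda>z. f z + g z) = B h f + B h g" "B h (\<lambda>z. c * f z) = c * B h f"
    using assms sub unfolding sym[OF assms(4) sub(1)] sym[OF assms(4) sub(2)] sym[OF assms(4,2)] sym[OF assms(4,3)]
    unfolding semi_inner_product_on_def by auto
qed

lemma semi_inner_quad: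
  assumes B: "semi_inner_product_on V B" and "f \<in> V" "g \<in> V"
  shows "B (\<lambda>z. a * f z + b * g z) (\<lambda>z. a * f z + b * g z)
     = a\<^sup>2 * B f f + 2 * a * b * B f g + b\<^sup>2 * B g g"
proof -
  have sc: "(\<lambda>z. c * h z) \<in> V" if "h \<in> V" for c h
    using B that unfolding semi_inner_product_on_def fun_subspace_def by blast
  have ad: "(\<lambda>z. a * f z + b * g z) \<in> V"
    using B sc assms(2,3) unfolding semi_inner_product_on_def fun_subspace_def by auto
  have addl: "B (\<lambda>z. u z + v z) h = B u h + B v h" if "u \<in> V" "v \<in> V" "h \<in> V" for u v h
    using B that unfolding semi_inner_product_on_def by blast
  have scl: "B (\<lambda>z. c * u z) h = c * B u h" if "u \<in> V" "h \<in> V" for u h c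
    using B that unfolding semi_inner_product_on_def by blast
  have "B g f = B f g" using B assms unfolding semi_inner_product_on_def by blast
  then show ?thesis
    using assms by (simp add: addl scl sc ad semi_inner_right[OF B] power2_eq_square algebra_simps)
qed

lemma semi_inner_CS:
  assumes B: "semi_inner_product_on V B" and "f \<in> V" "g \<in> V"
  shows "\<bar>B f g\<bar> \<le> sqrt (B f f) * sqrt (B g g)"
proof -
  have nn: "B h h \<ge> 0" if "h \<in> V" for h using B that unfolding semi_inner_product_on_def by blast
  have sub: "(\<lambda>z. a * f z + b * g z) \<in> V" for a b
    using B assms(2,3) unfolding semi_inner_product_on_def fun_subspace_def by auto
  have *: "0 \<le> a\<^sup>2 * B f f + 2 * a * b * B f g + b\<^sup>2 * B g g" for a b
    using nn[OF sub[of a b]] semi_inner_quad[OF assms, of a b] by simp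
  have "(B f g)\<^sup>2 \<le> B f f * B g g"
  proof (cases "B g g = 0")
    case True
    have "B f g = 0"
    proof (rule ccontr)
      assume nz: "B f g \<noteq> 0"
      \<comment> \<open>The coefficient of \<open>g\<close> is chosen so that the quadratic form
        takes the value -1.\<close>
      have "0 \<le> B f f + 2 * (- (B f f + 1) / (2 * B f g)) * B f g"
        using *[of 1 "- (B f f + 1) / (2 * B f g)"] True by simp
      then show False using nz by (simp add: field_simps)
    qed
    then show ?thesis using True by simp
  next
    case False
    then have p: "B g g > 0" using nn[OF assms(3)] by simp
    have "0 \<le> B g g * (B g g * B f f - (B f g)\<^sup>2)"
      using *[of "B g g" "- B f g"] by (simp add: power2_eq_square algebra_simps)
    then show ?thesis using p by (simp add: zero_le_mult_iff mult.commute)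
  qed
  then show ?thesis by (simp add: real_sqrt_mult[symmetric] real_le_rsqrt)
qed

lemma semi_inner_triangle:
  assumes B: "semi_inner_product_on V B" and "f \<in> V" "g \<in> V"
  shows "sqrt (B (\<lambda>z. f z + g z) (\<lambda>z. f z + g z)) \<le> sqrt (B f f) + sqrt (B g g)"
proof -
  have nn: "B f f \<ge> 0" "B g g \<ge> 0" using B assms unfolding semi_inner_product_on_def by blast+
  have "B (\<lambda>z. f z + g z) (\<lambda>z. f z + g z) = B f f + 2 * B f g + B g g"
    using semi_inner_quad[OF assms, of 1 1] by simp
  also have "\<dots> \<le> B f f + 2 * (sqrt (B f f) * sqrt (B g g)) + B g g"
    using semi_inner_CS[OF assms] by simp
  also have "\<dots> = (sqrt (B f f) + sqrt (B g g))\<^sup>2"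
    using nn by (simp add: power2_sum)
  finally show ?thesis using nn by (intro real_le_lsqrt) auto
qed

lemma semi_inner_Metric_space:
  assumes B: "semi_inner_product_on H ip"
    and def: "\<And>f. f \<in> H \<Longrightarrow> ip f f = 0 \<Longrightarrow> f = (\<lambda>_. 0)"
    and off: "\<And>f g. f \<notin> H \<or> g \<notin> H \<Longrightarrow> ip f g = 0"
  shows "Metric_space H (\<lambda>f g. sqrt (ip (\<lambda>z. f z - g z) (\<lambda>z. f z - g z)))"
proof
  have sc: "(\<lambda>z. c * h z) \<in> H" if "h \<in> H" for c h
    using B that unfolding semi_inner_product_on_def fun_subspace_def by blast
  have df: "(\<lambda>z. f z - g z) \<in> H" if "f \<in> H" "g \<in> H" for f g
  proof -
    have "(\<lambda>z. f z + (-1) * g z) \<in> H"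
      using B that(1) sc[OF that(2), of "-1"] unfolding semi_inner_product_on_def fun_subspace_def by auto
    then show ?thesis by simp
  qed
  have zero: "ip (\<lambda>_. 0) (\<lambda>_. 0) = 0"
  proof -
    have "(\<lambda>_. 0) \<in> H" using B unfolding semi_inner_product_on_def fun_subspace_def by blast
    then show ?thesis using semi_inner_right(2)[OF B, of "\<lambda>_. 0" "\<lambda>_. 0" "\<lambda>_. 0" 0] by simp
  qed
  fix f g h :: "'a \<Rightarrow> real"
  \<comment> \<open>\<open>Metric_space\<close> asks for nonnegativity and symmetry at all
    functions, also outside \<open>H\<close>; there the convention that \<open>ip\<close> vanishes
    settles the matter.\<close>
  show "0 \<le> sqrt (ip (\<lambda>z. f z - g z) (\<lambda>z. f z - g z))"
    using B off[of "\<lambda>z. f z - g z"] unfolding semi_inner_product_on_def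
    by (cases "(\<lambda>z. f z - g z) \<in> H") auto
  have "ip (\<lambda>z. (-1) * u z) (\<lambda>z. (-1) * u z) = ip u u" for u
  proof (cases "u \<in> H")
    case True
    then show ?thesis using semi_inner_quad[OF B True True, of "-1" 0] by simp
  next
    case False
    then have "(\<lambda>z. (-1) * u z) \<notin> H" using sc[of "\<lambda>z. (-1) * u z" "-1"] by auto
    then show ?thesis using False off[of u u] off[of "\<lambda>z. (-1) * u z" "\<lambda>z. (-1) * u z"] by simp
  qed
  from this[of "\<lambda>z. f z - g z"]
  show "sqrt (ip (\<lambda>z. f z - g z) (\<lambda>z. f z - g z)) = sqrt (ip (\<lambda>z. g z - f z) (\<lambda>z. g z - f z))"
    by simp
  show "(sqrt (ip (\<lambda>z. f z - g z) (\<lambda>z. f z - g z)) = 0) = (f = g)" if "f \<in> H" "g \<in> H"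
  proof
    assume "sqrt (ip (\<lambda>z. f z - g z) (\<lambda>z. f z - g z)) = 0"
    then have "(\<lambda>z. f z - g z) = (\<lambda>_. 0)" using def[OF df[OF that]] by simp
    then show "f = g" by (metis eq_iff_diff_eq_0 ext)
  qed (simp add: zero)
  show "sqrt (ip (\<lambda>z. f z - h z) (\<lambda>z. f z - h z))
      \<le> sqrt (ip (\<lambda>z. f z - g z) (\<lambda>z. f z - g z)) + sqrt (ip (\<lambda>z. g z - h z) (\<lambda>z. g z - h z))"
    if "f \<in> H" "g \<in> H" "h \<in> H"
    using semi_inner_triangle[OF B df[OF that(1,2)] df[OF that(2,3)]] by simp
qed

section \<open>Construction and uniqueness of the Hilbert space of a kernel\<close>

locale pd_kernel =
  fixes S :: "'p set" and K :: "'p \<Rightarrow> 'p \<Rightarrow> real"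
  assumes sym: "p \<in> S \<Longrightarrow> q \<in> S \<Longrightarrow> K p q = K q p"
    and pos: "w \<in> discrete_measures S \<Longrightarrow> dint w (\<lambda>q. dint w (\<lambda>p. K p q)) \<ge> 0"
begin

definition bil where "bil w v = dint v (\<lambda>q. dint w (\<lambda>p. K p q))"
definition comb where "comb w z = (if z \<in> S then dint w (\<lambda>p. K p z) else 0)"
text \<open>In the Hilbert space to be built this is the squared norm of \<open>f\<close> minus the
  squared norm of \<open>f - comb w\<close>. Its supremum over \<open>w\<close> must be the squared
  norm of \<open>f\<close>, since the combinations \<open>comb w\<close> are dense. It is defined
  for any function \<open>f\<close>, which yields a description of the space without a
  completion.\<close>

definition gain where "gain f w = 2 * dint w f - bil w w"
definition carr where
  "carr = {f. (\<forall>z. z \<notin> S \<longrightarrow> f z = 0) \<and> bdd_above (gain f ` discrete_measures S)}"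
definition nsq where "nsq f = (SUP w\<in>discrete_measures S. gain f w)"
definition iprod where
  "iprod f g = (if f \<in> carr \<and> g \<in> carr then (nsq (\<lambda>z. f z + g z) - nsq (\<lambda>z. f z - g z)) / 4 else 0)"

abbreviation "DS \<equiv> discrete_measures S"

lemma DS_ne: "DS \<noteq> {}" using discrete_measures_zero by blast

lemma bil_sym: "w \<in> DS \<Longrightarrow> v \<in> DS \<Longrightarrow> bil w v = bil v w"
  unfolding bil_def
proof -
  assume w: "w \<in> DS" and v: "v \<in> DS"
  have "dint v (\<lambda>q. dint w (\<lambda>p. K p q)) = dint v (\<lambda>q. dint w (\<lambda>p. K q p))"
    by (rule dint_cong[OF v], rule dint_cong[OF w]) (simp add: sym)
  then show "dint v (\<lambda>q. dint w (\<lambda>p. K p q)) = dint w (\<lambda>q. dint v (\<lambda>p. K p q))"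
    by (simp add: dint_swap[of w v])
qed

lemma bil_lin_left:
  "w \<in> DS \<Longrightarrow> v \<in> DS \<Longrightarrow> bil (\<lambda>p. a * w p + b * v p) u = a * bil w u + b * bil v u"
  unfolding bil_def by (simp only: dint_lin dint_lin_fun)

lemma bil_lin_right:
  "w \<in> DS \<Longrightarrow> v \<in> DS \<Longrightarrow> bil u (\<lambda>p. a * w p + b * v p) = a * bil u w + b * bil u v"
  unfolding bil_def by (simp only: dint_lin)

lemma bil_pos: "w \<in> DS \<Longrightarrow> bil w w \<ge> 0"
  unfolding bil_def by (rule pos)

lemma semi_inner_bil: "semi_inner_product_on DS bil"
  unfolding semi_inner_product_on_def fun_subspace_def
proof (intro conjI ballI allI)
  fix f g h c assume fgh: "f \<in> DS" "g \<in> DS"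
  show "(\<lambda>z. f z + g z) \<in> DS" using discrete_measures_lin[OF fgh, of 1 1] by simp
  show "bil (\<lambda>z. f z + g z) h = bil f h + bil g h" using bil_lin_left[OF fgh, of 1 1] by simp
next
  fix f h c assume f: "f \<in> DS"
  show "(\<lambda>z. c * f z) \<in> DS" using discrete_measures_lin[OF f f, of c 0] by simp
  show "bil (\<lambda>z. c * f z) h = c * bil f h" using bil_lin_left[OF f f, of c 0] by simp
qed (auto intro: bil_sym bil_pos discrete_measures_zero)

lemma bil_dirac: "bil (dirac x) (dirac y) = K x y"
  by (simp add: bil_def dint_dirac)

lemma bil_dirac_right: "y \<in> S \<Longrightarrow> bil w (dirac y) = comb w y"
  by (simp add: bil_def dint_dirac comb_def)

lemma bil_comb: "v \<in> DS \<Longrightarrow> bil w v = dint v (comb w)"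
  unfolding bil_def by (rule dint_cong) (auto simp: comb_def)

lemma K_diag_nonneg: "x \<in> S \<Longrightarrow> K x x \<ge> 0"
  using bil_pos[OF discrete_measures_dirac] by (simp add: bil_dirac)

lemma bil_quad:
  assumes "w \<in> DS" "v \<in> DS"
  shows "bil (\<lambda>p. a * w p + b * v p) (\<lambda>p. a * w p + b * v p)
     = a\<^sup>2 * bil w w + 2 * a * b * bil w v + b\<^sup>2 * bil v v"
  by (rule semi_inner_quad[OF semi_inner_bil assms])

lemmas bil_CS = semi_inner_CS[OF semi_inner_bil]

lemma kernel_CS: "x \<in> S \<Longrightarrow> y \<in> S \<Longrightarrow> \<bar>K x y\<bar> \<le> sqrt (K x x) * sqrt (K y y)"
  using bil_CS[OF discrete_measures_dirac discrete_measures_dirac, of x y]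
  by (simp add: bil_dirac)

lemma comb_bound:
  assumes "w \<in> DS" "x \<in> S"
  shows "\<bar>comb w x\<bar> \<le> sqrt (bil w w) * sqrt (K x x)"
  using bil_CS[OF assms(1) discrete_measures_dirac[OF assms(2)]] assms
  by (simp add: bil_dirac bil_dirac_right)

lemma gain_le_nsq: "f \<in> carr \<Longrightarrow> w \<in> DS \<Longrightarrow> gain f w \<le> nsq f"
  unfolding nsq_def carr_def by (intro cSUP_upper) auto

lemma nsq_leI: "(\<And>w. w \<in> DS \<Longrightarrow> gain f w \<le> C) \<Longrightarrow> nsq f \<le> C"
  unfolding nsq_def using DS_ne by (intro cSUP_least) auto

lemma carrI: "(\<And>z. z \<notin> S \<Longrightarrow> f z = 0) \<Longrightarrow> (\<And>w. w \<in> DS \<Longrightarrow> gain f w \<le> C) \<Longrightarrow> f \<in> carr"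
  unfolding carr_def by (auto intro!: bdd_aboveI2)

lemma carr_off: "f \<in> carr \<Longrightarrow> z \<notin> S \<Longrightarrow> f z = 0"
  unfolding carr_def by auto

lemma nsq_nonneg: "f \<in> carr \<Longrightarrow> 0 \<le> nsq f"
  using gain_le_nsq[OF _ discrete_measures_zero[of S], of f] by (simp add: gain_def dint_zero bil_def)

lemma gain_scale:
  assumes "w \<in> DS" "c \<noteq> 0"
  shows "gain (\<lambda>z. c * f z) w = c\<^sup>2 * gain f (\<lambda>p. (1/c) * w p + 0 * w p)"
proof -
  have "dint w (\<lambda>z. c * f z) = c * dint w f" using dint_lin_fun[of w c f 0 f] by simp
  moreover have "dint (\<lambda>p. (1/c) * w p + 0 * w p) f = (1/c) * dint w f + 0 * dint w f"
    by (rule dint_lin[OF assms(1) assms(1)])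
  moreover have "bil (\<lambda>p. (1/c) * w p + 0 * w p) (\<lambda>p. (1/c) * w p + 0 * w p) = (1/c)\<^sup>2 * bil w w"
    by (subst bil_quad[OF assms(1) assms(1)]) simp
  ultimately show ?thesis using assms(2) by (simp add: gain_def power2_eq_square algebra_simps)
qed

lemma carr_scale: "f \<in> carr \<Longrightarrow> (\<lambda>z. c * f z) \<in> carr"
proof (cases "c = 0")
  case True
  have "(\<lambda>z. 0) \<in> carr"
  proof (rule carrI[where C = 0])
    fix w assume "w \<in> DS"
    then show "gain (\<lambda>z. 0) w \<le> 0" using bil_pos[of w] by (simp add: gain_def dint_def)
  qed simp
  then show ?thesis using True by simp
next
  case False
  assume f: "f \<in> carr"
  show ?thesis
  proof (rule carrI[where C = "c\<^sup>2 * nsq f"])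
    fix w assume w: "w \<in> DS"
    show "gain (\<lambda>z. c * f z) w \<le> c\<^sup>2 * nsq f"
      unfolding gain_scale[OF w False]
      by (intro mult_left_mono gain_le_nsq f discrete_measures_lin w) simp
  qed (use carr_off[OF f] in auto)
qed

lemma nsq_scale_le: "f \<in> carr \<Longrightarrow> c \<noteq> 0 \<Longrightarrow> nsq (\<lambda>z. c * f z) \<le> c\<^sup>2 * nsq f"
  by (rule nsq_leI, subst gain_scale, assumption+, intro mult_left_mono gain_le_nsq discrete_measures_lin) auto

lemma gain_add:
  assumes "w \<in> DS" "v \<in> DS"
  shows "gain (\<lambda>z. f z + g z) (\<lambda>p. 1 * w p + 1 * v p) + gain (\<lambda>z. f z - g z) (\<lambda>p. 1 * w p + (-1) * v p)
    = 2 * gain f w + 2 * gain g v"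
proof -
  have "dint u (\<lambda>z. f z + g z) = dint u f + dint u g" for u using dint_lin_fun[of u 1 f 1 g] by simp
  moreover have "dint u (\<lambda>z. f z - g z) = dint u f - dint u g" for u
    using dint_lin_fun[of u 1 f "-1" g] by simp
  ultimately show ?thesis
    unfolding gain_def bil_quad[OF assms] dint_lin[OF assms] by (simp only:) (simp add: algebra_simps)
qed

lemma gain_add':
  assumes "a \<in> DS" "b \<in> DS"
  shows "gain (\<lambda>z. f z + g z) a + gain (\<lambda>z. f z - g z) b
    = 2 * gain f (\<lambda>p. (1/2) * a p + (1/2) * b p) + 2 * gain g (\<lambda>p. (1/2) * a p + (-1/2) * b p)"
  using gain_add[OF discrete_measures_lin[OF assms, of "1/2" "1/2"]
      discrete_measures_lin[OF assms, of "1/2" "-1/2"], of f g]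
  by (simp add: field_simps)

lemma carr_add:
  assumes "f \<in> carr" "g \<in> carr"
  shows "(\<lambda>z. f z + g z) \<in> carr"
proof (rule carrI[where C = "2 * nsq f + 2 * nsq g"])
  fix w assume w: "w \<in> DS"
  \<comment> \<open>The second measure is zero and has gain 0, so the parallelogram estimate bounds
    the gain of the sum alone, before the difference is known to lie in \<open>carr\<close>.\<close>
  have "gain (\<lambda>z. f z + g z) w + gain (\<lambda>z. f z - g z) (\<lambda>_. 0) \<le> 2 * nsq f + 2 * nsq g"
    unfolding gain_add'[OF w discrete_measures_zero]
    by (intro add_mono mult_left_mono gain_le_nsq assms discrete_measures_lin w discrete_measures_zero) auto
  then show "gain (\<lambda>z. f z + g z) w \<le> 2 * nsq f + 2 * nsq g" by (simp add: gain_def bil_def dint_zero)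
qed (use carr_off[OF assms(1)] carr_off[OF assms(2)] in auto)

lemma carr_diff: "f \<in> carr \<Longrightarrow> g \<in> carr \<Longrightarrow> (\<lambda>z. f z - g z) \<in> carr"
  using carr_add[of f "\<lambda>z. (-1) * g z"] carr_scale[of g "-1"] by simp

text \<open>Both suprema on the left range independently over \<open>(w + v, w - v)\<close>, so the parallelogram
  law is inherited from the quadratic form \<open>bil\<close>.\<close>

lemma parallelogram:
  assumes "f \<in> carr" "g \<in> carr"
  shows "nsq (\<lambda>z. f z + g z) + nsq (\<lambda>z. f z - g z) = 2 * nsq f + 2 * nsq g"
proof (rule antisym)
  show "nsq (\<lambda>z. f z + g z) + nsq (\<lambda>z. f z - g z) \<le> 2 * nsq f + 2 * nsq g"
    unfolding nsq_def[of "\<lambda>z. f z + g z"] nsq_def[of "\<lambda>z. f z - g z"]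
  proof (rule cSUP_add_le[OF DS_ne])
    fix a b assume ab: "a \<in> DS" "b \<in> DS"
    show "gain (\<lambda>z. f z + g z) a + gain (\<lambda>z. f z - g z) b \<le> 2 * nsq f + 2 * nsq g"
      unfolding gain_add'[OF ab]
      by (intro add_mono mult_left_mono gain_le_nsq assms discrete_measures_lin ab) auto
  qed
  have "nsq f + nsq g \<le> (nsq (\<lambda>z. f z + g z) + nsq (\<lambda>z. f z - g z)) / 2"
    unfolding nsq_def[of f] nsq_def[of g]
  proof (rule cSUP_add_le[OF DS_ne])
    fix a b assume ab: "a \<in> DS" "b \<in> DS"
    have "2 * gain f a + 2 * gain g b \<le> nsq (\<lambda>z. f z + g z) + nsq (\<lambda>z. f z - g z)"
      unfolding gain_add[OF ab, symmetric]
      by (intro add_mono gain_le_nsq carr_add carr_diff assms discrete_measures_lin ab)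
    then show "gain f a + gain g b \<le> (nsq (\<lambda>z. f z + g z) + nsq (\<lambda>z. f z - g z)) / 2" by simp
  qed
  then show "2 * nsq f + 2 * nsq g \<le> nsq (\<lambda>z. f z + g z) + nsq (\<lambda>z. f z - g z)" by simp
qed

lemma nsq_zero: "nsq (\<lambda>_. 0) = 0"
proof (rule antisym)
  show "nsq (\<lambda>_. 0) \<le> 0"
    by (rule nsq_leI) (use bil_pos in \<open>auto simp: gain_def dint_def\<close>)
  have "(\<lambda>_. 0) \<in> carr"
    by (rule carrI[where C = 0]) (use bil_pos in \<open>auto simp: gain_def dint_def\<close>)
  then show "0 \<le> nsq (\<lambda>_. 0)" by (rule nsq_nonneg)
qed

lemma carr_zero: "(\<lambda>_. 0) \<in> carr"
  by (rule carrI[where C = 0]) (use bil_pos in \<open>auto simp: gain_def dint_def\<close>)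

lemma nsq_minus: "f \<in> carr \<Longrightarrow> nsq (\<lambda>z. - f z) = nsq f"
  using nsq_scale_le[of f "-1"] nsq_scale_le[of "\<lambda>z. - f z" "-1"] carr_scale[of f "-1"] by simp

lemma nsq_diff_sym:
  assumes "f \<in> carr" "g \<in> carr"
  shows "nsq (\<lambda>z. f z - g z) = nsq (\<lambda>z. g z - f z)"
  using nsq_minus[OF carr_diff[OF assms]] by simp

lemma iprod_sym: "iprod f g = iprod g f"
  unfolding iprod_def using nsq_diff_sym[of f g] by (auto simp: add.commute)

lemma nsq_double: "f \<in> carr \<Longrightarrow> nsq (\<lambda>z. 2 * f z) = 4 * nsq f"
  using parallelogram[of f f] by (simp add: nsq_zero)

lemma iprod_self: "f \<in> carr \<Longrightarrow> iprod f f = nsq f"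
  unfolding iprod_def using nsq_double[of f] by (simp add: nsq_zero)

text \<open>Jordan-von Neumann argument: the parallelogram laws for the pairs \<open>f + h\<close>,
  \<open>g\<close> and \<open>f - h\<close>, \<open>g\<close> are subtracted from each
  other.\<close>

lemma iprod_sum_diff:
  assumes "f \<in> carr" "g \<in> carr" "h \<in> carr"
  shows "iprod (\<lambda>z. f z + g z) h + iprod (\<lambda>z. f z - g z) h = 2 * iprod f h"
proof -
  have 1: "nsq (\<lambda>z. (f z + h z) + g z) + nsq (\<lambda>z. (f z + h z) - g z) = 2 * nsq (\<lambda>z. f z + h z) + 2 * nsq g"
    by (rule parallelogram) (intro carr_add assms)+
  have 2: "nsq (\<lambda>z. (f z - h z) + g z) + nsq (\<lambda>z. (f z - h z) - g z) = 2 * nsq (\<lambda>z. f z - h z) + 2 * nsq g"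
    by (rule parallelogram) (intro carr_diff assms)+
  have e: "(\<lambda>z. f z + h z + g z) = (\<lambda>z. f z + g z + h z)" "(\<lambda>z. f z + h z - g z) = (\<lambda>z. f z - g z + h z)"
    "(\<lambda>z. f z - h z + g z) = (\<lambda>z. f z + g z - h z)" "(\<lambda>z. f z - h z - g z) = (\<lambda>z. f z - g z - h z)"
    by (auto simp: algebra_simps)
  show ?thesis using 1 2 unfolding e iprod_def
    using assms carr_add[OF assms(1,2)] carr_diff[OF assms(1,2)] by (simp add: field_simps)
qed

lemma iprod_zero_left: "iprod (\<lambda>_. 0) h = 0"
  unfolding iprod_def by (auto simp: nsq_minus)

lemma iprod_add:
  assumes "f \<in> carr" "g \<in> carr" "h \<in> carr"
  shows "iprod (\<lambda>z. f z + g z) h = iprod f h + iprod g h"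
proof -
  \<comment> \<open>With \<open>f = u + v\<close> and \<open>g = u - v\<close> the preceding
    identity gives \<open>iprod f h + iprod g h = 2 * iprod u h\<close>; the same identity for the
    pair \<open>u\<close>, \<open>u\<close> turns the right side into the value at
    \<open>u + u = f + g\<close>.\<close>
  define u where "u = (\<lambda>z. (1/2) * (f z + g z))"
  define v where "v = (\<lambda>z. (1/2) * (f z - g z))"
  have uv: "u \<in> carr" "v \<in> carr" unfolding u_def v_def by (intro carr_scale carr_add carr_diff assms)+
  have "iprod (\<lambda>z. u z + v z) h + iprod (\<lambda>z. u z - v z) h = 2 * iprod u h"
    by (rule iprod_sum_diff[OF uv assms(3)])
  moreover have "iprod (\<lambda>z. u z + u z) h + iprod (\<lambda>z. u z - u z) h = 2 * iprod u h"
    by (rule iprod_sum_diff[OF uv(1) uv(1) assms(3)])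
  moreover have "(\<lambda>z. u z + v z) = f" "(\<lambda>z. u z - v z) = g" "(\<lambda>z. u z + u z) = (\<lambda>z. f z + g z)"
    by (auto simp: u_def v_def field_simps)
  ultimately show ?thesis by (simp add: iprod_zero_left)
qed

lemma iprod_bound:
  assumes "f \<in> carr" "g \<in> carr"
  shows "\<bar>iprod f g\<bar> \<le> nsq f + nsq g"
  using parallelogram[OF assms] nsq_nonneg[OF carr_add[OF assms]] nsq_nonneg[OF carr_diff[OF assms]]
    nsq_nonneg[OF assms(1)] nsq_nonneg[OF assms(2)]
  unfolding iprod_def using assms by simp

lemma iprod_scale:
  assumes "f \<in> carr" "g \<in> carr"
  shows "iprod (\<lambda>z. c * f z) g = c * iprod f g"
proof -
  \<comment> \<open>The factor \<open>1 * f z\<close> is kept so that both sides are values of the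
    single additive function \<open>t \<mapsto> iprod (t * f) g\<close>.\<close>
  have "iprod (\<lambda>z. c * f z) g = c * iprod (\<lambda>z. 1 * f z) g"
  proof (rule additive_bounded_imp_linear[where B = "nsq f + nsq g"])
    fix s t
    show "iprod (\<lambda>z. (s + t) * f z) g = iprod (\<lambda>z. s * f z) g + iprod (\<lambda>z. t * f z) g"
      using iprod_add[OF carr_scale carr_scale assms(2), of f f s t] assms by (simp add: algebra_simps)
  next
    fix t :: real assume t: "0 \<le> t" "t \<le> 1"
    have "nsq (\<lambda>z. t * f z) \<le> nsq f"
    proof (cases "t = 0")
      case False
      have "nsq (\<lambda>z. t * f z) \<le> t\<^sup>2 * nsq f" using nsq_scale_le[OF assms(1) False] .
      also have "\<dots> \<le> 1 * nsq f" using t nsq_nonneg[OF assms(1)]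
        by (intro mult_right_mono) (auto simp: power_le_one)
      finally show ?thesis by simp
    qed (simp add: nsq_zero nsq_nonneg assms)
    then show "\<bar>iprod (\<lambda>z. t * f z) g\<bar> \<le> nsq f + nsq g"
      using iprod_bound[OF carr_scale[OF assms(1)] assms(2), of t] by simp
  qed
  then show ?thesis by simp
qed

lemma semi_inner_iprod: "semi_inner_product_on carr iprod"
  unfolding semi_inner_product_on_def fun_subspace_def
  by (auto simp: carr_zero carr_add carr_scale iprod_add iprod_scale iprod_self nsq_nonneg
      intro: iprod_sym)

lemma gain_shift:
  assumes "w \<in> DS" "v \<in> DS"
  shows "gain (\<lambda>z. f z + a * comb v z) (\<lambda>p. 1 * w p + a * v p)
    = gain f w + 2 * a * dint v f + a\<^sup>2 * bil v v"
proof -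
  let ?u = "\<lambda>p. 1 * w p + a * v p"
  have u: "?u \<in> DS" by (rule discrete_measures_lin[OF assms])
  have "dint ?u (\<lambda>z. f z + a * comb v z) = dint ?u f + a * dint ?u (comb v)"
    using dint_lin_fun[of ?u 1 f a "comb v"] by simp
  also have "dint ?u (comb v) = bil v ?u" by (rule bil_comb[OF u, symmetric])
  also have "bil v ?u = bil v w + a * bil v v" by (subst bil_lin_right[OF assms]) simp
  also have "dint ?u f = dint w f + a * dint v f" by (subst dint_lin[OF assms]) simp
  finally show ?thesis
    unfolding gain_def bil_quad[OF assms] using bil_sym[OF assms]
    by (simp add: power2_eq_square algebra_simps)
qed

text \<open>Completing the square: shifting \<open>f\<close> by \<open>a * comb v\<close> and
  \<open>w\<close> by \<open>a * v\<close> changes the gain by a constant. Shifts by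
  \<open>a * v\<close> are bijections of \<open>DS\<close>, so the supremum changes by exactly that
  constant. Polarization of the formula yields the reproducing property.\<close>

lemma nsq_shift:
  assumes "f \<in> carr" "v \<in> DS"
  shows "(\<lambda>z. f z + a * comb v z) \<in> carr" (is ?A)
    and "nsq (\<lambda>z. f z + a * comb v z) = nsq f + 2 * a * dint v f + a\<^sup>2 * bil v v" (is ?B)
proof -
  let ?h = "\<lambda>z. f z + a * comb v z"
  have le: "gain ?h w \<le> nsq f + 2 * a * dint v f + a\<^sup>2 * bil v v" if w: "w \<in> DS" for w
  proof -
    let ?w = "\<lambda>p. 1 * w p + (- a) * v p"
    have w': "?w \<in> DS" by (rule discrete_measures_lin[OF w assms(2)])
    have "w = (\<lambda>p. 1 * ?w p + a * v p)" by auto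
    then have "gain ?h w = gain f ?w + 2 * a * dint v f + a\<^sup>2 * bil v v"
      using gain_shift[OF w' assms(2), of f a] by simp
    then show ?thesis using gain_le_nsq[OF assms(1) w'] by simp
  qed
  show A: ?A by (rule carrI[OF _ le]) (auto simp: comb_def carr_off[OF assms(1)])
  have "gain f w \<le> nsq ?h - 2 * a * dint v f - a\<^sup>2 * bil v v" if w: "w \<in> DS" for w
    using gain_shift[OF w assms(2), of f a]
      gain_le_nsq[OF A discrete_measures_lin[OF w assms(2), of 1 a]] by simp
  then have "nsq f \<le> nsq ?h - 2 * a * dint v f - a\<^sup>2 * bil v v" by (rule nsq_leI)
  moreover have "nsq ?h \<le> nsq f + 2 * a * dint v f + a\<^sup>2 * bil v v" by (rule nsq_leI[OF le])
  ultimately show ?B by simp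
qed

lemma comb_carr: "w \<in> DS \<Longrightarrow> comb w \<in> carr"
  using nsq_shift(1)[OF carr_zero, of w 1] by simp

lemma iprod_comb:
  assumes "f \<in> carr" "w \<in> DS"
  shows "iprod f (comb w) = dint w f"
  using nsq_shift(2)[OF assms, of 1] nsq_shift(2)[OF assms, of "-1"] assms comb_carr
  unfolding iprod_def by simp

lemma comb_dirac: "y \<in> S \<Longrightarrow> comb (dirac y) = (\<lambda>z. if z \<in> S then K z y else 0)"
  by (auto simp: comb_def dint_dirac sym)

lemma eval_bound:
  assumes "f \<in> carr" "y \<in> S"
  shows "\<bar>f y\<bar> \<le> sqrt (nsq f) * sqrt (K y y)"
proof -
  have d: "dirac y \<in> DS" using assms by (simp add: discrete_measures_dirac)
  show ?thesis
    using semi_inner_CS[OF semi_inner_iprod assms(1) comb_carr[OF d]] d assms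
    by (simp add: iprod_comb comb_carr dint_dirac iprod_self[symmetric] bil_dirac[of y y] bil_dirac_right[OF assms(2), symmetric])
qed

lemma nsq_definite:
  assumes "f \<in> carr" "nsq f = 0"
  shows "f = (\<lambda>_. 0)"
proof
  fix z show "f z = 0"
    using eval_bound[OF assms(1), of z] carr_off[OF assms(1), of z] assms(2) by (cases "z \<in> S") auto
qed

lemma iprod_definite: "f \<in> carr \<Longrightarrow> iprod f f = 0 \<Longrightarrow> f = (\<lambda>_. 0)"
  using nsq_definite iprod_self by metis

lemma nsq_comb: "w \<in> DS \<Longrightarrow> nsq (comb w) = bil w w"
  by (simp add: iprod_self[symmetric] comb_carr iprod_comb bil_comb)

lemma comb_diff:
  assumes "w \<in> DS" "v \<in> DS"
  shows "(\<lambda>z. comb w z - comb v z) = comb (\<lambda>p. 1 * w p + (-1) * v p)"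
  by (rule ext) (subst comb_def[of "\<lambda>p. 1 * w p + (-1) * v p"], subst dint_lin[OF assms], simp add: comb_def)

text \<open>The amount by which \<open>w\<close> fails to attain the supremum is the squared
  distance from \<open>f\<close> to \<open>comb w\<close>; maximizing sequences are therefore
  approximating sequences.\<close>

lemma nsq_diff_comb:
  assumes "f \<in> carr" "w \<in> DS"
  shows "nsq (\<lambda>z. f z - comb w z) = nsq f - gain f w"
  using nsq_shift(2)[OF assms, of "-1"] by (simp add: gain_def)

lemma approximating_sequence:
  assumes "f \<in> carr"
  obtains w :: "nat \<Rightarrow> 'p \<Rightarrow> real" where "\<And>m. w m \<in> DS" "(\<lambda>m. nsq (\<lambda>z. f z - comb (w m) z)) \<longlonglongrightarrow> 0"
proof -
  have "\<exists>w\<in>DS. nsq f - inverse (real (Suc m)) < gain f w" for m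
    using assms DS_ne less_cSUP_iff[of DS "gain f" "nsq f - inverse (real (Suc m))"]
    unfolding carr_def nsq_def[symmetric] by auto
  then obtain w where w: "\<And>m. w m \<in> DS" "\<And>m. nsq f - inverse (real (Suc m)) < gain f (w m)" by metis
  have "(\<lambda>m. nsq (\<lambda>z. f z - comb (w m) z)) \<longlonglongrightarrow> 0"
  proof (rule tendsto_sandwich[OF _ _ tendsto_const LIMSEQ_inverse_real_of_nat])
    show "\<forall>\<^sub>F m in sequentially. 0 \<le> nsq (\<lambda>z. f z - comb (w m) z)"
      by (intro always_eventually allI nsq_nonneg carr_diff assms comb_carr w)
    show "\<forall>\<^sub>F m in sequentially. nsq (\<lambda>z. f z - comb (w m) z) \<le> inverse (real (Suc m))"
    proof (intro always_eventually allI)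
      fix m show "nsq (\<lambda>z. f z - comb (w m) z) \<le> inverse (real (Suc m))"
        using w(2)[of m] nsq_diff_comb[OF assms w(1)[of m]] by simp
    qed
  qed
  with w(1) show thesis by (rule that)
qed

lemma comb_tendsto:
  assumes "f \<in> carr" "\<And>m. w m \<in> DS" "(\<lambda>m. nsq (\<lambda>z. f z - comb (w m) z)) \<longlonglongrightarrow> 0" "y \<in> S"
  shows "(\<lambda>m. comb (w m) y) \<longlonglongrightarrow> f y"
proof -
  have "(\<lambda>m. f y - comb (w m) y) \<longlonglongrightarrow> 0"
  proof (rule Lim_null_comparison)
    show "\<forall>\<^sub>F m in sequentially. norm (f y - comb (w m) y) \<le> sqrt (nsq (\<lambda>z. f z - comb (w m) z)) * sqrt (K y y)"
      using eval_bound[OF carr_diff[OF assms(1) comb_carr[OF assms(2)]] assms(4)] by simp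
    show "(\<lambda>m. sqrt (nsq (\<lambda>z. f z - comb (w m) z)) * sqrt (K y y)) \<longlonglongrightarrow> 0"
      using tendsto_mult_right[OF tendsto_real_sqrt[OF assms(3)], of "sqrt (K y y)"] by simp
  qed
  from tendsto_diff[OF tendsto_const[of "f y"] this] show ?thesis by simp
qed

lemma iprod_off: "f \<notin> carr \<or> g \<notin> carr \<Longrightarrow> iprod f g = 0"
  unfolding iprod_def by auto

lemma Metric_space_carr:
  "Metric_space carr (\<lambda>f g. sqrt (iprod (\<lambda>z. f z - g z) (\<lambda>z. f z - g z)))"
  by (rule semi_inner_Metric_space[OF semi_inner_iprod iprod_definite iprod_off])

text \<open>Point evaluations are continuous, so a Cauchy sequence has a pointwise limit. The bounds
  on the gain at each single \<open>w\<close> survive pointwise limits, and the supremum over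
  \<open>w\<close> then gives membership and norm convergence.\<close>

lemma mcomplete_carr:
  "Metric_space.mcomplete carr (\<lambda>f g. sqrt (iprod (\<lambda>z. f z - g z) (\<lambda>z. f z - g z)))"
proof -
  let ?d = "\<lambda>f g. sqrt (iprod (\<lambda>z. f z - g z) (\<lambda>z. f z - g z))"
  interpret M: Metric_space carr ?d by (rule Metric_space_carr)
  have d: "?d f g = sqrt (nsq (\<lambda>z. f z - g z))" if "f \<in> carr" "g \<in> carr" for f g
    using that by (simp add: iprod_self carr_diff)
  show ?thesis unfolding M.mcomplete_def
  proof (intro allI impI)
    fix \<sigma> assume c: "M.MCauchy \<sigma>"
    then have in_carr: "\<sigma> m \<in> carr" for m unfolding M.MCauchy_def by auto
    have cauchy: "\<exists>N. \<forall>m m'. N \<le> m \<longrightarrow> N \<le> m' \<longrightarrow> sqrt (nsq (\<lambda>z. \<sigma> m z - \<sigma> m' z)) < e" if "e > 0" for e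
      using c that unfolding M.MCauchy_def by (auto simp: d in_carr)
    have "Cauchy (\<lambda>m. \<sigma> m y)" for y
    proof (cases "y \<in> S")
      case False
      then have "(\<lambda>m. \<sigma> m y) = (\<lambda>m. 0)" using in_carr carr_off by blast
      then show ?thesis by (simp add: convergent_Cauchy convergent_const)
    next
      case True
      show ?thesis
      proof (rule metric_CauchyI)
        fix e :: real assume e: "e > 0"
        have p: "0 < sqrt (K y y) + 1" by (simp add: K_diag_nonneg[OF True] add_nonneg_pos)
        obtain N where N: "\<And>m m'. N \<le> m \<Longrightarrow> N \<le> m' \<Longrightarrow> sqrt (nsq (\<lambda>z. \<sigma> m z - \<sigma> m' z)) < e / (sqrt (K y y) + 1)"
          using cauchy[of "e / (sqrt (K y y) + 1)"] e p by auto
        have "dist (\<sigma> m y) (\<sigma> m' y) < e" if "m \<ge> N" "m' \<ge> N" for m m'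
        proof -
          have "\<bar>\<sigma> m y - \<sigma> m' y\<bar> \<le> sqrt (nsq (\<lambda>z. \<sigma> m z - \<sigma> m' z)) * sqrt (K y y)"
            by (rule eval_bound[OF carr_diff[OF in_carr in_carr] True])
          also have "\<dots> \<le> sqrt (nsq (\<lambda>z. \<sigma> m z - \<sigma> m' z)) * (sqrt (K y y) + 1)"
            using nsq_nonneg[OF carr_diff[OF in_carr in_carr]] by (intro mult_left_mono) auto
          also have "\<dots> < e / (sqrt (K y y) + 1) * (sqrt (K y y) + 1)"
            using N[OF that] p by (intro mult_strict_right_mono) auto
          finally show ?thesis using p by (simp add: dist_real_def)
        qed
        then show "\<exists>N. \<forall>m\<ge>N. \<forall>m'\<ge>N. dist (\<sigma> m y) (\<sigma> m' y) < e" by blast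
      qed
    qed
    then have "\<exists>l. (\<lambda>m. \<sigma> m y) \<longlonglongrightarrow> l" for y using Cauchy_convergent convergent_def by blast
    then obtain f where f: "\<And>y. (\<lambda>m. \<sigma> m y) \<longlonglongrightarrow> f y" by metis
    have off: "f z = 0" if "z \<notin> S" for z
    proof -
      have "(\<lambda>m. \<sigma> m z) = (\<lambda>m. 0)" using in_carr carr_off that by blast
      then show ?thesis using f[of z] LIMSEQ_unique[OF _ tendsto_const] by auto
    qed
    \<comment> \<open>For fixed \<open>w\<close> the gain depends on finitely many values of its
      first argument, hence is continuous under pointwise convergence.\<close>
    have key: "gain (\<lambda>z. f z - \<sigma> m z) w \<le> e\<^sup>2"
      if "w \<in> DS" and N: "\<And>m'. N \<le> m' \<Longrightarrow> sqrt (nsq (\<lambda>z. \<sigma> m' z - \<sigma> m z)) < e" for e m w N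
    proof (rule LIMSEQ_le_const2)
      show "(\<lambda>m'. gain (\<lambda>z. \<sigma> m' z - \<sigma> m z) w) \<longlonglongrightarrow> gain (\<lambda>z. f z - \<sigma> m z) w"
        unfolding gain_def dint_def by (intro tendsto_intros f)
      have "gain (\<lambda>z. \<sigma> m' z - \<sigma> m z) w \<le> e\<^sup>2" if "N \<le> m'" for m'
      proof -
        have "gain (\<lambda>z. \<sigma> m' z - \<sigma> m z) w \<le> nsq (\<lambda>z. \<sigma> m' z - \<sigma> m z)"
          by (intro gain_le_nsq carr_diff in_carr \<open>w \<in> DS\<close>)
        also have "\<dots> \<le> e\<^sup>2" using N[OF that] by (intro sqrt_le_D) simp
        finally show ?thesis .
      qed
      then show "\<exists>N. \<forall>n\<ge>N. gain (\<lambda>z. \<sigma> n z - \<sigma> m z) w \<le> e\<^sup>2" by blast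
    qed
    have fc: "(\<lambda>z. f z - \<sigma> m z) \<in> carr" if "\<And>m'. N \<le> m' \<Longrightarrow> sqrt (nsq (\<lambda>z. \<sigma> m' z - \<sigma> m z)) < e" for m e N
      by (rule carrI[where C = "e\<^sup>2"]) (use key[OF _ that] off in_carr carr_off in auto)
    obtain N1 where "\<And>m m'. N1 \<le> m \<Longrightarrow> N1 \<le> m' \<Longrightarrow> sqrt (nsq (\<lambda>z. \<sigma> m z - \<sigma> m' z)) < 1"
      using cauchy[of 1] by auto
    then have "(\<lambda>z. f z - \<sigma> N1 z) \<in> carr" using fc[of N1 N1 1] by blast
    from carr_add[OF this in_carr[of N1]] have f_carr: "f \<in> carr" by simp
    have "\<exists>N. \<forall>n\<ge>N. \<sigma> n \<in> carr \<and> ?d (\<sigma> n) f < e" if "e > 0" for e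
    proof -
      obtain N where N: "\<And>m m'. N \<le> m \<Longrightarrow> N \<le> m' \<Longrightarrow> sqrt (nsq (\<lambda>z. \<sigma> m z - \<sigma> m' z)) < e/2"
        using cauchy[of "e/2"] \<open>e > 0\<close> by auto
      have "sqrt (nsq (\<lambda>z. \<sigma> m z - f z)) < e" if "m \<ge> N" for m
      proof -
        have "nsq (\<lambda>z. f z - \<sigma> m z) \<le> (e/2)\<^sup>2"
          by (rule nsq_leI) (use key[of _ N m "e/2"] N that in auto)
        then have "sqrt (nsq (\<lambda>z. f z - \<sigma> m z)) \<le> e/2" using \<open>e > 0\<close> by (intro real_le_lsqrt) auto
        then show ?thesis using \<open>e > 0\<close> nsq_diff_sym[OF f_carr in_carr] by simp
      qed
      then show ?thesis by (auto simp: d f_carr in_carr)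
    qed
    then have "limitin M.mtopology \<sigma> f sequentially"
      unfolding M.limitin_metric eventually_sequentially using f_carr by blast
    then show "\<exists>x. limitin M.mtopology \<sigma> x sequentially" by (rule exI[of _ f])
  qed
qed

lemma is_rkhs_carr: "is_rkhs S K carr iprod"
  unfolding is_rkhs_def
proof (intro conjI ballI allI impI)
  fix y f assume y: "y \<in> S"
  have d: "dirac y \<in> DS" using y by (simp add: discrete_measures_dirac)
  show "(\<lambda>z. if z \<in> S then K z y else 0) \<in> carr"
    using comb_carr[OF d] by (simp add: comb_dirac[OF y])
  show "iprod f (\<lambda>z. if z \<in> S then K z y else 0) = f y" if "f \<in> carr"
    using iprod_comb[OF that d] by (simp add: comb_dirac[OF y] dint_dirac)
qed (fact semi_inner_iprod mcomplete_carr | erule iprod_definite iprod_off carr_off, assumption?)+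

text \<open>In any competing space \<open>H\<close> the reproducing property expresses the gain by
  \<open>ip\<close>, so elements of \<open>H\<close> have bounded gain. Conversely the approximating
  combinations of an element of \<open>carr\<close> are Cauchy in \<open>H\<close> as well, because
  both norms agree on combinations, and completeness puts their common pointwise limit into
  \<open>H\<close>. Without uniqueness the \<open>THE\<close> in \<open>rkhs\<close> would carry no
  information.\<close>

lemma is_rkhs_unique:
  assumes R: "is_rkhs S K H ip"
  shows "H = carr \<and> ip = iprod"
proof -
  have B: "semi_inner_product_on H ip" and off: "\<And>f z. f \<in> H \<Longrightarrow> z \<notin> S \<Longrightarrow> f z = 0"
    and def: "\<And>f. f \<in> H \<Longrightarrow> ip f f = 0 \<Longrightarrow> f = (\<lambda>_. 0)"
    and ip_off: "\<And>f g. f \<notin> H \<or> g \<notin> H \<Longrightarrow> ip f g = 0"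
    and compl: "Metric_space.mcomplete H (\<lambda>f g. sqrt (ip (\<lambda>z. f z - g z) (\<lambda>z. f z - g z)))"
    and kH: "\<And>y. y \<in> S \<Longrightarrow> (\<lambda>z. if z \<in> S then K z y else 0) \<in> H"
    and rep: "\<And>y f. y \<in> S \<Longrightarrow> f \<in> H \<Longrightarrow> ip f (\<lambda>z. if z \<in> S then K z y else 0) = f y"
  proof -
    have R1: "\<forall>f\<in>H. \<forall>z. z \<notin> S \<longrightarrow> f z = 0" "semi_inner_product_on H ip"
      "\<forall>f\<in>H. ip f f = 0 \<longrightarrow> f = (\<lambda>_. 0)" "\<forall>f g. f \<notin> H \<or> g \<notin> H \<longrightarrow> ip f g = 0"
      "Metric_space.mcomplete H (\<lambda>f g. sqrt (ip (\<lambda>z. f z - g z) (\<lambda>z. f z - g z)))"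
      "\<forall>y\<in>S. (\<lambda>z. if z \<in> S then K z y else 0) \<in> H \<and>
        (\<forall>f\<in>H. ip f (\<lambda>z. if z \<in> S then K z y else 0) = f y)"
      using R unfolding is_rkhs_def by argo+
    show "semi_inner_product_on H ip" by (fact R1)
    show "f z = 0" if "f \<in> H" "z \<notin> S" for f z by (rule R1(1)[rule_format, OF that])
    show "f = (\<lambda>_. 0)" if "f \<in> H" "ip f f = 0" for f by (rule R1(3)[rule_format, OF that])
    show "ip f g = 0" if "f \<notin> H \<or> g \<notin> H" for f g by (rule R1(4)[rule_format, OF that])
    show "Metric_space.mcomplete H (\<lambda>f g. sqrt (ip (\<lambda>z. f z - g z) (\<lambda>z. f z - g z)))" by (fact R1)
    show "(\<lambda>z. if z \<in> S then K z y else 0) \<in> H" if "y \<in> S" for y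
      by (rule conjunct1[OF bspec[OF R1(6) that]])
    show "ip f (\<lambda>z. if z \<in> S then K z y else 0) = f y" if "y \<in> S" "f \<in> H" for y f
      by (rule bspec[OF conjunct2[OF bspec[OF R1(6) that(1)]] that(2)])
  qed
  interpret M: Metric_space H "\<lambda>f g. sqrt (ip (\<lambda>z. f z - g z) (\<lambda>z. f z - g z))"
    by (rule semi_inner_Metric_space[OF B def ip_off])
  have zero: "(\<lambda>_. 0) \<in> H" and add: "\<And>f g. f \<in> H \<Longrightarrow> g \<in> H \<Longrightarrow> (\<lambda>z. f z + g z) \<in> H"
    and sc: "\<And>c f. f \<in> H \<Longrightarrow> (\<lambda>z. c * f z) \<in> H" and nn: "\<And>f. f \<in> H \<Longrightarrow> ip f f \<ge> 0"
    using B unfolding semi_inner_product_on_def fun_subspace_def by auto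
  have df: "(\<lambda>z. f z - g z) \<in> H" if "f \<in> H" "g \<in> H" for f g
    using add[OF that(1) sc[OF that(2), of "-1"]] by simp
  have quad: "ip (\<lambda>z. f z - g z) (\<lambda>z. f z - g z) = ip f f - 2 * ip f g + ip g g"
    if "f \<in> H" "g \<in> H" for f g
    using semi_inner_quad[OF B that, of 1 "-1"] by simp
  let ?k = "\<lambda>p z. if z \<in> S then K z p else 0"
  have fin: "(\<lambda>z. \<Sum>p\<in>A. w p * ?k p z) \<in> H \<and> (\<forall>f\<in>H. ip f (\<lambda>z. \<Sum>p\<in>A. w p * ?k p z) = (\<Sum>p\<in>A. w p * f p))"
    if "finite A" "A \<subseteq> S" for A w
    using that
  proof (induction A)
    case empty
    have "ip f (\<lambda>_. 0) = 0" if "f \<in> H" for f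
      using semi_inner_right(2)[OF B zero zero that, of 0] by simp
    then show ?case using zero by simp
  next
    case (insert a A)
    then have a: "a \<in> S" and IH: "(\<lambda>z. \<Sum>p\<in>A. w p * ?k p z) \<in> H"
      "\<And>f. f \<in> H \<Longrightarrow> ip f (\<lambda>z. \<Sum>p\<in>A. w p * ?k p z) = (\<Sum>p\<in>A. w p * f p)" by auto
    have e: "(\<lambda>z. \<Sum>p\<in>insert a A. w p * ?k p z) = (\<lambda>z. w a * ?k a z + (\<Sum>p\<in>A. w p * ?k p z))"
      using insert.hyps by auto
    show ?case unfolding e
    proof (intro conjI ballI)
      show "(\<lambda>z. w a * ?k a z + (\<Sum>p\<in>A. w p * ?k p z)) \<in> H" by (rule add[OF sc[OF kH[OF a]] IH(1)])
      fix f assume f: "f \<in> H"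
      have "ip f (\<lambda>z. w a * ?k a z + (\<Sum>p\<in>A. w p * ?k p z)) = w a * ip f (?k a) + ip f (\<lambda>z. \<Sum>p\<in>A. w p * ?k p z)"
        using semi_inner_right(1)[OF B sc[OF kH[OF a]] IH(1) f, of "w a"]
          semi_inner_right(2)[OF B kH[OF a] kH[OF a] f, of "w a"] by (simp only:)
      then show "ip f (\<lambda>z. w a * ?k a z + (\<Sum>p\<in>A. w p * ?k p z)) = (\<Sum>p\<in>insert a A. w p * f p)"
        using insert.hyps by (simp only: rep[OF a f] IH(2)[OF f] sum.insert[OF insert.hyps])
    qed
  qed
  have comb_eq: "comb w = (\<lambda>z. \<Sum>p\<in>{p. w p \<noteq> 0}. w p * ?k p z)" if "w \<in> DS" for w
    using that unfolding comb_def dint_def discrete_measures_def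
    by (intro ext, simp) (intro impI sum.cong, auto simp: sym subset_iff)
  have combH: "comb w \<in> H" and ip_comb: "\<And>f. f \<in> H \<Longrightarrow> ip f (comb w) = dint w f" if "w \<in> DS" for w
    using fin[of "{p. w p \<noteq> 0}" w] that unfolding comb_eq[OF that] dint_def discrete_measures_def by auto
  have ip_cc: "ip (comb w) (comb w) = bil w w" if "w \<in> DS" for w
    by (simp add: ip_comb combH bil_comb that)
  have gain_ip: "gain f w = ip f f - ip (\<lambda>z. f z - comb w z) (\<lambda>z. f z - comb w z)" if "f \<in> H" "w \<in> DS" for f w
    unfolding quad[OF that(1) combH[OF that(2)]] gain_def ip_cc[OF that(2)] ip_comb[OF that(2,1)] by simp
  have sub: "f \<in> carr" if "f \<in> H" for f
    by (rule carrI[where C = "ip f f"]) (use gain_ip[OF that] nn[OF df[OF that combH]] off[OF that] in auto)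
  have main: "f \<in> H \<and> ip f f = nsq f" if f: "f \<in> carr" for f
  proof -
    obtain w where w: "\<And>m. w m \<in> DS" and lim: "(\<lambda>m. nsq (\<lambda>z. f z - comb (w m) z)) \<longlonglongrightarrow> 0"
      using approximating_sequence[OF f] by blast
    \<comment> \<open>\<open>ip\<close> and \<open>nsq\<close> agree on combinations, so the Cauchy
      estimate can be made in \<open>carr\<close> and transferred to \<open>H\<close>.\<close>
    have dd: "ip (\<lambda>z. comb (w m) z - comb (w l) z) (\<lambda>z. comb (w m) z - comb (w l) z)
        \<le> 2 * nsq (\<lambda>z. f z - comb (w m) z) + 2 * nsq (\<lambda>z. f z - comb (w l) z)" for m l
    proof -
      let ?u = "\<lambda>z. f z - comb (w m) z" and ?v = "\<lambda>z. f z - comb (w l) z"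
      have c: "?u \<in> carr" "?v \<in> carr" by (intro carr_diff f comb_carr w)+
      have "ip (\<lambda>z. comb (w m) z - comb (w l) z) (\<lambda>z. comb (w m) z - comb (w l) z)
          = nsq (\<lambda>z. comb (w m) z - comb (w l) z)"
        unfolding comb_diff[OF w w]
        by (simp only: ip_cc[OF discrete_measures_lin[OF w w]] nsq_comb[OF discrete_measures_lin[OF w w]])
      also have "\<dots> = nsq (\<lambda>z. ?v z - ?u z)" by simp
      also have "\<dots> \<le> 2 * nsq ?v + 2 * nsq ?u"
        using parallelogram[OF c(2,1)] nsq_nonneg[OF carr_add[OF c(2,1)]] by simp
      finally show ?thesis by simp
    qed
    have "M.MCauchy (\<lambda>m. comb (w m))"
      unfolding M.MCauchy_def
    proof (intro conjI allI impI)
      fix e :: real assume e: "e > 0"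
      have "\<forall>\<^sub>F m in sequentially. nsq (\<lambda>z. f z - comb (w m) z) < e\<^sup>2 / 4"
        using order_tendstoD(2)[OF lim, of "e\<^sup>2/4"] e by simp
      then obtain N where N: "\<And>m. m \<ge> N \<Longrightarrow> nsq (\<lambda>z. f z - comb (w m) z) < e\<^sup>2 / 4"
        unfolding eventually_sequentially by blast
      have "sqrt (ip (\<lambda>z. comb (w m) z - comb (w l) z) (\<lambda>z. comb (w m) z - comb (w l) z)) < e" if "N \<le> m" "N \<le> l" for m l
        using dd[of m l] N[OF that(1)] N[OF that(2)] e by (intro real_less_lsqrt) auto
      then show "\<exists>N. \<forall>n n'. N \<le> n \<longrightarrow> N \<le> n' \<longrightarrow>
          sqrt (ip (\<lambda>z. comb (w n) z - comb (w n') z) (\<lambda>z. comb (w n) z - comb (w n') z)) < e" by blast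
    qed (use combH w in auto)
    then obtain g where "limitin M.mtopology (\<lambda>m. comb (w m)) g sequentially"
      using compl unfolding M.mcomplete_def by blast
    then have g: "g \<in> H" and glim: "(\<lambda>m. sqrt (ip (\<lambda>z. comb (w m) z - g z) (\<lambda>z. comb (w m) z - g z))) \<longlonglongrightarrow> 0"
      unfolding M.limitin_metric_dist_null by auto
    have "g y = f y" for y
    proof (cases "y \<in> S")
      case True
      have "(\<lambda>m. comb (w m) y - g y) \<longlonglongrightarrow> 0"
      proof (rule Lim_null_comparison)
        show "\<forall>\<^sub>F m in sequentially. norm (comb (w m) y - g y)
          \<le> sqrt (ip (\<lambda>z. comb (w m) z - g z) (\<lambda>z. comb (w m) z - g z)) * sqrt (ip (?k y) (?k y))"
          using semi_inner_CS[OF B df[OF combH[OF w] g] kH[OF True]]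
          by (simp add: rep[OF True df[OF combH[OF w] g]])
        show "(\<lambda>m. sqrt (ip (\<lambda>z. comb (w m) z - g z) (\<lambda>z. comb (w m) z - g z)) * sqrt (ip (?k y) (?k y))) \<longlonglongrightarrow> 0"
          using tendsto_mult_left_zero[OF glim] by simp
      qed
      from tendsto_add[OF this tendsto_const[of "g y"]] have "(\<lambda>m. comb (w m) y) \<longlonglongrightarrow> g y" by simp
      with comb_tendsto[OF f w lim True] show ?thesis using LIMSEQ_unique by blast
    qed (use off[OF g] carr_off[OF f] in auto)
    then have gf: "g = f" by auto
    have fH: "f \<in> H" using g gf by simp
    \<comment> \<open>Both sides are \<open>gain f (w m)\<close>; letting \<open>m\<close> grow
      gives equality of the two squared norms of \<open>f\<close>.\<close>
    have "nsq f - nsq (\<lambda>z. f z - comb (w m) z) = ip f f - (sqrt (ip (\<lambda>z. comb (w m) z - f z) (\<lambda>z. comb (w m) z - f z)))\<^sup>2" for m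
    proof -
      have "ip (\<lambda>z. comb (w m) z - f z) (\<lambda>z. comb (w m) z - f z) = ip (\<lambda>z. f z - comb (w m) z) (\<lambda>z. f z - comb (w m) z)"
        using semi_inner_quad[OF B df[OF fH combH[OF w[of m]]] zero, of "-1" 0] by simp
      then show ?thesis
        using gain_ip[OF fH w[of m]] nsq_diff_comb[OF f w[of m]] nn[OF df[OF combH[OF w[of m]] fH]] by simp
    qed
    moreover have "(\<lambda>m. nsq f - nsq (\<lambda>z. f z - comb (w m) z)) \<longlonglongrightarrow> nsq f - 0"
      by (intro tendsto_intros lim)
    moreover have "(\<lambda>m. ip f f - (sqrt (ip (\<lambda>z. comb (w m) z - f z) (\<lambda>z. comb (w m) z - f z)))\<^sup>2) \<longlonglongrightarrow> ip f f - 0\<^sup>2"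
      by (intro tendsto_intros) (use glim gf in simp)
    ultimately show ?thesis using fH LIMSEQ_unique by fastforce
  qed
  have H: "H = carr" using sub main by blast
  have "ip f g = iprod f g" for f g
  proof (cases "f \<in> H \<and> g \<in> H")
    case True
    then have "ip (\<lambda>z. f z + g z) (\<lambda>z. f z + g z) = ip f f + 2 * ip f g + ip g g"
      using semi_inner_quad[OF B, of f g 1 1] by simp
    with quad[of f g] True main add[of f g] df[of f g] show ?thesis unfolding iprod_def H by simp
  qed (use ip_off iprod_off H in auto)
  with H show ?thesis by auto
qed

lemma rkhs_eq: "rkhs S K = (carr, iprod)"
  unfolding rkhs_def
proof (rule the_equality)
  show "is_rkhs S K (fst (carr, iprod)) (snd (carr, iprod))" using is_rkhs_carr by simp
  show "R = (carr, iprod)" if "is_rkhs S K (fst R) (snd R)" for R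
    using is_rkhs_unique[OF that] by (simp add: prod_eq_iff)
qed

end

section \<open>Mean embedding of a signed measure\<close>

locale kernel_mean = pd_kernel S K + finite_signed M \<mu>
  for S :: "'p set" and K :: "'p \<Rightarrow> 'p \<Rightarrow> real" and M :: "'p measure" and \<mu> +
  assumes space_M: "space M = S"
    and int_slice: "\<And>z. z \<in> S \<Longrightarrow> integrable (variation M \<mu>) (\<lambda>x. K x z)"
    and int_sqrt: "integrable (variation M \<mu>) (\<lambda>x. sqrt (K x x))"
begin

definition emb where "emb z = (if z \<in> S then sint M \<mu> (\<lambda>x. K x z) else 0)"

abbreviation "sqrt_mass \<equiv> (\<integral>x. sqrt (K x x) \<partial>V)"

lemma sqrt_mass_nonneg: "0 \<le> sqrt_mass"
  by (rule Bochner_Integration.integral_nonneg) (simp add: space_M K_diag_nonneg)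

lemma comb_eq_sum: "w \<in> DS \<Longrightarrow> x \<in> S \<Longrightarrow> comb w x = (\<Sum>p\<in>{p. w p \<noteq> 0}. w p * K x p)"
  unfolding comb_def dint_def discrete_measures_def by (auto intro!: sum.cong simp: sym)

lemma integrable_comb:
  assumes w: "w \<in> DS"
  shows "integrable V (comb w)"
proof -
  have "integrable V (\<lambda>x. \<Sum>p\<in>{p. w p \<noteq> 0}. w p * K x p)"
    using w by (intro Bochner_Integration.integrable_sum integrable_mult_right int_slice) (auto simp: discrete_measures_def)
  then show ?thesis
    by (rule iffD1[OF Bochner_Integration.integrable_cong[OF refl], rotated]) (simp add: space_M comb_eq_sum[OF w])
qed

lemma dint_emb:
  assumes w: "w \<in> DS"
  shows "dint w emb = sint M \<mu> (comb w)"
proof -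
  have fin: "finite {p. w p \<noteq> 0}" and sub: "{p. w p \<noteq> 0} \<subseteq> S" using w by (auto simp: discrete_measures_def)
  have "dint w emb = (\<Sum>p\<in>{p. w p \<noteq> 0}. sint M \<mu> (\<lambda>x. w p * K x p))"
    unfolding dint_def using sub by (intro sum.cong refl) (auto simp: emb_def sint_scale)
  also have "\<dots> = sint M \<mu> (\<lambda>x. \<Sum>p\<in>{p. w p \<noteq> 0}. w p * K x p)"
    using sub by (intro sint_sum[symmetric] fin integrable_mult_right int_slice) auto
  also have "\<dots> = sint M \<mu> (comb w)" by (rule sint_cong) (simp add: space_M comb_eq_sum[OF w])
  finally show ?thesis .
qed

lemma abs_sint_le_sqrt_mass:
  assumes "integrable V f" and c: "\<And>x. x \<in> S \<Longrightarrow> \<bar>f x\<bar> \<le> c * sqrt (K x x)"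
  shows "\<bar>sint M \<mu> f\<bar> \<le> c * sqrt_mass"
proof -
  have "\<bar>sint M \<mu> f\<bar> \<le> (\<integral>x. \<bar>f x\<bar> \<partial>V)" by (rule abs_sint_le[OF assms(1)])
  also have "\<dots> \<le> (\<integral>x. c * sqrt (K x x) \<partial>V)"
    using assms(1) by (intro integral_mono integrable_mult_right int_sqrt) (auto simp: space_M c)
  finally show ?thesis by simp
qed

text \<open>With \<open>s = sqrt (bil w w)\<close> the gain at \<open>w\<close> is at most
  \<open>2 * s * sqrt_mass - s * s\<close>, and this is at most the square of
  \<open>sqrt_mass\<close>.\<close>

lemma emb_carr: "emb \<in> carr"
proof (rule carrI[where C = "sqrt_mass\<^sup>2"])
  fix w assume w: "w \<in> DS"
  have "dint w emb \<le> sqrt (bil w w) * sqrt_mass"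
    using abs_sint_le_sqrt_mass[OF integrable_comb[OF w] comb_bound[OF w]] by (simp add: dint_emb[OF w])
  moreover have "0 \<le> (sqrt (bil w w) - sqrt_mass)\<^sup>2" by simp
  ultimately show "gain emb w \<le> sqrt_mass\<^sup>2"
    using bil_pos[OF w] by (simp add: gain_def power2_diff)
qed (simp add: emb_def)

text \<open>Members of \<open>carr\<close> are measurable as pointwise limits of finite combinations
  of sections, and they are dominated by a multiple of \<open>sqrt (K x x)\<close>.\<close>

lemma integrable_carr:
  assumes f: "f \<in> carr"
  shows "integrable V f"
proof -
  obtain w where w: "\<And>m::nat. w m \<in> DS" "(\<lambda>m. nsq (\<lambda>z. f z - comb (w m) z)) \<longlonglongrightarrow> 0"
    using approximating_sequence[OF f] by metis
  have "f \<in> borel_measurable V"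
  proof (rule borel_measurable_LIMSEQ_real)
    show "(\<lambda>m. comb (w m) x) \<longlonglongrightarrow> f x" if "x \<in> space V" for x
      by (rule comb_tendsto[OF f w]) (use that in \<open>simp add: space_M\<close>)
    show "comb (w m) \<in> borel_measurable V" for m using integrable_comb[OF w(1)] by (rule borel_measurable_integrable)
  qed
  then show ?thesis
    by (rule Bochner_Integration.integrable_bound[OF integrable_mult_right[OF int_sqrt, of "sqrt (nsq f)"]])
      (use eval_bound[OF f] nsq_nonneg[OF f] K_diag_nonneg in \<open>auto intro!: AE_I2 simp: space_M abs_mult\<close>)
qed

text \<open>Both sides agree on combinations and are continuous in the norm: the left by
  Cauchy-Schwarz, the right because values at \<open>x\<close> are at most the norm times
  \<open>sqrt (K x x)\<close>. The two effects produce the factor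
  \<open>sqrt (nsq emb) + sqrt_mass\<close>.\<close>

lemma iprod_emb:
  assumes f: "f \<in> carr"
  shows "iprod f emb = sint M \<mu> f"
proof -
  obtain w where w: "\<And>m::nat. w m \<in> DS" "(\<lambda>m. nsq (\<lambda>z. f z - comb (w m) z)) \<longlonglongrightarrow> 0"
    using approximating_sequence[OF f] by metis
  define d where "d m = (\<lambda>z. f z - comb (w m) z)" for m
  have dc: "d m \<in> carr" for m unfolding d_def by (intro carr_diff f comb_carr w)
  have fd: "f = (\<lambda>z. d m z + comb (w m) z)" for m by (simp add: d_def)
  have "iprod f emb - sint M \<mu> f = iprod (d m) emb - sint M \<mu> (d m)" for m
  proof -
    have "iprod f emb = iprod (d m) emb + iprod (comb (w m)) emb"
      by (subst fd[of m]) (rule iprod_add[OF dc comb_carr[OF w(1)] emb_carr])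
    moreover have "sint M \<mu> f = sint M \<mu> (d m) + sint M \<mu> (comb (w m))"
      by (subst fd[of m]) (rule sint_add[OF integrable_carr[OF dc] integrable_comb[OF w(1)]])
    moreover have "iprod (comb (w m)) emb = sint M \<mu> (comb (w m))"
      unfolding iprod_sym[of "comb (w m)"] iprod_comb[OF emb_carr w(1)] by (rule dint_emb[OF w(1)])
    ultimately show ?thesis by simp
  qed
  moreover have "\<bar>iprod (d m) emb - sint M \<mu> (d m)\<bar> \<le> sqrt (nsq (d m)) * (sqrt (nsq emb) + sqrt_mass)" for m
    using semi_inner_CS[OF semi_inner_iprod dc emb_carr, of m]
      abs_sint_le_sqrt_mass[OF integrable_carr[OF dc] eval_bound[OF dc], of m]
    by (simp add: iprod_self[OF dc] iprod_self[OF emb_carr] distrib_left)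
  ultimately have le: "\<bar>iprod f emb - sint M \<mu> f\<bar> \<le> sqrt (nsq (d m)) * (sqrt (nsq emb) + sqrt_mass)" for m
    by simp
  have "(\<lambda>m. sqrt (nsq (d m)) * (sqrt (nsq emb) + sqrt_mass)) \<longlonglongrightarrow> sqrt 0 * (sqrt (nsq emb) + sqrt_mass)"
    unfolding d_def by (intro tendsto_intros w(2))
  from LIMSEQ_le_const[OF this] le have "\<bar>iprod f emb - sint M \<mu> f\<bar> \<le> sqrt 0 * (sqrt (nsq emb) + sqrt_mass)" by blast
  then show ?thesis by simp
qed

end

section \<open>Radon products\<close>

lemma continuous_map_restrict:
  "J \<subseteq> I \<Longrightarrow> continuous_map (product_topology X I) (product_topology X J) (\<lambda>x. restrict x J)"
  unfolding continuous_map_componentwise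
proof (intro conjI ballI)
  fix i assume "J \<subseteq> I" and i: "i \<in> J"
  then have "continuous_map (product_topology X I) (X i) (\<lambda>x. x i)"
    by (intro continuous_map_product_projection) auto
  then show "continuous_map (product_topology X I) (X i) (\<lambda>x. restrict x J i)"
    using i by simp
qed auto

section \<open>Existence and uniqueness of the Radon product over disjoint blocks\<close>

locale radon_blocks =
  fixes X :: "nat \<Rightarrow> 'a topology" and \<pi> :: "nat set set" and \<kappa> :: "nat set \<Rightarrow> (nat \<Rightarrow> 'a) measure"
  assumes finite_pi: "finite \<pi>" and disj: "disjoint \<pi>"
    and haus: "\<And>i. i \<in> \<Union>\<pi> \<Longrightarrow> Hausdorff_space (X i)"
    and radon: "\<And>B. B \<in> \<pi> \<Longrightarrow> finite_radon (prod_sp X B) (\<kappa> B)"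
begin

abbreviation "TT \<equiv> prod_sp X (\<Union>\<pi>)"
definition rect where "rect A = {x \<in> topspace TT. \<forall>B\<in>\<pi>. restrict x B \<in> A B}"
definition block where "block i = (THE B. B \<in> \<pi> \<and> i \<in> B)"
text \<open>Identifies a family of points, one for each block, with a single point on the union of
  the blocks; inverse to restriction to the blocks.\<close>

definition glue :: "(nat set \<Rightarrow> nat \<Rightarrow> 'a) \<Rightarrow> nat \<Rightarrow> 'a" where "glue z = (\<lambda>i\<in>\<Union>\<pi>. z (block i) i)"
text \<open>The product measure locale asks for a sigma-finite measure at every index, so indices
  outside \<open>\<pi>\<close> receive the measure on the empty set.\<close>

definition kk where "kk B = (if B \<in> \<pi> then \<kappa> B else count_space {})"
definition Rects where "Rects = {rect A | A. \<forall>B\<in>\<pi>. A B \<in> sets (prod_borel X B)}"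
definition open_rects where "open_rects = {rect A | A. \<forall>B\<in>\<pi>. openin (prod_sp X B) (A B)}"
text \<open>The ordinary product measure moved to points on the union. It lives on the sigma-algebra
  of measurable rectangles, in general smaller than the Borel one, and is the input to
  \<open>radon_extension\<close>.\<close>

definition nu where "nu = distr (PiM \<pi> kk) (sigma (topspace TT) Rects) glue"

lemma haus_block: "B \<in> \<pi> \<Longrightarrow> Hausdorff_space (prod_sp X B)"
  unfolding Hausdorff_space_product_topology using haus by auto

lemma haus_TT: "Hausdorff_space TT"
  unfolding Hausdorff_space_product_topology using haus by auto

lemma block_eq: "B \<in> \<pi> \<Longrightarrow> i \<in> B \<Longrightarrow> block i = B"
  unfolding block_def
  by (rule the_equality) (use disj in \<open>auto simp: disjoint_def\<close>)

lemma glue_restrict: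
  assumes "z \<in> PiE \<pi> (\<lambda>B. topspace (prod_sp X B))" "B \<in> \<pi>"
  shows "restrict (glue z) B = z B"
proof
  fix i
  have "z B \<in> topspace (prod_sp X B)" using assms by auto
  then show "restrict (glue z) B i = z B i"
    using assms(2) block_eq[OF assms(2)] by (auto simp: glue_def restrict_def PiE_def extensional_def)
qed

lemma glue_topspace:
  assumes "z \<in> PiE \<pi> (\<lambda>B. topspace (prod_sp X B))"
  shows "glue z \<in> topspace TT"
  unfolding topspace_product_topology
proof (rule PiE_I)
  fix i assume "i \<in> \<Union>\<pi>"
  then obtain B where B: "B \<in> \<pi>" "i \<in> B" by auto
  have "z B \<in> topspace (prod_sp X B)" using assms B(1) by auto
  then show "glue z i \<in> topspace (X i)" using B block_eq[OF B] by (auto simp: glue_def)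
qed (auto simp: glue_def)

lemma restrict_topspace: "x \<in> topspace TT \<Longrightarrow> B \<in> \<pi> \<Longrightarrow> restrict x B \<in> topspace (prod_sp X B)"
  by (auto simp: PiE_def Pi_def)

lemma glue_blocks:
  assumes "x \<in> topspace TT"
  shows "glue (\<lambda>B\<in>\<pi>. restrict x B) = x"
proof
  fix i show "glue (\<lambda>B\<in>\<pi>. restrict x B) i = x i"
  proof (cases "i \<in> \<Union>\<pi>")
    case True
    then obtain B where "B \<in> \<pi>" "i \<in> B" by auto
    then show ?thesis using block_eq[of B i] by (auto simp: glue_def)
  next
    case False
    then show ?thesis using assms by (auto simp: glue_def PiE_def extensional_def)
  qed
qed

lemma rect_image: "rect A = glue ` (PiE \<pi> (\<lambda>B. A B \<inter> topspace (prod_sp X B)))"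
proof (intro equalityI subsetI)
  fix x assume x: "x \<in> rect A"
  then have "x = glue (\<lambda>B\<in>\<pi>. restrict x B)" by (simp add: rect_def glue_blocks)
  moreover have "(\<lambda>B\<in>\<pi>. restrict x B) \<in> PiE \<pi> (\<lambda>B. A B \<inter> topspace (prod_sp X B))"
    using x restrict_topspace unfolding rect_def by (auto simp del: topspace_product_topology)
  ultimately show "x \<in> glue ` (PiE \<pi> (\<lambda>B. A B \<inter> topspace (prod_sp X B)))" by blast
next
  fix x assume "x \<in> glue ` (PiE \<pi> (\<lambda>B. A B \<inter> topspace (prod_sp X B)))"
  then obtain z where z: "z \<in> PiE \<pi> (\<lambda>B. A B \<inter> topspace (prod_sp X B))" "x = glue z" by auto
  then have z': "z \<in> PiE \<pi> (\<lambda>B. topspace (prod_sp X B))" by (auto simp: PiE_def Pi_def)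
  have "restrict x B \<in> A B" if "B \<in> \<pi>" for B
    using glue_restrict[OF z' that] z that by (auto simp: PiE_def Pi_def)
  then show "x \<in> rect A" using glue_topspace[OF z'] z(2) by (simp add: rect_def)
qed

lemma continuous_glue: "continuous_map (product_topology (\<lambda>B. prod_sp X B) \<pi>) TT glue"
  unfolding continuous_map_componentwise
proof (intro conjI ballI)
  fix i assume "i \<in> \<Union>\<pi>"
  then obtain B where B: "B \<in> \<pi>" "i \<in> B" by auto
  have c: "continuous_map (product_topology (\<lambda>B. prod_sp X B) \<pi>) (X i) ((\<lambda>x. x i) \<circ> (\<lambda>z. z B))"
  proof (rule continuous_map_compose)
    show "continuous_map (product_topology (\<lambda>B. prod_sp X B) \<pi>) (prod_sp X B) (\<lambda>z. z B)"
      by (rule continuous_map_product_projection[OF B(1)])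
    show "continuous_map (prod_sp X B) (X i) (\<lambda>x. x i)"
      by (rule continuous_map_product_projection[OF B(2)])
  qed
  have e: "((\<lambda>x. x i) \<circ> (\<lambda>z. z B)) = (\<lambda>z. glue z i)"
  proof
    fix z show "((\<lambda>x. x i) \<circ> (\<lambda>z. z B)) z = glue z i"
      using \<open>i \<in> \<Union>\<pi>\<close> by (simp add: glue_def block_eq[OF B] del: Union_iff)
  qed
  show "continuous_map (product_topology (\<lambda>B. prod_sp X B) \<pi>) (X i) (\<lambda>z. glue z i)"
    using c unfolding e .
qed (auto simp: glue_def)

lemma compactin_rect:
  assumes "\<And>B. B \<in> \<pi> \<Longrightarrow> compactin (prod_sp X B) (C B)"
  shows "compactin TT (rect C)"
proof -
  have "PiE \<pi> (\<lambda>B. C B \<inter> topspace (prod_sp X B)) = PiE \<pi> C"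
    using compactin_subset_topspace[OF assms] by (intro PiE_cong) blast
  then have "rect C = glue ` PiE \<pi> C" by (simp add: rect_image)
  moreover have "compactin (product_topology (\<lambda>B. prod_sp X B) \<pi>) (PiE \<pi> C)"
    using assms by (simp add: compactin_PiE)
  ultimately show ?thesis using image_compactin[OF _ continuous_glue] by metis
qed

lemma openin_rect:
  assumes "\<And>B. B \<in> \<pi> \<Longrightarrow> openin (prod_sp X B) (A B)"
  shows "openin TT (rect A)"
proof -
  have "rect A = topspace TT \<inter> (\<Inter>B\<in>\<pi>. {x \<in> topspace TT. restrict x B \<in> A B})"
    by (auto simp: rect_def)
  moreover have "openin TT {x \<in> topspace TT. restrict x B \<in> A B}" if "B \<in> \<pi>" for B
    using continuous_map_restrict[of B "\<Union>\<pi>" X] assms[OF that] that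
    by (intro openin_continuous_map_preimage) auto
  ultimately show ?thesis
  proof (cases "\<pi> = {}")
    case True
    then have "rect A = topspace TT" unfolding rect_def by simp
    then show ?thesis by (simp only: openin_topspace)
  next
    case False
    assume *: "rect A = topspace TT \<inter> (\<Inter>B\<in>\<pi>. {x \<in> topspace TT. restrict x B \<in> A B})"
      and **: "\<And>B. B \<in> \<pi> \<Longrightarrow> openin TT {x \<in> topspace TT. restrict x B \<in> A B}"
    show ?thesis unfolding * by (intro openin_Int openin_topspace openin_INT2 finite_pi False **)
  qed
qed

lemma base_of_open_rects: "base_of TT open_rects"
  unfolding base_of_def
proof (intro conjI ballI allI impI)
  show "openin TT W" if "W \<in> open_rects" for W using that openin_rect unfolding open_rects_def by auto
  fix U x assume U: "openin TT U" and x: "x \<in> U"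
  have "\<exists>V. finite {i \<in> \<Union>\<pi>. V i \<noteq> topspace (X i)} \<and> (\<forall>i\<in>\<Union>\<pi>. openin (X i) (V i)) \<and>
      x \<in> PiE (\<Union>\<pi>) V \<and> PiE (\<Union>\<pi>) V \<subseteq> U"
    by (rule bspec[OF iffD1[OF openin_product_topology_alt U] x])
  then obtain V where V0: "finite {i \<in> \<Union>\<pi>. V i \<noteq> topspace (X i)}" "\<forall>i\<in>\<Union>\<pi>. openin (X i) (V i)"
    "x \<in> PiE (\<Union>\<pi>) V" "PiE (\<Union>\<pi>) V \<subseteq> U" by (elim exE conjE)
  note V = V0(1) bspec[OF V0(2)] V0(3,4)
  have Vt: "V i \<subseteq> topspace (X i)" if "i \<in> \<Union>\<pi>" for i using openin_subset[OF V(2)[OF that]] .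
  let ?A = "\<lambda>B. PiE B V"
  have "openin (prod_sp X B) (?A B)" if "B \<in> \<pi>" for B
    unfolding openin_PiE_gen using V(1,2) that by (auto intro: finite_subset[rotated])
  then have r1: "rect ?A \<in> open_rects" unfolding open_rects_def by auto
  have r2: "x \<in> rect ?A" using V(3) Vt unfolding rect_def by (fastforce simp: PiE_def Pi_def)
  have r3: "rect ?A \<subseteq> PiE (\<Union>\<pi>) V"
  proof
    fix y assume y: "y \<in> rect ?A"
    show "y \<in> PiE (\<Union>\<pi>) V"
    proof (rule PiE_I)
      fix i assume "i \<in> \<Union>\<pi>"
      then obtain B where "B \<in> \<pi>" "i \<in> B" by auto
      then show "y i \<in> V i" using y unfolding rect_def by (auto simp: PiE_def Pi_def)
    next
      fix i assume "i \<notin> \<Union>\<pi>"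
      then show "y i = undefined" using y unfolding rect_def by (auto simp: PiE_def extensional_def)
    qed
  qed
  show "\<exists>W\<in>open_rects. x \<in> W \<and> W \<subseteq> U"
  proof (rule bexI)
    show "x \<in> rect ?A \<and> rect ?A \<subseteq> U" by (intro conjI r2 subset_trans[OF r3 V(4)])
  qed (rule r1)
qed

lemma rect_Int: "rect A \<inter> rect A' = rect (\<lambda>B. A B \<inter> A' B)"
  by (auto simp: rect_def)

lemma rect_mono: "(\<And>B. B \<in> \<pi> \<Longrightarrow> A B \<subseteq> A' B) \<Longrightarrow> rect A \<subseteq> rect A'"
  unfolding rect_def by blast

lemma Rects_Pow: "Rects \<subseteq> Pow (topspace TT)"
  by (auto simp: Rects_def rect_def)

lemma Rects_Int_stable: "Int_stable Rects"
  unfolding Int_stable_def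
proof (intro ballI)
  fix R R' assume "R \<in> Rects" "R' \<in> Rects"
  then obtain A A' where "R = rect A" "R' = rect A'" "\<forall>B\<in>\<pi>. A B \<in> sets (prod_borel X B)"
    "\<forall>B\<in>\<pi>. A' B \<in> sets (prod_borel X B)" unfolding Rects_def by auto
  then show "R \<inter> R' \<in> Rects" unfolding Rects_def by (auto simp: rect_Int intro!: exI[of _ "\<lambda>B. A B \<inter> A' B"])
qed

lemma topspace_rect: "topspace TT = rect (\<lambda>B. topspace (prod_sp X B))"
  unfolding rect_def using restrict_topspace by (auto simp del: topspace_product_topology)

lemma topspace_Rects: "topspace TT \<in> Rects"
  unfolding Rects_def topspace_rect using sets.top[of "prod_borel X B" for B] by auto

lemma open_rects_Rects: "open_rects \<subseteq> Rects"
  unfolding open_rects_def Rects_def by (auto intro: openin_sets_borel_top)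

lemma Rects_borel: "Rects \<subseteq> sets (borel_top TT)"
proof
  fix R assume "R \<in> Rects"
  then obtain A where A: "R = rect A" "\<And>B. B \<in> \<pi> \<Longrightarrow> A B \<in> sets (prod_borel X B)" unfolding Rects_def by auto
  have "R = topspace TT \<inter> (\<Inter>B\<in>\<pi>. (\<lambda>x. restrict x B) -` A B \<inter> space (borel_top TT))"
    by (auto simp: A rect_def)
  moreover have "(\<lambda>x. restrict x B) -` A B \<inter> space (borel_top TT) \<in> sets (borel_top TT)" if "B \<in> \<pi>" for B
    by (rule measurable_sets[OF continuous_map_measurable_borel_top[OF continuous_map_restrict] A(2)]) (use that in auto)
  ultimately show "R \<in> sets (borel_top TT)"
  proof (cases "\<pi> = {}")
    case True
    then have "R = topspace TT" unfolding A(1) rect_def by simp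
    then show ?thesis by (simp only: openin_topspace openin_sets_borel_top)
  next
    case False
    assume *: "R = topspace TT \<inter> (\<Inter>B\<in>\<pi>. (\<lambda>x. restrict x B) -` A B \<inter> space (borel_top TT))"
      and **: "\<And>B. B \<in> \<pi> \<Longrightarrow> (\<lambda>x. restrict x B) -` A B \<inter> space (borel_top TT) \<in> sets (borel_top TT)"
    show ?thesis unfolding *
      by (intro sets.Int openin_sets_borel_top openin_topspace sets.finite_INT finite_pi False **)
  qed
qed

lemma sets_sigma_Rects: "sets (sigma (topspace TT) Rects) = sigma_sets (topspace TT) Rects"
  by (rule sets_measure_of[OF Rects_Pow])

lemma space_sigma_Rects: "space (sigma (topspace TT) Rects) = topspace TT"
  by (rule space_measure_of[OF Rects_Pow])

lemma sigma_Rects_borel: "sigma_sets (topspace TT) Rects \<subseteq> sets (borel_top TT)"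
  using sets.sigma_sets_subset[OF Rects_borel] by simp

lemma finite_kk: "finite_measure (kk B)"
  unfolding kk_def using finite_radonD(1)[OF radon] by (auto intro: finite_measure_count_space)

sublocale K: product_sigma_finite kk
  by (rule product_sigma_finite.intro) (rule finite_measure.axioms(1)[OF finite_kk])

lemma space_kk: "B \<in> \<pi> \<Longrightarrow> space (kk B) = topspace (prod_sp X B)"
  and sets_kk: "B \<in> \<pi> \<Longrightarrow> sets (kk B) = sets (prod_borel X B)"
  using finite_radonD[OF radon] by (auto simp: kk_def simp del: topspace_product_topology)

lemma space_PiM_kk: "space (PiM \<pi> kk) = PiE \<pi> (\<lambda>B. topspace (prod_sp X B))"
  unfolding space_PiM by (rule PiE_cong) (simp add: space_kk del: topspace_product_topology)

lemma glue_vimage_rect: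
  assumes "\<And>B. B \<in> \<pi> \<Longrightarrow> A B \<in> sets (prod_borel X B)"
  shows "glue -` rect A \<inter> space (PiM \<pi> kk) = PiE \<pi> A"
proof (intro equalityI subsetI)
  fix z assume z: "z \<in> glue -` rect A \<inter> space (PiM \<pi> kk)"
  then have z': "z \<in> PiE \<pi> (\<lambda>B. topspace (prod_sp X B))" by (simp add: space_PiM_kk)
  have "z B \<in> A B" if "B \<in> \<pi>" for B
    using z glue_restrict[OF z' that] that by (auto simp: rect_def)
  then show "z \<in> PiE \<pi> A" using z' by (auto simp: PiE_def Pi_def)
next
  fix z assume z: "z \<in> PiE \<pi> A"
  have "A B \<subseteq> topspace (prod_sp X B)" if "B \<in> \<pi>" for B
    using sets.sets_into_space[OF assms[OF that]] by (simp only: space_borel_top)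
  then have z': "z \<in> PiE \<pi> (\<lambda>B. topspace (prod_sp X B))" using z PiE_mono by blast
  have "restrict (glue z) B \<in> A B" if "B \<in> \<pi>" for B
    using z that unfolding glue_restrict[OF z' that] by auto
  then have "glue z \<in> rect A" using glue_topspace[OF z'] unfolding rect_def by blast
  then show "z \<in> glue -` rect A \<inter> space (PiM \<pi> kk)" using z' unfolding space_PiM_kk by blast
qed

lemma PiE_sets: "(\<And>B. B \<in> \<pi> \<Longrightarrow> A B \<in> sets (prod_borel X B)) \<Longrightarrow> PiE \<pi> A \<in> sets (PiM \<pi> kk)"
  by (rule sets_PiM_I_finite[OF finite_pi]) (simp only: sets_kk)

lemma measurable_glue: "glue \<in> measurable (PiM \<pi> kk) (sigma (topspace TT) Rects)"
proof (rule measurable_measure_of[OF Rects_Pow])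
  show "glue \<in> space (PiM \<pi> kk) \<rightarrow> topspace TT"
    using glue_topspace by (auto simp: space_PiM_kk simp del: topspace_product_topology)
  fix R assume "R \<in> Rects"
  then show "glue -` R \<inter> space (PiM \<pi> kk) \<in> sets (PiM \<pi> kk)"
    unfolding Rects_def using glue_vimage_rect PiE_sets by auto
qed

lemma emeasure_PiM_rect:
  assumes "\<And>B. B \<in> \<pi> \<Longrightarrow> A B \<in> sets (prod_borel X B)"
  shows "emeasure nu (rect A) = (\<Prod>B\<in>\<pi>. emeasure (\<kappa> B) (A B))"
proof -
  have "rect A \<in> Rects" using assms by (auto simp: Rects_def)
  then have "emeasure nu (rect A) = emeasure (PiM \<pi> kk) (PiE \<pi> A)"
    unfolding nu_def by (subst emeasure_distr[OF measurable_glue])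
      (simp_all only: sets_sigma_Rects glue_vimage_rect[OF assms] sigma_sets.Basic)
  also have "\<dots> = (\<Prod>B\<in>\<pi>. emeasure (kk B) (A B))"
    by (rule K.emeasure_PiM[OF finite_pi]) (simp add: sets_kk assms)
  finally show ?thesis by (simp add: kk_def)
qed

lemma space_nu: "space nu = topspace TT" and sets_nu: "sets nu = sigma_sets (topspace TT) Rects"
  by (simp_all add: nu_def space_sigma_Rects sets_sigma_Rects del: topspace_product_topology)

lemma finite_nu: "finite_measure nu"
proof
  have "emeasure (\<kappa> B) (topspace (prod_sp X B)) \<noteq> \<infinity>" if "B \<in> \<pi>" for B
    using finite_measure.emeasure_finite[OF finite_radonD(1)[OF radon[OF that]]] by simp
  then have "(\<Prod>B\<in>\<pi>. emeasure (\<kappa> B) (topspace (prod_sp X B))) \<noteq> \<infinity>"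
    by (auto simp: ennreal_prod_eq_top)
  then show "emeasure nu (space nu) \<noteq> \<infinity>"
    using emeasure_PiM_rect[of "\<lambda>B. topspace (prod_sp X B)"] sets.top[of "prod_borel X B" for B]
    by (simp add: space_nu topspace_rect[symmetric] del: topspace_product_topology)
qed

text \<open>A point of \<open>rect A\<close> outside \<open>rect C\<close> leaves \<open>C\<close>
  in some block, so the difference is covered by rectangles with one small side
  \<open>A B - C B\<close> and full sides elsewhere. The tolerance \<open>d\<close> is uniform in
  \<open>A\<close> and \<open>C\<close> and serves inner and outer approximation alike.\<close>

lemma nu_diff_small:
  assumes e: "e > 0"
  obtains d where "d > 0"
    "\<And>A C. (\<And>B. B \<in> \<pi> \<Longrightarrow> A B \<in> sets (prod_borel X B)) \<Longrightarrow> (\<And>B. B \<in> \<pi> \<Longrightarrow> C B \<in> sets (prod_borel X B)) \<Longrightarrow>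
      (\<And>B. B \<in> \<pi> \<Longrightarrow> measure (\<kappa> B) (A B - C B) \<le> d) \<Longrightarrow> measure nu (rect A - rect C) \<le> e"
proof -
  interpret finite_measure nu by (rule finite_nu)
  \<comment> \<open>The total masses are raised to at least 1 so that the product over the remaining
    blocks is bounded by the product over all blocks; \<open>d\<close> then absorbs one such product
    for each block.\<close>
  define k where "k B = max 1 (measure (\<kappa> B) (topspace (prod_sp X B)))" for B
  define d where "d = e / ((card \<pi> + 1) * (\<Prod>B\<in>\<pi>. k B))"
  have k1: "k B \<ge> 1" for B by (simp add: k_def)
  have K1: "(\<Prod>B\<in>\<pi>. k B) \<ge> 1" using k1 by (intro prod_ge_1) auto
  have d: "d > 0" unfolding d_def using e K1 by (intro divide_pos_pos mult_pos_pos) auto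
  have "measure nu (rect A - rect C) \<le> e"
    if A: "\<And>B. B \<in> \<pi> \<Longrightarrow> A B \<in> sets (prod_borel X B)" and C: "\<And>B. B \<in> \<pi> \<Longrightarrow> C B \<in> sets (prod_borel X B)"
      and le: "\<And>B. B \<in> \<pi> \<Longrightarrow> measure (\<kappa> B) (A B - C B) \<le> d" for A C
  proof -
    define D where "D B = (\<lambda>B'. if B' = B then A B - C B else topspace (prod_sp X B'))" for B
    have Ds: "D B B' \<in> sets (prod_borel X B')" if "B \<in> \<pi>" "B' \<in> \<pi>" for B B'
      using A C that sets.top[of "prod_borel X B'"] by (auto simp: D_def)
    have rs: "rect (D B) \<in> sets nu" if "B \<in> \<pi>" for B
      using Ds[OF that] by (auto simp: sets_nu Rects_def)
    have "rect A - rect C \<subseteq> (\<Union>B\<in>\<pi>. rect (D B))"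
      using restrict_topspace by (auto simp: rect_def D_def simp del: topspace_product_topology)
    then have "measure nu (rect A - rect C) \<le> measure nu (\<Union>B\<in>\<pi>. rect (D B))"
      using rs finite_pi by (intro finite_measure_mono) auto
    also have "\<dots> \<le> (\<Sum>B\<in>\<pi>. measure nu (rect (D B)))"
      using rs finite_pi by (intro measure_UNION_le) auto
    also have "\<dots> \<le> (\<Sum>B\<in>\<pi>. d * (\<Prod>B\<in>\<pi>. k B))"
    proof (rule sum_mono)
      fix B assume B: "B \<in> \<pi>"
      have fin: "emeasure (\<kappa> B') E = ennreal (measure (\<kappa> B') E)" if "B' \<in> \<pi>" for B' E
        by (rule finite_measure.emeasure_eq_measure[OF finite_radonD(1)[OF radon[OF that]]])
      have "emeasure nu (rect (D B)) = (\<Prod>B'\<in>\<pi>. ennreal (measure (\<kappa> B') (D B B')))"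
        using emeasure_PiM_rect[of "D B"] Ds[OF B] fin by simp
      then have "measure nu (rect (D B)) = (\<Prod>B'\<in>\<pi>. measure (\<kappa> B') (D B B'))"
        by (simp add: emeasure_eq_measure prod_ennreal prod_nonneg)
      also have "\<dots> = measure (\<kappa> B) (A B - C B) * (\<Prod>B'\<in>\<pi> - {B}. measure (\<kappa> B') (D B B'))"
        by (subst prod.remove[OF finite_pi B]) (simp add: D_def)
      also have "\<dots> \<le> d * (\<Prod>B'\<in>\<pi> - {B}. k B')"
        using le[OF B] d by (intro mult_mono prod_mono) (auto simp: D_def k_def prod_nonneg)
      also have "\<dots> \<le> d * (k B * (\<Prod>B'\<in>\<pi> - {B}. k B'))"
      proof (rule mult_left_mono)
        have "0 \<le> (\<Prod>B'\<in>\<pi> - {B}. k B')" using order_trans[OF zero_le_one k1] by (intro prod_nonneg) auto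
        from mult_right_mono[OF k1 this] show "(\<Prod>B'\<in>\<pi> - {B}. k B') \<le> k B * (\<Prod>B'\<in>\<pi> - {B}. k B')" by simp
      qed (use d in simp)
      also have "k B * (\<Prod>B'\<in>\<pi> - {B}. k B') = (\<Prod>B\<in>\<pi>. k B)"
        by (rule prod.remove[OF finite_pi B, symmetric])
      finally show "measure nu (rect (D B)) \<le> d * (\<Prod>B\<in>\<pi>. k B)" .
    qed
    also have "\<dots> \<le> (card \<pi> + 1) * (\<Prod>B\<in>\<pi>. k B) * d" using d K1 by (simp add: algebra_simps)
    also have "\<dots> = e" unfolding d_def using K1 by simp
    finally show ?thesis .
  qed
  then show thesis using d that by blast
qed

lemma inner_rect:
  assumes A: "\<And>B. B \<in> \<pi> \<Longrightarrow> A B \<in> sets (prod_borel X B)" and e: "e > 0"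
  obtains C where "\<And>B. B \<in> \<pi> \<Longrightarrow> C B \<in> sets (prod_borel X B)" "compactin TT (rect C)" "rect C \<subseteq> rect A"
    "measure nu (rect A - rect C) \<le> e"
proof -
  obtain d where d: "d > 0" and le:
    "\<And>A C. (\<And>B. B \<in> \<pi> \<Longrightarrow> A B \<in> sets (prod_borel X B)) \<Longrightarrow> (\<And>B. B \<in> \<pi> \<Longrightarrow> C B \<in> sets (prod_borel X B)) \<Longrightarrow>
      (\<And>B. B \<in> \<pi> \<Longrightarrow> measure (\<kappa> B) (A B - C B) \<le> d) \<Longrightarrow> measure nu (rect A - rect C) \<le> e"
    using nu_diff_small[OF e] by metis
  have "\<exists>C. compactin (prod_sp X B) C \<and> C \<subseteq> A B \<and> measure (\<kappa> B) (A B) \<le> measure (\<kappa> B) C + d" if "B \<in> \<pi>" for B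
    using finite_radon_compact[OF radon[OF that] _ d] A[OF that] finite_radonD(2)[OF radon[OF that]] by metis
  then obtain C where C: "\<And>B. B \<in> \<pi> \<Longrightarrow> compactin (prod_sp X B) (C B)" "\<And>B. B \<in> \<pi> \<Longrightarrow> C B \<subseteq> A B"
    "\<And>B. B \<in> \<pi> \<Longrightarrow> measure (\<kappa> B) (A B) \<le> measure (\<kappa> B) (C B) + d" by metis
  have Cs: "C B \<in> sets (prod_borel X B)" if "B \<in> \<pi>" for B
    by (rule compactin_sets_borel_top[OF haus_block[OF that] C(1)[OF that]])
  have "measure (\<kappa> B) (A B - C B) \<le> d" if "B \<in> \<pi>" for B
    using finite_measure.finite_measure_Diff[OF finite_radonD(1)[OF radon[OF that]], of "A B" "C B"]
      A[OF that] Cs[OF that] finite_radonD(2)[OF radon[OF that]] C(2,3)[OF that] by simp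
  then have "measure nu (rect A - rect C) \<le> e" by (intro le A Cs)
  then show thesis by (intro that[OF Cs compactin_rect[OF C(1)] rect_mono[OF C(2)]])
qed

sublocale E: radon_extension TT nu open_rects
proof (rule radon_extension.intro[OF haus_TT finite_nu space_nu base_of_open_rects])
  show "open_rects \<subseteq> sets nu" using open_rects_Rects unfolding sets_nu by auto
  fix W and e :: real assume W: "W \<in> open_rects" and e: "e > 0"
  then obtain A where A: "W = rect A" "\<And>B. B \<in> \<pi> \<Longrightarrow> openin (prod_sp X B) (A B)"
    unfolding open_rects_def by auto
  obtain C where C: "\<And>B. B \<in> \<pi> \<Longrightarrow> C B \<in> sets (prod_borel X B)" "compactin TT (rect C)" "rect C \<subseteq> rect A"
    "measure nu (rect A - rect C) \<le> e"
    using inner_rect[OF openin_sets_borel_top[OF A(2)] e] by metis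
  have "rect C \<in> sets nu" unfolding sets_nu Rects_def using C(1) by (intro sigma_sets.Basic) blast
  then show "\<exists>C. compactin TT C \<and> C \<in> sets nu \<and> C \<subseteq> W \<and> measure nu (W - C) \<le> e"
    using A(1) C by blast
qed

text \<open>The extension is controlled by construction on finite unions of open rectangles only. A
  general rectangle is enclosed by an open one from outside and approximated by a compact one from
  inside, block by block.\<close>

lemma emeasure_ext_rect:
  assumes A: "\<And>B. B \<in> \<pi> \<Longrightarrow> A B \<in> sets (prod_borel X B)"
  shows "emeasure E.ext (rect A) = (\<Prod>B\<in>\<pi>. emeasure (\<kappa> B) (A B))"
proof -
  interpret ext: finite_measure E.ext by (rule E.finite_measure_ext)
  have RA: "rect A \<in> sets nu" "rect A \<in> sets E.ext"
    using A Rects_borel by (auto simp: sets_nu Rects_def E.sets_ext)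
  have "measure E.ext (rect A) \<le> measure nu (rect A) + e" if e: "e > 0" for e
  proof -
    obtain d where d: "d > 0" and le:
      "\<And>A C. (\<And>B. B \<in> \<pi> \<Longrightarrow> A B \<in> sets (prod_borel X B)) \<Longrightarrow> (\<And>B. B \<in> \<pi> \<Longrightarrow> C B \<in> sets (prod_borel X B)) \<Longrightarrow>
        (\<And>B. B \<in> \<pi> \<Longrightarrow> measure (\<kappa> B) (A B - C B) \<le> d) \<Longrightarrow> measure nu (rect A - rect C) \<le> e"
      using nu_diff_small[OF e] by metis
    have "\<exists>U. openin (prod_sp X B) U \<and> A B \<subseteq> U \<and> measure (\<kappa> B) U \<le> measure (\<kappa> B) (A B) + d" if "B \<in> \<pi>" for B
      using finite_radon_open[OF haus_block[OF that] radon[OF that] _ d] A[OF that] finite_radonD(2)[OF radon[OF that]] by metis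
    then obtain U where U: "\<And>B. B \<in> \<pi> \<Longrightarrow> openin (prod_sp X B) (U B)" "\<And>B. B \<in> \<pi> \<Longrightarrow> A B \<subseteq> U B"
      "\<And>B. B \<in> \<pi> \<Longrightarrow> measure (\<kappa> B) (U B) \<le> measure (\<kappa> B) (A B) + d" by metis
    have Us: "U B \<in> sets (prod_borel X B)" if "B \<in> \<pi>" for B by (rule openin_sets_borel_top[OF U(1)[OF that]])
    have "measure (\<kappa> B) (U B - A B) \<le> d" if "B \<in> \<pi>" for B
      using finite_measure.finite_measure_Diff[OF finite_radonD(1)[OF radon[OF that]], of "U B" "A B"]
        A[OF that] Us[OF that] finite_radonD(2)[OF radon[OF that]] U(2,3)[OF that] by simp
    then have small: "measure nu (rect U - rect A) \<le> e" by (intro le A Us)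
    have sub: "rect A \<subseteq> rect U" by (rule rect_mono[OF U(2)])
    have RU: "rect U \<in> open_rects" "rect U \<in> sets nu" "rect U \<in> sets E.ext"
    proof -
      show "rect U \<in> open_rects" using U(1) unfolding open_rects_def by blast
      then have "rect U \<in> Rects" using open_rects_Rects by blast
      then show "rect U \<in> sets nu" "rect U \<in> sets E.ext"
        using Rects_borel by (auto simp only: sets_nu E.sets_ext intro: sigma_sets.Basic)
    qed
    have "emeasure E.ext (rect U) = emeasure nu (rect U)" using E.emeasure_ext_Union[of "{rect U}"] RU by simp
    then have "measure E.ext (rect U) = measure nu (rect U)" by (simp add: measure_def)
    then show ?thesis
      using ext.finite_measure_mono[OF sub] RU small E.finite_measure_Diff[OF RU(2) RA(1) sub] by simp
  qed
  then have 1: "measure E.ext (rect A) \<le> measure nu (rect A)" by (rule field_le_epsilon)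
  have "measure nu (rect A) \<le> measure E.ext (rect A) + e" if e: "e > 0" for e
  proof -
    obtain C where C: "\<And>B. B \<in> \<pi> \<Longrightarrow> C B \<in> sets (prod_borel X B)" "compactin TT (rect C)" "rect C \<subseteq> rect A"
      "measure nu (rect A - rect C) \<le> e"
      using inner_rect[OF A e] by metis
    have RC: "rect C \<in> sets nu" using C(1) by (auto simp: sets_nu Rects_def)
    have "measure nu (rect C) \<le> measure E.ext (rect C)"
      using E.emeasure_ext_compact[OF C(2) RC] by (simp add: E.emeasure_eq_measure ext.emeasure_eq_measure)
    also have "\<dots> \<le> measure E.ext (rect A)" by (rule ext.finite_measure_mono[OF C(3) RA(2)])
    finally show ?thesis using E.finite_measure_Diff[OF RA(1) RC C(3)] C(4) by simp
  qed
  then have "measure nu (rect A) \<le> measure E.ext (rect A)" by (rule field_le_epsilon)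
  with 1 have "emeasure E.ext (rect A) = emeasure nu (rect A)"
    by (simp add: E.emeasure_eq_measure ext.emeasure_eq_measure)
  then show ?thesis by (simp add: emeasure_PiM_rect[OF A])
qed

definition is_prod where
  "is_prod \<rho> \<longleftrightarrow> finite_radon TT \<rho> \<and>
    (\<forall>A. (\<forall>B\<in>\<pi>. A B \<in> sets (prod_borel X B)) \<longrightarrow> emeasure \<rho> (rect A) = (\<Prod>B\<in>\<pi>. emeasure (\<kappa> B) (A B)))"

lemma is_prod_ext: "is_prod E.ext"
  unfolding is_prod_def using E.finite_radon_ext emeasure_ext_rect by blast

lemma sigma_Rects_eqI:
  assumes m: "finite_measure m" "space m = topspace TT" "sigma_sets (topspace TT) Rects \<subseteq> sets m"
    and m': "finite_measure m'" "space m' = topspace TT" "sigma_sets (topspace TT) Rects \<subseteq> sets m'"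
    and eq: "\<And>A. (\<And>B. B \<in> \<pi> \<Longrightarrow> A B \<in> sets (prod_borel X B)) \<Longrightarrow> emeasure m (rect A) = emeasure m' (rect A)"
    and W: "W \<in> sigma_sets (topspace TT) Rects"
  shows "emeasure m W = emeasure m' W"
proof -
  let ?N = "sigma (topspace TT) Rects"
  \<comment> \<open>The two measures may live on larger, different sigma-algebras; the identity map
    pushes both to the one generated by rectangles, where the uniqueness theorem for
    intersection-stable generators applies.\<close>
  have em: "emeasure (distr \<rho> ?N (\<lambda>x. x)) R = emeasure \<rho> R"
    if \<rho>: "space \<rho> = topspace TT" "sigma_sets (topspace TT) Rects \<subseteq> sets \<rho>" and R: "R \<in> sigma_sets (topspace TT) Rects" for \<rho> R
  proof -
    have id: "(\<lambda>x. x) \<in> measurable \<rho> ?N"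
    proof (rule measurableI)
      fix R assume "R \<in> sets ?N"
      then have R: "R \<in> sets \<rho>" using \<rho>(2) by (auto simp only: sets_sigma_Rects)
      then have "(\<lambda>x. x) -` R \<inter> space \<rho> = R" using sets.sets_into_space by auto
      then show "(\<lambda>x. x) -` R \<inter> space \<rho> \<in> sets \<rho>" using R by simp
    qed (simp only: space_sigma_Rects \<rho>(1))
    have "R \<in> sets ?N" using R by (simp only: sets_sigma_Rects)
    moreover from this have "R \<subseteq> space \<rho>"
      using sets.sets_into_space[of R ?N] \<rho>(1) by (simp only: space_sigma_Rects)
    ultimately show ?thesis using emeasure_distr[OF id, of R] by (simp add: Int_absorb2)
  qed
  have "distr m ?N (\<lambda>x. x) = distr m' ?N (\<lambda>x. x)"
  proof (rule measure_eqI_generator_eq[OF Rects_Int_stable Rects_Pow, where A = "\<lambda>_. topspace TT"])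
    fix R assume R: "R \<in> Rects"
    then obtain A where A: "R = rect A" "\<And>B. B \<in> \<pi> \<Longrightarrow> A B \<in> sets (prod_borel X B)" unfolding Rects_def by auto
    have Rs: "R \<in> sigma_sets (topspace TT) Rects" using R by (rule sigma_sets.Basic)
    show "emeasure (distr m ?N (\<lambda>x. x)) R = emeasure (distr m' ?N (\<lambda>x. x)) R"
      unfolding em[OF m(2,3) Rs] em[OF m'(2,3) Rs] unfolding A(1) by (rule eq[OF A(2)])
  next
    show "emeasure (distr m ?N (\<lambda>x. x)) (topspace TT) \<noteq> \<infinity>"
      using em[OF m(2,3) sigma_sets_top] finite_measure.emeasure_finite[OF m(1)] by simp
  qed (use topspace_Rects in \<open>auto simp: sets_sigma_Rects simp del: topspace_product_topology\<close>)
  then show ?thesis using em[OF m(2,3) W] em[OF m'(2,3) W] by simp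
qed

lemma finite_radon_sigma_Rects:
  assumes "finite_radon TT \<rho>"
  shows "sigma_sets (topspace TT) Rects \<subseteq> sets \<rho>"
  using sigma_Rects_borel finite_radonD(2)[OF assms] by blast

lemma is_prod_nu:
  assumes "is_prod \<rho>" "W \<in> sigma_sets (topspace TT) Rects"
  shows "emeasure \<rho> W = emeasure nu W"
proof (rule sigma_Rects_eqI[OF _ _ _ finite_nu space_nu _ _ assms(2)])
  have fr: "finite_radon TT \<rho>" using assms(1) unfolding is_prod_def by (rule conjunct1)
  show "finite_measure \<rho>" "space \<rho> = topspace TT" "sigma_sets (topspace TT) Rects \<subseteq> sets \<rho>"
    using finite_radonD[OF fr] finite_radon_sigma_Rects[OF fr] by blast+
  show "sigma_sets (topspace TT) Rects \<subseteq> sets nu" by (simp only: sets_nu order_refl)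
  fix A assume A: "\<And>B. B \<in> \<pi> \<Longrightarrow> A B \<in> sets (prod_borel X B)"
  have "emeasure \<rho> (rect A) = (\<Prod>B\<in>\<pi>. emeasure (\<kappa> B) (A B))" using assms(1) A unfolding is_prod_def by blast
  then show "emeasure \<rho> (rect A) = emeasure nu (rect A)" using emeasure_PiM_rect[OF A] by simp
qed

lemma open_rects_Union: "finite \<F> \<Longrightarrow> \<F> \<subseteq> open_rects \<Longrightarrow> \<Union>\<F> \<in> sigma_sets (topspace TT) Rects"
  using E.Union_sets unfolding sets_nu .

text \<open>Agreement on rectangles extends to the generated sigma-algebra, which contains finite
  unions of open rectangles; regularity does the rest, even for Borel sets outside that
  sigma-algebra.\<close>

lemma finite_radon_eq_on_rects:
  assumes \<rho>: "finite_radon TT \<rho>" "finite_radon TT \<rho>'"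
    and eq: "\<And>A. (\<And>B. B \<in> \<pi> \<Longrightarrow> A B \<in> sets (prod_borel X B)) \<Longrightarrow> emeasure \<rho> (rect A) = emeasure \<rho>' (rect A)"
  shows "\<rho> = \<rho>'"
proof (rule finite_radon_eq_from_base[OF haus_TT base_of_open_rects \<rho>])
  fix \<F> assume "finite \<F>" "\<F> \<subseteq> open_rects"
  then have W: "\<Union>\<F> \<in> sigma_sets (topspace TT) Rects" by (rule open_rects_Union)
  have "emeasure \<rho> (\<Union>\<F>) = emeasure \<rho>' (\<Union>\<F>)"
    by (rule sigma_Rects_eqI[OF finite_radonD(1,3)[OF \<rho>(1)] finite_radon_sigma_Rects[OF \<rho>(1)]
          finite_radonD(1,3)[OF \<rho>(2)] finite_radon_sigma_Rects[OF \<rho>(2)] eq W])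
  then show "measure \<rho> (\<Union>\<F>) = measure \<rho>' (\<Union>\<F>)" by (simp only: measure_def)
qed

lemma is_prod_unique:
  assumes "is_prod \<rho>" "is_prod \<rho>'"
  shows "\<rho> = \<rho>'"
  by (rule finite_radon_eq_on_rects) (use assms in \<open>simp_all add: is_prod_def\<close>)

lemma radon_product_eqI:
  assumes "is_prod \<rho>"
  shows "radon_product X \<pi> \<kappa> = \<rho>"
  unfolding radon_product_def
proof (rule the_equality)
  show "radon_measure TT \<rho> \<and> (\<forall>A. (\<forall>B\<in>\<pi>. A B \<in> sets (prod_borel X B)) \<longrightarrow>
     emeasure \<rho> {x \<in> topspace TT. \<forall>B\<in>\<pi>. restrict x B \<in> A B} = (\<Prod>B\<in>\<pi>. emeasure (\<kappa> B) (A B)))"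
    using assms finite_radon_imp_radon_measure[OF haus_TT] unfolding is_prod_def rect_def by blast
next
  fix \<rho>' assume \<rho>': "radon_measure TT \<rho>' \<and> (\<forall>A. (\<forall>B\<in>\<pi>. A B \<in> sets (prod_borel X B)) \<longrightarrow>
     emeasure \<rho>' {x \<in> topspace TT. \<forall>B\<in>\<pi>. restrict x B \<in> A B} = (\<Prod>B\<in>\<pi>. emeasure (\<kappa> B) (A B)))"
  then have r: "emeasure \<rho>' (rect A) = (\<Prod>B\<in>\<pi>. emeasure (\<kappa> B) (A B))" if "\<forall>B\<in>\<pi>. A B \<in> sets (prod_borel X B)" for A
    using that unfolding rect_def by blast
  have tops: "\<forall>B\<in>\<pi>. topspace (prod_sp X B) \<in> sets (prod_borel X B)"
    by (intro ballI openin_sets_borel_top openin_topspace)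
  have rm: "radon_measure TT \<rho>'" using \<rho>' by (rule conjunct1)
  \<comment> \<open>A competitor is known only as a \<open>radon_measure\<close>; its total mass is
    the prescribed value on the full rectangle, which makes it finite.\<close>
  have "emeasure \<rho>' (topspace TT) = emeasure nu (topspace TT)"
    unfolding topspace_rect by (subst r[OF tops], rule emeasure_PiM_rect[symmetric], rule bspec[OF tops])
  moreover have "space \<rho>' = topspace TT" using rm unfolding radon_measure_def by (rule conjunct1)
  ultimately have "emeasure \<rho>' (space \<rho>') \<noteq> \<infinity>"
    using finite_measure.emeasure_finite[OF finite_nu, of "topspace TT"] by (simp only: infinity_ennreal_def not_False_eq_True)
  then have "finite_measure \<rho>'" by (rule finite_measureI)
  from radon_measure_imp_finite_radon[OF this rm] have "is_prod \<rho>'" unfolding is_prod_def using r by blast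
  then show "\<rho>' = \<rho>" using assms by (rule is_prod_unique)
qed

lemma is_prod_radon_product: "is_prod (radon_product X \<pi> \<kappa>)"
  using radon_product_eqI[OF is_prod_ext] is_prod_ext by simp

lemma emeasure_radon_product_PiM:
  assumes "W \<in> sigma_sets (topspace TT) Rects"
  shows "emeasure (radon_product X \<pi> \<kappa>) W = emeasure (PiM \<pi> kk) (glue -` W \<inter> space (PiM \<pi> kk))"
  unfolding is_prod_nu[OF is_prod_radon_product assms] unfolding nu_def
  by (rule emeasure_distr[OF measurable_glue]) (simp only: assms sets_sigma_Rects)

end

section \<open>Measurability of parameter integrals of continuous functions\<close>

lemma compact_exhaustion:
  assumes T: "Hausdorff_space T" and m: "finite_radon T m"
  obtains D :: "nat \<Rightarrow> 'p set" where "\<forall>j. compactin T (D j)" "incseq D" "AE x in m. x \<in> (\<Union>j. D j)"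
proof -
  interpret finite_measure m by (rule finite_radonD[OF m])
  have "\<exists>C. compactin T C \<and> C \<subseteq> space m \<and> measure m (space m) \<le> measure m C + inverse (real (Suc j))" for j
    using finite_radon_compact[OF m sets.top, of "inverse (real (Suc j))"] by (metis inverse_positive_iff_positive of_nat_0_less_iff zero_less_Suc)
  then obtain C where C: "\<And>j. compactin T (C j)" "\<And>j. C j \<subseteq> space m"
    "\<And>j. measure m (space m) \<le> measure m (C j) + inverse (real (Suc j))" by metis
  define D where "D j = (\<Union>i\<in>{..j}. C i)" for j
  have Dc: "compactin T (D j)" for j
    unfolding D_def by (rule compactin_Union) (auto simp: C(1))
  have Ds: "D j \<in> sets m" for j
    using compactin_sets_borel_top[OF T Dc] finite_radonD(2)[OF m] by simp
  have Dsub: "D j \<subseteq> space m" for j using C(2) by (auto simp: D_def)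
  have "measure m (space m - (\<Union>j. D j)) \<le> inverse (real (Suc j))" for j
  proof -
    have "measure m (space m - (\<Union>j. D j)) \<le> measure m (space m - C j)"
      using C(1) compactin_sets_borel_top[OF T] finite_radonD(2)[OF m] by (intro finite_measure_mono) (auto simp: D_def)
    also have "\<dots> = measure m (space m) - measure m (C j)"
      using C(1) compactin_sets_borel_top[OF T] finite_radonD(2)[OF m] by (intro finite_measure_compl) auto
    finally show ?thesis using C(3)[of j] by simp
  qed
  then have "measure m (space m - (\<Union>j. D j)) \<le> 0"
    by (intro LIMSEQ_le_const[OF LIMSEQ_inverse_real_of_nat]) auto
  then have "measure m (space m - (\<Union>j. D j)) = 0" using measure_nonneg[of m] by (simp add: order_antisym)
  then have "emeasure m (space m - (\<Union>j. D j)) = 0" by (simp add: emeasure_eq_measure)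
  moreover have "space m - (\<Union>j. D j) \<in> sets m" using Ds by auto
  ultimately have "AE x in m. x \<in> (\<Union>j. D j)"
    by (intro AE_I[where N = "space m - (\<Union>j. D j)"]) auto
  moreover have "incseq D" unfolding incseq_def D_def by (intro allI impI UN_mono) auto
  ultimately show thesis using Dc by (intro that) auto
qed

lemma continuous_map_slice:
  assumes "continuous_map (prod_topology T1 T2) T3 (\<lambda>(u, v). f u v)" "v \<in> topspace T2"
  shows "continuous_map T1 T3 (\<lambda>u. f u v)"
proof -
  have "continuous_map T1 (prod_topology T1 T2) (\<lambda>u. (u, v))"
    using assms(2) by (simp add: continuous_map_paired)
  from continuous_map_compose[OF this assms(1)] show ?thesis by (simp add: comp_def)
qed

text \<open>The integral is lower semicontinuous in the parameter: it is a supremum of integrals over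
  compact sets, on which the integrand is uniformly close to its value at the parameter.\<close>

lemma borel_measurable_nn_integral_continuous:
  assumes T: "Hausdorff_space T1" and m: "finite_radon T1 m"
    and f: "continuous_map (prod_topology T1 T2) euclideanreal (\<lambda>(u, v). f u v)"
    and nn: "\<And>u v. 0 \<le> f u v"
  shows "(\<lambda>v. \<integral>\<^sup>+u. ennreal (f u v) \<partial>m) \<in> borel_measurable (borel_top T2)"
proof (rule borel_measurableI_greater)
  interpret finite_measure m by (rule finite_radonD[OF m])
  have sp: "space m = topspace T1" and st: "sets m = sets (borel_top T1)" using finite_radonD[OF m] by auto
  let ?g = "\<lambda>v. \<integral>\<^sup>+u. ennreal (f u v) \<partial>m"
  have meas: "(\<lambda>u. f u v) \<in> borel_measurable m" if "v \<in> topspace T2" for v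
    using continuous_map_borel_measurable[OF continuous_map_slice[OF f that]]
    by (simp add: measurable_cong_sets[OF st refl])
  obtain D where D0: "\<forall>j. compactin T1 (D j)" "incseq D" "AE x in m. x \<in> (\<Union>j. D j)"
    using compact_exhaustion[OF T m] .
  note D = spec[OF D0(1)] D0(2,3)
  have Ds: "D j \<in> sets m" for j using compactin_sets_borel_top[OF T D(1)] st by simp
  fix y :: ennreal
  have "\<exists>V. openin T2 V \<and> v0 \<in> V \<and> V \<subseteq> {v \<in> topspace T2. y < ?g v}"
    if v0: "v0 \<in> topspace T2" and y: "y < ?g v0" for v0
  proof -
    have mono: "incseq (\<lambda>j u. ennreal (f u v0) * indicator (D j) u)"
      using D(2) by (auto simp: incseq_def le_fun_def indicator_def split: if_splits)
    have "?g v0 = (\<integral>\<^sup>+u. (SUP j. ennreal (f u v0) * indicator (D j) u) \<partial>m)"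
    proof (rule nn_integral_cong_AE)
      show "AE u in m. ennreal (f u v0) = (SUP j. ennreal (f u v0) * indicator (D j) u)"
        using D(3)
      proof (rule AE_mp, intro AE_I2 impI)
        fix u assume "u \<in> (\<Union>j. D j)"
        then obtain j where j: "u \<in> D j" by auto
        show "ennreal (f u v0) = (SUP j. ennreal (f u v0) * indicator (D j) u)"
        proof (rule antisym)
          show "ennreal (f u v0) \<le> (SUP j. ennreal (f u v0) * indicator (D j) u)"
            by (rule SUP_upper2[of j]) (use j in auto)
          show "(SUP j. ennreal (f u v0) * indicator (D j) u) \<le> ennreal (f u v0)"
            by (rule SUP_least) (auto simp: indicator_def)
        qed
      qed
    qed
    also have "\<dots> = (SUP j. \<integral>\<^sup>+u. ennreal (f u v0) * indicator (D j) u \<partial>m)"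
      by (rule nn_integral_monotone_convergence_SUP[OF mono]) (use meas[OF v0] Ds in measurable)
    finally obtain j where j: "y < (\<integral>\<^sup>+u. ennreal (f u v0) * indicator (D j) u \<partial>m)"
      using y by (auto simp: less_SUP_iff)
    let ?I = "\<integral>\<^sup>+u. ennreal (f u v0) * indicator (D j) u \<partial>m"
    obtain e :: real where e: "e > 0" "y + ennreal e < ?I"
    proof -
      obtain z where z: "y < z" "z < ?I" using dense[OF j] by blast
      have "y < top" "z < top" using z by (auto intro: order.strict_trans2 simp: less_top top.not_eq_extremum)
      then obtain a b where ab: "y = ennreal a" "0 \<le> a" "z = ennreal b" "0 \<le> b"
        by (metis ennreal_cases less_irrefl)
      have "a < b" using z(1) ab by (simp add: ennreal_less_iff)
      moreover from this have "y + ennreal (b - a) = z" using ab by (simp flip: ennreal_plus)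
      ultimately show thesis using z(2) by (intro that[of "b - a"]) auto
    qed
    \<comment> \<open>A uniform error \<open>d\<close> of the integrand then costs at most
      \<open>e\<close> in the integral over the whole space.\<close>
    define d where "d = e / (measure m (space m) + 1)"
    have d: "d > 0" using e(1) by (simp add: d_def add_nonneg_pos)
    have dm: "d * measure m (space m) \<le> e"
    proof -
      have "d * measure m (space m) \<le> d * (measure m (space m) + 1)" using d by (intro mult_left_mono) auto
      also have "\<dots> = e" using measure_nonneg[of m "space m"] by (simp add: d_def add_nonneg_eq_0_iff)
      finally show ?thesis .
    qed
    let ?h = "\<lambda>(u, v). \<bar>f u v - f u v0\<bar>"
    have slice: "continuous_map (prod_topology T1 T2) euclideanreal (\<lambda>(u, v). f u v0)"
      using continuous_map_compose[OF continuous_map_fst continuous_map_slice[OF f v0], of T2]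
      by (simp add: comp_def case_prod_unfold)
    have "continuous_map (prod_topology T1 T2) euclideanreal (\<lambda>p. \<bar>(\<lambda>(u, v). f u v) p - (\<lambda>(u, v). f u v0) p\<bar>)"
      using f slice by (intro continuous_intros)
    then have h: "continuous_map (prod_topology T1 T2) euclideanreal ?h" by (simp add: case_prod_unfold)
    let ?W = "{p \<in> topspace (prod_topology T1 T2). ?h p \<in> {..<d}}"
    have W: "openin (prod_topology T1 T2) ?W"
      by (rule openin_continuous_map_preimage[OF h]) (simp add: open_lessThan)
    have "D j \<times> {v0} \<subseteq> ?W" using compactin_subset_topspace[OF D(1)] v0 d by auto
    \<comment> \<open>The tube lemma makes the error smaller than \<open>d\<close> on all of the
      compact \<open>D j\<close> for every \<open>v\<close> in one neighbourhood of
      \<open>v0\<close>.\<close>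
    from tube_lemma_left[OF W D(1) v0 this] obtain U V where UV: "openin T2 V" "D j \<subseteq> U" "v0 \<in> V" "U \<times> V \<subseteq> ?W" by blast
    have "y < ?g v" if v: "v \<in> V" for v
    proof (rule ccontr)
      assume "\<not> y < ?g v"
      then have le: "?g v \<le> y" by simp
      have vT: "v \<in> topspace T2" using UV(1) v openin_subset by blast
      have "?I \<le> (\<integral>\<^sup>+u. ennreal (f u v) + ennreal d \<partial>m)"
      proof (rule nn_integral_mono)
        fix u
        show "ennreal (f u v0) * indicator (D j) u \<le> ennreal (f u v) + ennreal d"
        proof (cases "u \<in> D j")
          case True
          then have "(u, v) \<in> ?W" using UV v by blast
          then have "f u v0 \<le> f u v + d" by auto
          then show ?thesis using True nn d by (simp flip: ennreal_plus)
        qed simp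
      qed
      also have "\<dots> = ?g v + ennreal d * emeasure m (space m)"
        using meas[OF vT] by (subst nn_integral_add) auto
      also have "ennreal d * emeasure m (space m) = ennreal (d * measure m (space m))"
        using d by (simp add: emeasure_eq_measure ennreal_mult)
      also have "?g v + ennreal (d * measure m (space m)) \<le> y + ennreal e"
        by (intro add_mono le ennreal_leI dm)
      finally show False using e(2) by (simp add: leD)
    qed
    then have "V \<subseteq> {v \<in> topspace T2. y < ?g v}" using openin_subset[OF UV(1)] by auto
    then show ?thesis using UV by blast
  qed
  then have "openin T2 {v \<in> topspace T2. y < ?g v}" by (subst openin_subopen) blast
  then show "{v \<in> space (borel_top T2). y < ?g v} \<in> sets (borel_top T2)"
    by (simp add: openin_sets_borel_top)
qed

lemma borel_measurable_integral_continuous: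
  assumes T: "Hausdorff_space T1" and m: "finite_radon T1 m"
    and f: "continuous_map (prod_topology T1 T2) euclideanreal (\<lambda>(u, v). f u v)"
    and int: "\<And>v. v \<in> topspace T2 \<Longrightarrow> integrable m (\<lambda>u. f u v)"
  shows "(\<lambda>v. \<integral>u. f u v \<partial>m) \<in> borel_measurable (borel_top T2)"
proof -
  have fm: "continuous_map (prod_topology T1 T2) euclideanreal (\<lambda>p. - (\<lambda>(u, v). f u v) p)"
    by (rule continuous_map_minus[OF f])
  have "continuous_map (prod_topology T1 T2) euclideanreal (\<lambda>p. max 0 ((\<lambda>(u, v). f u v) p))"
    by (intro continuous_map_real_max f continuous_map_const[THEN iffD2]) auto
  then have p: "continuous_map (prod_topology T1 T2) euclideanreal (\<lambda>(u, v). max 0 (f u v))"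
    by (simp add: case_prod_unfold)
  have "continuous_map (prod_topology T1 T2) euclideanreal (\<lambda>p. max 0 (- (\<lambda>(u, v). f u v) p))"
    by (intro continuous_map_real_max fm continuous_map_const[THEN iffD2]) auto
  then have q: "continuous_map (prod_topology T1 T2) euclideanreal (\<lambda>(u, v). max 0 (- f u v))"
    by (simp add: case_prod_unfold)
  have "(\<lambda>v. enn2real (\<integral>\<^sup>+u. ennreal (max 0 (f u v)) \<partial>m) - enn2real (\<integral>\<^sup>+u. ennreal (max 0 (- f u v)) \<partial>m))
      \<in> borel_measurable (borel_top T2)"
    using borel_measurable_nn_integral_continuous[OF T m p] borel_measurable_nn_integral_continuous[OF T m q]
    by (intro borel_measurable_diff measurable_compose[OF _ borel_measurable_enn2real]) auto
  moreover have "(\<integral>u. f u v \<partial>m) = enn2real (\<integral>\<^sup>+u. ennreal (max 0 (f u v)) \<partial>m) - enn2real (\<integral>\<^sup>+u. ennreal (max 0 (- f u v)) \<partial>m)"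
    if "v \<in> space (borel_top T2)" for v
  proof -
    have e: "ennreal (max 0 x) = ennreal x" for x :: real by (cases "0 \<le> x") (auto simp: max_def ennreal_neg)
    show ?thesis using real_lebesgue_integral_def[OF int[of v]] that by (simp add: e)
  qed
  ultimately show ?thesis by (subst measurable_cong) auto
qed

text \<open>If each factor is dominated by a sum, the product is dominated by the expanded product
  of sums, indexed by choice functions. The claim is about integrals and not only about sets because
  in the induction the inner integral over the new coordinate becomes the next integrand.\<close>

lemma nn_integral_PiM_le:
  fixes \<kappa> :: "'i \<Rightarrow> 'p measure" and \<kappa>' :: "'i \<Rightarrow> 't \<Rightarrow> 'p measure"
  assumes sf: "\<And>i. sigma_finite_measure (\<kappa> i)" "\<And>i t. sigma_finite_measure (\<kappa>' i t)"
    and s: "\<And>i t. sets (\<kappa>' i t) = sets (\<kappa> i)"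
    and I: "finite I" "\<And>i. i \<in> I \<Longrightarrow> finite (T i)"
    and le: "\<And>i A. i \<in> I \<Longrightarrow> A \<in> sets (\<kappa> i) \<Longrightarrow> emeasure (\<kappa> i) A \<le> c * (\<Sum>t\<in>T i. emeasure (\<kappa>' i t) A)"
    and f: "f \<in> borel_measurable (PiM I \<kappa>)"
  shows "(\<integral>\<^sup>+z. f z \<partial>PiM I \<kappa>) \<le> c ^ card I * (\<Sum>ch\<in>PiE I T. \<integral>\<^sup>+z. f z \<partial>PiM I (\<lambda>i. \<kappa>' i (ch i)))"
  using I le f
proof (induction I arbitrary: f rule: finite_induct)
  case empty
  have "PiM {} (\<lambda>i. \<kappa>' i undefined) = PiM {} \<kappa>" by (rule PiM_cong) auto
  then show ?case by (simp add: PiM_empty)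
next
  case (insert i I)
  interpret K: product_sigma_finite \<kappa> by (rule product_sigma_finite.intro) (rule sf)
  have K': "product_sigma_finite (\<lambda>i. \<kappa>' i (ch i))" for ch by (rule product_sigma_finite.intro) (rule sf)
  have sP: "sets (PiM J (\<lambda>i. \<kappa>' i (ch i))) = sets (PiM J \<kappa>)" for J ch by (rule sets_PiM_cong) (auto simp: s)
  note f = insert.prems(3)
  have fyx: "(\<lambda>(z, y). f (z(i := y))) \<in> borel_measurable (PiM I \<kappa> \<Otimes>\<^sub>M \<kappa>' i t)" for t
  proof -
    have s1: "sets (PiM I \<kappa> \<Otimes>\<^sub>M \<kappa>' i t) = sets (PiM I \<kappa> \<Otimes>\<^sub>M \<kappa> i)" by (rule sets_pair_measure_cong) (auto simp: s)
    have "(\<lambda>(z, y). z(i := y)) \<in> measurable (PiM I \<kappa> \<Otimes>\<^sub>M \<kappa> i) (PiM (insert i I) \<kappa>)" by (rule measurable_add_dim)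
    from measurable_compose[OF this f] have "(\<lambda>(z, y). f (z(i := y))) \<in> borel_measurable (PiM I \<kappa> \<Otimes>\<^sub>M \<kappa> i)"
      by (simp add: case_prod_unfold fun_upd_def)
    then show ?thesis using measurable_cong_sets[OF s1 refl] by blast
  qed
  have meas: "(\<lambda>z. \<integral>\<^sup>+y. f (z(i := y)) \<partial>\<kappa>' i t) \<in> borel_measurable (PiM I \<kappa>)" for t
    using sigma_finite_measure.borel_measurable_nn_integral[OF sf(2) fyx] by simp
  have Tf: "finite (T j)" if "j \<in> I" for j using insert.prems(1) that by simp
  have "(\<integral>\<^sup>+z. f z \<partial>PiM (insert i I) \<kappa>) = (\<integral>\<^sup>+z. (\<integral>\<^sup>+y. f (z(i := y)) \<partial>\<kappa> i) \<partial>PiM I \<kappa>)"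
    by (rule K.product_nn_integral_insert[OF insert.hyps f])
  also have "\<dots> \<le> (\<integral>\<^sup>+z. c * (\<Sum>t\<in>T i. \<integral>\<^sup>+y. f (z(i := y)) \<partial>\<kappa>' i t) \<partial>PiM I \<kappa>)"
    by (intro nn_integral_mono nn_integral_le_sum) (use insert.prems(2) s in auto)
  also have "\<dots> = c * (\<Sum>t\<in>T i. \<integral>\<^sup>+z. (\<integral>\<^sup>+y. f (z(i := y)) \<partial>\<kappa>' i t) \<partial>PiM I \<kappa>)"
    using meas by (subst nn_integral_cmult) (auto intro!: arg_cong2[where f = "(*)"] nn_integral_sum)
  also have "\<dots> \<le> c * (\<Sum>t\<in>T i. c ^ card I * (\<Sum>ch\<in>PiE I T. \<integral>\<^sup>+z. (\<integral>\<^sup>+y. f (z(i := y)) \<partial>\<kappa>' i t) \<partial>PiM I (\<lambda>i. \<kappa>' i (ch i))))"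
  proof (intro mult_left_mono sum_mono)
    fix t
    show "(\<integral>\<^sup>+z. (\<integral>\<^sup>+y. f (z(i := y)) \<partial>\<kappa>' i t) \<partial>PiM I \<kappa>)
      \<le> c ^ card I * (\<Sum>ch\<in>PiE I T. \<integral>\<^sup>+z. (\<integral>\<^sup>+y. f (z(i := y)) \<partial>\<kappa>' i t) \<partial>PiM I (\<lambda>i. \<kappa>' i (ch i)))"
      by (rule insert.IH[OF Tf insert.prems(2) meas]) auto
  qed simp
  also have "\<dots> = c ^ card (insert i I) * (\<Sum>t\<in>T i. \<Sum>ch\<in>PiE I T. \<integral>\<^sup>+z. (\<integral>\<^sup>+y. f (z(i := y)) \<partial>\<kappa>' i t) \<partial>PiM I (\<lambda>i. \<kappa>' i (ch i)))"
    using insert.hyps by (simp add: sum_distrib_left mult.assoc)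
  also have "(\<Sum>t\<in>T i. \<Sum>ch\<in>PiE I T. \<integral>\<^sup>+z. (\<integral>\<^sup>+y. f (z(i := y)) \<partial>\<kappa>' i t) \<partial>PiM I (\<lambda>i. \<kappa>' i (ch i)))
    = (\<Sum>t\<in>T i. \<Sum>ch\<in>PiE I T. \<integral>\<^sup>+z. f z \<partial>PiM (insert i I) (\<lambda>j. \<kappa>' j ((ch(i := t)) j)))"
  proof (intro sum.cong refl)
    fix t ch
    have e: "PiM I (\<lambda>j. \<kappa>' j ((ch(i := t)) j)) = PiM I (\<lambda>j. \<kappa>' j (ch j))"
      using insert.hyps by (intro PiM_cong) auto
    have "f \<in> borel_measurable (PiM (insert i I) (\<lambda>j. \<kappa>' j ((ch(i := t)) j)))"
      using f measurable_cong_sets[OF sP refl] by blast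
    from product_sigma_finite.product_nn_integral_insert[OF K' insert.hyps this]
    show "(\<integral>\<^sup>+z. (\<integral>\<^sup>+y. f (z(i := y)) \<partial>\<kappa>' i t) \<partial>PiM I (\<lambda>i. \<kappa>' i (ch i)))
       = (\<integral>\<^sup>+z. f z \<partial>PiM (insert i I) (\<lambda>j. \<kappa>' j ((ch(i := t)) j)))" unfolding e by simp
  qed
  also have "\<dots> = (\<Sum>(t, ch)\<in>T i \<times> PiE I T. \<integral>\<^sup>+z. f z \<partial>PiM (insert i I) (\<lambda>j. \<kappa>' j ((ch(i := t)) j)))"
    by (rule sum.cartesian_product)
  also have "\<dots> = (\<Sum>ch\<in>PiE (insert i I) T. \<integral>\<^sup>+z. f z \<partial>PiM (insert i I) (\<lambda>j. \<kappa>' j (ch j)))"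
    unfolding PiE_insert_eq
    by (subst sum.reindex[OF inj_combinator[OF insert.hyps(2)]]) (simp add: comp_def case_prod_unfold)
  finally show ?case .
qed

lemma finite_radon_emeasure: "finite_radon T m \<Longrightarrow> emeasure m A = ennreal (measure m A)"
  by (rule finite_measure.emeasure_eq_measure[OF finite_radonD(1)])

section \<open>Marginals, products over partitions, and domination by a probability\<close>

locale radon_space =
  fixes X :: "nat \<Rightarrow> 'a topology" and n :: nat
  assumes haus: "\<And>i. i \<in> {1..n} \<Longrightarrow> Hausdorff_space (X i)" and n0: "0 < n"
begin

abbreviation "TP \<equiv> prod_sp X {1..n}"
abbreviation "parts \<equiv> {\<pi>. partition_on {1..n} \<pi>}"

lemma finite_parts: "finite parts"
  by (rule finitely_many_partition_on) simp

lemma haus_sub: "F \<subseteq> {1..n} \<Longrightarrow> Hausdorff_space (prod_sp X F)"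
  unfolding Hausdorff_space_product_topology using haus by blast

lemma full_partition: "partition_on {1..n} {{1..n}}"
  using n0 by (auto simp: partition_on_def)

lemma measurable_restrict_marg:
  assumes "finite_radon (prod_sp X F) m" "B \<subseteq> F"
  shows "(\<lambda>x. restrict x B) \<in> measurable m (prod_borel X B)"
  using continuous_map_measurable_borel_top[OF continuous_map_restrict[OF assms(2), of X]]
    measurable_cong_sets[OF finite_radonD(2)[OF assms(1)] refl] by blast

lemma marg_radon:
  assumes "finite_radon (prod_sp X F) m" "B \<subseteq> F" "F \<subseteq> {1..n}"
  shows "finite_radon (prod_sp X B) (marg X B m)"
  unfolding marg_def
  by (rule finite_radon_distr[OF haus_sub assms(1) continuous_map_restrict]) (use assms in auto)

lemma emeasure_marg:
  assumes "finite_radon (prod_sp X F) m" "B \<subseteq> F" "A \<in> sets (prod_borel X B)"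
  shows "emeasure (marg X B m) A = emeasure m {x \<in> topspace (prod_sp X F). restrict x B \<in> A}"
proof -
  have "(\<lambda>x. restrict x B) -` A \<inter> space m = {x \<in> topspace (prod_sp X F). restrict x B \<in> A}"
    unfolding finite_radonD(3)[OF assms(1)] by blast
  then show ?thesis
    unfolding marg_def using emeasure_distr[OF measurable_restrict_marg[OF assms(1,2)] assms(3)] by (simp only:)
qed

lemma restrict_topspace_sub: "x \<in> topspace (prod_sp X F) \<Longrightarrow> B \<subseteq> F \<Longrightarrow> restrict x B \<in> topspace (prod_sp X B)"
  by (auto simp: PiE_def Pi_def)

lemma emeasure_marg_top:
  assumes "finite_radon (prod_sp X F) m" "B \<subseteq> F"
  shows "emeasure (marg X B m) (topspace (prod_sp X B)) = emeasure m (space m)"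
proof -
  have "{x \<in> topspace (prod_sp X F). restrict x B \<in> topspace (prod_sp X B)} = space m"
    unfolding finite_radonD(3)[OF assms(1)] using restrict_topspace_sub assms(2) by blast
  then show ?thesis
    using emeasure_marg[OF assms openin_sets_borel_top[OF openin_topspace]] by (simp only:)
qed

lemma marg_marg:
  assumes "finite_radon (prod_sp X F) m" "B \<subseteq> A" "A \<subseteq> F"
  shows "marg X B (marg X A m) = marg X B m"
proof -
  have "marg X B (marg X A m) = distr m (prod_borel X B) ((\<lambda>x. restrict x B) \<circ> (\<lambda>x. restrict x A))"
    unfolding marg_def
    by (rule distr_distr[OF continuous_map_measurable_borel_top[OF continuous_map_restrict[OF assms(2)]]
          measurable_restrict_marg[OF assms(1,3)]])
  also have "(\<lambda>x. restrict x B) \<circ> (\<lambda>x. restrict x A) = (\<lambda>x::nat \<Rightarrow> 'a. restrict x B)"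
    using assms(2) by (auto simp: fun_eq_iff restrict_def)
  finally show ?thesis by (simp only: marg_def)
qed

lemma blocks:
  assumes "finite_radon (prod_sp X F) m" "F \<subseteq> {1..n}" "partition_on F \<pi>"
  shows "radon_blocks X \<pi> (\<lambda>B. marg X B m)"
proof
  have fF: "finite F" using assms(2) finite_subset by auto
  have U: "\<Union>\<pi> = F" using assms(3) by (simp add: partition_on_def)
  show "finite \<pi>" using finite_elements[OF fF assms(3)] .
  show "disjoint \<pi>" using assms(3) by (simp add: partition_on_def)
  show "Hausdorff_space (X i)" if "i \<in> \<Union>\<pi>" for i using that U assms(2) haus by blast
  show "finite_radon (prod_sp X B) (marg X B m)" if "B \<in> \<pi>" for B
    by (rule marg_radon[OF assms(1) _ assms(2)]) (use that U in blast)
qed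

lemma part_prod_radon:
  assumes "finite_radon (prod_sp X F) m" "F \<subseteq> {1..n}" "partition_on F \<pi>"
  shows "finite_radon (prod_sp X F) (part_prod X m \<pi>)"
proof -
  interpret R: radon_blocks X \<pi> "\<lambda>B. marg X B m" by (rule blocks[OF assms])
  have U: "\<Union>\<pi> = F" using assms(3) by (simp add: partition_on_def)
  show ?thesis using R.is_prod_radon_product unfolding R.is_prod_def part_prod_def U by (rule conjunct1)
qed

lemma emeasure_part_prod:
  assumes "finite_radon (prod_sp X F) m" "F \<subseteq> {1..n}" "partition_on F \<pi>"
    and A: "\<And>B. B \<in> \<pi> \<Longrightarrow> A B \<in> sets (prod_borel X B)"
  shows "emeasure (part_prod X m \<pi>) {x \<in> topspace (prod_sp X F). \<forall>B\<in>\<pi>. restrict x B \<in> A B}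
    = (\<Prod>B\<in>\<pi>. emeasure (marg X B m) (A B))"
proof -
  interpret R: radon_blocks X \<pi> "\<lambda>B. marg X B m" by (rule blocks[OF assms(1-3)])
  have U: "\<Union>\<pi> = F" using assms(3) by (simp add: partition_on_def)
  have "\<forall>A. (\<forall>B\<in>\<pi>. A B \<in> sets (prod_borel X B)) \<longrightarrow>
      emeasure (radon_product X \<pi> (\<lambda>B. marg X B m)) (R.rect A) = (\<Prod>B\<in>\<pi>. emeasure (marg X B m) (A B))"
    using R.is_prod_radon_product unfolding R.is_prod_def by (rule conjunct2)
  then show ?thesis using A unfolding R.rect_def part_prod_def U by blast
qed

lemma part_prod_eqI:
  assumes "finite_radon (prod_sp X F) m" "F \<subseteq> {1..n}" "partition_on F \<pi>"
    and \<rho>: "finite_radon (prod_sp X F) \<rho>"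
    and eq: "\<And>A. (\<And>B. B \<in> \<pi> \<Longrightarrow> A B \<in> sets (prod_borel X B)) \<Longrightarrow>
       emeasure \<rho> {x \<in> topspace (prod_sp X F). \<forall>B\<in>\<pi>. restrict x B \<in> A B} = (\<Prod>B\<in>\<pi>. emeasure (marg X B m) (A B))"
  shows "part_prod X m \<pi> = \<rho>"
proof -
  interpret R: radon_blocks X \<pi> "\<lambda>B. marg X B m" by (rule blocks[OF assms(1-3)])
  have U: "\<Union>\<pi> = F" using assms(3) by (simp add: partition_on_def)
  have "R.is_prod \<rho>" unfolding R.is_prod_def R.rect_def U using \<rho> eq by blast
  then show ?thesis unfolding part_prod_def by (rule R.radon_product_eqI)
qed

lemma part_prod_single:
  assumes m: "finite_radon TP m"
  shows "part_prod X m {{1..n}} = m"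
proof (rule part_prod_eqI[OF m subset_refl full_partition m])
  fix A assume A: "\<And>B. B \<in> {{1..n}} \<Longrightarrow> A B \<in> sets (prod_borel X B)"
  have "{x \<in> topspace TP. \<forall>B\<in>{{1..n}}. restrict x B \<in> A B} = {x \<in> topspace TP. restrict x {1..n} \<in> A {1..n}}" by blast
  then show "emeasure m {x \<in> topspace TP. \<forall>B\<in>{{1..n}}. restrict x B \<in> A B} = (\<Prod>B\<in>{{1..n}}. emeasure (marg X B m) (A B))"
    using emeasure_marg[OF m subset_refl A] by simp
qed

text \<open>The complementary block carries total mass 1 and disappears when the
  \<open>A\<close>-marginal is taken. In this way partitions of a proper subset, which occur in the
  delimitation bound, are traded for partitions of \<open>{1..n}\<close>, which occur in
  \<open>FIP\<close>.\<close>

lemma marg_part_prod: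
  assumes m: "finite_radon TP m" and one: "emeasure m (space m) = 1"
    and A: "A \<subseteq> {1..n}" "A \<noteq> {1..n}" and \<tau>: "partition_on A \<tau>"
  shows "partition_on {1..n} (insert ({1..n} - A) \<tau>)"
    and "marg X A (part_prod X m (insert ({1..n} - A) \<tau>)) = part_prod X (marg X A m) \<tau>"
proof -
  let ?N = "{1..n} - A" let ?\<pi> = "insert ?N \<tau>"
  have ne: "?N \<noteq> {}" using A by blast
  have \<tau>': "\<Union>\<tau> = A" "disjoint \<tau>" "{} \<notin> \<tau>" using \<tau> unfolding partition_on_def by blast+
  have N\<tau>: "?N \<notin> \<tau>" using ne \<tau>'(1) by blast
  have "disjoint ?\<pi>" using \<tau>' by (auto simp: disjoint_def)
  moreover have "\<Union>?\<pi> = {1..n}" using \<tau>'(1) A(1) by blast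
  ultimately show \<pi>: "partition_on {1..n} ?\<pi>" using ne \<tau>'(3) unfolding partition_on_def by blast
  have fA: "finite A" using A(1) finite_subset by auto
  have f\<tau>: "finite \<tau>" by (rule finite_elements[OF fA \<tau>])
  note pr = part_prod_radon[OF m subset_refl \<pi>]
  show "marg X A (part_prod X m ?\<pi>) = part_prod X (marg X A m) \<tau>"
  proof (rule part_prod_eqI[OF marg_radon[OF m A(1) subset_refl] A(1) \<tau> marg_radon[OF pr A(1) subset_refl], symmetric])
    fix D assume D: "\<And>B. B \<in> \<tau> \<Longrightarrow> D B \<in> sets (prod_borel X B)"
    let ?R = "{x \<in> topspace (prod_sp X A). \<forall>B\<in>\<tau>. restrict x B \<in> D B}"
    interpret R: radon_blocks X \<tau> "\<lambda>B. marg X B (marg X A m)"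
      by (rule blocks[OF marg_radon[OF m A(1) subset_refl] A(1) \<tau>])
    have "R.rect D \<in> R.Rects" unfolding R.Rects_def using D by blast
    then have Rs: "?R \<in> sets (prod_borel X A)" using R.Rects_borel unfolding R.rect_def \<tau>'(1) by blast
    let ?D = "\<lambda>B. if B = ?N then topspace (prod_sp X ?N) else D B"
    have D': "?D B \<in> sets (prod_borel X B)" if "B \<in> ?\<pi>" for B
      using that D by (cases "B = ?N") (simp_all only: if_True if_False openin_sets_borel_top openin_topspace insert_iff simp_thms)
    have rr: "restrict (restrict x A) B = restrict x B" if "B \<in> \<tau>" for x :: "nat \<Rightarrow> 'a" and B
      using that \<tau>'(1) by (auto simp: fun_eq_iff restrict_def)
    have "{x \<in> topspace TP. restrict x A \<in> ?R} = {x \<in> topspace TP. \<forall>B\<in>?\<pi>. restrict x B \<in> ?D B}" (is "?L = ?L'")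
    proof (intro equalityI subsetI)
      fix x assume "x \<in> ?L"
      then have x: "x \<in> topspace TP" "\<forall>B\<in>\<tau>. restrict (restrict x A) B \<in> D B" by blast+
      have "restrict x B \<in> ?D B" if "B \<in> ?\<pi>" for B
        using that x(2) restrict_topspace_sub[OF x(1), of ?N] rr[of B x] by (cases "B = ?N") auto
      then show "x \<in> ?L'" using x(1) by blast
    next
      fix x assume "x \<in> ?L'"
      then have x: "x \<in> topspace TP" "\<forall>B\<in>?\<pi>. restrict x B \<in> ?D B" by blast+
      have "restrict (restrict x A) B \<in> D B" if "B \<in> \<tau>" for B
      proof -
        have "B \<noteq> ?N" using that N\<tau> by blast
        then show ?thesis using bspec[OF x(2), of B] that rr[OF that, of x] by simp
      qed
      then show "x \<in> ?L" using x(1) restrict_topspace_sub[OF x(1) A(1)] by blast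
    qed
    then have "emeasure (marg X A (part_prod X m ?\<pi>)) ?R = (\<Prod>B\<in>?\<pi>. emeasure (marg X B m) (?D B))"
      using emeasure_marg[OF pr A(1) Rs] emeasure_part_prod[OF m subset_refl \<pi> D'] by (simp only:)
    also have "\<dots> = emeasure (marg X ?N m) (topspace (prod_sp X ?N)) * (\<Prod>B\<in>\<tau>. emeasure (marg X B m) (?D B))"
      by (subst prod.insert[OF f\<tau> N\<tau>]) simp
    also have "emeasure (marg X ?N m) (topspace (prod_sp X ?N)) = 1" using emeasure_marg_top[OF m, of ?N] one by auto
    also have "(\<Prod>B\<in>\<tau>. emeasure (marg X B m) (?D B)) = (\<Prod>B\<in>\<tau>. emeasure (marg X B (marg X A m)) (D B))"
    proof (rule prod.cong[OF refl])
      fix B assume B: "B \<in> \<tau>"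
      then have "B \<noteq> ?N" "B \<subseteq> A" using N\<tau> \<tau>'(1) by blast+
      then show "emeasure (marg X B m) (?D B) = emeasure (marg X B (marg X A m)) (D B)"
        using marg_marg[OF m _ A(1), of B] by simp
    qed
    finally show "emeasure (marg X A (part_prod X m ?\<pi>)) ?R = (\<Prod>B\<in>\<tau>. emeasure (marg X B (marg X A m)) (D B))"
      by (simp only: mult_1_left)
  qed
qed

text \<open>The second conclusion allows products over the refined partition to be split block by
  block.\<close>

lemma partition_on_refine:
  assumes \<pi>: "partition_on F \<pi>" and c: "\<And>B. B \<in> \<pi> \<Longrightarrow> partition_on B (c B)"
  shows "partition_on F (\<Union>B\<in>\<pi>. c B)" "\<And>B B'. B \<in> \<pi> \<Longrightarrow> B' \<in> \<pi> \<Longrightarrow> B \<noteq> B' \<Longrightarrow> c B \<inter> c B' = {}"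
proof -
  have p: "\<Union>\<pi> = F" "disjoint \<pi>" "{} \<notin> \<pi>" using \<pi> unfolding partition_on_def by blast+
  have cB: "\<Union>(c B) = B" "disjoint (c B)" "{} \<notin> c B" if "B \<in> \<pi>" for B
    using c[OF that] unfolding partition_on_def by blast+
  have sep: "D \<inter> D' = {}" if "B \<in> \<pi>" "B' \<in> \<pi>" "B \<noteq> B'" "D \<in> c B" "D' \<in> c B'" for B B' D D'
  proof -
    have "B \<inter> B' = {}" using p(2) that unfolding disjoint_def by blast
    moreover have "D \<subseteq> B" "D' \<subseteq> B'" using cB(1) that by blast+
    ultimately show ?thesis by blast
  qed
  show "c B \<inter> c B' = {}" if "B \<in> \<pi>" "B' \<in> \<pi>" "B \<noteq> B'" for B B'
  proof (rule ccontr)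
    assume "c B \<inter> c B' \<noteq> {}"
    then obtain D where "D \<in> c B" "D \<in> c B'" by blast
    then show False using sep[OF that, of D D] cB(3)[OF that(1)] by auto
  qed
  have "disjoint (\<Union>B\<in>\<pi>. c B)"
  proof (rule disjointI)
    fix D D' assume "D \<in> (\<Union>B\<in>\<pi>. c B)" "D' \<in> (\<Union>B\<in>\<pi>. c B)" and ne: "D \<noteq> D'"
    then obtain B B' where B: "B \<in> \<pi>" "D \<in> c B" "B' \<in> \<pi>" "D' \<in> c B'" by blast
    show "D \<inter> D' = {}"
    proof (cases "B = B'")
      case True
      then show ?thesis using disjointD[OF cB(2)[OF B(1)] B(2) _ ne] B(4) by simp
    next
      case False
      then show ?thesis by (rule sep[OF B(1,3) _ B(2,4)])
    qed
  qed
  moreover have "\<Union>(\<Union>B\<in>\<pi>. c B) = F" using cB(1) p(1) by blast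
  moreover have "{} \<notin> (\<Union>B\<in>\<pi>. c B)" using cB(3) by blast
  ultimately show "partition_on F (\<Union>B\<in>\<pi>. c B)" unfolding partition_on_def by blast
qed

text \<open>Both sides are Radon and have the same values on rectangles of the refined partition,
  since a marginal of a marginal is a marginal.\<close>

lemma blocks_refine:
  assumes m: "finite_radon TP m" and \<pi>: "partition_on {1..n} \<pi>" and c: "\<And>B. B \<in> \<pi> \<Longrightarrow> partition_on B (c B)"
  shows "radon_blocks X \<pi> (\<lambda>B. part_prod X (marg X B m) (c B))"
    and "radon_product X \<pi> (\<lambda>B. part_prod X (marg X B m) (c B)) = part_prod X m (\<Union>B\<in>\<pi>. c B)"
proof -
  have sub: "B \<subseteq> {1..n}" if "B \<in> \<pi>" for B using \<pi> that unfolding partition_on_def by blast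
  have U: "\<Union>\<pi> = {1..n}" using \<pi> unfolding partition_on_def by blast
  have f\<pi>: "finite \<pi>" by (rule finite_elements[OF finite_atLeastAtMost \<pi>])
  have mr: "finite_radon (prod_sp X B) (marg X B m)" if "B \<in> \<pi>" for B
    by (rule marg_radon[OF m sub[OF that] subset_refl])
  show Q: "radon_blocks X \<pi> (\<lambda>B. part_prod X (marg X B m) (c B))"
  proof
    show "Hausdorff_space (X i)" if "i \<in> \<Union>\<pi>" for i using that U haus by blast
    show "finite_radon (prod_sp X B) (part_prod X (marg X B m) (c B))" if "B \<in> \<pi>" for B
      by (rule part_prod_radon[OF mr[OF that] sub[OF that] c[OF that]])
  qed (use f\<pi> \<pi> in \<open>auto simp: partition_on_def\<close>)
  interpret Q: radon_blocks X \<pi> "\<lambda>B. part_prod X (marg X B m) (c B)" by (rule Q)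
  let ?\<rho> = "radon_product X \<pi> (\<lambda>B. part_prod X (marg X B m) (c B))"
  have \<rho>: "finite_radon TP ?\<rho>" using Q.is_prod_radon_product unfolding Q.is_prod_def U by (rule conjunct1)
  note ref = partition_on_refine[OF \<pi> c]
  show "?\<rho> = part_prod X m (\<Union>B\<in>\<pi>. c B)"
  proof (rule part_prod_eqI[OF m subset_refl ref(1) \<rho>, symmetric])
    fix D assume D: "\<And>B. B \<in> (\<Union>B\<in>\<pi>. c B) \<Longrightarrow> D B \<in> sets (prod_borel X B)"
    define E where "E B = {z \<in> topspace (prod_sp X B). \<forall>C\<in>c B. restrict z C \<in> D C}" for B
    have cU: "\<Union>(c B) = B" if "B \<in> \<pi>" for B using c[OF that] unfolding partition_on_def by blast
    have Es: "E B \<in> sets (prod_borel X B)" if B: "B \<in> \<pi>" for B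
    proof -
      interpret R: radon_blocks X "c B" "\<lambda>C. marg X C (marg X B m)" by (rule blocks[OF mr[OF B] sub[OF B] c[OF B]])
      have "R.rect D \<in> R.Rects" unfolding R.Rects_def using D B by blast
      then show ?thesis using R.Rects_borel unfolding R.rect_def cU[OF B] E_def by blast
    qed
    have rr: "restrict (restrict x B) C = restrict x C" if "B \<in> \<pi>" "C \<in> c B" for x :: "nat \<Rightarrow> 'a" and B C
    proof -
      have "C \<subseteq> B" using cU[OF that(1)] that(2) by blast
      then show ?thesis by (auto simp: fun_eq_iff restrict_def)
    qed
    have "{x \<in> topspace TP. \<forall>C\<in>(\<Union>B\<in>\<pi>. c B). restrict x C \<in> D C} = Q.rect E" (is "?L = _")
    proof (intro equalityI subsetI)
      fix x assume "x \<in> ?L"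
      then have x: "x \<in> topspace TP" "\<And>B C. B \<in> \<pi> \<Longrightarrow> C \<in> c B \<Longrightarrow> restrict x C \<in> D C" by blast+
      have "restrict x B \<in> E B" if "B \<in> \<pi>" for B
        unfolding E_def using restrict_topspace_sub[OF x(1) sub[OF that]] x(2)[OF that] rr[OF that] by simp
      then show "x \<in> Q.rect E" using x(1) unfolding Q.rect_def U by blast
    next
      fix x assume "x \<in> Q.rect E"
      then have x: "x \<in> topspace TP" "\<And>B. B \<in> \<pi> \<Longrightarrow> restrict x B \<in> E B" unfolding Q.rect_def U by blast+
      have "restrict x C \<in> D C" if "B \<in> \<pi>" "C \<in> c B" for B C
        using x(2)[OF that(1)] that rr[OF that, of x] unfolding E_def by auto
      then show "x \<in> ?L" using x(1) by blast
    qed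
    moreover have "\<forall>A. (\<forall>B\<in>\<pi>. A B \<in> sets (prod_borel X B)) \<longrightarrow>
        emeasure ?\<rho> (Q.rect A) = (\<Prod>B\<in>\<pi>. emeasure (part_prod X (marg X B m) (c B)) (A B))"
      using Q.is_prod_radon_product unfolding Q.is_prod_def by (rule conjunct2)
    ultimately have "emeasure ?\<rho> {x \<in> topspace TP. \<forall>C\<in>(\<Union>B\<in>\<pi>. c B). restrict x C \<in> D C}
        = (\<Prod>B\<in>\<pi>. emeasure (part_prod X (marg X B m) (c B)) (E B))" using Es by simp
    also have "\<dots> = (\<Prod>B\<in>\<pi>. \<Prod>C\<in>c B. emeasure (marg X C m) (D C))"
    proof (rule prod.cong[OF refl])
      fix B assume B: "B \<in> \<pi>"
      have "emeasure (part_prod X (marg X B m) (c B)) (E B) = (\<Prod>C\<in>c B. emeasure (marg X C (marg X B m)) (D C))"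
        unfolding E_def by (rule emeasure_part_prod[OF mr[OF B] sub[OF B] c[OF B] D]) (use B in blast)
      also have "\<dots> = (\<Prod>C\<in>c B. emeasure (marg X C m) (D C))"
      proof (rule prod.cong[OF refl])
        fix C assume "C \<in> c B"
        then have "C \<subseteq> B" using cU[OF B] by blast
        then show "emeasure (marg X C (marg X B m)) (D C) = emeasure (marg X C m) (D C)"
          using marg_marg[OF m _ sub[OF B], of C] by simp
      qed
      finally show "emeasure (part_prod X (marg X B m) (c B)) (E B) = (\<Prod>C\<in>c B. emeasure (marg X C m) (D C))" .
    qed
    also have "\<dots> = (\<Prod>C\<in>(\<Union>B\<in>\<pi>. c B). emeasure (marg X C m) (D C))"
    proof (rule prod.UNION_disjoint[symmetric, OF f\<pi>])
      show "\<forall>B\<in>\<pi>. finite (c B)" using finite_elements c sub finite_subset[OF _ finite_atLeastAtMost] by metis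
      show "\<forall>B\<in>\<pi>. \<forall>B'\<in>\<pi>. B \<noteq> B' \<longrightarrow> c B \<inter> c B' = {}" using ref(2) by blast
    qed
    finally show "emeasure ?\<rho> {x \<in> topspace TP. \<forall>C\<in>(\<Union>B\<in>\<pi>. c B). restrict x C \<in> D C}
        = (\<Prod>C\<in>(\<Union>B\<in>\<pi>. c B). emeasure (marg X C m) (D C))" .
  qed auto
qed

text \<open>The condition in \<open>marginally_delimited\<close> with its bound \<open>M\<close>
  made explicit and with ordinary measures in place of signed ones.\<close>

definition delim where
  "delim P M \<nu> \<longleftrightarrow> (\<forall>F\<subseteq>{1..n}. card F \<le> n - 1 \<longrightarrow> (\<forall>A\<in>sets (prod_borel X F).
     emeasure (marg X F \<nu>) A \<le> ennreal M * (\<Sum>\<pi>\<in>{\<pi>. partition_on F \<pi>}. emeasure (part_prod X (marg X F P) \<pi>) A)))"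

lemma proper_card: "F \<subseteq> {1..n} \<Longrightarrow> F \<noteq> {1..n} \<Longrightarrow> card F \<le> n - 1"
proof -
  assume "F \<subseteq> {1..n}" "F \<noteq> {1..n}"
  then have "card F < card {1..n}" by (intro psubset_card_mono) auto
  then show "card F \<le> n - 1" by simp
qed

lemma delimD:
  assumes "delim P M \<nu>" "F \<subseteq> {1..n}" "F \<noteq> {1..n}" "A \<in> sets (prod_borel X F)"
  shows "emeasure (marg X F \<nu>) A \<le> ennreal M * (\<Sum>\<pi>\<in>{\<pi>. partition_on F \<pi>}. emeasure (part_prod X (marg X F P) \<pi>) A)"
  using assms proper_card[OF assms(2,3)] unfolding delim_def by blast

text \<open>Every block of a partition other than the trivial one is proper, so delimitation applies
  to each factor. Expanding the product of sums chooses a partition of every block, and these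
  choices together form a partition of \<open>{1..n}\<close>.\<close>

lemma part_prod_dominated:
  assumes P: "finite_radon TP P" and \<nu>: "finite_radon TP \<nu>" and d: "delim P M \<nu>" and M: "0 \<le> M"
    and \<pi>: "partition_on {1..n} \<pi>" "\<pi> \<noteq> {{1..n}}"
  obtains C where "0 \<le> C" "\<And>E. E \<in> sets (borel_top TP) \<Longrightarrow>
    emeasure (part_prod X \<nu> \<pi>) E \<le> ennreal C * (\<Sum>\<pi>'\<in>parts. emeasure (part_prod X P \<pi>') E)"
proof -
  have sub: "B \<subseteq> {1..n}" if "B \<in> \<pi>" for B using \<pi> that unfolding partition_on_def by blast
  have U: "\<Union>\<pi> = {1..n}" "disjoint \<pi>" "{} \<notin> \<pi>" using \<pi> unfolding partition_on_def by blast+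
  have proper: "B \<noteq> {1..n}" if B: "B \<in> \<pi>" for B
  proof
    assume e: "B = {1..n}"
    have "B' = B" if "B' \<in> \<pi>" for B'
    proof (rule ccontr)
      assume "B' \<noteq> B"
      then have "B' \<inter> B = {}" using disjointD[OF U(2) that B] by blast
      then show False using sub[OF that] e U(3) that by (metis inf.absorb1)
    qed
    then have "\<pi> = {{1..n}}" using B e by blast
    then show False using \<pi>(2) by blast
  qed
  have f\<pi>: "finite \<pi>" by (rule finite_elements[OF finite_atLeastAtMost \<pi>(1)])
  define T where "T B = {\<tau>. partition_on B \<tau>}" for B :: "nat set"
  have fT: "finite (T B)" if "B \<in> \<pi>" for B
    unfolding T_def by (rule finitely_many_partition_on[OF finite_subset[OF sub[OF that] finite_atLeastAtMost]])
  interpret R: radon_blocks X \<pi> "\<lambda>B. marg X B \<nu>" by (rule blocks[OF \<nu> subset_refl \<pi>(1)])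
  \<comment> \<open>Arguments that are no blocks or no partitions get the null measure, so the whole
    family is finite and has the right sigma-algebras.\<close>
  define \<kappa>' where "\<kappa>' B \<tau> = (if B \<in> \<pi> \<and> partition_on B \<tau> then part_prod X (marg X B P) \<tau> else null_measure (R.kk B))" for B \<tau>
  have pr: "finite_radon (prod_sp X B) (part_prod X (marg X B P) \<tau>)" if "B \<in> \<pi>" "partition_on B \<tau>" for B \<tau>
    by (rule part_prod_radon[OF marg_radon[OF P sub[OF that(1)] subset_refl] sub[OF that(1)] that(2)])
  have fk: "finite_measure (\<kappa>' B \<tau>)" for B \<tau>
    using finite_radonD(1)[OF pr] by (auto simp: \<kappa>'_def intro!: finite_measureI)
  have sk: "sets (\<kappa>' B \<tau>) = sets (R.kk B)" for B \<tau>
    using finite_radonD(2)[OF pr] R.sets_kk by (auto simp: \<kappa>'_def)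
  have le: "emeasure (R.kk B) A \<le> ennreal M * (\<Sum>\<tau>\<in>T B. emeasure (\<kappa>' B \<tau>) A)" if B: "B \<in> \<pi>" and A: "A \<in> sets (R.kk B)" for B A
  proof -
    have "emeasure (marg X B \<nu>) A \<le> ennreal M * (\<Sum>\<tau>\<in>{\<tau>. partition_on B \<tau>}. emeasure (part_prod X (marg X B P) \<tau>) A)"
      by (rule delimD[OF d sub[OF B] proper[OF B]]) (use A R.sets_kk[OF B] in blast)
    also have "(\<Sum>\<tau>\<in>{\<tau>. partition_on B \<tau>}. emeasure (part_prod X (marg X B P) \<tau>) A) = (\<Sum>\<tau>\<in>T B. emeasure (\<kappa>' B \<tau>) A)"
      unfolding T_def by (rule sum.cong[OF refl]) (use B in \<open>simp add: \<kappa>'_def\<close>)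
    finally show ?thesis using B by (simp add: R.kk_def)
  qed
  \<comment> \<open>One factor \<open>M\<close> for each block, times the number of choice
    functions, since each choice is bounded crudely by the sum over all partitions.\<close>
  define C where "C = M ^ card \<pi> * real (card (PiE \<pi> T))"
  have C0: "0 \<le> C" using M by (simp add: C_def)
  have PP: "finite_radon TP (part_prod X P \<pi>')" if "\<pi>' \<in> parts" for \<pi>'
    using part_prod_radon[OF P subset_refl] that by blast
  have key: "emeasure (part_prod X \<nu> \<pi>) W \<le> ennreal C * (\<Sum>\<pi>'\<in>parts. emeasure (part_prod X P \<pi>') W)"
    if W: "W \<in> sigma_sets (topspace R.TT) R.Rects" for W
  proof -
    let ?W = "R.glue -` W \<inter> space (PiM \<pi> R.kk)"
    have Ws: "?W \<in> sets (PiM \<pi> R.kk)"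
      by (rule measurable_sets[OF R.measurable_glue]) (simp only: R.sets_sigma_Rects W)
    have "emeasure (part_prod X \<nu> \<pi>) W = (\<integral>\<^sup>+z. indicator ?W z \<partial>PiM \<pi> R.kk)"
      unfolding part_prod_def R.emeasure_radon_product_PiM[OF W] using Ws by simp
    also have "\<dots> \<le> ennreal M ^ card \<pi> * (\<Sum>ch\<in>PiE \<pi> T. \<integral>\<^sup>+z. indicator ?W z \<partial>PiM \<pi> (\<lambda>B. \<kappa>' B (ch B)))"
      by (rule nn_integral_PiM_le[OF finite_measure.axioms(1)[OF R.finite_kk] finite_measure.axioms(1)[OF fk] sk f\<pi> fT le])
        (use Ws in auto)
    also have "\<dots> \<le> ennreal M ^ card \<pi> * (\<Sum>ch\<in>PiE \<pi> T. \<Sum>\<pi>'\<in>parts. emeasure (part_prod X P \<pi>') W)"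
    proof (intro mult_left_mono sum_mono)
      fix ch assume ch: "ch \<in> PiE \<pi> T"
      have c: "partition_on B (ch B)" if "B \<in> \<pi>" for B using PiE_mem[OF ch that] by (simp add: T_def)
      interpret Q: radon_blocks X \<pi> "\<lambda>B. part_prod X (marg X B P) (ch B)" by (rule blocks_refine(1)[OF P \<pi>(1) c])
      have kk: "PiM \<pi> (\<lambda>B. \<kappa>' B (ch B)) = PiM \<pi> Q.kk"
        by (rule PiM_cong) (use c in \<open>auto simp: \<kappa>'_def Q.kk_def\<close>)
      have sp: "space (PiM \<pi> Q.kk) = space (PiM \<pi> R.kk)" unfolding Q.space_PiM_kk R.space_PiM_kk ..
      have "sets (PiM \<pi> Q.kk) = sets (PiM \<pi> R.kk)"
        by (rule sets_PiM_cong) (simp_all only: Q.sets_kk R.sets_kk)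
      then have Wq: "?W \<in> sets (PiM \<pi> Q.kk)" using Ws by blast
      have "(\<integral>\<^sup>+z. indicator ?W z \<partial>PiM \<pi> (\<lambda>B. \<kappa>' B (ch B))) = emeasure (PiM \<pi> Q.kk) ?W"
        unfolding kk using Wq by simp
      also have "\<dots> = emeasure (part_prod X P (\<Union>B\<in>\<pi>. ch B)) W"
      proof -
        have e: "radon_product X \<pi> (\<lambda>B. part_prod X (marg X B P) (ch B)) = part_prod X P (\<Union>B\<in>\<pi>. ch B)"
          by (rule blocks_refine(2)[OF P \<pi>(1) c])
        show ?thesis using Q.emeasure_radon_product_PiM[OF W] unfolding e sp by (rule sym)
      qed
      also have "\<dots> \<le> (\<Sum>\<pi>'\<in>parts. emeasure (part_prod X P \<pi>') W)"
        by (rule sum_nonneg_leq_bound[OF finite_parts _ refl]) (use partition_on_refine(1)[OF \<pi>(1) c] in auto)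
      finally show "(\<integral>\<^sup>+z. indicator ?W z \<partial>PiM \<pi> (\<lambda>B. \<kappa>' B (ch B))) \<le> (\<Sum>\<pi>'\<in>parts. emeasure (part_prod X P \<pi>') W)" .
    qed simp
    also have "\<dots> = ennreal C * (\<Sum>\<pi>'\<in>parts. emeasure (part_prod X P \<pi>') W)"
      using M by (simp add: C_def ennreal_mult ennreal_power mult.assoc ennreal_of_nat_eq_real_of_nat)
    finally show ?thesis .
  qed
  note NP = part_prod_radon[OF \<nu> subset_refl \<pi>(1)]
  have conv: "(\<Sum>\<pi>'\<in>parts. emeasure (part_prod X P \<pi>') E) = ennreal (\<Sum>\<pi>'\<in>parts. measure (part_prod X P \<pi>') E)" for E
  proof -
    have "(\<Sum>\<pi>'\<in>parts. emeasure (part_prod X P \<pi>') E) = (\<Sum>\<pi>'\<in>parts. ennreal (measure (part_prod X P \<pi>') E))"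
      by (rule sum.cong[OF refl]) (rule finite_radon_emeasure[OF PP])
    also have "\<dots> = ennreal (\<Sum>\<pi>'\<in>parts. measure (part_prod X P \<pi>') E)" by (rule sum_ennreal) simp
    finally show ?thesis .
  qed
  have "emeasure (part_prod X \<nu> \<pi>) E \<le> ennreal C * (\<Sum>\<pi>'\<in>parts. emeasure (part_prod X P \<pi>') E)"
    if E: "E \<in> sets (borel_top TP)" for E
  proof -
    \<comment> \<open>The expansion works on the sigma-algebra of rectangles only; regularity
      carries the inequality to all Borel sets.\<close>
    have "measure (part_prod X \<nu> \<pi>) E \<le> C * (\<Sum>\<pi>'\<in>parts. measure (part_prod X P \<pi>') E)"
    proof (rule finite_radon_le_from_base[OF haus_sub[OF subset_refl] _ NP finite_parts PP C0 _ E])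
      show "base_of TP R.open_rects" using R.base_of_open_rects unfolding U(1) .
      fix \<F> assume "finite \<F>" "\<F> \<subseteq> R.open_rects"
      from key[OF R.open_rects_Union[OF this]]
      show "measure (part_prod X \<nu> \<pi>) (\<Union>\<F>) \<le> C * (\<Sum>\<pi>'\<in>parts. measure (part_prod X P \<pi>') (\<Union>\<F>))"
        unfolding conv finite_radon_emeasure[OF NP] using C0
        by (simp add: ennreal_mult[symmetric] sum_nonneg)
    qed
    then show ?thesis unfolding conv finite_radon_emeasure[OF NP] using C0
      by (simp add: ennreal_mult[symmetric] sum_nonneg)
  qed
  with C0 show thesis by (rule that)
qed

end

section \<open>Complete symmetric kernels\<close>

lemma sum_Pow_insert:
  assumes "finite N" "j \<notin> N"
  shows "(\<Sum>H\<in>Pow (insert j N). f H) = (\<Sum>H\<in>Pow N. f H) + (\<Sum>H\<in>Pow N. f (insert j H))"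
proof -
  have "inj_on (insert j) (Pow N)" using assms(2) by (auto simp: inj_on_def)
  then have "(\<Sum>H\<in>insert j ` Pow N. f H) = (\<Sum>H\<in>Pow N. f (insert j H))" by (simp add: sum.reindex)
  moreover have "(\<Sum>H\<in>Pow N \<union> insert j ` Pow N. f H) = (\<Sum>H\<in>Pow N. f H) + (\<Sum>H\<in>insert j ` Pow N. f H)"
    using assms by (intro sum.union_disjoint) auto
  ultimately show ?thesis by (simp add: Pow_insert)
qed

text \<open>The Walsh function with index \<open>S\<close> on subsets \<open>H\<close>; it is a
  character for symmetric difference.\<close>

definition chi :: "nat set \<Rightarrow> nat set \<Rightarrow> real" where "chi S H = (-1) ^ card (S \<inter> H)"

lemma chi_insert: "finite H \<Longrightarrow> j \<notin> H \<Longrightarrow> chi S (insert j H) = (if j \<in> S then - chi S H else chi S H)"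
  by (simp add: chi_def)

lemma chi_insert': "finite S \<Longrightarrow> j \<notin> S \<Longrightarrow> chi (insert j S) H = (if j \<in> H then - chi S H else chi S H)"
  by (simp add: chi_def)

lemma chi_symdiff:
  assumes "finite F" "finite G"
  shows "chi S F * chi S G = chi S ((F - G) \<union> (G - F))"
proof -
  have "card (S \<inter> F) = card (S \<inter> (F - G)) + card (S \<inter> F \<inter> G)"
    using assms by (subst card_Un_disjoint[symmetric]) (auto intro: arg_cong[where f = card])
  moreover have "card (S \<inter> G) = card (S \<inter> (G - F)) + card (S \<inter> F \<inter> G)"
    using assms by (subst card_Un_disjoint[symmetric]) (auto intro: arg_cong[where f = card])
  moreover have "card (S \<inter> ((F - G) \<union> (G - F))) = card (S \<inter> (F - G)) + card (S \<inter> (G - F))"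
    using assms by (subst card_Un_disjoint[symmetric]) (auto intro: arg_cong[where f = card])
  moreover have "(-1::real) ^ card (S \<inter> F \<inter> G) * (-1) ^ card (S \<inter> F \<inter> G) = 1"
    by (simp add: power_mult_distrib[symmetric])
  ultimately show ?thesis unfolding chi_def by (simp add: power_add)
qed

lemma sum_chi: "finite N \<Longrightarrow> (\<Sum>S\<in>Pow N. chi S H) = (if N \<inter> H = {} then 2 ^ card N else 0)"
proof (induction N rule: finite_induct)
  case (insert j N)
  have "(\<Sum>S\<in>Pow N. chi (insert j S) H) = (if j \<in> H then -1 else 1) * (\<Sum>S\<in>Pow N. chi S H)"
    unfolding sum_distrib_left
    by (intro sum.cong refl, subst chi_insert') (use insert.hyps in \<open>auto intro: finite_subset\<close>)
  then show ?case using insert by (simp add: sum_Pow_insert)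
qed (simp add: chi_def)

lemma sum_chi':
  assumes "finite N" "H \<subseteq> N"
  shows "(\<Sum>S\<in>Pow N. (-1) ^ card S * chi S H) = (if H = N then 2 ^ card N else 0)"
proof -
  have "(-1) ^ card S * chi S H = chi S (N - H)" if "S \<in> Pow N" for S
  proof -
    have fS: "finite S" using that assms(1) finite_subset by auto
    have "card S = card (S \<inter> (N - H)) + card (S \<inter> H)"
      using fS that by (subst card_Un_disjoint[symmetric]) (auto intro: arg_cong[where f = card])
    moreover have "(-1::real) ^ card (S \<inter> H) * (-1) ^ card (S \<inter> H) = 1"
      by (simp add: power_mult_distrib[symmetric])
    ultimately show ?thesis unfolding chi_def by (simp add: power_add)
  qed
  then have "(\<Sum>S\<in>Pow N. (-1) ^ card S * chi S H) = (\<Sum>S\<in>Pow N. chi S (N - H))" by (rule sum.cong[OF refl])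
  also have "\<dots> = (if N \<inter> (N - H) = {} then 2 ^ card N else 0)" by (rule sum_chi[OF assms(1)])
  also have "(N \<inter> (N - H) = {}) = (H = N)" using assms(2) by auto
  finally show ?thesis .
qed

text \<open>By orthogonality \<open>g N - g {}\<close> is, up to the factor
  \<open>2 ^ card N\<close>, the sum of the Walsh coefficients of \<open>g\<close> weighted by
  \<open>(-1) ^ card S - 1\<close>. These weights are nonpositive and vanish at the empty
  \<open>S\<close>.\<close>

lemma cube_mono_first:
  assumes "finite N" and le: "\<And>S. S \<subseteq> N \<Longrightarrow> S \<noteq> {} \<Longrightarrow> (\<Sum>H\<in>Pow N. chi S H * g H) \<le> 0"
  shows "g {} \<le> (g N :: real)"
proof -
  have "0 \<le> (\<Sum>S\<in>Pow N. ((-1) ^ card S - 1) * (\<Sum>H\<in>Pow N. chi S H * g H))"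
  proof (rule sum_nonneg)
    fix S assume S: "S \<in> Pow N"
    show "0 \<le> ((-1) ^ card S - 1) * (\<Sum>H\<in>Pow N. chi S H * g H)"
    proof (cases "S = {}")
      case False
      have "(-1::real) ^ card S - 1 \<le> 0" by (cases "even (card S)") auto
      then show ?thesis using le[of S] S False by (intro mult_nonpos_nonpos) auto
    qed simp
  qed
  also have "\<dots> = (\<Sum>H\<in>Pow N. \<Sum>S\<in>Pow N. ((-1) ^ card S * chi S H - chi S H) * g H)"
    unfolding sum_distrib_left by (subst sum.swap) (simp add: algebra_simps)
  also have "\<dots> = (\<Sum>H\<in>Pow N. ((if H = N then 2 ^ card N else 0) - (if H = {} then 2 ^ card N else 0)) * g H)"
  proof (rule sum.cong[OF refl])
    fix H assume H: "H \<in> Pow N"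
    then have "(N \<inter> H = {}) = (H = {})" by auto
    then show "(\<Sum>S\<in>Pow N. ((-1) ^ card S * chi S H - chi S H) * g H)
        = ((if H = N then 2 ^ card N else 0) - (if H = {} then 2 ^ card N else 0)) * g H"
      using sum_chi'[OF assms(1), of H] sum_chi[OF assms(1), of H] H
      by (simp add: sum_distrib_right[symmetric] sum_subtractf)
  qed
  also have "\<dots> = (\<Sum>H\<in>Pow N. if H = N then 2 ^ card N * g H else 0) - (\<Sum>H\<in>Pow N. if H = {} then 2 ^ card N * g H else 0)"
    unfolding sum_subtractf[symmetric] by (rule sum.cong) auto
  also have "\<dots> = 2 ^ card N * g N - 2 ^ card N * g {}"
    using assms(1) by (simp add: sum.delta)
  finally have "0 \<le> 2 ^ card N * (g N - g {})" by (simp add: algebra_simps)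
  then have "0 \<le> (2 ^ card N * (g N - g {})) / 2 ^ card N" by (rule divide_nonneg_pos) simp
  then show ?thesis by simp
qed

text \<open>Only \<open>k \<ge> 1\<close> is possible: for \<open>k = 0\<close> the hypothesis says that \<open>g\<close> is positive definite on the
  cube, which does not determine the sign of its value at the top.\<close>

lemma cube_nonneg:
  assumes "finite N" "1 \<le> k"
    and "\<And>H. H \<subseteq> N \<Longrightarrow> card H < k \<Longrightarrow> g H = 0"
    and "\<And>S. S \<subseteq> N \<Longrightarrow> k \<le> card S \<Longrightarrow> 0 \<le> (-1) ^ k * (\<Sum>H\<in>Pow N. chi S H * g H)"
  shows "0 \<le> (g N :: real)"
  using assms
proof (induction N arbitrary: k g rule: finite_induct)
  case empty
  then show ?case by simp
next
  case (insert j N)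
  note zero = insert.prems(2) and pos = insert.prems(3)
  have fS: "finite S" if "S \<subseteq> N" for S using that insert.hyps(1) finite_subset by blast
  \<comment> \<open>\<open>A\<close> and \<open>B\<close> are the Walsh sums over the faces without
    and with \<open>j\<close>; on the larger cube the coefficients at \<open>S\<close> and at
    \<open>insert j S\<close> are their sum and their difference.\<close>
  define A where "A S = (\<Sum>H\<in>Pow N. chi S H * g H)" for S
  define B where "B S = (\<Sum>H\<in>Pow N. chi S H * g (insert j H))" for S
  have t1: "(\<Sum>H\<in>Pow (insert j N). chi S H * g H) = A S + B S" if "S \<subseteq> N" for S
  proof -
    have "(\<Sum>H\<in>Pow N. chi S (insert j H) * g (insert j H)) = B S"
      unfolding B_def
    proof (rule sum.cong[OF refl])
      fix H assume "H \<in> Pow N"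
      then have "finite H" "j \<notin> H" "j \<notin> S" using that insert.hyps fS by auto
      then show "chi S (insert j H) * g (insert j H) = chi S H * g (insert j H)" by (simp add: chi_insert)
    qed
    then show ?thesis by (simp add: sum_Pow_insert insert.hyps A_def)
  qed
  have t2: "(\<Sum>H\<in>Pow (insert j N). chi (insert j S) H * g H) = A S - B S" if "S \<subseteq> N" for S
  proof -
    have jS: "j \<notin> S" using that insert.hyps by auto
    have "(\<Sum>H\<in>Pow N. chi (insert j S) H * g H) = A S"
      unfolding A_def using insert.hyps by (intro sum.cong) (auto simp: chi_insert'[OF fS[OF that] jS])
    moreover have "(\<Sum>H\<in>Pow N. chi (insert j S) (insert j H) * g (insert j H)) = - B S"
      unfolding B_def sum_negf[symmetric]
    proof (rule sum.cong[OF refl])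
      fix H assume "H \<in> Pow N"
      then have "j \<notin> H" "finite H" using insert.hyps fS by auto
      then show "chi (insert j S) (insert j H) * g (insert j H) = - (chi S H * g (insert j H))"
        using jS by (simp add: chi_insert'[OF fS[OF that] jS] chi_insert)
    qed
    ultimately show ?thesis by (simp add: sum_Pow_insert insert.hyps)
  qed
  \<comment> \<open>On the face without \<open>j\<close> the hypothesis with the same
    \<open>k\<close> is inherited: the coefficient \<open>A S\<close> is the average of the two
    coefficients on the larger cube.\<close>
  have gN: "0 \<le> g N"
  proof (rule insert.IH[OF insert.prems(1)])
    show "g H = 0" if "H \<subseteq> N" "card H < k" for H using zero[of H] that by auto
    fix S assume S: "S \<subseteq> N" "k \<le> card S"
    have "0 \<le> (-1) ^ k * (A S + B S)" using pos[of S] S t1[OF S(1)] by auto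
    moreover have "0 \<le> (-1) ^ k * (A S - B S)"
      using pos[of "insert j S"] S t2[OF S(1)] card_insert_le[of S j] by (auto simp: subset_insertI2)
    ultimately have "0 \<le> (-1) ^ k * A S" by (simp add: algebra_simps)
    then show "0 \<le> (-1) ^ k * (\<Sum>H\<in>Pow N. chi S H * g H)" by (simp only: A_def)
  qed
  show ?case
  proof (cases "k = 1")
    case True
    have "g {} \<le> g (insert j N)"
    proof (rule cube_mono_first)
      fix S assume S: "S \<subseteq> insert j N" "S \<noteq> {}"
      then have "1 \<le> card S" using insert.hyps(1) finite_subset[OF S(1)] by (simp add: Suc_le_eq card_gt_0_iff)
      then show "(\<Sum>H\<in>Pow (insert j N). chi S H * g H) \<le> 0" using pos[of S] S True by simp
    qed (use insert.hyps in simp)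
    moreover have "g {} = 0" using zero[of "{}"] True by simp
    ultimately show ?thesis by simp
  next
    case False
    then have k: "1 \<le> k - 1" "k = Suc (k - 1)" using insert.prems(1) by auto
    \<comment> \<open>The difference in direction \<open>j\<close> vanishes on sets smaller than
      \<open>k - 1\<close>, and its coefficient at \<open>S\<close> is minus the one of
      \<open>g\<close> at \<open>insert j S\<close>. The lost degree and the changed sign match, so
      the induction hypothesis applies with \<open>k - 1\<close>.\<close>
    have "0 \<le> g (insert j N) - g N"
    proof (rule insert.IH[OF k(1), of "\<lambda>H. g (insert j H) - g H"])
      fix H assume H: "H \<subseteq> N" "card H < k - 1"
      have "card (insert j H) \<le> Suc (card H)" using fS[OF H(1)] by (simp add: card_insert_if)
      then have "card (insert j H) < k" using H(2) by linarith
      then show "g (insert j H) - g H = 0" using zero[of H] zero[of "insert j H"] H(1,2) by (simp add: subset_insertI2 insert_mono)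
    next
      fix S assume S: "S \<subseteq> N" "k - 1 \<le> card S"
      have "j \<notin> S" using S insert.hyps by auto
      then have "k \<le> card (insert j S)" using S fS[OF S(1)] k(2) by simp
      then have "0 \<le> (-1) ^ k * (A S - B S)"
        using pos[of "insert j S"] S t2[OF S(1)] by (auto simp: subset_insertI2)
      also have "(-1) ^ k * (A S - B S) = (-1) ^ (k - 1) * (B S - A S)" by (subst k(2)) (simp add: right_diff_distrib)
      also have "B S - A S = (\<Sum>H\<in>Pow N. chi S H * (g (insert j H) - g H))"
        unfolding A_def B_def by (simp add: sum_subtractf right_diff_distrib)
      finally show "0 \<le> (-1) ^ (k - 1) * (\<Sum>H\<in>Pow N. chi S H * (g (insert j H) - g H))" .
    qed
    with gN show ?thesis by simp
  qed
qed

section \<open>A binomial identity and sums of point masses\<close>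

lemma sum_card_Pow:
  assumes "finite M"
  shows "(\<Sum>F\<in>Pow M. \<phi> (card F)) = (\<Sum>i\<le>card M. real (card M choose i) * \<phi> i)"
proof -
  have "(\<Sum>F\<in>Pow M. \<phi> (card F)) = (\<Sum>i\<le>card M. \<Sum>F\<in>{F\<in>Pow M. card F = i}. \<phi> (card F))"
    using assms by (intro sum.group[symmetric]) (auto intro: card_mono)
  also have "\<dots> = (\<Sum>i\<le>card M. real (card M choose i) * \<phi> i)"
    using n_subsets[OF assms] by (intro sum.cong) (auto simp: Pow_def)
  finally show ?thesis .
qed

text \<open>Negating the upper index absorbs the sign and turns the sum into a Vandermonde
  convolution of \<open>n\<close> with \<open>k - n - 1\<close>, whose value is
  \<open>(k - 1) choose (k - 1)\<close>.\<close>

lemma alternating_choose_sum: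
  assumes "1 \<le> k" "k \<le> n"
  shows "(\<Sum>i<k. (-1) ^ (k - i) * real ((n - 1 - i) choose (n - k)) * real (n choose i)) = -1"
proof -
  have "(-1) ^ (k - i) * real ((n - 1 - i) choose (n - k)) * real (n choose i)
      = - ((real n gchoose i) * ((real k - real n - 1) gchoose (k - 1 - i)))" if i: "i < k" for i
  proof -
    have "(n - 1 - i) choose (n - k) = (n - 1 - i) choose (k - 1 - i)"
      using assms i by (subst binomial_symmetric) (auto intro: arg_cong2[where f = binomial])
    then have "real ((n - 1 - i) choose (n - k)) = (real (n - 1 - i) gchoose (k - 1 - i))"
      by (simp add: binomial_gbinomial)
    also have "\<dots> = (-1) ^ (k - 1 - i) * ((real (k - 1 - i) - real (n - 1 - i) - 1) gchoose (k - 1 - i))"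
      by (rule gbinomial_negated_upper)
    also have "real (k - 1 - i) - real (n - 1 - i) - 1 = real k - real n - 1"
      using assms i by (simp add: of_nat_diff)
    finally have *: "real ((n - 1 - i) choose (n - k)) = (-1) ^ (k - 1 - i) * ((real k - real n - 1) gchoose (k - 1 - i))" .
    have s: "k - i = Suc (k - 1 - i)" using i by simp
    have "(-1::real) ^ (k - i) * (-1) ^ (k - 1 - i) = -1"
      unfolding s by (simp add: power_mult_distrib[symmetric])
    then show ?thesis unfolding * by (simp add: binomial_gbinomial mult.assoc[symmetric] mult.commute)
  qed
  then have "(\<Sum>i<k. (-1) ^ (k - i) * real ((n - 1 - i) choose (n - k)) * real (n choose i))
      = (\<Sum>i<k. - ((real n gchoose i) * ((real k - real n - 1) gchoose (k - 1 - i))))"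
    by (intro sum.cong) auto
  also have "\<dots> = - (\<Sum>i\<le>k - 1. (real n gchoose i) * ((real k - real n - 1) gchoose (k - 1 - i)))"
  proof -
    have "{..<k} = {..k - 1}" using assms by auto
    then show ?thesis by (simp add: sum_negf)
  qed
  also have "(\<Sum>i\<le>k - 1. (real n gchoose i) * ((real k - real n - 1) gchoose (k - 1 - i))) = ((real n + (real k - real n - 1)) gchoose (k - 1))"
    using gbinomial_Vandermonde[of "real n" "real k - real n - 1" "k - 1"] by (simp only: atLeast0AtMost)
  also have "real n + (real k - real n - 1) = real (k - 1)" using assms by (simp add: of_nat_diff)
  also have "(real (k - 1) gchoose (k - 1)) = 1" by (simp flip: binomial_gbinomial)
  finally show ?thesis .
qed

text \<open>The points \<open>pt a\<close> may coincide and their weights may cancel, so the support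
  is only contained in the image; the sum is taken over the image and then redistributed.\<close>

lemma dint_dirac_sum:
  assumes "finite A"
  shows "dint (\<lambda>q. \<Sum>a\<in>A. \<alpha> a * dirac (pt a) q) f = (\<Sum>a\<in>A. \<alpha> a * f (pt a))"
proof -
  have sub: "{q. (\<Sum>a\<in>A. \<alpha> a * dirac (pt a) q) \<noteq> 0} \<subseteq> pt ` A"
  proof
    fix q assume "q \<in> {q. (\<Sum>a\<in>A. \<alpha> a * dirac (pt a) q) \<noteq> 0}"
    then obtain a where "a \<in> A" "\<alpha> a * dirac (pt a) q \<noteq> 0" by (auto elim: sum.not_neutral_contains_not_neutral)
    then show "q \<in> pt ` A" by (auto simp: dirac_def split: if_splits)
  qed
  have "dint (\<lambda>q. \<Sum>a\<in>A. \<alpha> a * dirac (pt a) q) f = (\<Sum>q\<in>pt ` A. (\<Sum>a\<in>A. \<alpha> a * dirac (pt a) q) * f q)"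
    by (rule dint_superset[OF _ sub]) (use assms in simp)
  also have "\<dots> = (\<Sum>a\<in>A. \<Sum>q\<in>pt ` A. (\<alpha> a * dirac (pt a) q) * f q)"
    unfolding sum_distrib_right by (rule sum.swap)
  also have "\<dots> = (\<Sum>a\<in>A. \<alpha> a * f (pt a))"
  proof (rule sum.cong[OF refl])
    fix a assume a: "a \<in> A"
    have "(\<Sum>q\<in>pt ` A. (\<alpha> a * dirac (pt a) q) * f q) = (\<Sum>q\<in>pt ` A. if q = pt a then \<alpha> a * f q else 0)"
      by (rule sum.cong) (auto simp: dirac_def)
    also have "\<dots> = \<alpha> a * f (pt a)" using assms a by (simp add: sum.delta)
    finally show "(\<Sum>q\<in>pt ` A. (\<alpha> a * dirac (pt a) q) * f q) = \<alpha> a * f (pt a)" .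
  qed
  finally show ?thesis .
qed

lemma discrete_measures_dirac_sum:
  assumes "finite A" "\<And>a. a \<in> A \<Longrightarrow> pt a \<in> S"
  shows "(\<lambda>q. \<Sum>a\<in>A. \<alpha> a * dirac (pt a) q) \<in> discrete_measures S"
proof -
  have "{q. (\<Sum>a\<in>A. \<alpha> a * dirac (pt a) q) \<noteq> 0} \<subseteq> pt ` A"
  proof
    fix q assume "q \<in> {q. (\<Sum>a\<in>A. \<alpha> a * dirac (pt a) q) \<noteq> 0}"
    then obtain a where "a \<in> A" "\<alpha> a * dirac (pt a) q \<noteq> 0" by (auto elim: sum.not_neutral_contains_not_neutral)
    then show "q \<in> pt ` A" by (auto simp: dirac_def split: if_splits)
  qed
  then show ?thesis using assms finite_subset[of _ "pt ` A"] unfolding discrete_measures_def by blast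
qed

lemma dmeas_dint: "w \<in> discrete_measures S \<Longrightarrow> dmeas w A = dint w (\<lambda>p. if p \<in> A then 1 else 0)"
  unfolding dmeas_def dint_def discrete_measures_def
  by (rule sum.mono_neutral_cong_left) auto

lemma mix_apply [simp]: "i \<in> {1..n} \<Longrightarrow> mix n F x y i = (if i \<in> F then x i else y i)"
  by (simp add: mix_def)

lemma points_iff: "x \<in> points X n \<longleftrightarrow> (\<forall>i\<in>{1..n}. x i \<in> topspace (X i)) \<and> x \<in> extensional {1..n}"
  by (auto simp: PiE_def Pi_def)

lemma points_coord: "x \<in> points X n \<Longrightarrow> i \<in> {1..n} \<Longrightarrow> x i \<in> topspace (X i)"
  by (simp only: points_iff)

lemma points_eqI: "x \<in> points X n \<Longrightarrow> y \<in> points X n \<Longrightarrow> (\<And>i. i \<in> {1..n} \<Longrightarrow> x i = y i) \<Longrightarrow> x = y"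
  unfolding points_iff by (auto intro: extensionalityI)

lemma mix_points: "x \<in> points X n \<Longrightarrow> y \<in> points X n \<Longrightarrow> mix n F x y \<in> points X n"
  unfolding points_iff by (auto simp: mix_def)

lemma upd_points: "x \<in> points X n \<Longrightarrow> i \<in> {1..n} \<Longrightarrow> c \<in> topspace (X i) \<Longrightarrow> x(i := c) \<in> points X n"
  unfolding points_iff by (auto simp: extensional_def)

lemma mix_full: "x \<in> points X n \<Longrightarrow> mix n {1..n} x y = x"
  unfolding points_iff by (auto simp: mix_def extensional_def fun_eq_iff)

lemma mix_empty: "y \<in> points X n \<Longrightarrow> mix n {} x y = y"
  unfolding points_iff by (auto simp: mix_def extensional_def fun_eq_iff)

section \<open>Symmetries and inequalities of the kernel\<close>

locale cns_kernel =
  fixes X :: "nat \<Rightarrow> 'a topology" and n k :: nat and J :: "(nat \<Rightarrow> 'a) \<Rightarrow> (nat \<Rightarrow> 'a) \<Rightarrow> real"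
  assumes kn: "k < n"
    and cns: "complete_n_symmetric X n J"
    and pdi: "PDI X n k J"
    and diag: "\<And>x y. (x, y) \<in> ext_diag X n k \<Longrightarrow> J x y = 0"
begin

abbreviation "PT \<equiv> points X n"

text \<open>Both symmetries in a single coordinatewise test. Coordinates where each pair is diagonal
  are first moved to the common value of the second pair; the others are then swapped where
  necessary.\<close>

lemma J_eqI:
  assumes pts: "u \<in> PT" "v \<in> PT" "u' \<in> PT" "v' \<in> PT"
    and j: "\<And>j. j \<in> {1..n} \<Longrightarrow> (u j = u' j \<and> v j = v' j) \<or> (u j = v' j \<and> v j = u' j) \<or> (u j = v j \<and> u' j = v' j)"
  shows "J u v = J u' v'"
proof -
  \<comment> \<open>The coordinates outside \<open>D\<close> are diagonal for both pairs and are
    replaced by those of \<open>u'\<close>; afterwards each coordinate agrees with the second pair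
    up to a swap.\<close>
  define D where "D = {j\<in>{1..n}. \<not> (u j = v j \<and> u' j = v' j)}"
  define a where "a = mix n D u u'"
  define b where "b = mix n D v u'"
  have aP: "a \<in> PT" and bP: "b \<in> PT" unfolding a_def b_def by (intro mix_points pts)+
  have 1: "mix n D u u = u" by (rule points_eqI[OF mix_points[OF pts(1,1)] pts(1)]) simp
  have 2: "mix n D v u = v" by (rule points_eqI[OF mix_points[OF pts(2,1)] pts(2)]) (auto simp: D_def)
  have DS: "D \<subseteq> {1..n}" unfolding D_def by auto
  have "J (mix n D u u) (mix n D v u) = J (mix n D u u') (mix n D v u')"
    using cns pts DS unfolding complete_n_symmetric_def by blast
  then have e1: "J u v = J a b" by (simp only: 1 2 a_def b_def)
  define F where "F = {j\<in>{1..n}. a j = u' j \<and> b j = v' j}"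
  have FS: "F \<subseteq> {1..n}" unfolding F_def by auto
  have aj: "a j = (if j \<in> D then u j else u' j)" and bj: "b j = (if j \<in> D then v j else u' j)"
    if "j \<in> {1..n}" for j using that by (simp_all add: a_def b_def)
  have sw: "(a j = u' j \<and> b j = v' j) \<or> (a j = v' j \<and> b j = u' j)" if "j \<in> {1..n}" for j
    using j[OF that] that unfolding aj[OF that] bj[OF that] D_def by auto
  have 3: "mix n F a b = u'"
    by (rule points_eqI[OF mix_points[OF aP bP] pts(3)]) (use sw in \<open>auto simp: F_def\<close>)
  have 4: "mix n F b a = v'"
    by (rule points_eqI[OF mix_points[OF bP aP] pts(4)]) (use sw in \<open>auto simp: F_def\<close>)
  have "n_symmetric X n J" using cns unfolding complete_n_symmetric_def by (rule conjunct1)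
  then have "J a b = J (mix n F a b) (mix n F b a)"
    using aP bP FS unfolding n_symmetric_def by blast
  then show ?thesis by (simp only: e1 3 4)
qed

lemma J_sym: "u \<in> PT \<Longrightarrow> v \<in> PT \<Longrightarrow> J u v = J v u"
  by (rule J_eqI) auto

lemma J_diag_const: "u \<in> PT \<Longrightarrow> v \<in> PT \<Longrightarrow> J u u = J v v"
  by (rule J_eqI) auto

lemma J_zero:
  assumes "u \<in> PT" "v \<in> PT" "A \<subseteq> {1..n}" "card A < k" "\<And>i. i \<in> {1..n} - A \<Longrightarrow> u i = v i"
  shows "J u v = 0"
proof (rule diag)
  have fA: "finite A" using assms(3) finite_subset by auto
  have "card ({1..n} - A) \<le> card {i\<in>{1..n}. u i = v i}" using assms(5) by (intro card_mono) auto
  moreover have "card ({1..n} - A) = n - card A" using assms(3) fA by (simp add: card_Diff_subset)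
  ultimately show "(u, v) \<in> ext_diag X n k" using assms(1,2,4) kn unfolding ext_diag_def by auto
qed

text \<open>The positivity condition for a measure listed with possible repetitions. Membership in
  \<open>discrete_k\<close> is restated by the number of restricted factors: at least
  \<open>n - k + 1\<close> full factors means fewer than \<open>k\<close> restricted ones.\<close>

lemma pdi_sum:
  assumes A: "finite A" "\<And>a. a \<in> A \<Longrightarrow> pt a \<in> PT"
    and zero: "\<And>B. (\<And>i. i \<in> {1..n} \<Longrightarrow> B i \<subseteq> topspace (X i)) \<Longrightarrow>
       card {i\<in>{1..n}. B i \<noteq> topspace (X i)} < k \<Longrightarrow>
       (\<Sum>a\<in>A. \<alpha> a * (if \<forall>i\<in>{1..n}. pt a i \<in> B i then 1 else 0)) = 0"
  shows "0 \<le> (-1) ^ k * (\<Sum>a\<in>A. \<Sum>b\<in>A. \<alpha> a * \<alpha> b * J (pt a) (pt b))"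
proof -
  let ?w = "\<lambda>q. \<Sum>a\<in>A. \<alpha> a * dirac (pt a) q"
  have w: "?w \<in> discrete_measures PT" by (rule discrete_measures_dirac_sum[OF A])
  have "dmeas ?w (PiE {1..n} B) = 0"
    if B: "\<forall>i\<in>{1..n}. B i \<subseteq> topspace (X i)" "card {i\<in>{1..n}. B i = topspace (X i)} \<ge> n - k + 1" for B
  proof -
    have "card {i\<in>{1..n}. B i \<noteq> topspace (X i)} = card ({1..n} - {i\<in>{1..n}. B i = topspace (X i)})"
      by (rule arg_cong[where f = card]) auto
    also have "\<dots> = n - card {i\<in>{1..n}. B i = topspace (X i)}" by (subst card_Diff_subset) auto
    also have "\<dots> < k"
    proof -
      have "card {i\<in>{1..n}. B i = topspace (X i)} \<le> card {1..n}" by (rule card_mono) auto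
      then have "card {i\<in>{1..n}. B i = topspace (X i)} \<le> n" by simp
      then show "n - card {i\<in>{1..n}. B i = topspace (X i)} < k" using B(2) kn by linarith
    qed
    finally have small: "card {i\<in>{1..n}. B i \<noteq> topspace (X i)} < k" .
    have "dmeas ?w (PiE {1..n} B) = (\<Sum>a\<in>A. \<alpha> a * (if pt a \<in> PiE {1..n} B then 1 else 0))"
      by (subst dmeas_dint[OF w], rule dint_dirac_sum[OF A(1)])
    also have "\<dots> = (\<Sum>a\<in>A. \<alpha> a * (if \<forall>i\<in>{1..n}. pt a i \<in> B i then 1 else 0))"
    proof (rule sum.cong[OF refl])
      fix a assume "a \<in> A"
      then have "pt a \<in> extensional {1..n}" using A(2) points_iff by blast
      then have "(pt a \<in> PiE {1..n} B) = (\<forall>i\<in>{1..n}. pt a i \<in> B i)" by (auto simp: PiE_def Pi_def)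
      then show "\<alpha> a * (if pt a \<in> PiE {1..n} B then 1 else 0) = \<alpha> a * (if \<forall>i\<in>{1..n}. pt a i \<in> B i then 1 else 0)"
        by (simp only:)
    qed
    also have "\<dots> = 0" by (rule zero[OF _ small]) (use B(1) in auto)
    finally show ?thesis .
  qed
  then have "?w \<in> discrete_k X n k" using w unfolding discrete_k_def by blast
  then have "0 \<le> dint ?w (\<lambda>v. dint ?w (\<lambda>u. (-1) ^ k * J u v))" using pdi unfolding PDI_def by blast
  also have "\<dots> = (\<Sum>b\<in>A. \<alpha> b * (\<Sum>a\<in>A. \<alpha> a * ((-1) ^ k * J (pt a) (pt b))))"
    by (simp only: dint_dirac_sum[OF A(1)])
  also have "\<dots> = (\<Sum>a\<in>A. \<Sum>b\<in>A. \<alpha> b * (\<alpha> a * ((-1) ^ k * J (pt a) (pt b))))"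
    unfolding sum_distrib_left by (rule sum.swap)
  also have "\<dots> = (-1) ^ k * (\<Sum>a\<in>A. \<Sum>b\<in>A. \<alpha> a * \<alpha> b * J (pt a) (pt b))"
    unfolding sum_distrib_left by (intro sum.cong refl) (simp add: mult_ac)
  finally show ?thesis .
qed

text \<open>The test measures are products: in coordinate \<open>i\<close> the point masses at
  \<open>x i\<close>, \<open>y i\<close>, \<open>c\<close> with weights 1, 1, -2, and in every other
  coordinate the difference or the sum of the point masses at \<open>y\<close> and \<open>x\<close>,
  according to whether the coordinate lies in \<open>S\<close>. If \<open>S\<close> has at least
  \<open>k - 1\<close> elements, at least \<open>k\<close> factors have mass 0 and the measure is
  admissible. The resulting conditions are those of \<open>cube_nonneg\<close> with
  \<open>k - 1\<close>, which is why \<open>k\<close> must be at least 2.\<close>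

lemma quasi_triangle:
  assumes k2: "2 \<le> k" and xy: "x \<in> PT" "y \<in> PT" and i: "i \<in> {1..n}" and c: "c \<in> topspace (X i)"
  shows "J x y \<le> 2 * J x (y(i := c)) + 2 * J (x(i := c)) y - 3 * J (x(i := c)) (y(i := c))"
proof -
  define N where "N = {1..n} - {i}"
  have fN: "finite N" and iN: "i \<notin> N" unfolding N_def by auto
  define cc where "cc l = (if l = 0 then x i else if l = 1 then y i else c)" for l :: nat
  \<comment> \<open>Total mass 0, so that coordinate \<open>i\<close> supplies one of the
    \<open>k\<close> factors of mass 0.\<close>
  define w where "w l = (if l = 2 then -2 else 1 :: real)" for l :: nat
  define L where "L = {0,1,2::nat}"
  have fL: "finite L" and w0: "(\<Sum>l\<in>L. w l) = 0" by (simp_all add: L_def w_def)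
  have xt: "x i \<in> topspace (X i)" "y i \<in> topspace (X i)" using points_coord[OF xy(1) i] points_coord[OF xy(2) i] .
  have ct: "cc l \<in> topspace (X i)" for l using xt c by (simp add: cc_def)
  define p where "p F l = (mix n F x y)(i := cc l)" for F l
  have pP: "p F l \<in> PT" for F l unfolding p_def by (intro upd_points mix_points xy i ct)
  have pj: "p F l j = (if j = i then cc l else if j \<in> F then x j else y j)" if "j \<in> {1..n}" for F l j
    using that by (simp add: p_def)
  \<comment> \<open>The form after summation over coordinate \<open>i\<close>, as a function on the
    cube of the other coordinates: \<open>H\<close> is the set of those in which the two points
    still differ in origin.\<close>
  define \<gamma> where "\<gamma> H = (\<Sum>l\<in>L. \<Sum>m\<in>L. w l * w m * J (p H l) (p {} m))" for H
  have Jp: "J (p F l) (p G m) = J (p ((F - G) \<union> (G - F)) l) (p {} m)" for F G l m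
  proof (rule J_eqI[OF pP pP pP pP])
    fix j assume "j \<in> {1..n}"
    note pj' = pj[OF this]
    show "p F l j = p ((F - G) \<union> (G - F)) l j \<and> p G m j = p {} m j \<or>
        p F l j = p {} m j \<and> p G m j = p ((F - G) \<union> (G - F)) l j \<or>
        p F l j = p G m j \<and> p ((F - G) \<union> (G - F)) l j = p {} m j"
      unfolding pj' by (cases "j = i"; cases "j \<in> F"; cases "j \<in> G") auto
  qed
  have "0 \<le> - \<gamma> N"
  proof (rule cube_nonneg[OF fN, of "k - 1" "\<lambda>H. - \<gamma> H"])
    show "1 \<le> k - 1" using k2 by simp
    fix H assume H: "H \<subseteq> N" "card H < k - 1"
    have "J (p H l) (p {} m) = 0" for l m
    proof (rule J_zero[OF pP pP, of "insert i H"])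
      show "insert i H \<subseteq> {1..n}" using H i by (auto simp: N_def)
      have "card (insert i H) \<le> Suc (card H)" using finite_subset[OF H(1) fN] by (simp add: card_insert_if)
      then show "card (insert i H) < k" using H(2) by linarith
    qed (simp add: pj)
    then show "- \<gamma> H = 0" by (simp add: \<gamma>_def)
  next
    fix S assume S: "S \<subseteq> N" "k - 1 \<le> card S"
    have fS: "finite S" using S fN finite_subset by auto
    let ?A = "L \<times> Pow N"
    let ?\<alpha> = "\<lambda>(l, F). w l * chi S F" and ?pt = "\<lambda>(l, F). p F l"
    have "0 \<le> (-1) ^ k * (\<Sum>a\<in>?A. \<Sum>b\<in>?A. ?\<alpha> a * ?\<alpha> b * J (?pt a) (?pt b))"
    proof (rule pdi_sum)
      fix B assume B: "\<And>j. j \<in> {1..n} \<Longrightarrow> B j \<subseteq> topspace (X j)"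
        and small: "card {j\<in>{1..n}. B j \<noteq> topspace (X j)} < k"
      let ?R = "{j\<in>{1..n}. B j \<noteq> topspace (X j)}"
      let ?I = "\<lambda>l F. (if \<forall>j\<in>{1..n}. p F l j \<in> B j then 1 else 0 :: real)"
      have full: "p F l j \<in> B j" if "j \<in> {1..n}" "j \<notin> ?R" for F l j
        using pP[of F l] that unfolding points_iff by auto
      have "(\<Sum>a\<in>?A. ?\<alpha> a * (if \<forall>j\<in>{1..n}. ?pt a j \<in> B j then 1 else 0)) = (\<Sum>l\<in>L. \<Sum>F\<in>Pow N. w l * chi S F * ?I l F)"
        by (simp add: sum.cartesian_product split_def)
      also have "\<dots> = 0"
      proof (cases "S \<subseteq> ?R")
        case True
        \<comment> \<open>At most \<open>k - 1\<close> coordinates are restricted and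
          \<open>S\<close> already has that many, so coordinate \<open>i\<close> is unrestricted and
          its mass 0 makes the sum vanish.\<close>
        have "S = ?R"
          by (rule card_subset_eq[OF _ True]) (use card_mono[OF _ True] S(2) small in auto)
        then have iR: "i \<notin> ?R" using S(1) iN by auto
        have I: "?I l F = ?I 0 F" for l F
        proof -
          have "(p F l j \<in> B j) = (p F 0 j \<in> B j)" if "j \<in> {1..n}" for j
            using full[of i F l] full[of i F 0] that i iR pj[OF that, of F l] pj[OF that, of F 0] by (cases "j = i") auto
          then show ?thesis by simp
        qed
        have "(\<Sum>l\<in>L. \<Sum>F\<in>Pow N. w l * chi S F * ?I l F) = (\<Sum>l\<in>L. w l * (\<Sum>F\<in>Pow N. chi S F * ?I 0 F))"
          unfolding sum_distrib_left by (intro sum.cong refl) (subst I, simp only: mult.assoc)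
        also have "\<dots> = 0" unfolding sum_distrib_right[symmetric] by (simp only: w0 mult_zero_left)
        finally show ?thesis .
      next
        case False
        then obtain j where j: "j \<in> S" "j \<notin> ?R" by auto
        have jN: "j \<in> N" and j1: "j \<in> {1..n}" using j S(1) by (auto simp: N_def)
        have ji: "j \<noteq> i" using jN iN by auto
        have "(\<Sum>F\<in>Pow N. w l * chi S F * ?I l F) = 0" for l
        proof -
          have N: "N = insert j (N - {j})" using jN by auto
          \<comment> \<open>The coordinate \<open>j\<close> of \<open>S\<close> is unrestricted, so
            moving it between \<open>F\<close> and its complement changes only the sign of the
            character and the terms cancel in pairs.\<close>
          have ins: "w l * chi S (insert j F) * ?I l (insert j F) = - (w l * chi S F * ?I l F)" if F: "F \<in> Pow (N - {j})" for F
          proof -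
            have fF: "finite F" "j \<notin> F" using F fN finite_subset[of F N] by auto
            have "(p (insert j F) l q \<in> B q) = (p F l q \<in> B q)" if "q \<in> {1..n}" for q
              using full[OF j1 j(2)] pj[OF that] by (cases "q = j") auto
            then show ?thesis using j(1) by (simp add: chi_insert[OF fF])
          qed
          have "(\<Sum>F\<in>Pow N. w l * chi S F * ?I l F)
            = (\<Sum>F\<in>Pow (N - {j}). w l * chi S F * ?I l F) + (\<Sum>F\<in>Pow (N - {j}). w l * chi S (insert j F) * ?I l (insert j F))"
            by (subst N, rule sum_Pow_insert) (use fN in auto)
          also have "(\<Sum>F\<in>Pow (N - {j}). w l * chi S (insert j F) * ?I l (insert j F)) = - (\<Sum>F\<in>Pow (N - {j}). w l * chi S F * ?I l F)"
            unfolding sum_negf[symmetric] by (rule sum.cong[OF refl ins])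
          finally show ?thesis by simp
        qed
        then show ?thesis by simp
      qed
      finally show "(\<Sum>a\<in>?A. ?\<alpha> a * (if \<forall>j\<in>{1..n}. ?pt a j \<in> B j then 1 else 0)) = 0" .
    qed (use fL fN pP in auto)
    \<comment> \<open>Kernel values and characters depend on \<open>F\<close> and \<open>G\<close>
      only through the symmetric difference, and each subset of \<open>N\<close> arises from
      \<open>2 ^ card N\<close> pairs.\<close>
    also have "(\<Sum>a\<in>?A. \<Sum>b\<in>?A. ?\<alpha> a * ?\<alpha> b * J (?pt a) (?pt b)) = 2 ^ card N * (\<Sum>H\<in>Pow N. chi S H * \<gamma> H)"
    proof -
      have sp: "(\<Sum>a\<in>L \<times> Pow N. f a) = (\<Sum>l\<in>L. \<Sum>F\<in>Pow N. f (l, F))" for f :: "_ \<Rightarrow> real"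
        by (simp add: sum.cartesian_product)
      have "(\<Sum>a\<in>?A. \<Sum>b\<in>?A. ?\<alpha> a * ?\<alpha> b * J (?pt a) (?pt b))
        = (\<Sum>l\<in>L. \<Sum>F\<in>Pow N. \<Sum>m\<in>L. \<Sum>G\<in>Pow N. (w l * chi S F) * (w m * chi S G) * J (p F l) (p G m))"
        by (simp only: sp case_prod_conv)
      also have "\<dots> = (\<Sum>F\<in>Pow N. \<Sum>G\<in>Pow N. \<Sum>l\<in>L. \<Sum>m\<in>L. (w l * chi S F) * (w m * chi S G) * J (p F l) (p G m))"
      proof (subst sum.swap, rule sum.cong[OF refl])
        fix F
        have "(\<Sum>l\<in>L. \<Sum>m\<in>L. \<Sum>G\<in>Pow N. (w l * chi S F) * (w m * chi S G) * J (p F l) (p G m)) = (\<Sum>l\<in>L. \<Sum>G\<in>Pow N. \<Sum>m\<in>L. (w l * chi S F) * (w m * chi S G) * J (p F l) (p G m))"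
          by (rule sum.cong[OF refl]) (rule sum.swap)
        also have "\<dots> = (\<Sum>G\<in>Pow N. \<Sum>l\<in>L. \<Sum>m\<in>L. (w l * chi S F) * (w m * chi S G) * J (p F l) (p G m))" by (rule sum.swap)
        finally show "(\<Sum>l\<in>L. \<Sum>m\<in>L. \<Sum>G\<in>Pow N. (w l * chi S F) * (w m * chi S G) * J (p F l) (p G m)) = (\<Sum>G\<in>Pow N. \<Sum>l\<in>L. \<Sum>m\<in>L. (w l * chi S F) * (w m * chi S G) * J (p F l) (p G m))" .
      qed
      also have "\<dots> = (\<Sum>F\<in>Pow N. \<Sum>G\<in>Pow N. chi S ((F - G) \<union> (G - F)) * \<gamma> ((F - G) \<union> (G - F)))"
      proof (intro sum.cong refl)
        fix F G assume "F \<in> Pow N" "G \<in> Pow N"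
        then have "finite F" "finite G" using fN finite_subset by auto
        note ch = chi_symdiff[OF this, of S]
        show "(\<Sum>l\<in>L. \<Sum>m\<in>L. (w l * chi S F) * (w m * chi S G) * J (p F l) (p G m))
          = chi S ((F - G) \<union> (G - F)) * \<gamma> ((F - G) \<union> (G - F))"
          unfolding \<gamma>_def sum_distrib_left ch[symmetric] Jp[of F _ G] by (intro sum.cong refl) (simp add: mult_ac)
      qed
      also have "\<dots> = (\<Sum>F\<in>Pow N. \<Sum>H\<in>Pow N. chi S H * \<gamma> H)"
      proof (rule sum.cong[OF refl])
        fix F assume F: "F \<in> Pow N"
        show "(\<Sum>G\<in>Pow N. chi S ((F - G) \<union> (G - F)) * \<gamma> ((F - G) \<union> (G - F))) = (\<Sum>H\<in>Pow N. chi S H * \<gamma> H)"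
          by (rule sum.reindex_bij_witness[of _ "\<lambda>H. (F - H) \<union> (H - F)" "\<lambda>H. (F - H) \<union> (H - F)"]) (use F in auto)
      qed
      also have "\<dots> = 2 ^ card N * (\<Sum>H\<in>Pow N. chi S H * \<gamma> H)" using fN by (simp add: card_Pow)
      finally show ?thesis .
    qed
    finally have "0 \<le> ((-1) ^ k * (2 ^ card N * (\<Sum>H\<in>Pow N. chi S H * \<gamma> H))) / 2 ^ card N"
      by (rule divide_nonneg_pos) simp
    then have "0 \<le> (-1) ^ k * (\<Sum>H\<in>Pow N. chi S H * \<gamma> H)" by (simp only: times_divide_eq_right[symmetric]) simp
    also have "(-1) ^ k * (\<Sum>H\<in>Pow N. chi S H * \<gamma> H) = (-1) ^ (k - 1) * (\<Sum>H\<in>Pow N. chi S H * - \<gamma> H)"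
    proof -
      have "k = Suc (k - 1)" using k2 by simp
      then have "(-1::real) ^ k = - ((-1) ^ (k - 1))" by (metis power_Suc mult_minus1)
      then show ?thesis by (simp add: sum_negf)
    qed
    finally show "0 \<le> (-1) ^ (k - 1) * (\<Sum>H\<in>Pow N. chi S H * - \<gamma> H)" .
  qed
  then have le: "\<gamma> N \<le> 0" by simp
  have up: "z(i := c') \<in> PT" if "z \<in> PT" "c' \<in> topspace (X i)" for z c'
    using that i by (intro upd_points)
  have pN: "p N l = x(i := cc l)" for l
    by (rule points_eqI[OF pP up[OF xy(1) ct]]) (simp add: pj N_def)
  have p0: "p {} l = y(i := cc l)" for l
    by (rule points_eqI[OF pP up[OF xy(2) ct]]) (simp add: pj)
  let ?g = "J (x(i := c)) (y(i := c))"
  have x0: "x(i := x i) = x" "y(i := y i) = y" by auto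
  have gx: "J x (y(i := x i)) = ?g"
    by (rule J_eqI) (auto intro: up xy c xt simp del: topspace_product_topology One_nat_def)
  have gy: "J (x(i := y i)) y = ?g"
    by (rule J_eqI) (auto intro: up xy c xt simp del: topspace_product_topology One_nat_def)
  have sw: "J (x(i := y i)) (y(i := x i)) = J x y"
    by (rule J_eqI) (auto intro: up xy c xt simp del: topspace_product_topology One_nat_def)
  have sx: "J (x(i := c)) (y(i := x i)) = J x (y(i := c))"
    by (rule J_eqI) (auto intro: up xy c xt simp del: topspace_product_topology One_nat_def)
  have sy: "J (x(i := y i)) (y(i := c)) = J (x(i := c)) y"
    by (rule J_eqI) (auto intro: up xy c xt simp del: topspace_product_topology One_nat_def)
  \<comment> \<open>The three pairs with equal index have weights 1, 1, 4 and all give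
    \<open>?g\<close>; each mixed pair occurs twice, with weight 1, -2 or -2. Halving gives the
    constants of the statement.\<close>
  have "\<gamma> N = 6 * ?g + 2 * J x y - 4 * J x (y(i := c)) - 4 * J (x(i := c)) y"
    unfolding \<gamma>_def pN p0 L_def
    by (simp add: w_def cc_def gx gy sw sx sy)
  with le show ?thesis by simp
qed

text \<open>Apply \<open>quasi_triangle\<close> to \<open>x\<close> and \<open>y(i := x i)\<close>
  with \<open>c = y i\<close>. By symmetry the first two terms on the right both equal
  \<open>2 * J x y\<close> and the third is -3 times the left side.\<close>

lemma J_mono_coord:
  assumes k2: "2 \<le> k" and xy: "x \<in> PT" "y \<in> PT" and i: "i \<in> {1..n}"
  shows "J x (y(i := x i)) \<le> J x y"
proof -
  have xt: "x i \<in> topspace (X i)" "y i \<in> topspace (X i)" using points_coord[OF xy(1) i] points_coord[OF xy(2) i] .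
  have up: "z(i := c') \<in> PT" if "z \<in> PT" "c' \<in> topspace (X i)" for z c'
    using that i by (intro upd_points)
  have y': "y(i := x i) \<in> PT" by (rule upd_points[OF xy(2) i xt(1)])
  have e1: "(y(i := x i))(i := y i) = y" by auto
  have e2: "J (x(i := y i)) (y(i := x i)) = J x y"
    by (rule J_eqI) (auto intro: up xy xt simp del: topspace_product_topology One_nat_def)
  have e3: "J (x(i := y i)) y = J x (y(i := x i))"
    by (rule J_eqI) (auto intro: up xy xt simp del: topspace_product_topology One_nat_def)
  show ?thesis using quasi_triangle[OF k2 xy(1) y' i xt(2)] unfolding e1 e2 e3 by simp
qed

text \<open>For \<open>k = 1\<close> the difference of the two point masses is a test measure. For
  larger \<open>k\<close> the coordinates of \<open>y\<close> are replaced one by one by those of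
  \<open>x\<close>, which never increases \<open>J\<close> and ends at the value 0 on the
  diagonal.\<close>

lemma J_nonneg:
  assumes k1: "1 \<le> k" and xy: "x \<in> PT" "y \<in> PT"
  shows "0 \<le> J x y"
proof (cases "k = 1")
  case True
  define pt where "pt b = (if b then x else y)" for b
  have "0 \<le> (-1) ^ k * (\<Sum>a\<in>UNIV. \<Sum>b\<in>UNIV. (if a then 1 else -1) * (if b then 1 else -1) * J (pt a) (pt b))"
  proof (rule pdi_sum)
    fix B assume "card {i\<in>{1..n}. B i \<noteq> topspace (X i)} < k"
    then have "{i\<in>{1..n}. B i \<noteq> topspace (X i)} = {}" using True by simp
    then have "\<forall>i\<in>{1..n}. B i = topspace (X i)" by blast
    then have "\<forall>i\<in>{1..n}. pt a i \<in> B i" for a using xy unfolding points_iff pt_def by auto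
    then show "(\<Sum>a\<in>UNIV. (if a then 1 else -1) * (if \<forall>i\<in>{1..n}. pt a i \<in> B i then 1 else 0)) = (0::real)"
      by (simp add: UNIV_bool)
  qed (use xy in \<open>auto simp: pt_def simp del: topspace_product_topology\<close>)
  moreover have "J x x = 0" "J y y = 0" using J_zero[of x x "{}"] J_zero[of y y "{}"] xy k1 by auto
  ultimately show ?thesis using True J_sym[OF xy] by (simp add: UNIV_bool pt_def)
next
  case False
  then have k2: "2 \<le> k" using k1 by simp
  have "J x (mix n A x y) \<le> J x y" if "finite A" "A \<subseteq> {1..n}" for A
    using that
  proof (induction A)
    case empty
    then show ?case by (simp only: mix_empty[OF xy(2)])
  next
    case (insert i A)
    then have i: "i \<in> {1..n}" by auto
    have "mix n (insert i A) x y = (mix n A x y)(i := x i)"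
      using i by (auto simp: mix_def fun_eq_iff)
    then have "J x (mix n (insert i A) x y) \<le> J x (mix n A x y)"
      using J_mono_coord[OF k2 xy(1) mix_points[OF xy] i, of A] by simp
    also have "\<dots> \<le> J x y" using insert by auto
    finally show ?case .
  qed
  from this[of "{1..n}"] have "J x x \<le> J x y" by (simp only: mix_full[OF xy(1)] finite_atLeastAtMost subset_refl simp_thms)
  moreover have "J x x = 0" using J_zero[of x x "{}"] xy k1 by auto
  ultimately show ?thesis by simp
qed

text \<open>Each coordinate of \<open>A\<close> is handed to \<open>c\<close> either in
  \<open>u\<close> or in \<open>v\<close>, at the price of a factor 2; the third term of
  \<open>quasi_triangle\<close> is dropped by nonnegativity. For the full set of coordinates
  \<open>u\<close> and \<open>v\<close> survive in complementary sets.\<close>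

lemma J_split_bound:
  assumes k2: "2 \<le> k" and uvc: "u \<in> PT" "v \<in> PT" "c \<in> PT" and A: "finite A" "A \<subseteq> {1..n}"
  shows "J u v \<le> 2 ^ card A * (\<Sum>B\<in>Pow A. J (mix n B c u) (mix n (A - B) c v))"
  using A
proof (induction A)
  case empty
  show ?case using mix_empty[OF uvc(1)] mix_empty[OF uvc(2)] by simp
next
  case (insert i A)
  then have i: "i \<in> {1..n}" and A: "A \<subseteq> {1..n}" by auto
  have ci: "c i \<in> topspace (X i)" using points_coord[OF uvc(3) i] .
  have mi: "mix n (insert i B) c z = (mix n B c z)(i := c i)" for B z
    using i by (auto simp: mix_def fun_eq_iff)
  have step: "J (mix n B c u) (mix n (A - B) c v)
      \<le> 2 * J (mix n B c u) (mix n (insert i A - B) c v) + 2 * J (mix n (insert i B) c u) (mix n (insert i A - insert i B) c v)"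
    if B: "B \<in> Pow A" for B
  proof -
    have e: "insert i A - B = insert i (A - B)" "insert i A - insert i B = A - B" using B insert.hyps by auto
    show ?thesis
      using quasi_triangle[OF k2 mix_points[OF uvc(3,1)] mix_points[OF uvc(3,2)] i ci, of B "A - B"]
        J_nonneg[of "(mix n B c u)(i := c i)" "(mix n (A - B) c v)(i := c i)"] k2
        upd_points[OF mix_points[OF uvc(3,1)] i ci, of B] upd_points[OF mix_points[OF uvc(3,2)] i ci, of "A - B"]
      unfolding e mi by linarith
  qed
  have "J u v \<le> 2 ^ card A * (\<Sum>B\<in>Pow A. J (mix n B c u) (mix n (A - B) c v))"
    by (rule insert.IH[OF A])
  also have "\<dots> \<le> 2 ^ card A * (\<Sum>B\<in>Pow A. 2 * J (mix n B c u) (mix n (insert i A - B) c v) + 2 * J (mix n (insert i B) c u) (mix n (insert i A - insert i B) c v))"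
    by (intro mult_left_mono sum_mono step) auto
  also have "\<dots> = 2 ^ card (insert i A) * (\<Sum>B\<in>Pow (insert i A). J (mix n B c u) (mix n (insert i A - B) c v))"
    unfolding sum_Pow_insert[OF insert.hyps(1,2)] using insert.hyps
    by (simp add: sum.distrib sum_distrib_left[symmetric] algebra_simps)
  finally show ?case .
qed

text \<open>Three regimes share one form. For \<open>k = 0\<close> positive definiteness and the
  constant diagonal bound \<open>J\<close>, and the summand 1 is there for this case. For
  \<open>k = 1\<close> only the terms with \<open>B\<close> empty or full are used. For larger
  \<open>k\<close> it is the coordinatewise splitting.\<close>

lemma J_bound:
  assumes c: "c \<in> PT"
  obtains C where "0 \<le> C"
    "\<And>u v. u \<in> PT \<Longrightarrow> v \<in> PT \<Longrightarrow> \<bar>J u v\<bar> \<le> C * (1 + (\<Sum>B\<in>Pow {1..n}. \<bar>J (mix n B c u) (mix n ({1..n} - B) c v)\<bar>))"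
proof -
  consider "k = 0" | "k = 1" | "2 \<le> k" by linarith
  then show thesis
  proof cases
    case 1
    \<comment> \<open>For \<open>k = 0\<close> every finitely supported measure is a test measure;
      the sum and the difference of the two point masses bound \<open>J u v\<close> on both
      sides.\<close>
    have le: "\<bar>J u v\<bar> \<le> J c c" if uv: "u \<in> PT" "v \<in> PT" for u v
    proof -
      define pt where "pt b = (if b then u else v)" for b
      have "0 \<le> (-1) ^ k * (\<Sum>a\<in>UNIV. \<Sum>b\<in>UNIV. (if a then 1 else s) * (if b then 1 else s) * J (pt a) (pt b))" for s :: real
        by (rule pdi_sum) (use uv 1 in \<open>auto simp: pt_def simp del: topspace_product_topology\<close>)
      from this[of 1] this[of "-1"] show ?thesis
        using 1 J_sym[OF uv] J_diag_const[OF uv(1) c] J_diag_const[OF uv(2) c] by (simp add: UNIV_bool pt_def)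
    qed
    have nn: "0 \<le> J c c" using le[OF c c] by simp
    show thesis
    proof (rule that[OF nn])
      fix u v assume uv: "u \<in> PT" "v \<in> PT"
      have "\<bar>J u v\<bar> \<le> J c c * 1" using le[OF uv] by simp
      also have "\<dots> \<le> J c c * (1 + (\<Sum>B\<in>Pow {1..n}. \<bar>J (mix n B c u) (mix n ({1..n} - B) c v)\<bar>))"
        by (intro mult_left_mono nn) (simp add: sum_nonneg)
      finally show "\<bar>J u v\<bar> \<le> J c c * (1 + (\<Sum>B\<in>Pow {1..n}. \<bar>J (mix n B c u) (mix n ({1..n} - B) c v)\<bar>))" .
    qed
  next
    case 2
    show thesis
    proof (rule that[of 2])
      fix u v assume uv: "u \<in> PT" "v \<in> PT"
      define pt where "pt l = (if l = 0 then u else if l = 1 then v else c)" for l :: nat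
      \<comment> \<open>The weights 1, 1, -2 are now placed on whole points instead of values of one
        coordinate, since for \<open>k = 1\<close> only the total mass has to vanish.\<close>
      define w where "w l = (if l = 2 then -2 else 1 :: real)" for l :: nat
      have "0 \<le> (-1) ^ k * (\<Sum>a\<in>{0,1,2}. \<Sum>b\<in>{0,1,2}. w a * w b * J (pt a) (pt b))"
      proof (rule pdi_sum)
        fix B assume "card {i\<in>{1..n}. B i \<noteq> topspace (X i)} < k"
        then have "{i\<in>{1..n}. B i \<noteq> topspace (X i)} = {}" using 2 by simp
        then have "\<forall>i\<in>{1..n}. B i = topspace (X i)" by blast
        then have "\<forall>i\<in>{1..n}. pt a i \<in> B i" for a using uv c unfolding points_iff pt_def by auto
        then show "(\<Sum>a\<in>{0,1,2}. w a * (if \<forall>i\<in>{1..n}. pt a i \<in> B i then 1 else 0)) = 0"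
          by (simp add: w_def)
      qed (use uv c in \<open>auto simp: pt_def simp del: topspace_product_topology\<close>)
      moreover have "J z z = 0" if "z \<in> PT" for z using J_zero[of z z "{}"] that 2 by auto
      ultimately have "J u v \<le> 2 * J u c + 2 * J c v"
        using 2 J_sym[OF uv] J_sym[OF uv(1) c] J_sym[OF uv(2) c] uv c by (simp add: pt_def w_def)
      moreover have "J u c + J c v \<le> (\<Sum>B\<in>Pow {1..n}. \<bar>J (mix n B c u) (mix n ({1..n} - B) c v)\<bar>)"
      proof -
        have ne: "{} \<noteq> {1..n}" using kn by auto
        have "(\<Sum>B\<in>{{}, {1..n}}. \<bar>J (mix n B c u) (mix n ({1..n} - B) c v)\<bar>)
            \<le> (\<Sum>B\<in>Pow {1..n}. \<bar>J (mix n B c u) (mix n ({1..n} - B) c v)\<bar>)"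
          by (rule sum_mono2) auto
        then show ?thesis using ne mix_full[OF c] mix_empty[OF uv(1)] mix_empty[OF uv(2)] by simp
      qed
      ultimately show "\<bar>J u v\<bar> \<le> 2 * (1 + (\<Sum>B\<in>Pow {1..n}. \<bar>J (mix n B c u) (mix n ({1..n} - B) c v)\<bar>))"
        using J_nonneg[OF _ uv] 2 by simp
    qed simp
  next
    case 3
    show thesis
    proof (rule that[of "2 ^ n"])
      fix u v assume uv: "u \<in> PT" "v \<in> PT"
      have "\<bar>J u v\<bar> \<le> 2 ^ n * (\<Sum>B\<in>Pow {1..n}. J (mix n B c u) (mix n ({1..n} - B) c v))"
        using J_split_bound[OF 3 uv c, of "{1..n}"] J_nonneg[OF _ uv] 3 by simp
      also have "\<dots> \<le> 2 ^ n * (1 + (\<Sum>B\<in>Pow {1..n}. \<bar>J (mix n B c u) (mix n ({1..n} - B) c v)\<bar>))"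
        by (intro mult_left_mono add_increasing sum_mono) auto
      finally show "\<bar>J u v\<bar> \<le> 2 ^ n * (1 + (\<Sum>B\<in>Pow {1..n}. \<bar>J (mix n B c u) (mix n ({1..n} - B) c v)\<bar>))" .
    qed simp
  qed
qed

section \<open>The measure \<open>mu_kn\<close> and the kernel \<open>KJ\<close>\<close>

definition cf where
  "cf F = (if F = {1..n} then 1 else if card F < k then (-1) ^ (k - card F) * real ((n - card F - 1) choose (n - k)) else 0)"

text \<open>\<open>cf F\<close> is the weight at \<open>mix n F x x0\<close>. Passing from sums over
  cardinalities to one sum over all subsets gives the cardinalities from \<open>k\<close> to
  \<open>n - 1\<close> the weight 0 and the full set the weight 1.\<close>

lemma mu_kn_sum:
  assumes "x \<in> PT"
  shows "mu_kn n k x x0 = (\<lambda>p. \<Sum>F\<in>Pow {1..n}. cf F * dirac (mix n F x x0) p)"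
proof
  fix p
  let ?d = "\<lambda>F. dirac (mix n F x x0) p"
  let ?c = "\<lambda>j. (-1) ^ (k - j) * real ((n - j - 1) choose (n - k)) :: real"
  let ?S = "{F\<in>Pow {1..n}. card F < k}"
  have nS: "{1..n} \<notin> ?S" using kn by simp
  have "(\<Sum>F\<in>Pow {1..n}. cf F * ?d F) = cf {1..n} * ?d {1..n} + (\<Sum>F\<in>Pow {1..n} - {{1..n}}. cf F * ?d F)"
    by (rule sum.remove) auto
  also have "(\<Sum>F\<in>Pow {1..n} - {{1..n}}. cf F * ?d F) = (\<Sum>F\<in>?S. cf F * ?d F)"
    by (rule sum.mono_neutral_right) (use nS in \<open>auto simp: cf_def\<close>)
  also have "\<dots> = (\<Sum>F\<in>?S. ?c (card F) * ?d F)"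
    by (rule sum.cong[OF refl]) (use nS in \<open>auto simp: cf_def\<close>)
  also have "\<dots> = (\<Sum>j<k. \<Sum>F\<in>{F\<in>?S. card F = j}. ?c (card F) * ?d F)"
    by (rule sum.group[symmetric]) auto
  also have "\<dots> = (\<Sum>j<k. ?c j * (\<Sum>F\<in>{F. F \<subseteq> {1..n} \<and> card F = j}. ?d F))"
  proof (rule sum.cong[OF refl])
    fix j assume "j \<in> {..<k}"
    then have "{F\<in>?S. card F = j} = {F. F \<subseteq> {1..n} \<and> card F = j}" by auto
    then show "(\<Sum>F\<in>{F\<in>?S. card F = j}. ?c (card F) * ?d F) = ?c j * (\<Sum>F\<in>{F. F \<subseteq> {1..n} \<and> card F = j}. ?d F)"
      by (simp add: sum_distrib_left)
  qed
  also have "cf {1..n} * ?d {1..n} = dirac x p" by (simp only: cf_def if_True mix_full[OF assms] mult_1_left simp_thms)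
  finally show "mu_kn n k x x0 p = (\<Sum>F\<in>Pow {1..n}. cf F * ?d F)" by (simp add: mu_kn_def)
qed

lemma dint_mu_kn:
  "x \<in> PT \<Longrightarrow> dint (mu_kn n k x x0) f = (\<Sum>F\<in>Pow {1..n}. cf F * f (mix n F x x0))"
  by (simp only: mu_kn_sum) (rule dint_dirac_sum, simp)

lemma KJ_expand:
  assumes "x \<in> PT" "y \<in> PT"
  shows "KJ n k J x0 x y
    = (\<Sum>G\<in>Pow {1..n}. \<Sum>F\<in>Pow {1..n}. cf G * cf F * ((-1) ^ k * J (mix n F x x0) (mix n G y x0)))"
  unfolding KJ_def dint_mu_kn[OF assms(2)] dint_mu_kn[OF assms(1)] sum_distrib_left
  by (simp only: mult.assoc)

text \<open>Removing \<open>T\<close> lowers \<open>n\<close> and \<open>k\<close> by the same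
  amount and leaves \<open>n - k\<close> unchanged, so this is \<open>alternating_choose_sum\<close>
  for the smaller parameters; its value -1 cancels the weight 1 of the full set.\<close>

lemma sum_cf_superset:
  assumes T: "T \<subseteq> {1..n}" "card T < k"
  shows "(\<Sum>F\<in>{F\<in>Pow {1..n}. T \<subseteq> F}. cf F) = 0"
proof -
  let ?M = "{1..n} - T"
  define t where "t = card T"
  define m where "m = n - t"
  have fT: "finite T" using T(1) finite_subset by auto
  have cM: "card ?M = m" using T(1) fT by (simp add: card_Diff_subset t_def m_def)
  have tk: "t < k" "t < n" using T(2) kn by (auto simp: t_def)
  let ?\<phi> = "\<lambda>i. (if i = m then 1 else 0) + (if i < k - t then (-1) ^ ((k - t) - i) * real ((m - 1 - i) choose (m - (k - t))) else 0) :: real"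
  have "(\<Sum>F\<in>{F\<in>Pow {1..n}. T \<subseteq> F}. cf F) = (\<Sum>F'\<in>Pow ?M. cf (T \<union> F'))"
    by (rule sum.reindex_bij_witness[of _ "\<lambda>F'. T \<union> F'" "\<lambda>F. F - T"]) (use T(1) in \<open>auto intro: arg_cong[where f = cf]\<close>)
  also have "\<dots> = (\<Sum>F'\<in>Pow ?M. ?\<phi> (card F'))"
  proof (rule sum.cong[OF refl])
    fix F' assume F': "F' \<in> Pow ?M"
    have fF: "finite F'" using F' finite_subset[of F' "{1..n}"] by auto
    have card: "card (T \<union> F') = t + card F'" using F' fF fT by (subst card_Un_disjoint) (auto simp: t_def)
    have full: "T \<union> F' = {1..n} \<longleftrightarrow> card F' = m"
    proof
      assume "T \<union> F' = {1..n}"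
      then have "t + card F' = n" using card by simp
      then show "card F' = m" by (simp add: m_def)
    next
      assume "card F' = m"
      then have "card (T \<union> F') = card {1..n}" using card tk by (simp add: m_def)
      then show "T \<union> F' = {1..n}" by (intro card_subset_eq) (use F' T(1) in auto)
    qed
    have lt: "card (T \<union> F') < k \<longleftrightarrow> card F' < k - t" using card by auto
    have "m \<ge> k - t" using kn by (simp add: m_def)
    moreover have "n - k = m - (k - t)" "k - card (T \<union> F') = (k - t) - card F'" "n - card (T \<union> F') - 1 = m - 1 - card F'"
      using tk kn by (auto simp: card m_def)
    ultimately show "cf (T \<union> F') = ?\<phi> (card F')" unfolding cf_def full lt by auto
  qed
  also have "\<dots> = (\<Sum>i\<le>m. real (m choose i) * ?\<phi> i)" unfolding cM[symmetric] by (rule sum_card_Pow) simp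
  also have "\<dots> = (\<Sum>i\<le>m. (if i = m then real (m choose i) else 0))
      + (\<Sum>i\<le>m. if i < k - t then (-1) ^ ((k - t) - i) * real ((m - 1 - i) choose (m - (k - t))) * real (m choose i) else 0)"
    unfolding sum.distrib[symmetric] by (rule sum.cong[OF refl]) (simp add: algebra_simps)
  also have "(\<Sum>i\<le>m. (if i = m then real (m choose i) else 0)) = 1" by (simp add: sum.delta)
  also have "(\<Sum>i\<le>m. if i < k - t then (-1) ^ ((k - t) - i) * real ((m - 1 - i) choose (m - (k - t))) * real (m choose i) else 0)
    = (\<Sum>i<k - t. (-1) ^ ((k - t) - i) * real ((m - 1 - i) choose (m - (k - t))) * real (m choose i))"
    by (rule sum.mono_neutral_cong_right) (use kn in \<open>auto simp: m_def\<close>)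
  also have "\<dots> = -1"
    by (rule alternating_choose_sum) (use tk kn in \<open>auto simp: m_def\<close>)
  finally show ?thesis by simp
qed

text \<open>An element \<open>s\<close> of \<open>U\<close> outside \<open>T\<close> is released:
  the sets with trace \<open>T\<close> on \<open>U - {s}\<close> have trace \<open>T\<close> or
  \<open>insert s T\<close> on \<open>U\<close>. The induction on the size of \<open>U - T\<close>
  ends at the supersets of \<open>T\<close>.\<close>

lemma sum_cf_inter:
  assumes "U \<subseteq> {1..n}" "card U < k" "T \<subseteq> U"
  shows "(\<Sum>F\<in>{F\<in>Pow {1..n}. F \<inter> U = T}. cf F) = 0"
  using assms
proof (induction "card (U - T)" arbitrary: U T)
  case 0
  have "finite (U - T)" using 0(2) finite_subset[of U "{1..n}"] by auto
  then have "U = T" using 0 by auto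
  then have "{F\<in>Pow {1..n}. F \<inter> U = T} = {F\<in>Pow {1..n}. T \<subseteq> F}" by auto
  then show ?case using sum_cf_superset[of T] 0 \<open>U = T\<close> by simp
next
  case (Suc d)
  have fU: "finite U" using Suc.prems(1) finite_subset by auto
  obtain s where s: "s \<in> U" "s \<notin> T" using Suc.hyps(2) by (metis Diff_iff card.empty ex_in_conv nat.distinct(1))
  let ?A = "\<lambda>U T. {F\<in>Pow {1..n}. F \<inter> U = T}"
  have d: "card ((U - {s}) - T) = d" "card (U - insert s T) = d"
  proof -
    have "(U - {s}) - T = (U - T) - {s}" "U - insert s T = (U - T) - {s}" by auto
    moreover have "card ((U - T) - {s}) = d" using Suc.hyps(2) s fU by (subst card_Diff_singleton) auto
    ultimately show "card ((U - {s}) - T) = d" "card (U - insert s T) = d" by simp_all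
  qed
  have "card (U - {s}) \<le> card U" using fU by (intro card_mono) auto
  then have c: "card (U - {s}) < k" using Suc.prems(2) by simp
  have 1: "(\<Sum>F\<in>?A (U - {s}) T. cf F) = 0"
    using Suc.prems s c by (intro Suc.hyps(1)[of "U - {s}" T]) (use d in auto)
  have 2: "(\<Sum>F\<in>?A U (insert s T). cf F) = 0"
    using Suc.prems s by (intro Suc.hyps(1)[of U "insert s T"]) (use d in auto)
  have "?A (U - {s}) T = ?A U T \<union> ?A U (insert s T)" using s by auto
  then have "(\<Sum>F\<in>?A (U - {s}) T. cf F) = (\<Sum>F\<in>?A U T. cf F) + (\<Sum>F\<in>?A U (insert s T). cf F)"
    using s by (simp only:) (rule sum.union_disjoint, auto)
  with 1 2 show ?case by simp
qed

text \<open>This says that \<open>mu_kn\<close> belongs to the test measures. Whether the mixed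
  point lies in the product set depends only on the trace of \<open>F\<close> on the restricted
  coordinates, and the weights with a given trace on fewer than \<open>k\<close> coordinates sum to
  0.\<close>

lemma sum_cf_indicator:
  assumes small: "card {i\<in>{1..n}. B i \<noteq> topspace (X i)} < k"
    and x: "x \<in> PT" "x0 \<in> PT"
  shows "(\<Sum>F\<in>Pow {1..n}. cf F * (if \<forall>i\<in>{1..n}. mix n F x x0 i \<in> B i then 1 else 0)) = 0"
proof -
  let ?S = "{i\<in>{1..n}. B i \<noteq> topspace (X i)}"
  let ?I = "\<lambda>F. (if \<forall>i\<in>{1..n}. mix n F x x0 i \<in> B i then 1 else 0 :: real)"
  have I: "?I F = ?I (F \<inter> ?S)" for F
  proof -
    have "(mix n F x x0 i \<in> B i) = (mix n (F \<inter> ?S) x x0 i \<in> B i)" if i: "i \<in> {1..n}" for i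
      using points_coord[OF x(1) i] points_coord[OF x(2) i] unfolding mix_apply[OF i] using i by (cases "i \<in> ?S") auto
    then show ?thesis by (simp only: cong: ball_cong)
  qed
  have "(\<Sum>F\<in>Pow {1..n}. cf F * ?I F) = (\<Sum>T\<in>Pow ?S. \<Sum>F\<in>{F\<in>Pow {1..n}. F \<inter> ?S = T}. cf F * ?I F)"
    by (rule sum.group[symmetric]) auto
  also have "\<dots> = (\<Sum>T\<in>Pow ?S. 0)"
  proof (rule sum.cong[OF refl])
    fix T assume T: "T \<in> Pow ?S"
    have "(\<Sum>F\<in>{F\<in>Pow {1..n}. F \<inter> ?S = T}. cf F * ?I F) = (\<Sum>F\<in>{F\<in>Pow {1..n}. F \<inter> ?S = T}. cf F * ?I T)"
    proof (rule sum.cong[OF refl])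
      fix F assume F: "F \<in> {F\<in>Pow {1..n}. F \<inter> ?S = T}"
      then have "F \<inter> ?S = T" by simp
      then show "cf F * ?I F = cf F * ?I T" using I[of F] by (simp only:)
    qed
    also have "\<dots> = (\<Sum>F\<in>{F\<in>Pow {1..n}. F \<inter> ?S = T}. cf F) * ?I T" by (rule sum_distrib_right[symmetric])
    also have "(\<Sum>F\<in>{F\<in>Pow {1..n}. F \<inter> ?S = T}. cf F) = 0"
      by (rule sum_cf_inter[OF _ small]) (use T in auto)
    finally show "(\<Sum>F\<in>{F\<in>Pow {1..n}. F \<inter> ?S = T}. cf F * ?I F) = 0" by simp
  qed
  finally show ?thesis by simp
qed

lemma KJ_sym:
  assumes "x0 \<in> PT" "x \<in> PT" "y \<in> PT"
  shows "KJ n k J x0 x y = KJ n k J x0 y x"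
proof -
  have "KJ n k J x0 x y = (\<Sum>G\<in>Pow {1..n}. \<Sum>F\<in>Pow {1..n}. cf F * cf G * ((-1) ^ k * J (mix n G y x0) (mix n F x x0)))"
    unfolding KJ_expand[OF assms(2,3)]
    by (intro sum.cong refl) (simp only: J_sym[OF mix_points[OF assms(2,1)] mix_points[OF assms(3,1)]] mult.commute)
  also have "\<dots> = (\<Sum>F\<in>Pow {1..n}. \<Sum>G\<in>Pow {1..n}. cf F * cf G * ((-1) ^ k * J (mix n G y x0) (mix n F x x0)))"
    by (rule sum.swap)
  also have "\<dots> = KJ n k J x0 y x" unfolding KJ_expand[OF assms(3,2)] ..
  finally show ?thesis .
qed

text \<open>The form of \<open>KJ\<close> at \<open>w\<close> is the form of
  \<open>(-1) ^ k * J\<close> at the combination of the measures \<open>mu_kn\<close> with weights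
  \<open>w\<close>, and this combination is again a test measure.\<close>

lemma pd_kernel_KJ:
  assumes x0: "x0 \<in> PT"
  shows "pd_kernel PT (KJ n k J x0)"
proof
  show "KJ n k J x0 p q = KJ n k J x0 q p" if "p \<in> PT" "q \<in> PT" for p q by (rule KJ_sym[OF x0 that])
  fix w assume w: "w \<in> discrete_measures PT"
  let ?Z = "{p. w p \<noteq> 0}"
  have fZ: "finite ?Z" and ZP: "?Z \<subseteq> PT" using w unfolding discrete_measures_def by blast+
  let ?A = "?Z \<times> Pow {1..n}"
  let ?\<alpha> = "\<lambda>(p, F). w p * cf F" and ?pt = "\<lambda>(p, F). mix n F p x0"
  have sp: "(\<Sum>a\<in>?A. f a) = (\<Sum>p\<in>?Z. \<Sum>F\<in>Pow {1..n}. f (p, F))" for f :: "_ \<Rightarrow> real"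
    by (simp add: sum.cartesian_product)
  have "0 \<le> (-1) ^ k * (\<Sum>a\<in>?A. \<Sum>b\<in>?A. ?\<alpha> a * ?\<alpha> b * J (?pt a) (?pt b))"
  proof (rule pdi_sum)
    show "finite ?A" using fZ by simp
    show "?pt a \<in> PT" if "a \<in> ?A" for a
      using that ZP x0 by (cases a) (simp only: case_prod_conv, blast intro: mix_points)
    fix B assume small: "card {i\<in>{1..n}. B i \<noteq> topspace (X i)} < k"
    have "(\<Sum>p\<in>?Z. \<Sum>F\<in>Pow {1..n}. w p * cf F * (if \<forall>i\<in>{1..n}. mix n F p x0 i \<in> B i then 1 else 0)) = 0"
    proof (rule sum.neutral, rule ballI)
      fix p assume "p \<in> ?Z"
      then have p: "p \<in> PT" using ZP by blast
      show "(\<Sum>F\<in>Pow {1..n}. w p * cf F * (if \<forall>i\<in>{1..n}. mix n F p x0 i \<in> B i then 1 else 0)) = 0"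
        by (simp only: mult.assoc sum_distrib_left[symmetric] sum_cf_indicator[OF small p x0] mult_zero_right)
    qed
    then show "(\<Sum>a\<in>?A. ?\<alpha> a * (if \<forall>i\<in>{1..n}. ?pt a i \<in> B i then 1 else 0)) = 0"
      by (simp only: sp case_prod_conv)
  qed
  also have "\<dots> = (\<Sum>p\<in>?Z. \<Sum>F\<in>Pow {1..n}. \<Sum>q\<in>?Z. \<Sum>G\<in>Pow {1..n}. w p * w q * (cf G * cf F * ((-1) ^ k * J (mix n F p x0) (mix n G q x0))))"
    unfolding sp case_prod_conv sum_distrib_left by (intro sum.cong refl) (simp only: mult_ac)
  also have "\<dots> = (\<Sum>p\<in>?Z. \<Sum>q\<in>?Z. w p * w q * KJ n k J x0 p q)"
  proof (rule sum.cong[OF refl])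
    fix p assume "p \<in> ?Z"
    then have p: "p \<in> PT" using ZP by blast
    have "(\<Sum>F\<in>Pow {1..n}. \<Sum>q\<in>?Z. \<Sum>G\<in>Pow {1..n}. w p * w q * (cf G * cf F * ((-1) ^ k * J (mix n F p x0) (mix n G q x0))))
       = (\<Sum>q\<in>?Z. \<Sum>F\<in>Pow {1..n}. \<Sum>G\<in>Pow {1..n}. w p * w q * (cf G * cf F * ((-1) ^ k * J (mix n F p x0) (mix n G q x0))))"
      by (rule sum.swap)
    also have "\<dots> = (\<Sum>q\<in>?Z. w p * w q * KJ n k J x0 p q)"
    proof (rule sum.cong[OF refl])
      fix q assume "q \<in> ?Z"
      then have q: "q \<in> PT" using ZP by blast
      show "(\<Sum>F\<in>Pow {1..n}. \<Sum>G\<in>Pow {1..n}. w p * w q * (cf G * cf F * ((-1) ^ k * J (mix n F p x0) (mix n G q x0))))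
          = w p * w q * KJ n k J x0 p q"
        unfolding KJ_expand[OF p q] sum_distrib_left by (rule sum.swap)
    qed
    finally show "(\<Sum>F\<in>Pow {1..n}. \<Sum>q\<in>?Z. \<Sum>G\<in>Pow {1..n}. w p * w q * (cf G * cf F * ((-1) ^ k * J (mix n F p x0) (mix n G q x0))))
       = (\<Sum>q\<in>?Z. w p * w q * KJ n k J x0 p q)" .
  qed
  also have "\<dots> = (\<Sum>q\<in>?Z. \<Sum>p\<in>?Z. w p * w q * KJ n k J x0 p q)" by (rule sum.swap)
  also have "\<dots> = dint w (\<lambda>q. dint w (\<lambda>p. KJ n k J x0 p q))"
    unfolding dint_def sum_distrib_left by (intro sum.cong refl) (simp only: mult_ac)
  finally show "0 \<le> dint w (\<lambda>q. dint w (\<lambda>p. KJ n k J x0 p q))" .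
qed

text \<open>By symmetry in each coordinate and independence of the common coordinates,
  only the symmetric difference of the two masks matters.\<close>

lemma J_mix_symdiff:
  assumes "x \<in> PT" "x0 \<in> PT"
  shows "J (mix n F x x0) (mix n G x x0) = J (mix n ((F - G) \<union> (G - F)) x x0) x0"
proof (rule J_eqI)
  fix j assume "j \<in> {1..n}"
  note m = mix_apply[OF this]
  show "mix n F x x0 j = mix n ((F - G) \<union> (G - F)) x x0 j \<and> mix n G x x0 j = x0 j \<or>
        mix n F x x0 j = x0 j \<and> mix n G x x0 j = mix n ((F - G) \<union> (G - F)) x x0 j \<or>
        mix n F x x0 j = mix n G x x0 j \<and> mix n ((F - G) \<union> (G - F)) x x0 j = x0 j"
    unfolding m by (cases "j \<in> F"; cases "j \<in> G") auto
qed (intro mix_points assms)+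

end

section \<open>Integrability\<close>

lemma nn_integral_zero_space:
  assumes "emeasure m (space m) = 0"
  shows "(\<integral>\<^sup>+x. f x \<partial>m) = 0"
proof -
  have "AE x in m. f x = 0" by (rule AE_I[of _ _ "space m"]) (use assms in auto)
  then have "(\<integral>\<^sup>+x. f x \<partial>m) = (\<integral>\<^sup>+x. 0 \<partial>m)" by (rule nn_integral_cong_AE)
  then show ?thesis by simp
qed

context radon_space
begin

text \<open>For the trivial partition the integrand sees only the proper marginal of
  \<open>\<nu>\<close>, whose bound is lifted to partitions of \<open>{1..n}\<close> by
  \<open>marg_part_prod\<close>. For every other partition the whole product is dominated
  already.\<close>

lemma nn_integral_restrict_dominated:
  assumes P: "finite_radon TP P" and one: "emeasure P (space P) = 1"
    and \<nu>: "finite_radon TP \<nu>" and d: "delim P M \<nu>" and M: "0 \<le> M"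
    and A: "A \<subseteq> {1..n}" "A \<noteq> {1..n}" and \<pi>: "partition_on {1..n} \<pi>"
  obtains C :: real where "0 \<le> C" "\<And>g :: _ \<Rightarrow> ennreal. g \<in> borel_measurable (prod_borel X A) \<Longrightarrow>
    (\<integral>\<^sup>+x. g (restrict x A) \<partial>part_prod X \<nu> \<pi>) \<le> ennreal C * (\<Sum>\<pi>'\<in>parts. \<integral>\<^sup>+x. g (restrict x A) \<partial>part_prod X P \<pi>')"
proof (cases "\<pi> = {{1..n}}")
  case True
  let ?T = "{\<tau>. partition_on A \<tau>}" and ?N = "{1..n} - A"
  have fT: "finite ?T" by (rule finitely_many_partition_on[OF finite_subset[OF A(1)]]) simp
  note MA = marg_radon[OF P A(1) subset_refl]
  have sm: "sets (marg X A m) = sets (prod_borel X A)" for m by (simp add: marg_def)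
  have push: "(\<integral>\<^sup>+x. g x \<partial>marg X A m) = (\<integral>\<^sup>+x. g (restrict x A) \<partial>m)"
    if "finite_radon TP m" "g \<in> borel_measurable (prod_borel X A)" for m and g :: "_ \<Rightarrow> ennreal"
    unfolding marg_def by (rule nn_integral_distr[OF measurable_restrict_marg[OF that(1) A(1)]]) (use that in simp)
  show thesis
  proof (rule that[of "M * real (card ?T)"])
    show "0 \<le> M * real (card ?T)" using M by simp
    fix g :: "_ \<Rightarrow> ennreal" assume g: "g \<in> borel_measurable (prod_borel X A)"
    let ?S = "\<Sum>\<pi>'\<in>parts. \<integral>\<^sup>+x. g (restrict x A) \<partial>part_prod X P \<pi>'"
    have "(\<integral>\<^sup>+x. g (restrict x A) \<partial>part_prod X \<nu> \<pi>) = (\<integral>\<^sup>+x. g x \<partial>marg X A \<nu>)"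
      unfolding True part_prod_single[OF \<nu>] by (rule push[OF \<nu> g, symmetric])
    also have "\<dots> \<le> ennreal M * (\<Sum>\<tau>\<in>?T. \<integral>\<^sup>+x. g x \<partial>part_prod X (marg X A P) \<tau>)"
    proof (rule nn_integral_le_sum)
      fix \<tau> assume "\<tau> \<in> ?T"
      then have "finite_radon (prod_sp X A) (part_prod X (marg X A P) \<tau>)" using part_prod_radon[OF MA A(1)] by blast
      then show "sets (part_prod X (marg X A P) \<tau>) = sets (marg X A \<nu>)" using finite_radonD(2) sm by metis
    next
      fix B assume "B \<in> sets (marg X A \<nu>)"
      then show "emeasure (marg X A \<nu>) B \<le> ennreal M * (\<Sum>\<tau>\<in>?T. emeasure (part_prod X (marg X A P) \<tau>) B)"
        using delimD[OF d A] sm by blast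
    qed
    also have "\<dots> \<le> ennreal M * (\<Sum>\<tau>\<in>?T. ?S)"
    proof (intro mult_left_mono sum_mono)
      fix \<tau> assume "\<tau> \<in> ?T"
      then have \<tau>: "partition_on A \<tau>" by simp
      note mp = marg_part_prod[OF P one A \<tau>]
      have "(\<integral>\<^sup>+x. g x \<partial>part_prod X (marg X A P) \<tau>) = (\<integral>\<^sup>+x. g (restrict x A) \<partial>part_prod X P (insert ?N \<tau>))"
        unfolding mp(2)[symmetric] by (rule push[OF part_prod_radon[OF P subset_refl mp(1)] g])
      also have "\<dots> \<le> ?S"
        by (rule sum_nonneg_leq_bound[OF finite_parts _ refl]) (use mp(1) in auto)
      finally show "(\<integral>\<^sup>+x. g x \<partial>part_prod X (marg X A P) \<tau>) \<le> ?S" .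
    qed simp
    also have "\<dots> = ennreal (M * real (card ?T)) * ?S"
      using M by (simp add: ennreal_mult mult.assoc ennreal_of_nat_eq_real_of_nat)
    finally show "(\<integral>\<^sup>+x. g (restrict x A) \<partial>part_prod X \<nu> \<pi>) \<le> ennreal (M * real (card ?T)) * ?S" .
  qed
next
  case False
  obtain C where C: "0 \<le> C" "\<And>E. E \<in> sets (borel_top TP) \<Longrightarrow>
    emeasure (part_prod X \<nu> \<pi>) E \<le> ennreal C * (\<Sum>\<pi>'\<in>parts. emeasure (part_prod X P \<pi>') E)"
    using part_prod_dominated[OF P \<nu> d M \<pi> False] by metis
  show thesis
  proof (rule that[OF C(1)])
    fix g :: "_ \<Rightarrow> ennreal"
    show "(\<integral>\<^sup>+x. g (restrict x A) \<partial>part_prod X \<nu> \<pi>) \<le> ennreal C * (\<Sum>\<pi>'\<in>parts. \<integral>\<^sup>+x. g (restrict x A) \<partial>part_prod X P \<pi>')"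
    proof (rule nn_integral_le_sum)
      note sN = finite_radonD(2)[OF part_prod_radon[OF \<nu> subset_refl \<pi>]]
      show "sets (part_prod X P \<pi>') = sets (part_prod X \<nu> \<pi>)" if "\<pi>' \<in> parts" for \<pi>'
        using finite_radonD(2)[OF part_prod_radon[OF P subset_refl]] that sN by blast
      show "emeasure (part_prod X \<nu> \<pi>) E \<le> ennreal C * (\<Sum>\<pi>'\<in>parts. emeasure (part_prod X P \<pi>') E)"
        if "E \<in> sets (part_prod X \<nu> \<pi>)" for E by (rule C(2)) (use that sN in blast)
    qed
  qed
qed

end

section \<open>Finiteness of the double integrals of the kernel\<close>

locale radon_kernel = cns_kernel X n k J + radon_space X n
  for X :: "nat \<Rightarrow> 'a topology" and n k :: nat and J :: "(nat \<Rightarrow> 'a) \<Rightarrow> (nat \<Rightarrow> 'a) \<Rightarrow> real" +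
  assumes cont: "continuous_map (prod_topology (prod_sp X {1..n}) (prod_sp X {1..n})) euclideanreal (\<lambda>(u, v). J u v)"
begin

lemma cont_mix:
  assumes G: "G \<subseteq> F" "F \<subseteq> {1..n}" and c: "c \<in> PT"
  shows "continuous_map (prod_sp X F) TP (\<lambda>z. mix n G z c)"
  unfolding continuous_map_componentwise
proof (intro conjI ballI)
  fix i assume i: "i \<in> {1..n}"
  show "continuous_map (prod_sp X F) (X i) (\<lambda>z. mix n G z c i)"
  proof (cases "i \<in> G")
    case True
    then have "continuous_map (prod_sp X F) (X i) (\<lambda>z. z i)" using G by (intro continuous_map_product_projection) auto
    then show ?thesis unfolding mix_apply[OF i] using True by simp
  next
    case False
    then show ?thesis unfolding mix_apply[OF i] using points_coord[OF c i] by simp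
  qed
qed (auto simp: mix_def)

lemma cont_id: "continuous_map TP TP (\<lambda>x. x)"
  using continuous_map_id[of TP] by (simp add: id_def)

lemma cont_J:
  assumes g: "continuous_map T1 TP g" and h: "continuous_map T2 TP h"
  shows "continuous_map (prod_topology T1 T2) euclideanreal (\<lambda>(u, v). J (g u) (h v))"
proof -
  have "continuous_map (prod_topology T1 T2) (prod_topology TP TP) (\<lambda>p. (g (fst p), h (snd p)))"
    using continuous_map_compose[OF continuous_map_fst g, of T2] continuous_map_compose[OF continuous_map_snd h, of T1]
    by (simp add: continuous_map_paired comp_def)
  from continuous_map_compose[OF this cont] show ?thesis by (simp add: comp_def case_prod_unfold)
qed

lemma cont_abs_J:
  assumes "continuous_map T1 TP g" "continuous_map T2 TP h"
  shows "continuous_map (prod_topology T1 T2) euclideanreal (\<lambda>(u, v). \<bar>J (g u) (h v)\<bar>)"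
  using continuous_map_real_abs[OF cont_J[OF assms]] by (simp add: case_prod_unfold)

lemma cont_J1:
  assumes g: "continuous_map T1 TP g" and c: "c \<in> PT"
  shows "continuous_map T1 euclideanreal (\<lambda>u. J (g u) c)"
  by (rule continuous_map_slice[OF cont_J[OF g cont_id] c])

lemma meas_J:
  assumes "continuous_map T1 TP g" "c \<in> PT" "sets m = sets (borel_top T1)"
  shows "(\<lambda>u. J (g u) c) \<in> borel_measurable m"
  using continuous_map_borel_measurable[OF cont_J1[OF assms(1,2)]] measurable_cong_sets[OF assms(3) refl] by blast

lemma meas_abs_J:
  assumes "continuous_map T1 TP g" "c \<in> PT" "sets m = sets (borel_top T1)"
  shows "(\<lambda>u. ennreal \<bar>J (g u) c\<bar>) \<in> borel_measurable m"
  by (intro measurable_compose[OF borel_measurable_abs[OF meas_J[OF assms]] measurable_ennreal])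

text \<open>A condition on one variable only, hence inherited by every measure dominated by a sum.
  Together with delimitation it will stand in for \<open>FIP\<close>.\<close>

definition fixed_integrable where
  "fixed_integrable m \<longleftrightarrow> (\<forall>c\<in>PT. (\<integral>\<^sup>+x. ennreal \<bar>J x c\<bar> \<partial>m) < \<infinity>)"

text \<open>\<open>FIP\<close> with possibly different measures in the two variables; with the
  variation of one measure in both places it is \<open>FIP\<close> itself.\<close>

definition doubly_finite where
  "doubly_finite m m' \<longleftrightarrow> (\<forall>x2\<in>PT. \<forall>y2\<in>PT. \<forall>F\<subseteq>{1..n}. \<forall>G\<subseteq>{1..n}. \<forall>\<pi>\<in>parts. \<forall>\<sigma>\<in>parts.
     (\<integral>\<^sup>+y1. (\<integral>\<^sup>+x1. ennreal \<bar>J (mix n F x1 x2) (mix n G y1 y2)\<bar> \<partial>part_prod X m \<pi>) \<partial>part_prod X m' \<sigma>) < \<infinity>)"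

lemma doubly_finiteD:
  assumes "doubly_finite m m'" "x2 \<in> PT" "y2 \<in> PT" "F \<subseteq> {1..n}" "G \<subseteq> {1..n}" "partition_on {1..n} \<pi>" "partition_on {1..n} \<sigma>"
  shows "(\<integral>\<^sup>+y1. (\<integral>\<^sup>+x1. ennreal \<bar>J (mix n F x1 x2) (mix n G y1 y2)\<bar> \<partial>part_prod X m \<pi>) \<partial>part_prod X m' \<sigma>) < \<infinity>"
  using assms unfolding doubly_finite_def by blast

lemma doubly_finite_single:
  assumes "doubly_finite m m'" "finite_radon TP m" "finite_radon TP m'" "x2 \<in> PT" "y2 \<in> PT" "F \<subseteq> {1..n}" "G \<subseteq> {1..n}"
  shows "(\<integral>\<^sup>+y1. (\<integral>\<^sup>+x1. ennreal \<bar>J (mix n F x1 x2) (mix n G y1 y2)\<bar> \<partial>m) \<partial>m') < \<infinity>"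
  using doubly_finiteD[OF assms(1,4-7) full_partition full_partition]
  unfolding part_prod_single[OF assms(2)] part_prod_single[OF assms(3)] .

text \<open>Choosing \<open>G\<close> empty freezes the second point at \<open>c\<close>, and the
  outer integral becomes a factor, the total mass.\<close>

lemma doubly_finite_fixed:
  assumes df: "doubly_finite m m" and m: "finite_radon TP m" and x: "x2 \<in> PT" "c \<in> PT" and F: "F \<subseteq> {1..n}" and \<pi>: "partition_on {1..n} \<pi>"
  shows "(\<integral>\<^sup>+x. ennreal \<bar>J (mix n F x x2) c\<bar> \<partial>part_prod X m \<pi>) < \<infinity>"
proof -
  let ?I = "\<integral>\<^sup>+x. ennreal \<bar>J (mix n F x x2) c\<bar> \<partial>part_prod X m \<pi>" and ?S = "part_prod X m \<pi>"
  have "(\<integral>\<^sup>+y. ?I \<partial>?S) < \<infinity>"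
    using doubly_finiteD[OF df x F empty_subsetI \<pi> \<pi>] unfolding mix_empty[OF x(2)] .
  then have "?I * emeasure ?S (space ?S) < \<infinity>" by simp
  \<comment> \<open>A product of 0 and infinity is 0 in \<open>ennreal\<close>, so zero mass has to
    be excluded before finiteness of the product says anything.\<close>
  moreover have "?I = 0" if "emeasure ?S (space ?S) = 0" by (rule nn_integral_zero_space[OF that])
  ultimately show ?thesis
    by (cases "emeasure ?S (space ?S) = 0") (auto simp: ennreal_mult_less_top)
qed

lemma mix_mix1: "mix n B c (mix n F x y) = mix n (F - B) x (mix n B c y)"
  by (auto simp: mix_def fun_eq_iff)

lemma mix_restrict: "A \<subseteq> {1..n} \<Longrightarrow> mix n A (restrict x A) c = mix n A x c"
  by (auto simp: mix_def fun_eq_iff)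

lemma fixed_part:
  assumes P: "finite_radon TP P" and dfP: "doubly_finite P P"
    and \<nu>: "finite_radon TP \<nu>" and d: "delim P M \<nu>" and M: "0 \<le> M" and fi: "fixed_integrable \<nu>"
    and \<pi>: "partition_on {1..n} \<pi>" and c: "c \<in> PT"
  shows "(\<integral>\<^sup>+x. ennreal \<bar>J x c\<bar> \<partial>part_prod X \<nu> \<pi>) < \<infinity>"
proof (cases "\<pi> = {{1..n}}")
  case True
  then show ?thesis using fi c part_prod_single[OF \<nu>] unfolding fixed_integrable_def by simp
next
  case False
  obtain C where C: "0 \<le> C" "\<And>E. E \<in> sets (borel_top TP) \<Longrightarrow>
    emeasure (part_prod X \<nu> \<pi>) E \<le> ennreal C * (\<Sum>\<pi>'\<in>parts. emeasure (part_prod X P \<pi>') E)"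
    using part_prod_dominated[OF P \<nu> d M \<pi> False] by metis
  note NP = part_prod_radon[OF \<nu> subset_refl \<pi>]
  have PP: "finite_radon TP (part_prod X P \<pi>')" if "\<pi>' \<in> parts" for \<pi>'
    using part_prod_radon[OF P subset_refl] that by blast
  have "(\<integral>\<^sup>+x. ennreal \<bar>J x c\<bar> \<partial>part_prod X \<nu> \<pi>) \<le> ennreal C * (\<Sum>\<pi>'\<in>parts. \<integral>\<^sup>+x. ennreal \<bar>J x c\<bar> \<partial>part_prod X P \<pi>')"
  proof (rule nn_integral_le_sum)
    show "sets (part_prod X P \<pi>') = sets (part_prod X \<nu> \<pi>)" if "\<pi>' \<in> parts" for \<pi>'
      using finite_radonD(2)[OF PP[OF that]] finite_radonD(2)[OF NP] by blast
    show "emeasure (part_prod X \<nu> \<pi>) E \<le> ennreal C * (\<Sum>\<pi>'\<in>parts. emeasure (part_prod X P \<pi>') E)"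
      if "E \<in> sets (part_prod X \<nu> \<pi>)" for E by (rule C(2)) (use that finite_radonD(2)[OF NP] in blast)
  qed
  also have "\<dots> < \<infinity>"
  proof -
    have "(\<integral>\<^sup>+x. ennreal \<bar>J x c\<bar> \<partial>part_prod X P \<pi>') < \<infinity>" if "\<pi>' \<in> parts" for \<pi>'
    proof -
      have "(\<integral>\<^sup>+x. ennreal \<bar>J x c\<bar> \<partial>part_prod X P \<pi>') = (\<integral>\<^sup>+x. ennreal \<bar>J (mix n {1..n} x c) c\<bar> \<partial>part_prod X P \<pi>')"
      proof (rule nn_integral_cong)
        fix x assume "x \<in> space (part_prod X P \<pi>')"
        then have "x \<in> PT" using finite_radonD(3)[OF PP[OF that]] by blast
        then show "ennreal \<bar>J x c\<bar> = ennreal \<bar>J (mix n {1..n} x c) c\<bar>" by (simp only: mix_full)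
      qed
      also have "\<dots> < \<infinity>" by (rule doubly_finite_fixed[OF dfP P c c subset_refl]) (use that in blast)
      finally show ?thesis .
    qed
    then have "(\<Sum>\<pi>'\<in>parts. \<integral>\<^sup>+x. ennreal \<bar>J x c\<bar> \<partial>part_prod X P \<pi>') < top"
      unfolding infinity_ennreal_def by (intro ennreal_sum_less_top[THEN iffD2] ballI finite_parts) blast
    then show ?thesis by (simp add: ennreal_mult_less_top)
  qed
  finally show ?thesis .
qed

lemma doubly_finiteI:
  assumes P: "finite_radon TP P" and one: "emeasure P (space P) = 1" and dfP: "doubly_finite P P"
    and \<nu>: "finite_radon TP \<nu>" and d: "delim P M \<nu>" and M: "0 \<le> M" and fi: "fixed_integrable \<nu>"
    and \<nu>': "finite_radon TP \<nu>'" and d': "delim P M' \<nu>'" and M': "0 \<le> M'" and fi': "fixed_integrable \<nu>'"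
    and c0: "c \<in> PT"
  shows "doubly_finite \<nu> \<nu>'"
  unfolding doubly_finite_def
proof (intro ballI allI impI)
  fix x2 y2 F G \<pi> \<sigma>
  assume x2: "x2 \<in> PT" and y2: "y2 \<in> PT" and F: "F \<subseteq> {1..n}" and G: "G \<subseteq> {1..n}" and "\<pi> \<in> parts" "\<sigma> \<in> parts"
  then have \<pi>: "partition_on {1..n} \<pi>" and \<sigma>: "partition_on {1..n} \<sigma>" by simp_all
  let ?N = "part_prod X \<nu> \<pi>" and ?N' = "part_prod X \<nu>' \<sigma>"
  note NP = part_prod_radon[OF \<nu> subset_refl \<pi>] and NP' = part_prod_radon[OF \<nu>' subset_refl \<sigma>]
  note sN = finite_radonD[OF NP] and sN' = finite_radonD[OF NP']
  have massN: "emeasure ?N (space ?N) < \<infinity>" using finite_measure.emeasure_finite[OF sN(1)] by (simp add: less_top)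
  have massN': "emeasure ?N' (space ?N') < \<infinity>" using finite_measure.emeasure_finite[OF sN'(1)] by (simp add: less_top)
  have PP: "finite_radon TP (part_prod X P \<pi>')" if "\<pi>' \<in> parts" for \<pi>'
    using part_prod_radon[OF P subset_refl] that by blast
  \<comment> \<open>The sets of active coordinates are disjoint: if one of them is everything, the
    other is empty and a one-variable integral remains; otherwise both variables enter through
    proper subsets and are dominated by \<open>P\<close>.\<close>
  have term_finite: "(\<integral>\<^sup>+y. (\<integral>\<^sup>+x. ennreal \<bar>J (mix n A x p) (mix n A' y q)\<bar> \<partial>?N) \<partial>?N') < \<infinity>"
    if A: "A \<subseteq> {1..n}" and A': "A' \<subseteq> {1..n}" and dis: "A \<inter> A' = {}" and p: "p \<in> PT" and q: "q \<in> PT" for A A' p q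
  proof -
    consider "A = {1..n}" | "A' = {1..n}" | "A \<noteq> {1..n}" "A' \<noteq> {1..n}" by blast
    then show ?thesis
    proof cases
      case 1
      then have A'e: "A' = {}" using dis A' by blast
      have "(\<integral>\<^sup>+x. ennreal \<bar>J (mix n A x p) q\<bar> \<partial>?N) = (\<integral>\<^sup>+x. ennreal \<bar>J x q\<bar> \<partial>?N)"
      proof (rule nn_integral_cong)
        fix x assume "x \<in> space ?N"
        then have "x \<in> PT" using sN(3) by blast
        then show "ennreal \<bar>J (mix n A x p) q\<bar> = ennreal \<bar>J x q\<bar>" by (simp only: 1 mix_full)
      qed
      also have "\<dots> < \<infinity>" by (rule fixed_part[OF P dfP \<nu> d M fi \<pi> q])
      finally show ?thesis using massN' unfolding A'e mix_empty[OF q] by (simp add: ennreal_mult_less_top)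
    next
      case 2
      then have Ae: "A = {}" using dis A by blast
      have "(\<integral>\<^sup>+y. (\<integral>\<^sup>+x. ennreal \<bar>J p (mix n A' y q)\<bar> \<partial>?N) \<partial>?N') = (\<integral>\<^sup>+y. ennreal \<bar>J y p\<bar> * emeasure ?N (space ?N) \<partial>?N')"
      proof (rule nn_integral_cong)
        fix y assume "y \<in> space ?N'"
        then have y: "y \<in> PT" using sN'(3) by blast
        then have "mix n A' y q = y" by (simp only: 2 mix_full)
        then show "(\<integral>\<^sup>+x. ennreal \<bar>J p (mix n A' y q)\<bar> \<partial>?N) = ennreal \<bar>J y p\<bar> * emeasure ?N (space ?N)"
          using J_sym[OF p y] by simp
      qed
      also have "\<dots> = (\<integral>\<^sup>+y. ennreal \<bar>J y p\<bar> \<partial>?N') * emeasure ?N (space ?N)"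
        by (rule nn_integral_multc[OF meas_abs_J[OF cont_id p sN'(2)]])
      also have "\<dots> < \<infinity>" using fixed_part[OF P dfP \<nu>' d' M' fi' \<sigma> p] massN by (simp add: ennreal_mult_less_top)
      finally show ?thesis unfolding Ae mix_empty[OF p] .
    next
      case 3
      obtain C where C: "0 \<le> C" "\<And>g :: _ \<Rightarrow> ennreal. g \<in> borel_measurable (prod_borel X A) \<Longrightarrow>
        (\<integral>\<^sup>+x. g (restrict x A) \<partial>?N) \<le> ennreal C * (\<Sum>\<pi>'\<in>parts. \<integral>\<^sup>+x. g (restrict x A) \<partial>part_prod X P \<pi>')"
        using nn_integral_restrict_dominated[OF P one \<nu> d M A 3(1) \<pi>] by metis
      obtain C' where C': "0 \<le> C'" "\<And>g :: _ \<Rightarrow> ennreal. g \<in> borel_measurable (prod_borel X A') \<Longrightarrow>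
        (\<integral>\<^sup>+x. g (restrict x A') \<partial>?N') \<le> ennreal C' * (\<Sum>\<pi>'\<in>parts. \<integral>\<^sup>+x. g (restrict x A') \<partial>part_prod X P \<pi>')"
        using nn_integral_restrict_dominated[OF P one \<nu>' d' M' A' 3(2) \<sigma>] by metis
      \<comment> \<open>The inner variable is dominated first, for each fixed outer one;
        \<open>h\<close> is the result. It depends on its argument only through the coordinates in
        \<open>A'\<close> and is Borel by continuity of \<open>J\<close>, so the outer variable can
        be dominated next without exchanging integrals.\<close>
      define h where "h \<pi>' z = (\<integral>\<^sup>+x. ennreal \<bar>J (mix n A x p) (mix n A' z q)\<bar> \<partial>part_prod X P \<pi>')" for \<pi>' z
      have hres: "h \<pi>' (restrict y A') = h \<pi>' y" for \<pi>' y unfolding h_def mix_restrict[OF A'] ..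
      have hm: "h \<pi>' \<in> borel_measurable (prod_borel X A')" if "\<pi>' \<in> parts" for \<pi>'
        unfolding h_def
        by (rule borel_measurable_nn_integral_continuous[OF haus_sub[OF subset_refl] PP[OF that]
              cont_abs_J[OF cont_mix[OF A subset_refl p] cont_mix[OF subset_refl A' q]]]) simp
      have hmN: "h \<pi>' \<in> borel_measurable ?N'" if "\<pi>' \<in> parts" for \<pi>'
      proof -
        have "(\<lambda>y. h \<pi>' (restrict y A')) \<in> borel_measurable ?N'"
          by (rule measurable_compose[OF measurable_restrict_marg[OF NP' A'] hm[OF that]])
        then show ?thesis unfolding hres .
      qed
      have "(\<integral>\<^sup>+y. (\<integral>\<^sup>+x. ennreal \<bar>J (mix n A x p) (mix n A' y q)\<bar> \<partial>?N) \<partial>?N')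
          \<le> (\<integral>\<^sup>+y. ennreal C * (\<Sum>\<pi>'\<in>parts. h \<pi>' y) \<partial>?N')"
      proof (rule nn_integral_mono)
        fix y assume "y \<in> space ?N'"
        then have y: "y \<in> PT" using sN'(3) by blast
        have "(\<lambda>x. ennreal \<bar>J (mix n A x p) (mix n A' y q)\<bar>) \<in> borel_measurable (prod_borel X A)"
          by (rule meas_abs_J[OF cont_mix[OF subset_refl A p] mix_points[OF y q] refl])
        from C(2)[OF this] show "(\<integral>\<^sup>+x. ennreal \<bar>J (mix n A x p) (mix n A' y q)\<bar> \<partial>?N) \<le> ennreal C * (\<Sum>\<pi>'\<in>parts. h \<pi>' y)"
          unfolding h_def mix_restrict[OF A] .
      qed
      also have "\<dots> = ennreal C * (\<Sum>\<pi>'\<in>parts. \<integral>\<^sup>+y. h \<pi>' y \<partial>?N')"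
      proof -
        have "(\<integral>\<^sup>+y. (\<Sum>\<pi>'\<in>parts. h \<pi>' y) \<partial>?N') = (\<Sum>\<pi>'\<in>parts. \<integral>\<^sup>+y. h \<pi>' y \<partial>?N')"
          by (rule nn_integral_sum[OF hmN])
        moreover have "(\<integral>\<^sup>+y. ennreal C * (\<Sum>\<pi>'\<in>parts. h \<pi>' y) \<partial>?N') = ennreal C * (\<integral>\<^sup>+y. (\<Sum>\<pi>'\<in>parts. h \<pi>' y) \<partial>?N')"
          by (rule nn_integral_cmult[OF borel_measurable_sum[OF hmN]])
        ultimately show ?thesis by simp
      qed
      also have "\<dots> \<le> ennreal C * (\<Sum>\<pi>'\<in>parts. ennreal C' * (\<Sum>\<sigma>'\<in>parts. \<integral>\<^sup>+y. h \<pi>' y \<partial>part_prod X P \<sigma>'))"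
      proof (intro mult_left_mono sum_mono)
        fix \<pi>' assume "\<pi>' \<in> parts"
        from C'(2)[OF hm[OF this]] show "(\<integral>\<^sup>+y. h \<pi>' y \<partial>?N') \<le> ennreal C' * (\<Sum>\<sigma>'\<in>parts. \<integral>\<^sup>+y. h \<pi>' y \<partial>part_prod X P \<sigma>')"
          unfolding hres .
      qed simp
      also have "\<dots> < \<infinity>"
      proof -
        have "(\<integral>\<^sup>+y. h \<pi>' y \<partial>part_prod X P \<sigma>') < \<infinity>" if "\<pi>' \<in> parts" "\<sigma>' \<in> parts" for \<pi>' \<sigma>'
          unfolding h_def by (rule doubly_finiteD[OF dfP p q A A']) (use that in auto)
        then have "(\<Sum>\<sigma>'\<in>parts. \<integral>\<^sup>+y. h \<pi>' y \<partial>part_prod X P \<sigma>') < top" if "\<pi>' \<in> parts" for \<pi>'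
          unfolding infinity_ennreal_def using that by (intro ennreal_sum_less_top[THEN iffD2] ballI finite_parts) blast
        then have "ennreal C' * (\<Sum>\<sigma>'\<in>parts. \<integral>\<^sup>+y. h \<pi>' y \<partial>part_prod X P \<sigma>') < top" if "\<pi>' \<in> parts" for \<pi>'
          using that by (simp add: ennreal_mult_less_top)
        then have "(\<Sum>\<pi>'\<in>parts. ennreal C' * (\<Sum>\<sigma>'\<in>parts. \<integral>\<^sup>+y. h \<pi>' y \<partial>part_prod X P \<sigma>')) < top"
          by (intro ennreal_sum_less_top[THEN iffD2] ballI finite_parts) blast
        then show ?thesis by (simp add: ennreal_mult_less_top)
      qed
      finally show ?thesis .
    qed
  qed
  have "\<exists>C0\<ge>0. \<forall>u\<in>PT. \<forall>v\<in>PT.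
      \<bar>J u v\<bar> \<le> C0 * (1 + (\<Sum>B\<in>Pow {1..n}. \<bar>J (mix n B c u) (mix n ({1..n} - B) c v)\<bar>))"
    by (rule J_bound[OF c0]) (intro exI conjI ballI)
  then obtain C0 where C0: "0 \<le> C0" "\<forall>u\<in>PT. \<forall>v\<in>PT.
      \<bar>J u v\<bar> \<le> C0 * (1 + (\<Sum>B\<in>Pow {1..n}. \<bar>J (mix n B c u) (mix n ({1..n} - B) c v)\<bar>))" by (elim exE conjE)
  \<comment> \<open>\<open>J_bound\<close> is applied to points that are mixed already; the first
    then varies only in \<open>F - B\<close> and the second only in \<open>G - ({1..n} - B)\<close>,
    which are disjoint.\<close>
  define t where "t B x y = ennreal \<bar>J (mix n (F - B) x (mix n B c x2)) (mix n (G - ({1..n} - B)) y (mix n ({1..n} - B) c y2))\<bar>" for B x y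
  have t_eq: "t B x y = ennreal \<bar>J (mix n B c (mix n F x x2)) (mix n ({1..n} - B) c (mix n G y y2))\<bar>" for B x y
    unfolding t_def mix_mix1[of B c F x x2] mix_mix1[of "{1..n} - B" c G y y2] ..
  have pq: "mix n B c x2 \<in> PT" "mix n B c y2 \<in> PT" for B by (intro mix_points c0 x2 y2)+
  have FB: "F - B \<subseteq> {1..n}" "G - ({1..n} - B) \<subseteq> {1..n}" for B using F G by blast+
  have bound: "ennreal \<bar>J (mix n F x x2) (mix n G y y2)\<bar> \<le> ennreal C0 * (1 + (\<Sum>B\<in>Pow {1..n}. t B x y))"
    if x: "x \<in> PT" and y: "y \<in> PT" for x y
  proof -
    have "ennreal \<bar>J (mix n F x x2) (mix n G y y2)\<bar>
      \<le> ennreal (C0 * (1 + (\<Sum>B\<in>Pow {1..n}. \<bar>J (mix n B c (mix n F x x2)) (mix n ({1..n} - B) c (mix n G y y2))\<bar>)))"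
      by (intro ennreal_leI bspec[OF bspec[OF C0(2)]] mix_points x y x2 y2)
    also have "\<dots> = ennreal C0 * (1 + (\<Sum>B\<in>Pow {1..n}. t B x y))"
      using C0(1) by (simp add: t_eq ennreal_mult ennreal_plus sum_nonneg sum_ennreal)
    finally show ?thesis .
  qed
  have tm1: "t B \<in> UNIV \<rightarrow> UNIV \<and> (\<lambda>x. t B x y) \<in> borel_measurable ?N" if "y \<in> PT" for B y
    unfolding t_def
    using meas_abs_J[OF cont_mix[OF FB(1) subset_refl pq(1)] mix_points[OF that pq(2)] sN(2)] by blast
  have tm2: "(\<lambda>y. \<integral>\<^sup>+x. t B x y \<partial>?N) \<in> borel_measurable ?N'" for B
  proof -
    have "(\<lambda>y. \<integral>\<^sup>+x. t B x y \<partial>?N) \<in> borel_measurable (borel_top TP)"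
      unfolding t_def
      by (rule borel_measurable_nn_integral_continuous[OF haus_sub[OF subset_refl] NP
            cont_abs_J[OF cont_mix[OF FB(1) subset_refl pq(1)] cont_mix[OF FB(2) subset_refl pq(2)]]]) simp
    then show ?thesis using measurable_cong_sets[OF sN'(2) refl] by blast
  qed
  have tfin: "(\<integral>\<^sup>+y. (\<integral>\<^sup>+x. t B x y \<partial>?N) \<partial>?N') < \<infinity>" if "B \<in> Pow {1..n}" for B
    unfolding t_def by (rule term_finite[OF FB _ pq]) (use G in blast)
  have "(\<integral>\<^sup>+y. (\<integral>\<^sup>+x. ennreal \<bar>J (mix n F x x2) (mix n G y y2)\<bar> \<partial>?N) \<partial>?N')
      \<le> (\<integral>\<^sup>+y. ennreal C0 * (emeasure ?N (space ?N) + (\<Sum>B\<in>Pow {1..n}. \<integral>\<^sup>+x. t B x y \<partial>?N)) \<partial>?N')"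
  proof (rule nn_integral_mono)
    fix y assume "y \<in> space ?N'"
    then have y: "y \<in> PT" using sN'(3) by blast
    have "(\<integral>\<^sup>+x. ennreal \<bar>J (mix n F x x2) (mix n G y y2)\<bar> \<partial>?N) \<le> (\<integral>\<^sup>+x. ennreal C0 * (1 + (\<Sum>B\<in>Pow {1..n}. t B x y)) \<partial>?N)"
      by (rule nn_integral_mono, rule bound[OF _ y]) (use sN(3) in blast)
    also have "\<dots> = ennreal C0 * (\<integral>\<^sup>+x. 1 + (\<Sum>B\<in>Pow {1..n}. t B x y) \<partial>?N)"
      using tm1[OF y] by (intro nn_integral_cmult) auto
    also have "(\<integral>\<^sup>+x. 1 + (\<Sum>B\<in>Pow {1..n}. t B x y) \<partial>?N) = (\<integral>\<^sup>+x. 1 \<partial>?N) + (\<integral>\<^sup>+x. (\<Sum>B\<in>Pow {1..n}. t B x y) \<partial>?N)"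
      using tm1[OF y] by (intro nn_integral_add) auto
    also have "(\<integral>\<^sup>+x. (\<Sum>B\<in>Pow {1..n}. t B x y) \<partial>?N) = (\<Sum>B\<in>Pow {1..n}. \<integral>\<^sup>+x. t B x y \<partial>?N)"
      using tm1[OF y] by (intro nn_integral_sum) auto
    finally show "(\<integral>\<^sup>+x. ennreal \<bar>J (mix n F x x2) (mix n G y y2)\<bar> \<partial>?N)
      \<le> ennreal C0 * (emeasure ?N (space ?N) + (\<Sum>B\<in>Pow {1..n}. \<integral>\<^sup>+x. t B x y \<partial>?N))" by simp
  qed
  also have "\<dots> = ennreal C0 * (\<integral>\<^sup>+y. emeasure ?N (space ?N) + (\<Sum>B\<in>Pow {1..n}. \<integral>\<^sup>+x. t B x y \<partial>?N) \<partial>?N')"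
    using tm2 by (intro nn_integral_cmult borel_measurable_add borel_measurable_sum) auto
  also have "(\<integral>\<^sup>+y. emeasure ?N (space ?N) + (\<Sum>B\<in>Pow {1..n}. \<integral>\<^sup>+x. t B x y \<partial>?N) \<partial>?N')
    = (\<integral>\<^sup>+y. emeasure ?N (space ?N) \<partial>?N') + (\<integral>\<^sup>+y. (\<Sum>B\<in>Pow {1..n}. \<integral>\<^sup>+x. t B x y \<partial>?N) \<partial>?N')"
    using tm2 by (intro nn_integral_add borel_measurable_sum) auto
  also have "(\<integral>\<^sup>+y. (\<Sum>B\<in>Pow {1..n}. \<integral>\<^sup>+x. t B x y \<partial>?N) \<partial>?N') = (\<Sum>B\<in>Pow {1..n}. \<integral>\<^sup>+y. (\<integral>\<^sup>+x. t B x y \<partial>?N) \<partial>?N')"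
    using tm2 by (intro nn_integral_sum) auto
  also have "ennreal C0 * ((\<integral>\<^sup>+y. emeasure ?N (space ?N) \<partial>?N') + (\<Sum>B\<in>Pow {1..n}. \<integral>\<^sup>+y. (\<integral>\<^sup>+x. t B x y \<partial>?N) \<partial>?N')) < \<infinity>"
  proof -
    have "(\<Sum>B\<in>Pow {1..n}. \<integral>\<^sup>+y. (\<integral>\<^sup>+x. t B x y \<partial>?N) \<partial>?N') < top"
      using tfin unfolding infinity_ennreal_def by (intro ennreal_sum_less_top[THEN iffD2] ballI) auto
    then show ?thesis using massN massN' by (simp add: ennreal_mult_less_top)
  qed
  finally show "(\<integral>\<^sup>+y. (\<integral>\<^sup>+x. ennreal \<bar>J (mix n F x x2) (mix n G y y2)\<bar> \<partial>?N) \<partial>?N') < \<infinity>" .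
qed

end

section \<open>Vanishing of low-dimensional marginals\<close>

context radon_space
begin

abbreviation "MM \<equiv> prod_borel X {1..n}"

lemma haus_TP: "Hausdorff_space TP"
  by (rule haus_sub[OF subset_refl])

lemma radon_kD:
  assumes "L \<in> radon_k X n k"
  shows "L \<in> radon_signed TP"
    and "(\<And>i. i \<in> {1..n} \<Longrightarrow> A i \<in> sets (borel_top (X i))) \<Longrightarrow>
      n - k + 1 \<le> card {i\<in>{1..n}. A i = topspace (X i)} \<Longrightarrow> L (PiE {1..n} A) = 0"
  using assms unfolding radon_k_def by blast+

text \<open>The vanishing of \<open>L\<close> on products with enough full factors says that the
  \<open>F\<close>-marginals of its Jordan parts agree on rectangles. Being Radon, they are equal on
  all Borel sets, so every Borel function of the coordinates in \<open>F\<close> has integral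
  0.\<close>

lemma sint_restrict_eq_0:
  assumes L: "L \<in> radon_k X n k" and F: "F \<subseteq> {1..n}" "card F < k" "k \<le> n"
    and g: "g \<in> borel_measurable (prod_borel X F)"
  shows "sint MM L (\<lambda>x. g (restrict x F)) = (0::real)"
proof -
  note LS = radon_kD(1)[OF L]
  interpret S: finite_signed MM L by (rule radon_signedD(1)[OF LS])
  note pn = finite_radon_pn[OF haus_TP LS]
  note mP = marg_radon[OF pn(1) F(1) subset_refl] and mN = marg_radon[OF pn(2) F(1) subset_refl]
  \<comment> \<open>The partition into singletons makes the rectangles of
    \<open>radon_blocks\<close> products of coordinate sets.\<close>
  let ?\<pi> = "(\<lambda>i. {i}) ` F"
  have \<pi>: "partition_on F ?\<pi>" by (auto simp: partition_on_def disjoint_def)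
  interpret R: radon_blocks X ?\<pi> "\<lambda>B. marg X B (marg X F S.P)" by (rule blocks[OF mP F(1) \<pi>])
  have U: "\<Union>?\<pi> = F" by blast
  have "marg X F S.P = marg X F S.N"
  proof (rule R.finite_radon_eq_on_rects[unfolded U, OF mP mN])
    fix A assume A: "\<And>B. B \<in> ?\<pi> \<Longrightarrow> A B \<in> sets (prod_borel X B)"
    \<comment> \<open>Rewrites the sides of the rectangle, which are sets of functions on
      singletons, as sets of coordinate values, with the full factor outside
      \<open>F\<close>.\<close>
    define D where "D i = (if i \<in> F then {c \<in> topspace (X i). (\<lambda>j\<in>{i}. c) \<in> A {i}} else topspace (X i))" for i
    have Ds: "D i \<in> sets (borel_top (X i))" if "i \<in> {1..n}" for i
    proof (cases "i \<in> F")
      case True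
      have "continuous_map (X i) (prod_sp X {i}) (\<lambda>c. \<lambda>j\<in>{i}. c)"
        using continuous_map_id[of "X i"] by (simp add: continuous_map_componentwise id_def image_subset_iff)
      then have "(\<lambda>c. \<lambda>j\<in>{i}. c) \<in> measurable (borel_top (X i)) (prod_borel X {i})"
        by (rule continuous_map_measurable_borel_top)
      moreover have "A {i} \<in> sets (prod_borel X {i})" using True by (intro A) blast
      ultimately have "(\<lambda>c. \<lambda>j\<in>{i}. c) -` A {i} \<inter> space (borel_top (X i)) \<in> sets (borel_top (X i))"
        by (rule measurable_sets)
      also have "(\<lambda>c. \<lambda>j\<in>{i}. c) -` A {i} \<inter> space (borel_top (X i)) = D i" using True by (auto simp: D_def)
      finally show ?thesis .
    next
      case False
      then show ?thesis by (simp add: D_def openin_sets_borel_top)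
    qed
    have eq: "{x \<in> topspace TP. restrict x F \<in> R.rect A} = PiE {1..n} D"
    proof (intro equalityI subsetI)
      fix x assume "x \<in> {x \<in> topspace TP. restrict x F \<in> R.rect A}"
      then have x: "x \<in> topspace TP" "\<And>i. i \<in> F \<Longrightarrow> restrict (restrict x F) {i} \<in> A {i}"
        unfolding R.rect_def by blast+
      show "x \<in> PiE {1..n} D"
      proof (rule PiE_I)
        fix i assume i: "i \<in> {1..n}"
        have "restrict (restrict x F) {i} = (\<lambda>j\<in>{i}. x i)" if "i \<in> F" using that by (auto simp: restrict_def)
        then show "x i \<in> D i" using points_coord[OF x(1) i] x(2)[of i] by (simp add: D_def)
      next
        fix i assume "i \<notin> {1..n}"
        then show "x i = undefined" using x(1) by (auto simp: PiE_def extensional_def)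
      qed
    next
      fix x assume x: "x \<in> PiE {1..n} D"
      then have xT: "x \<in> topspace TP" unfolding points_iff by (auto simp: D_def PiE_def Pi_def split: if_splits)
      have "restrict (restrict x F) {i} \<in> A {i}" if "i \<in> F" for i
      proof -
        have "x i \<in> D i" using x F(1) that by (meson PiE_mem subsetD)
        moreover have "restrict (restrict x F) {i} = (\<lambda>j\<in>{i}. x i)" using that by (auto simp: restrict_def)
        ultimately show ?thesis using that by (simp add: D_def)
      qed
      then show "x \<in> {x \<in> topspace TP. restrict x F \<in> R.rect A}"
        using xT restrict_topspace_sub[OF xT F(1)] unfolding R.rect_def U by blast
    qed
    have "R.rect A \<in> R.Rects" unfolding R.Rects_def using A by blast
    then have Rs: "R.rect A \<in> sets (prod_borel X F)" using R.Rects_borel unfolding U by blast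
    have E: "PiE {1..n} D \<in> sets MM"
    proof -
      have "(\<lambda>x. restrict x F) -` R.rect A \<inter> space MM \<in> sets MM"
        using continuous_map_measurable_borel_top[OF continuous_map_restrict[OF F(1)]] Rs by (rule measurable_sets)
      also have "(\<lambda>x. restrict x F) -` R.rect A \<inter> space MM = {x \<in> topspace TP. restrict x F \<in> R.rect A}"
        unfolding space_borel_top by blast
      finally show ?thesis unfolding eq .
    qed
    have "n - k + 1 \<le> card ({1..n} - F)" using F finite_subset[OF F(1)] by (simp add: card_Diff_subset)
    also have "\<dots> \<le> card {i\<in>{1..n}. D i = topspace (X i)}" by (intro card_mono) (auto simp: D_def)
    finally have "L (PiE {1..n} D) = 0" by (rule radon_kD(2)[OF L, rotated]) (rule Ds)
    then have "emeasure S.P (PiE {1..n} D) = emeasure S.N (PiE {1..n} D)" by (simp only: S.emeasure_pn[OF E] add_0_right diff_zero)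
    then show "emeasure (marg X F S.P) (R.rect A) = emeasure (marg X F S.N) (R.rect A)"
      unfolding emeasure_marg[OF pn(1) F(1) Rs] emeasure_marg[OF pn(2) F(1) Rs] eq .
  qed
  moreover have "(\<integral>x. g (restrict x F) \<partial>m) = (\<integral>x. g x \<partial>marg X F m)" if "finite_radon TP m" for m
    unfolding marg_def by (rule integral_distr[OF measurable_restrict_marg[OF that F(1)] g, symmetric])
  ultimately show ?thesis unfolding sint_def using pn by simp
qed

end

section \<open>Integrability of the kernel sections and elimination of the low terms\<close>

context radon_kernel
begin

definition slice_finite where
  "slice_finite L \<longleftrightarrow> (\<forall>F\<subseteq>{1..n}. \<forall>c\<in>PT. \<forall>z\<in>PT. (\<integral>\<^sup>+x. ennreal \<bar>J (mix n F x c) z\<bar> \<partial>variation MM L) < \<infinity>)"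

lemma integrable_slice:
  assumes s: "slice_finite L" and F: "F \<subseteq> {1..n}" and c: "c \<in> PT" and z: "z \<in> PT"
  shows "integrable (variation MM L) (\<lambda>x. J (mix n F x c) z)"
proof (rule integrableI_bounded)
  show "(\<lambda>x. J (mix n F x c) z) \<in> borel_measurable (variation MM L)"
    by (rule meas_J[OF cont_mix[OF F subset_refl c] z]) simp
  show "(\<integral>\<^sup>+x. ennreal (norm (J (mix n F x c) z)) \<partial>variation MM L) < \<infinity>"
    using assms unfolding slice_finite_def real_norm_def by blast
qed

lemma integrable_J:
  assumes "slice_finite L" "z \<in> PT"
  shows "integrable (variation MM L) (\<lambda>x. J x z)"
proof -
  have "integrable (variation MM L) (\<lambda>x. J (mix n {1..n} x z) z)"
    by (rule integrable_slice[OF assms(1) subset_refl assms(2,2)])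
  moreover have "(J (mix n {1..n} x z) z) = J x z" if "x \<in> space (variation MM L)" for x
    using that unfolding space_variation space_borel_top by (simp only: mix_full)
  ultimately show ?thesis by (rule iffD1[OF Bochner_Integration.integrable_cong[OF refl], rotated])
qed

lemma integrable_KJ_slice:
  assumes s: "slice_finite L" and x0: "x0 \<in> PT" and z: "z \<in> PT"
  shows "integrable (variation MM L) (\<lambda>x. KJ n k J x0 x z)"
proof -
  have "integrable (variation MM L) (\<lambda>x. \<Sum>G\<in>Pow {1..n}. \<Sum>F\<in>Pow {1..n}. cf G * cf F * ((-1) ^ k * J (mix n F x x0) (mix n G z x0)))"
    by (intro Bochner_Integration.integrable_sum integrable_mult_right integrable_slice[OF s _ x0 mix_points[OF z x0]]) blast
  moreover have "(\<Sum>G\<in>Pow {1..n}. \<Sum>F\<in>Pow {1..n}. cf G * cf F * ((-1) ^ k * J (mix n F x x0) (mix n G z x0))) = KJ n k J x0 x z"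
    if "x \<in> space (variation MM L)" for x
    using KJ_expand[of x z x0] that z unfolding space_variation space_borel_top by simp
  ultimately show ?thesis by (rule iffD1[OF Bochner_Integration.integrable_cong[OF refl], rotated])
qed

lemma integrable_sqrt_KJ:
  assumes s: "slice_finite L" and fin: "finite_measure (variation MM L)" and x0: "x0 \<in> PT"
  shows "integrable (variation MM L) (\<lambda>x. sqrt (KJ n k J x0 x x))"
proof -
  interpret R: pd_kernel PT "KJ n k J x0" by (rule pd_kernel_KJ[OF x0])
  let ?V = "variation MM L"
  have "integrable ?V (\<lambda>x. \<Sum>G\<in>Pow {1..n}. \<Sum>F\<in>Pow {1..n}. cf G * cf F * ((-1) ^ k * J (mix n ((F - G) \<union> (G - F)) x x0) x0))"
    by (intro Bochner_Integration.integrable_sum integrable_mult_right integrable_slice[OF s _ x0 x0]) blast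
  moreover have "(\<Sum>G\<in>Pow {1..n}. \<Sum>F\<in>Pow {1..n}. cf G * cf F * ((-1) ^ k * J (mix n ((F - G) \<union> (G - F)) x x0) x0)) = KJ n k J x0 x x"
    if "x \<in> space ?V" for x
  proof -
    have x: "x \<in> PT" using that unfolding space_variation space_borel_top .
    show ?thesis unfolding KJ_expand[OF x x] J_mix_symdiff[OF x x0] ..
  qed
  ultimately have K: "integrable ?V (\<lambda>x. KJ n k J x0 x x)"
    by (rule iffD1[OF Bochner_Integration.integrable_cong[OF refl], rotated])
  \<comment> \<open>The square root of a nonnegative \<open>t\<close> is at most
    \<open>1 + t\<close>, and the constant is integrable because the variation is finite.\<close>
  have "integrable ?V (\<lambda>x. 1 + KJ n k J x0 x x)"
    by (intro Bochner_Integration.integrable_add K finite_measure.integrable_const[OF fin])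
  then show ?thesis
  proof (rule Bochner_Integration.integrable_bound)
    show "(\<lambda>x. sqrt (KJ n k J x0 x x)) \<in> borel_measurable ?V"
      by (rule borel_measurable_sqrt[THEN measurable_compose[OF borel_measurable_integrable[OF K]]])
    show "AE x in ?V. norm (sqrt (KJ n k J x0 x x)) \<le> norm (1 + KJ n k J x0 x x)"
    proof (rule AE_I2)
      fix x assume "x \<in> space ?V"
      then have "x \<in> PT" unfolding space_variation space_borel_top .
      then have p: "0 \<le> KJ n k J x0 x x" by (rule R.K_diag_nonneg)
      have "(1 + KJ n k J x0 x x)\<^sup>2 = 1 + 2 * KJ n k J x0 x x + (KJ n k J x0 x x)\<^sup>2" by (simp add: power2_sum)
      then have "sqrt (KJ n k J x0 x x) \<le> 1 + KJ n k J x0 x x" using p by (intro real_le_lsqrt) auto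
      then show "norm (sqrt (KJ n k J x0 x x)) \<le> norm (1 + KJ n k J x0 x x)" using p by simp
    qed
  qed
qed

lemma sint_KJ_slice:
  assumes L: "L \<in> radon_k X n k" and s: "slice_finite L" and x0: "x0 \<in> PT" and z: "z \<in> PT"
  shows "sint MM L (\<lambda>x. KJ n k J x0 x z) = (\<Sum>G\<in>Pow {1..n}. cf G * ((-1) ^ k * sint MM L (\<lambda>x. J x (mix n G z x0))))"
proof -
  interpret S: finite_signed MM L by (rule radon_signedD(1)[OF radon_kD(1)[OF L]])
  let ?f = "\<lambda>F G x. J (mix n F x x0) (mix n G z x0)"
  note zG = mix_points[OF z x0]
  have int: "integrable S.V (?f F G)" if "F \<in> Pow {1..n}" for F G
    using that by (intro integrable_slice[OF s _ x0 zG]) blast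
  \<comment> \<open>A proper \<open>F\<close> either has fewer than \<open>k\<close> elements, and
    the integral vanishes, or has weight \<open>cf F = 0\<close>.\<close>
  have low: "cf F * sint MM L (?f F G) = 0" if F: "F \<in> Pow {1..n} - {{1..n}}" for F G
  proof (cases "card F < k")
    case True
    have FF: "F \<subseteq> {1..n}" using F by blast
    have "sint MM L (\<lambda>x. J (mix n F (restrict x F) x0) (mix n G z x0)) = 0"
      by (rule sint_restrict_eq_0[OF L FF True less_imp_le[OF kn] meas_J[OF cont_mix[OF subset_refl FF x0] zG refl]])
    then show ?thesis unfolding mix_restrict[OF FF] by simp
  next
    case False
    then show ?thesis using F by (simp add: cf_def)
  qed
  have "sint MM L (\<lambda>x. KJ n k J x0 x z) = sint MM L (\<lambda>x. \<Sum>G\<in>Pow {1..n}. \<Sum>F\<in>Pow {1..n}. cf G * cf F * ((-1) ^ k * ?f F G x))"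
    by (rule S.sint_cong) (simp only: space_borel_top KJ_expand[OF _ z])
  also have "\<dots> = (\<Sum>G\<in>Pow {1..n}. \<Sum>F\<in>Pow {1..n}. sint MM L (\<lambda>x. cf G * cf F * ((-1) ^ k * ?f F G x)))"
    using int by (simp only: S.sint_sum Bochner_Integration.integrable_sum integrable_mult_right finite_Pow_iff finite_atLeastAtMost)
  also have "\<dots> = (\<Sum>G\<in>Pow {1..n}. cf G * ((-1) ^ k * (\<Sum>F\<in>Pow {1..n}. cf F * sint MM L (?f F G))))"
    unfolding S.sint_scale sum_distrib_left by (intro sum.cong refl) (simp only: mult_ac)
  also have "\<dots> = (\<Sum>G\<in>Pow {1..n}. cf G * ((-1) ^ k * sint MM L (\<lambda>x. J x (mix n G z x0))))"
  proof (rule sum.cong[OF refl])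
    fix G
    have "(\<Sum>F\<in>Pow {1..n}. cf F * sint MM L (?f F G)) = cf {1..n} * sint MM L (?f {1..n} G) + (\<Sum>F\<in>Pow {1..n} - {{1..n}}. cf F * sint MM L (?f F G))"
      by (rule sum.remove) auto
    also have "(\<Sum>F\<in>Pow {1..n} - {{1..n}}. cf F * sint MM L (?f F G)) = 0" using low by (intro sum.neutral) blast
    also have "sint MM L (?f {1..n} G) = sint MM L (\<lambda>x. J x (mix n G z x0))"
      by (rule S.sint_cong) (simp only: space_borel_top mix_full)
    finally show "cf G * ((-1) ^ k * (\<Sum>F\<in>Pow {1..n}. cf F * sint MM L (?f F G))) = cf G * ((-1) ^ k * sint MM L (\<lambda>x. J x (mix n G z x0)))"
      by (simp add: cf_def)
  qed
  finally show ?thesis .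
qed

end

context radon_space
begin

lemma sint_continuous_measurable:
  assumes L: "L \<in> radon_signed TP"
    and f: "continuous_map (prod_topology TP TP) euclideanreal (\<lambda>(u, v). f u v)"
    and int: "\<And>v. v \<in> topspace TP \<Longrightarrow> integrable (variation MM L) (\<lambda>u. f u v)"
  shows "(\<lambda>v. sint MM L (\<lambda>u. f u v)) \<in> borel_measurable MM"
proof -
  interpret S: finite_signed MM L by (rule radon_signedD(1)[OF L])
  note pn = finite_radon_pn[OF haus_TP L]
  have "(\<lambda>v. \<integral>u. f u v \<partial>S.P) \<in> borel_measurable MM" "(\<lambda>v. \<integral>u. f u v \<partial>S.N) \<in> borel_measurable MM"
    by (rule borel_measurable_integral_continuous[OF haus_TP pn(1) f S.integrable_pn(1)[OF int]], assumption,
        rule borel_measurable_integral_continuous[OF haus_TP pn(2) f S.integrable_pn(2)[OF int]], assumption)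
  then show ?thesis unfolding sint_def by (rule borel_measurable_diff)
qed

text \<open>Continuity makes both inner integrals, of \<open>f\<close> and of its absolute value,
  Borel functions of \<open>v\<close>; the assumed finite iterated integral then controls the
  absolute one, which dominates the signed one.\<close>

lemma dsintegrable_continuous:
  assumes L: "L \<in> radon_signed TP" and E: "E \<in> radon_signed TP"
    and f: "continuous_map (prod_topology TP TP) euclideanreal (\<lambda>(u, v). f u v)"
    and int: "\<And>v. v \<in> topspace TP \<Longrightarrow> integrable (variation MM L) (\<lambda>u. f u v)"
    and fin: "(\<integral>\<^sup>+v. (\<integral>\<^sup>+u. ennreal \<bar>f u v\<bar> \<partial>variation MM L) \<partial>variation MM E) < \<infinity>"
  shows "dsintegrable MM L E f"
proof -
  let ?V = "variation MM L" and ?W = "variation MM E"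
  interpret S: finite_signed MM L by (rule radon_signedD(1)[OF L])
  have sp: "v \<in> topspace TP" if "v \<in> space ?W" for v using that unfolding space_variation space_borel_top .
  have mW: "g \<in> borel_measurable ?W" if "g \<in> borel_measurable MM" for g :: "_ \<Rightarrow> real"
    using that measurable_cong_sets[OF sets_variation refl] by blast
  have fa: "continuous_map (prod_topology TP TP) euclideanreal (\<lambda>(u, v). \<bar>f u v\<bar>)"
    using continuous_map_real_abs[OF f] by (simp add: case_prod_unfold)
  have inta: "integrable ?V (\<lambda>u. \<bar>f u v\<bar>)" if "v \<in> topspace TP" for v
    by (rule integrable_abs[OF int[OF that]])
  have A: "integrable ?W (\<lambda>v. \<integral>u. \<bar>f u v\<bar> \<partial>?V)"
  proof (rule integrableI_bounded)
    show "(\<lambda>v. \<integral>u. \<bar>f u v\<bar> \<partial>?V) \<in> borel_measurable ?W"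
      by (rule mW[OF borel_measurable_integral_continuous[OF haus_TP radon_signedD(2)[OF L] fa inta]])
    have "(\<integral>\<^sup>+v. ennreal (norm (\<integral>u. \<bar>f u v\<bar> \<partial>?V)) \<partial>?W) = (\<integral>\<^sup>+v. (\<integral>\<^sup>+u. ennreal \<bar>f u v\<bar> \<partial>?V) \<partial>?W)"
    proof (rule nn_integral_cong)
      fix v assume "v \<in> space ?W"
      from inta[OF sp[OF this]] show "ennreal (norm (\<integral>u. \<bar>f u v\<bar> \<partial>?V)) = (\<integral>\<^sup>+u. ennreal \<bar>f u v\<bar> \<partial>?V)"
        by (subst nn_integral_eq_integral) auto
    qed
    then show "(\<integral>\<^sup>+v. ennreal (norm (\<integral>u. \<bar>f u v\<bar> \<partial>?V)) \<partial>?W) < \<infinity>" using fin by simp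
  qed
  moreover have "integrable ?W (\<lambda>v. sint MM L (\<lambda>u. f u v))"
  proof (rule Bochner_Integration.integrable_bound[OF A mW[OF sint_continuous_measurable[OF L f int]]])
    show "AE v in ?W. norm (sint MM L (\<lambda>u. f u v)) \<le> norm (\<integral>u. \<bar>f u v\<bar> \<partial>?V)"
    proof (rule AE_I2)
      fix v assume "v \<in> space ?W"
      from S.abs_sint_le[OF int[OF sp[OF this]]]
      show "norm (sint MM L (\<lambda>u. f u v)) \<le> norm (\<integral>u. \<bar>f u v\<bar> \<partial>?V)" unfolding real_norm_def by (rule order_trans[OF _ abs_ge_self])
    qed
  qed
  moreover have "AE v in ?W. integrable ?V (\<lambda>u. f u v)"
    by (rule AE_I2) (use int sp in blast)
  ultimately show ?thesis unfolding dsintegrable_def by blast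
qed

end

section \<open>Double integrals as inner products\<close>

context radon_kernel
begin

definition pair_finite where
  "pair_finite L E \<longleftrightarrow> (\<forall>G\<subseteq>{1..n}. \<forall>c\<in>PT.
     (\<integral>\<^sup>+y. (\<integral>\<^sup>+x. ennreal \<bar>J x (mix n G y c)\<bar> \<partial>variation MM L) \<partial>variation MM E) < \<infinity>)"

lemma cont_KJ:
  assumes x0: "x0 \<in> PT"
  shows "continuous_map (prod_topology TP TP) euclideanreal (\<lambda>(x, y). KJ n k J x0 x y)"
proof -
  have J: "continuous_map (prod_topology TP TP) euclideanreal (\<lambda>(x, y). J (mix n F x x0) (mix n G y x0))"
    if "F \<subseteq> {1..n}" "G \<subseteq> {1..n}" for F G
    by (rule cont_J[OF cont_mix[OF that(1) subset_refl x0] cont_mix[OF that(2) subset_refl x0]])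
  have "continuous_map (prod_topology TP TP) euclideanreal
     (\<lambda>p. \<Sum>G\<in>Pow {1..n}. \<Sum>F\<in>Pow {1..n}. cf G * cf F * ((-1) ^ k * (\<lambda>(x, y). J (mix n F x x0) (mix n G y x0)) p))"
    by (intro continuous_map_sum continuous_map_real_mult_left J) auto
  then show ?thesis
  proof (rule continuous_map_eq)
    fix p assume "p \<in> topspace (prod_topology TP TP)"
    then have "fst p \<in> PT" "snd p \<in> PT" unfolding topspace_prod_topology by (metis mem_Times_iff)+
    from KJ_expand[OF this, of x0]
    show "(\<Sum>G\<in>Pow {1..n}. \<Sum>F\<in>Pow {1..n}. cf G * cf F * ((-1) ^ k * (\<lambda>(x, y). J (mix n F x x0) (mix n G y x0)) p))
      = (\<lambda>(x, y). KJ n k J x0 x y) p" by (simp only: case_prod_unfold)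
  qed
qed

lemma dsintegrable_J_mix:
  assumes LE: "L \<in> radon_signed TP" "E \<in> radon_signed TP" and s: "slice_finite L" and pf: "pair_finite L E"
    and G: "G \<subseteq> {1..n}" and c: "c \<in> PT"
  shows "dsintegrable MM L E (\<lambda>u v. J u (mix n G v c))"
proof (rule dsintegrable_continuous[OF LE cont_J[OF cont_id cont_mix[OF G subset_refl c]]])
  show "integrable (variation MM L) (\<lambda>u. J u (mix n G v c))" if "v \<in> PT" for v
    by (rule integrable_J[OF s mix_points[OF that c]])
  show "(\<integral>\<^sup>+v. (\<integral>\<^sup>+u. ennreal \<bar>J u (mix n G v c)\<bar> \<partial>variation MM L) \<partial>variation MM E) < \<infinity>"
    using pf G c unfolding pair_finite_def by blast
qed

lemma dsintegrable_J:
  assumes LE: "L \<in> radon_signed TP" "E \<in> radon_signed TP" and s: "slice_finite L" and pf: "pair_finite L E"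
    and c: "c \<in> PT"
  shows "dsintegrable MM L E (\<lambda>u v. (-1) ^ k * J u v)"
proof (rule dsintegrable_continuous[OF LE])
  show "continuous_map (prod_topology TP TP) euclideanreal (\<lambda>(u, v). (-1) ^ k * J u v)"
    using continuous_map_real_mult_left[OF cont, of "(-1) ^ k"] by (simp add: case_prod_unfold)
  show "integrable (variation MM L) (\<lambda>u. (-1) ^ k * J u v)" if "v \<in> PT" for v
    by (rule integrable_mult_right[OF integrable_J[OF s that]])
  have "(\<integral>\<^sup>+v. (\<integral>\<^sup>+u. ennreal \<bar>(-1) ^ k * J u v\<bar> \<partial>variation MM L) \<partial>variation MM E)
     = (\<integral>\<^sup>+v. (\<integral>\<^sup>+u. ennreal \<bar>J u (mix n {1..n} v c)\<bar> \<partial>variation MM L) \<partial>variation MM E)"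
  proof (rule nn_integral_cong)
    fix v assume "v \<in> space (variation MM E)"
    then have "v \<in> PT" unfolding space_variation space_borel_top .
    then show "(\<integral>\<^sup>+u. ennreal \<bar>(-1) ^ k * J u v\<bar> \<partial>variation MM L) = (\<integral>\<^sup>+u. ennreal \<bar>J u (mix n {1..n} v c)\<bar> \<partial>variation MM L)"
      by (simp only: mix_full abs_mult power_abs abs_minus_cancel abs_one power_one mult_1_left)
  qed
  also have "\<dots> < \<infinity>" using pf c unfolding pair_finite_def by blast
  finally show "(\<integral>\<^sup>+v. (\<integral>\<^sup>+u. ennreal \<bar>(-1) ^ k * J u v\<bar> \<partial>variation MM L) \<partial>variation MM E) < \<infinity>" .
qed

lemma dsint_KJ_eq_dsint_J:
  assumes L: "L \<in> radon_k X n k" and E: "E \<in> radon_k X n k"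
    and s: "slice_finite L" and pf: "pair_finite L E" and x0: "x0 \<in> PT"
  shows "dsint MM L E (\<lambda>u v. (-1) ^ k * J u v) = dsint MM L E (KJ n k J x0)"
proof -
  note LE = radon_kD(1)[OF L] radon_kD(1)[OF E]
  interpret SL: finite_signed MM L by (rule radon_signedD(1)[OF LE(1)])
  interpret SE: finite_signed MM E by (rule radon_signedD(1)[OF LE(2)])
  let ?h = "\<lambda>v. sint MM L (\<lambda>u. J u v)"
  have hm: "?h \<in> borel_measurable MM"
    by (rule sint_continuous_measurable[OF LE(1) cont integrable_J[OF s]])
  have int: "integrable SE.V (\<lambda>v. ?h (mix n G v x0))" if "G \<in> Pow {1..n}" for G
    using dsintegrable_J_mix[OF LE s pf _ x0, of G] that unfolding dsintegrable_def by blast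
  \<comment> \<open>The elimination is repeated in the second variable, for the Borel function
    \<open>?h\<close> obtained by integrating out the first.\<close>
  have low: "cf G * sint MM E (\<lambda>v. ?h (mix n G v x0)) = 0" if G: "G \<in> Pow {1..n} - {{1..n}}" for G
  proof (cases "card G < k")
    case True
    have GG: "G \<subseteq> {1..n}" using G by blast
    have "sint MM E (\<lambda>v. ?h (mix n G (restrict v G) x0)) = 0"
      by (rule sint_restrict_eq_0[OF E GG True less_imp_le[OF kn]
            measurable_compose[OF continuous_map_measurable_borel_top[OF cont_mix[OF subset_refl GG x0]] hm]])
    then show ?thesis unfolding mix_restrict[OF GG] by simp
  next
    case False
    then show ?thesis using G by (simp add: cf_def)
  qed
  have "dsint MM L E (KJ n k J x0) = sint MM E (\<lambda>v. \<Sum>G\<in>Pow {1..n}. cf G * ((-1) ^ k * ?h (mix n G v x0)))"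
    unfolding dsint_def by (rule SE.sint_cong) (simp only: space_borel_top sint_KJ_slice[OF L s x0])
  also have "\<dots> = (\<Sum>G\<in>Pow {1..n}. sint MM E (\<lambda>v. cf G * ((-1) ^ k * ?h (mix n G v x0))))"
    using int by (simp only: SE.sint_sum integrable_mult_right finite_Pow_iff finite_atLeastAtMost)
  also have "\<dots> = (-1) ^ k * (\<Sum>G\<in>Pow {1..n}. cf G * sint MM E (\<lambda>v. ?h (mix n G v x0)))"
    unfolding SE.sint_scale sum_distrib_left by (intro sum.cong refl) (simp only: mult_ac)
  also have "(\<Sum>G\<in>Pow {1..n}. cf G * sint MM E (\<lambda>v. ?h (mix n G v x0)))
    = cf {1..n} * sint MM E (\<lambda>v. ?h (mix n {1..n} v x0)) + (\<Sum>G\<in>Pow {1..n} - {{1..n}}. cf G * sint MM E (\<lambda>v. ?h (mix n G v x0)))"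
    by (rule sum.remove) auto
  also have "(\<Sum>G\<in>Pow {1..n} - {{1..n}}. cf G * sint MM E (\<lambda>v. ?h (mix n G v x0))) = 0"
    using low by (intro sum.neutral) blast
  also have "sint MM E (\<lambda>v. ?h (mix n {1..n} v x0)) = sint MM E ?h"
    by (rule SE.sint_cong) (simp only: space_borel_top mix_full)
  finally show ?thesis
    unfolding dsint_def SL.sint_scale SE.sint_scale by (simp add: cf_def)
qed

lemma kernel_mean_KJ:
  assumes L: "L \<in> radon_signed TP" and s: "slice_finite L" and x0: "x0 \<in> PT"
  shows "kernel_mean PT (KJ n k J x0) MM L"
proof (intro kernel_mean.intro pd_kernel_KJ[OF x0] radon_signedD(1)[OF L] kernel_mean_axioms.intro)
  show "space MM = PT" by (rule space_borel_top)
  show "integrable (variation MM L) (\<lambda>x. KJ n k J x0 x z)" if "z \<in> PT" for z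
    by (rule integrable_KJ_slice[OF s x0 that])
  show "integrable (variation MM L) (\<lambda>x. sqrt (KJ n k J x0 x x))"
    by (rule integrable_sqrt_KJ[OF s finite_radonD(1)[OF radon_signedD(2)[OF L]] x0])
qed

text \<open>By Cauchy-Schwarz for the kernel the double integral is at most the product of the two
  integrals of \<open>sqrt (K x x)\<close>, so a condition on each measure separately
  suffices.\<close>

lemma dsintegrable_KJ:
  assumes L: "L \<in> radon_signed TP" "slice_finite L" and E: "E \<in> radon_signed TP" "slice_finite E" and x0: "x0 \<in> PT"
  shows "dsintegrable MM L E (KJ n k J x0)"
proof (rule dsintegrable_continuous[OF L(1) E(1) cont_KJ[OF x0]])
  interpret KL: kernel_mean PT "KJ n k J x0" MM L by (rule kernel_mean_KJ[OF L x0])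
  interpret KE: kernel_mean PT "KJ n k J x0" MM E by (rule kernel_mean_KJ[OF E x0])
  show "integrable (variation MM L) (\<lambda>u. KJ n k J x0 u v)" if "v \<in> PT" for v by (rule KL.int_slice[OF that])
  have "(\<integral>\<^sup>+v. (\<integral>\<^sup>+u. ennreal \<bar>KJ n k J x0 u v\<bar> \<partial>KL.V) \<partial>KE.V)
      \<le> (\<integral>\<^sup>+v. ennreal (sqrt (KJ n k J x0 v v)) * ennreal KL.sqrt_mass \<partial>KE.V)"
  proof (rule nn_integral_mono)
    fix v assume "v \<in> space KE.V"
    then have v: "v \<in> PT" unfolding space_variation space_borel_top .
    have "(\<integral>\<^sup>+u. ennreal \<bar>KJ n k J x0 u v\<bar> \<partial>KL.V) \<le> (\<integral>\<^sup>+u. ennreal (sqrt (KJ n k J x0 u u) * sqrt (KJ n k J x0 v v)) \<partial>KL.V)"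
      by (rule nn_integral_mono, rule ennreal_leI, rule KL.kernel_CS[OF _ v]) (simp only: space_variation space_borel_top)
    also have "\<dots> = ennreal (\<integral>u. sqrt (KJ n k J x0 u u) * sqrt (KJ n k J x0 v v) \<partial>KL.V)"
      by (rule nn_integral_eq_integral[OF integrable_mult_left[OF KL.int_sqrt]])
        (use KL.K_diag_nonneg v KL.space_M in \<open>auto intro!: AE_I2 mult_nonneg_nonneg simp del: topspace_product_topology\<close>)
    also have "\<dots> = ennreal (sqrt (KJ n k J x0 v v)) * ennreal KL.sqrt_mass"
      using KL.K_diag_nonneg[OF v] KL.sqrt_mass_nonneg by (simp add: ennreal_mult mult.commute)
    finally show "(\<integral>\<^sup>+u. ennreal \<bar>KJ n k J x0 u v\<bar> \<partial>KL.V) \<le> ennreal (sqrt (KJ n k J x0 v v)) * ennreal KL.sqrt_mass" .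
  qed
  also have "\<dots> = (\<integral>\<^sup>+v. ennreal (sqrt (KJ n k J x0 v v)) \<partial>KE.V) * ennreal KL.sqrt_mass"
    by (rule nn_integral_multc) (rule measurable_compose[OF borel_measurable_integrable[OF KE.int_sqrt] measurable_ennreal])
  also have "(\<integral>\<^sup>+v. ennreal (sqrt (KJ n k J x0 v v)) \<partial>KE.V) = ennreal KE.sqrt_mass"
    by (rule nn_integral_eq_integral[OF KE.int_sqrt])
      (use KL.K_diag_nonneg KL.space_M in \<open>auto intro!: AE_I2 simp del: topspace_product_topology\<close>)
  finally show "(\<integral>\<^sup>+v. (\<integral>\<^sup>+u. ennreal \<bar>KJ n k J x0 u v\<bar> \<partial>KL.V) \<partial>KE.V) < \<infinity>"
    by (simp add: ennreal_mult_less_top order.strict_trans1)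
qed

lemma HJ_ipJ:
  assumes "x0 \<in> PT"
  shows "HJ X n k J x0 = pd_kernel.carr PT (KJ n k J x0)" "ipJ X n k J x0 = pd_kernel.iprod PT (KJ n k J x0)"
  using pd_kernel.rkhs_eq[OF pd_kernel_KJ[OF assms]] unfolding HJ_def ipJ_def by simp_all

lemma KJ_embed_mem:
  assumes L: "L \<in> radon_signed TP" "slice_finite L" and x0: "x0 \<in> PT"
  shows "KJ_embed X n k J x0 L \<in> HJ X n k J x0"
proof -
  interpret K: kernel_mean PT "KJ n k J x0" MM L by (rule kernel_mean_KJ[OF L x0])
  have "KJ_embed X n k J x0 L = K.emb" unfolding KJ_embed_def K.emb_def ..
  then show ?thesis using K.emb_carr unfolding HJ_ipJ(1)[OF x0] by (simp only:)
qed

lemma dsint_KJ: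
  assumes L: "L \<in> radon_signed TP" "slice_finite L" and E: "E \<in> radon_signed TP" "slice_finite E" and x0: "x0 \<in> PT"
  shows "dsint MM L E (KJ n k J x0) = ipJ X n k J x0 (KJ_embed X n k J x0 L) (KJ_embed X n k J x0 E)"
proof -
  interpret KL: kernel_mean PT "KJ n k J x0" MM L by (rule kernel_mean_KJ[OF L x0])
  interpret KE: kernel_mean PT "KJ n k J x0" MM E by (rule kernel_mean_KJ[OF E x0])
  have e: "KJ_embed X n k J x0 L = KL.emb" "KJ_embed X n k J x0 E = KE.emb"
    unfolding KJ_embed_def KL.emb_def KE.emb_def by (rule refl)+
  have "dsint MM L E (KJ n k J x0) = sint MM E KL.emb"
    unfolding dsint_def by (rule KE.sint_cong) (simp only: space_borel_top KL.emb_def if_True)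
  also have "\<dots> = KL.iprod KL.emb KE.emb" by (rule KE.iprod_emb[OF KL.emb_carr, symmetric])
  finally show ?thesis unfolding e HJ_ipJ(2)[OF x0] .
qed

end

context radon_kernel
begin

lemma FIP_iff: "FIP X n J \<mu> \<longleftrightarrow> doubly_finite (variation MM \<mu>) (variation MM \<mu>)"
  unfolding FIP_def doubly_finite_def Let_def by blast

lemma doubly_finite_slice:
  assumes "L \<in> radon_signed TP" "doubly_finite (variation MM L) (variation MM L)"
  shows "slice_finite L"
  unfolding slice_finite_def
  using doubly_finite_fixed[OF assms(2) radon_signedD(2)[OF assms(1)] _ _ _ full_partition]
  unfolding part_prod_single[OF radon_signedD(2)[OF assms(1)]] by blast

lemma doubly_finite_pair:
  assumes L: "L \<in> radon_signed TP" and E: "E \<in> radon_signed TP"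
    and df: "doubly_finite (variation MM L) (variation MM E)"
  shows "pair_finite L E"
  unfolding pair_finite_def
proof (intro allI impI ballI)
  fix G c assume G: "G \<subseteq> {1..n}" and c: "c \<in> PT"
  have "(\<integral>\<^sup>+y. (\<integral>\<^sup>+x. ennreal \<bar>J x (mix n G y c)\<bar> \<partial>variation MM L) \<partial>variation MM E)
    = (\<integral>\<^sup>+y. (\<integral>\<^sup>+x. ennreal \<bar>J (mix n {1..n} x c) (mix n G y c)\<bar> \<partial>variation MM L) \<partial>variation MM E)"
    by (intro nn_integral_cong) (simp only: space_variation space_borel_top mix_full)
  also have "\<dots> < \<infinity>"
    by (rule doubly_finite_single[OF df radon_signedD(2)[OF L] radon_signedD(2)[OF E] c c subset_refl G])
  finally show "(\<integral>\<^sup>+y. (\<integral>\<^sup>+x. ennreal \<bar>J x (mix n G y c)\<bar> \<partial>variation MM L) \<partial>variation MM E) < \<infinity>" .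
qed

lemma slice_finite_fixed:
  assumes "slice_finite L"
  shows "fixed_integrable (variation MM L)"
  unfolding fixed_integrable_def
proof (rule ballI)
  fix c assume c: "c \<in> PT"
  have "(\<integral>\<^sup>+x. ennreal \<bar>J x c\<bar> \<partial>variation MM L) = (\<integral>\<^sup>+x. ennreal \<bar>J (mix n {1..n} x c) c\<bar> \<partial>variation MM L)"
    by (intro nn_integral_cong) (simp only: space_variation space_borel_top mix_full)
  also have "\<dots> < \<infinity>" using assms c unfolding slice_finite_def by blast
  finally show "(\<integral>\<^sup>+x. ennreal \<bar>J x c\<bar> \<partial>variation MM L) < \<infinity>" .
qed

lemma ipJ_nonneg:
  assumes x0: "x0 \<in> PT" and f: "f \<in> HJ X n k J x0"
  shows "0 \<le> ipJ X n k J x0 f f"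
proof -
  interpret pd_kernel PT "KJ n k J x0" by (rule pd_kernel_KJ[OF x0])
  show ?thesis using f nsq_nonneg[of f] unfolding HJ_ipJ[OF x0] by (simp only: iprod_self)
qed

lemma KJ_embed_lin:
  assumes L: "L \<in> radon_signed TP" "slice_finite L" and E: "E \<in> radon_signed TP" "slice_finite E"
    and s: "slice_finite (\<lambda>A. a * L A + b * E A)" and x0: "x0 \<in> PT"
  shows "KJ_embed X n k J x0 (\<lambda>A. a * L A + b * E A) = (\<lambda>z. a * KJ_embed X n k J x0 L z + b * KJ_embed X n k J x0 E z)"
proof
  fix z
  show "KJ_embed X n k J x0 (\<lambda>A. a * L A + b * E A) z = a * KJ_embed X n k J x0 L z + b * KJ_embed X n k J x0 E z"
  proof (cases "z \<in> PT")
    case True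
    have "sint MM (\<lambda>A. a * L A + b * E A) (\<lambda>x. KJ n k J x0 x z) = a * sint MM L (\<lambda>x. KJ n k J x0 x z) + b * sint MM E (\<lambda>x. KJ n k J x0 x z)"
      by (rule sint_lin_measure[OF radon_signedD(1)[OF L(1)] radon_signedD(1)[OF E(1)]
            radon_signedD(1)[OF radon_signed_lin(1)[OF haus_TP L(1) E(1)]]
            integrable_KJ_slice[OF L(2) x0 True] integrable_KJ_slice[OF E(2) x0 True] integrable_KJ_slice[OF s x0 True]])
    then show ?thesis using True unfolding KJ_embed_def by (simp only: if_True)
  next
    case False
    then show ?thesis unfolding KJ_embed_def by (simp only: if_False mult_zero_right add_0_right)
  qed
qed

end

section \<open>The vector space of measures delimited by a probability\<close>

locale prob_kernel = radon_kernel X n k J for X :: "nat \<Rightarrow> 'a topology" and n k :: nat and J +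
  fixes P :: "(nat \<Rightarrow> 'a) set \<Rightarrow> real"
  assumes prob: "P \<in> probJ X n J" and PT_ne: "points X n \<noteq> {}"
begin

abbreviation "Q \<equiv> variation MM P"
abbreviation "\<V> \<equiv> measJ_kP X n k J P"

lemma P_radon: "P \<in> radon_signed TP" and P_FIP: "doubly_finite Q Q" and P_nonneg: "0 \<le> P A" and P_one: "P PT = 1"
  using prob unfolding probJ_def measJ_def FIP_iff by blast+

lemma Q_eq: "Q = to_measure MM P"
  by (rule variation_nonneg[OF finite_signed.signed[OF radon_signedD(1)[OF P_radon]] P_nonneg])

lemma Q_mass: "emeasure Q (space Q) = 1"
proof -
  note sg = finite_signed.signed[OF radon_signedD(1)[OF P_radon]]
  have "emeasure (to_measure MM P) PT = ennreal (P PT)"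
    by (rule emeasure_to_measure[OF P_nonneg signed_measure_empty[OF sg] signed_measure_sums[OF sg]])
      (assumption | rule openin_sets_borel_top openin_topspace)+
  then show ?thesis unfolding Q_eq P_one by (simp only: space_to_measure space_borel_top ennreal_1)
qed

lemma marginally_delimited_iff: "marginally_delimited X n P \<mu> \<longleftrightarrow> (\<exists>M\<ge>1. delim Q M (variation MM \<mu>))"
  unfolding marginally_delimited_def delim_def Q_eq by blast

lemma pair_doubly_finite:
  assumes L: "L \<in> radon_signed TP" "fixed_integrable (variation MM L)" "delim Q M (variation MM L)" "1 \<le> M"
    and E: "E \<in> radon_signed TP" "fixed_integrable (variation MM E)" "delim Q M' (variation MM E)" "1 \<le> M'"
  shows "doubly_finite (variation MM L) (variation MM E)"
proof -
  obtain c where c: "c \<in> PT" using PT_ne by blast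
  have M: "0 \<le> M" "0 \<le> M'" using L(4) E(4) by simp_all
  show ?thesis
    by (rule doubly_finiteI[OF radon_signedD(2)[OF P_radon] Q_mass P_FIP
          radon_signedD(2)[OF L(1)] L(3) M(1) L(2) radon_signedD(2)[OF E(1)] E(3) M(2) E(2) c])
qed

text \<open>In this form membership can be checked on sums: integrability for a fixed second point
  and the delimitation bound both follow from bounds on the variation, whereas \<open>FIP\<close> of
  a sum involves mixed double integrals.\<close>

lemma mem_iff: "\<mu> \<in> \<V> \<longleftrightarrow> \<mu> \<in> radon_k X n k \<and> fixed_integrable (variation MM \<mu>) \<and> (\<exists>M\<ge>1. delim Q M (variation MM \<mu>))"
proof
  assume "\<mu> \<in> \<V>"
  then have "\<mu> \<in> radon_k X n k" "doubly_finite (variation MM \<mu>) (variation MM \<mu>)" "\<exists>M\<ge>1. delim Q M (variation MM \<mu>)"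
    unfolding measJ_kP_def measJ_k_def measJ_def FIP_iff marginally_delimited_iff by blast+
  then show "\<mu> \<in> radon_k X n k \<and> fixed_integrable (variation MM \<mu>) \<and> (\<exists>M\<ge>1. delim Q M (variation MM \<mu>))"
    using slice_finite_fixed[OF doubly_finite_slice[OF radon_kD(1)]] by blast
next
  assume *: "\<mu> \<in> radon_k X n k \<and> fixed_integrable (variation MM \<mu>) \<and> (\<exists>M\<ge>1. delim Q M (variation MM \<mu>))"
  then obtain M where M: "1 \<le> M" "delim Q M (variation MM \<mu>)" by blast
  have k: "\<mu> \<in> radon_k X n k" and fi: "fixed_integrable (variation MM \<mu>)" using * by blast+
  have "doubly_finite (variation MM \<mu>) (variation MM \<mu>)"
    by (rule pair_doubly_finite[OF radon_kD(1)[OF k] fi M(2,1) radon_kD(1)[OF k] fi M(2,1)])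
  then show "\<mu> \<in> \<V>"
    unfolding measJ_kP_def measJ_k_def measJ_def FIP_iff marginally_delimited_iff using * radon_kD(1)[OF k] by blast
qed

lemma memD:
  assumes "L \<in> \<V>"
  shows "L \<in> radon_k X n k" "L \<in> radon_signed TP" "slice_finite L"
proof -
  show "L \<in> radon_k X n k" using assms unfolding measJ_kP_def measJ_k_def by blast
  then show L: "L \<in> radon_signed TP" by (rule radon_kD(1))
  show "slice_finite L"
    by (rule doubly_finite_slice[OF L]) (use assms in \<open>unfold measJ_kP_def measJ_k_def measJ_def FIP_iff, blast\<close>)
qed

lemma mem_pair:
  assumes "L \<in> \<V>" "E \<in> \<V>"
  shows "pair_finite L E"
proof -
  obtain M M' where "1 \<le> M" "delim Q M (variation MM L)" "1 \<le> M'" "delim Q M' (variation MM E)"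
    using assms unfolding mem_iff by blast
  moreover have "fixed_integrable (variation MM L)" "fixed_integrable (variation MM E)" using assms unfolding mem_iff by blast+
  ultimately show ?thesis
    by (intro doubly_finite_pair pair_doubly_finite memD(2)[OF assms(1)] memD(2)[OF assms(2)])
qed

lemma mem_zero: "(\<lambda>_. 0) \<in> \<V>"
  unfolding mem_iff
proof (intro conjI exI)
  let ?V = "variation MM (\<lambda>_. 0)"
  \<comment> \<open>The zero measure is the combination of \<open>P\<close> with itself with
    coefficients 0, which also gives the bound 0 on its variation.\<close>
  have r: "(\<lambda>_. 0) \<in> radon_signed TP" using radon_signed_lin(1)[OF haus_TP P_radon P_radon, of 0 0] by simp
  have z: "emeasure ?V (space ?V) = 0"
    using radon_signed_lin(2)[OF haus_TP P_radon P_radon sets.top, of 0 0] by simp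
  show "(\<lambda>_. 0) \<in> radon_k X n k" unfolding radon_k_def using r by blast
  show "fixed_integrable ?V" unfolding fixed_integrable_def nn_integral_zero_space[OF z] by simp
  show "(1::real) \<le> 1" by simp
  show "delim Q 1 ?V"
    unfolding delim_def
  proof (intro allI impI ballI)
    fix F A assume F: "F \<subseteq> {1..n}" and A: "A \<in> sets (prod_borel X F)"
    have "emeasure (marg X F ?V) A \<le> emeasure ?V (space ?V)"
      unfolding emeasure_marg[OF radon_signedD(2)[OF r] F A] by (rule emeasure_space)
    then show "emeasure (marg X F ?V) A \<le> ennreal 1 * (\<Sum>\<pi>\<in>{\<pi>. partition_on F \<pi>}. emeasure (part_prod X (marg X F Q) \<pi>) A)"
      unfolding z by simp
  qed
qed

lemma mem_lin:
  assumes L: "L \<in> \<V>" and E: "E \<in> \<V>"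
  shows "(\<lambda>A. a * L A + b * E A) \<in> \<V>"
proof -
  let ?s = "\<lambda>A. a * L A + b * E A"
  let ?V = "variation MM"
  note LE = memD(2)[OF L] memD(2)[OF E]
  note r = radon_signed_lin(1)[OF haus_TP LE, of a b]
  note le = radon_signed_lin(2)[OF haus_TP LE, of _ a b]
  have 1: "?s \<in> radon_k X n k"
    using r memD(1)[OF L] memD(1)[OF E] unfolding radon_k_def by simp
  have 2: "fixed_integrable (?V ?s)"
    unfolding fixed_integrable_def
  proof (rule ballI)
    fix c assume c: "c \<in> PT"
    let ?I = "\<lambda>m. \<integral>\<^sup>+x. ennreal \<bar>J x c\<bar> \<partial>m"
    have "?I (?V ?s) \<le> ennreal (\<bar>a\<bar> + \<bar>b\<bar>) * (\<Sum>i\<in>UNIV. ?I (?V (if i then L else E)))"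
    proof (rule nn_integral_le_sum)
      fix A assume "A \<in> sets (?V ?s)"
      then have "emeasure (?V ?s) A \<le> ennreal \<bar>a\<bar> * emeasure (?V L) A + ennreal \<bar>b\<bar> * emeasure (?V E) A"
        by (intro le) (simp only: sets_variation)
      also have "\<dots> \<le> ennreal (\<bar>a\<bar> + \<bar>b\<bar>) * emeasure (?V L) A + ennreal (\<bar>a\<bar> + \<bar>b\<bar>) * emeasure (?V E) A"
        by (intro add_mono mult_right_mono ennreal_leI) auto
      also have "\<dots> = ennreal (\<bar>a\<bar> + \<bar>b\<bar>) * (\<Sum>i\<in>UNIV. emeasure (?V (if i then L else E)) A)"
        by (simp add: UNIV_bool distrib_left add.commute)
      finally show "emeasure (?V ?s) A \<le> ennreal (\<bar>a\<bar> + \<bar>b\<bar>) * (\<Sum>i\<in>UNIV. emeasure (?V (if i then L else E)) A)" .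
    qed (simp only: sets_variation)
    also have "(\<Sum>i\<in>UNIV. ?I (?V (if i then L else E))) = ?I (?V E) + ?I (?V L)" by (simp add: UNIV_bool)
    also have "ennreal (\<bar>a\<bar> + \<bar>b\<bar>) * \<dots> < \<infinity>"
      using L E c unfolding mem_iff fixed_integrable_def by (auto simp: ennreal_mult_less_top)
    finally show "?I (?V ?s) < \<infinity>" .
  qed
  obtain M M' where M: "1 \<le> M" "delim Q M (?V L)" "1 \<le> M'" "delim Q M' (?V E)"
    using L E unfolding mem_iff by blast
  \<comment> \<open>\<open>\<bar>a\<bar> * M + \<bar>b\<bar> * M'\<close> bounds the combination;
    the maximum with 1 restores the demanded lower bound on the constant.\<close>
  let ?M = "max 1 (\<bar>a\<bar> * M + \<bar>b\<bar> * M')"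
  have 3: "delim Q ?M (?V ?s)"
    unfolding delim_def
  proof (intro allI impI ballI)
    fix F A assume F: "F \<subseteq> {1..n}" and cF: "card F \<le> n - 1" and A: "A \<in> sets (prod_borel X F)"
    let ?S = "\<Sum>\<pi>\<in>{\<pi>. partition_on F \<pi>}. emeasure (part_prod X (marg X F Q) \<pi>) A"
    let ?B = "{x \<in> topspace TP. restrict x F \<in> A}"
    have "(\<lambda>x. restrict x F) -` A \<inter> space MM \<in> sets MM"
      by (rule measurable_sets[OF continuous_map_measurable_borel_top[OF continuous_map_restrict[OF F]] A])
    also have "(\<lambda>x. restrict x F) -` A \<inter> space MM = ?B" unfolding space_borel_top by blast
    finally have B: "?B \<in> sets MM" .
    note em = emeasure_marg[OF radon_signedD(2) F A]
    have dL: "emeasure (?V L) ?B \<le> ennreal M * ?S" and dE: "emeasure (?V E) ?B \<le> ennreal M' * ?S"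
      using M(2,4) F cF A unfolding delim_def em[OF LE(1), symmetric] em[OF LE(2), symmetric] by blast+
    have "emeasure (marg X F (?V ?s)) A \<le> ennreal \<bar>a\<bar> * emeasure (?V L) ?B + ennreal \<bar>b\<bar> * emeasure (?V E) ?B"
      unfolding em[OF r] by (rule le[OF B])
    also have "\<dots> \<le> ennreal \<bar>a\<bar> * (ennreal M * ?S) + ennreal \<bar>b\<bar> * (ennreal M' * ?S)"
      by (intro add_mono mult_left_mono dL dE) simp_all
    also have "\<dots> = ennreal (\<bar>a\<bar> * M + \<bar>b\<bar> * M') * ?S"
      using M(1,3) by (simp add: ennreal_plus ennreal_mult distrib_right mult.assoc)
    also have "\<dots> \<le> ennreal ?M * ?S" by (intro mult_right_mono ennreal_leI) simp_all
    finally show "emeasure (marg X F (?V ?s)) A \<le> ennreal ?M * ?S" .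
  qed
  show ?thesis unfolding mem_iff using 1 2 3 by (intro conjI exI[of _ ?M]) simp_all
qed

lemma dsint_J_eq_ipJ:
  assumes L: "L \<in> \<V>" and E: "E \<in> \<V>" and x0: "x0 \<in> PT"
  shows "dsint MM L E (\<lambda>u v. (-1) ^ k * J u v) = ipJ X n k J x0 (KJ_embed X n k J x0 L) (KJ_embed X n k J x0 E)"
  using dsint_KJ_eq_dsint_J[OF memD(1)[OF L] memD(1)[OF E] memD(3)[OF L] mem_pair[OF L E] x0]
    dsint_KJ[OF memD(2,3)[OF L] memD(2,3)[OF E] x0] by (rule trans)

text \<open>After one base point is fixed the form is the inner product of the embeddings, which are
  linear in the measure. Symmetry thus comes from the Hilbert space and not from exchanging the
  order of integration.\<close>

lemma semi_inner_product_on_V: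
  "semi_inner_product_on \<V> (\<lambda>L E. dsint MM L E (\<lambda>u v. (-1) ^ k * J u v))"
proof -
  obtain x0 where x0: "x0 \<in> PT" using PT_ne by blast
  interpret K: pd_kernel PT "KJ n k J x0" by (rule pd_kernel_KJ[OF x0])
  let ?B = "\<lambda>L E. dsint MM L E (\<lambda>u v. (-1) ^ k * J u v)" and ?e = "KJ_embed X n k J x0"
  have B: "?B L E = K.iprod (?e L) (?e E)" if "L \<in> \<V>" "E \<in> \<V>" for L E
    using dsint_J_eq_ipJ[OF that x0] unfolding HJ_ipJ(2)[OF x0] .
  have carr: "?e L \<in> K.carr" if "L \<in> \<V>" for L
    using KJ_embed_mem[OF memD(2,3)[OF that] x0] unfolding HJ_ipJ(1)[OF x0] .
  have lin: "?B (\<lambda>A. a * L A + b * E A) H = a * ?B L H + b * ?B E H"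
    if L: "L \<in> \<V>" and E: "E \<in> \<V>" and H: "H \<in> \<V>" for L E H a b
  proof -
    have "?B (\<lambda>A. a * L A + b * E A) H = K.iprod (\<lambda>z. a * ?e L z + b * ?e E z) (?e H)"
      unfolding B[OF mem_lin[OF L E] H] KJ_embed_lin[OF memD(2,3)[OF L] memD(2,3)[OF E] memD(3)[OF mem_lin[OF L E]] x0] ..
    also have "\<dots> = a * K.iprod (?e L) (?e H) + b * K.iprod (?e E) (?e H)"
      unfolding K.iprod_add[OF K.carr_scale[OF carr[OF L]] K.carr_scale[OF carr[OF E]] carr[OF H]]
        K.iprod_scale[OF carr[OF L] carr[OF H]] K.iprod_scale[OF carr[OF E] carr[OF H]] ..
    finally show ?thesis unfolding B[OF L H] B[OF E H] .
  qed
  show ?thesis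
    unfolding semi_inner_product_on_def fun_subspace_def
  proof (intro conjI ballI allI)
    fix L E H a assume L: "L \<in> \<V>" and E: "E \<in> \<V>"
    show "(\<lambda>A. L A + E A) \<in> \<V>" using mem_lin[OF L E, of 1 1] by simp
    show "?B L E = ?B E L" unfolding B[OF L E] B[OF E L] by (rule K.iprod_sym)
    show "?B (\<lambda>A. L A + E A) H = ?B L H + ?B E H" if H: "H \<in> \<V>" using lin[OF L E H, of 1 1] by simp
  next
    fix L H a assume L: "L \<in> \<V>"
    show "(\<lambda>A. a * L A) \<in> \<V>" using mem_lin[OF L L, of a 0] by simp
    show "0 \<le> ?B L L" unfolding B[OF L L] K.iprod_self[OF carr[OF L]] by (rule K.nsq_nonneg[OF carr[OF L]])
    show "?B (\<lambda>A. a * L A) H = a * ?B L H" if H: "H \<in> \<V>" using lin[OF L L H, of a 0] by simp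
  qed (rule mem_zero)
qed

end

theorem theorem39:
  fixes X :: "nat \<Rightarrow> 'a topology" and n k :: nat
    and J :: "(nat \<Rightarrow> 'a) \<Rightarrow> (nat \<Rightarrow> 'a) \<Rightarrow> real"
  assumes "k < n"
    and "\<And>i. i \<in> {1..n} \<Longrightarrow> Hausdorff_space (X i)"
    and "\<And>i. i \<in> {1..n} \<Longrightarrow> topspace (X i) \<noteq> {}"
    and "continuous_map (prod_topology (prod_sp X {1..n}) (prod_sp X {1..n})) euclideanreal
           (\<lambda>(u, v). J u v)"
    and "complete_n_symmetric X n J"
    and "PDI X n k J"
    and "\<And>x y. (x, y) \<in> ext_diag X n k \<Longrightarrow> J x y = 0"
  shows "(\<forall>L\<in>measJ_k X n k J. \<forall>x0\<in>points X n.
            dsintegrable (prod_borel X {1..n}) L L (\<lambda>u v. (-1) ^ k * J u v) \<and>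
            dsintegrable (prod_borel X {1..n}) L L (KJ n k J x0) \<and>
            integrable (variation (prod_borel X {1..n}) L) (\<lambda>x. sqrt (KJ n k J x0 x x)) \<and>
            KJ_embed X n k J x0 L \<in> HJ X n k J x0 \<and>
            dsint (prod_borel X {1..n}) L L (\<lambda>u v. (-1) ^ k * J u v)
              = dsint (prod_borel X {1..n}) L L (KJ n k J x0) \<and>
            dsint (prod_borel X {1..n}) L L (KJ n k J x0)
              = ipJ X n k J x0 (KJ_embed X n k J x0 L) (KJ_embed X n k J x0 L) \<and>
            ipJ X n k J x0 (KJ_embed X n k J x0 L) (KJ_embed X n k J x0 L) \<ge> 0) \<and>
         (\<forall>P\<in>probJ X n J.
            (\<forall>L\<in>measJ_kP X n k J P. \<forall>\<eta>\<in>measJ_kP X n k J P.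
               dsintegrable (prod_borel X {1..n}) L \<eta> (\<lambda>u v. (-1) ^ k * J u v)) \<and>
            semi_inner_product_on (measJ_kP X n k J P)
              (\<lambda>L \<eta>. dsint (prod_borel X {1..n}) L \<eta> (\<lambda>u v. (-1) ^ k * J u v)) \<and>
            (\<forall>L\<in>measJ_kP X n k J P. \<forall>\<eta>\<in>measJ_kP X n k J P. \<forall>x0\<in>points X n.
               dsintegrable (prod_borel X {1..n}) L \<eta> (KJ n k J x0) \<and>
               dsint (prod_borel X {1..n}) L \<eta> (\<lambda>u v. (-1) ^ k * J u v)
                 = dsint (prod_borel X {1..n}) L \<eta> (KJ n k J x0) \<and>
               dsint (prod_borel X {1..n}) L \<eta> (KJ n k J x0)
                 = ipJ X n k J x0 (KJ_embed X n k J x0 L) (KJ_embed X n k J x0 \<eta>)))"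
proof -
  have n0: "0 < n" using assms(1) by simp
  interpret radon_kernel X n k J
    by (intro radon_kernel.intro cns_kernel.intro radon_space.intro radon_kernel_axioms.intro assms n0)
  have ne: "PT \<noteq> {}"
    using assms(3) unfolding topspace_product_topology PiE_eq_empty_iff by blast
  show ?thesis
  proof (intro conjI ballI)
    fix L x0 assume "L \<in> measJ_k X n k J" and x0: "x0 \<in> PT"
    then have k: "L \<in> radon_k X n k" and df: "doubly_finite (variation MM L) (variation MM L)"
      unfolding measJ_k_def measJ_def FIP_iff by blast+
    note r = radon_kD(1)[OF k]
    note s = doubly_finite_slice[OF r df] and p = doubly_finite_pair[OF r r df]
    show "dsintegrable MM L L (\<lambda>u v. (-1) ^ k * J u v)" by (rule dsintegrable_J[OF r r s p x0])
    show "dsintegrable MM L L (KJ n k J x0)" by (rule dsintegrable_KJ[OF r s r s x0])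
    show "integrable (variation MM L) (\<lambda>x. sqrt (KJ n k J x0 x x))"
      by (rule integrable_sqrt_KJ[OF s finite_radonD(1)[OF radon_signedD(2)[OF r]] x0])
    show "KJ_embed X n k J x0 L \<in> HJ X n k J x0" by (rule KJ_embed_mem[OF r s x0])
    then show "0 \<le> ipJ X n k J x0 (KJ_embed X n k J x0 L) (KJ_embed X n k J x0 L)" by (rule ipJ_nonneg[OF x0])
    show "dsint MM L L (\<lambda>u v. (-1) ^ k * J u v) = dsint MM L L (KJ n k J x0)"
      by (rule dsint_KJ_eq_dsint_J[OF k k s p x0])
    show "dsint MM L L (KJ n k J x0) = ipJ X n k J x0 (KJ_embed X n k J x0 L) (KJ_embed X n k J x0 L)"
      by (rule dsint_KJ[OF r s r s x0])
  next
    fix P assume P: "P \<in> probJ X n J"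
    interpret prob_kernel X n k J P
      by (intro prob_kernel.intro prob_kernel_axioms.intro radon_kernel_axioms P ne)
    show "semi_inner_product_on \<V> (\<lambda>L \<eta>. dsint MM L \<eta> (\<lambda>u v. (-1) ^ k * J u v))"
      by (rule semi_inner_product_on_V)
    fix L \<eta> assume L: "L \<in> \<V>" and E: "\<eta> \<in> \<V>"
    \<comment> \<open>Any base point will do: for integrability of \<open>J\<close> itself it is
      mixed in with all coordinates of the variable point retained.\<close>
    obtain c where c: "c \<in> PT" using ne by blast
    show "dsintegrable MM L \<eta> (\<lambda>u v. (-1) ^ k * J u v)"
      by (rule dsintegrable_J[OF memD(2)[OF L] memD(2)[OF E] memD(3)[OF L] mem_pair[OF L E] c])
    fix x0 assume x0: "x0 \<in> PT"
    show "dsintegrable MM L \<eta> (KJ n k J x0)" by (rule dsintegrable_KJ[OF memD(2,3)[OF L] memD(2,3)[OF E] x0])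
    show "dsint MM L \<eta> (\<lambda>u v. (-1) ^ k * J u v) = dsint MM L \<eta> (KJ n k J x0)"
      by (rule dsint_KJ_eq_dsint_J[OF memD(1)[OF L] memD(1)[OF E] memD(3)[OF L] mem_pair[OF L E] x0])
    show "dsint MM L \<eta> (KJ n k J x0) = ipJ X n k J x0 (KJ_embed X n k J x0 L) (KJ_embed X n k J x0 \<eta>)"
      by (rule dsint_KJ[OF memD(2,3)[OF L] memD(2,3)[OF E] x0])
  qed
qed

end
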